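(* Let $\mu$ be a positive Radon measure on $\mathbb{R}^n$. The measure $\mu$ can be written as $\mu=\sum_{i=0}^n\mu_i$, where each $\mu_i$ is an $i$-dimensional rectifiable measure, if and only if for every Lipschitz function $f:\mathbb{R}^n\to\mathbb{R}$ and every $\varepsilon>0$ there exists a function $g:\mathbb{R}^n\to\mathbb{R}$ of class $C^1$ such that $$\mu(\{x\in\mathbb{R}^n:g(x)\neq f(x)\})<\varepsilon.$$
   Context: $\mathscr{H}^k$ denotes the $k$-dimensional Hausdorff measure on $\mathbb{R}^n$, and for a set $E$ the restriction $\mathscr{H}^k\llcorner E$ is the measure $A\mapsto\mathscr{H}^k(A\cap E)$. For $0\leq k\leq n$, a set $E\subset\mathbb{R}^n$ is $k$-rectifiable if there are sets $E_i$ ($i=1,2,\ldots$) such that each $E_i$ is a Lipschitz image of $\mathbb{R}^k$ and $\mathscr{H}^k(E\setminus\bigcup_{i\geq 1}E_i)=0$. A Radon measure is $k$-rectifiable (a $k$-dimensional rectifiable measure) if it is absolutely continuous with respect to $\mathscr{H}^k\llcorner E$ for some $k$-rectifiable set $E$. *)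

theory Defs
  imports "HOL-Analysis.Analysis"
begin

(* The weight of one covering set. The empty set is singled out because the power 0 ^ 0 = 1
   is needed for singletons (k = 0 gives counting measure) but must not be charged for {}. *)
definition hausdorff_weight :: "nat \<Rightarrow> 'a::metric_space set \<Rightarrow> ennreal" where
  "hausdorff_weight k U =
     (if U = {} then 0 else ennreal (unit_ball_vol (real k) * (diameter U / 2) ^ k))"

(* Boundedness is required explicitly since the library's real-valued diameter is
   unspecified on unbounded sets. If no cover exists, the infimum is \<infinity>. *)
definition hausdorff_premeasure :: "nat \<Rightarrow> real \<Rightarrow> 'a::metric_space set \<Rightarrow> ennreal" where
  "hausdorff_premeasure k \<delta> A =
     (INF U \<in> {U :: nat \<Rightarrow> 'a set. A \<subseteq> (\<Union>i. U i) \<and> (\<forall>i. bounded (U i) \<and> diameter (U i) \<le> \<delta>)}.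
        \<Sum>i. hausdorff_weight k (U i))"

(* k-dimensional Hausdorff (outer) measure, defined on all subsets, with the normalisation
   that makes it agree with Lebesgue outer measure when k is the dimension of the space. *)
definition hausdorff_measure :: "nat \<Rightarrow> 'a::metric_space set \<Rightarrow> ennreal" where
  "hausdorff_measure k A = (SUP \<delta> \<in> {0<..}. hausdorff_premeasure k \<delta> A)"

definition hausdorff_restriction ::
    "nat \<Rightarrow> 'a::metric_space set \<Rightarrow> 'a set \<Rightarrow> ennreal" where
  "hausdorff_restriction k E A = hausdorff_measure k (A \<inter> E)"

(* The dimension k is a value, so R^k is the carrier of the library's Euclidean_space k,
   the functions nat => real vanishing at all indices >= k, with the Euclidean distance. *)
definition lipschitz_image :: "nat \<Rightarrow> 'a::metric_space set \<Rightarrow> bool" where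
  "lipschitz_image k S \<longleftrightarrow>
     (\<exists>(h :: (nat \<Rightarrow> real) \<Rightarrow> 'a) L.
        (\<forall>x \<in> topspace (Euclidean_space k). \<forall>y \<in> topspace (Euclidean_space k).
           dist (h x) (h y) \<le> L * L2_set (\<lambda>i. x i - y i) {..<k}) \<and>
        S = h ` topspace (Euclidean_space k))"

definition rectifiable_set :: "nat \<Rightarrow> 'a::metric_space set \<Rightarrow> bool" where
  "rectifiable_set k E \<longleftrightarrow>
     (\<exists>F :: nat \<Rightarrow> 'a set. (\<forall>i. lipschitz_image k (F i)) \<and>
        hausdorff_measure k (E - (\<Union>i. F i)) = 0)"

(* Positive Radon measures on a Euclidean space: the Borel measures finite on compact sets
   (inner and outer regularity are automatic there). *)
definition radon_measure :: "'a::euclidean_space measure \<Rightarrow> bool" where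
  "radon_measure \<mu> \<longleftrightarrow>
     sets \<mu> = sets borel \<and> (\<forall>K. compact K \<longrightarrow> emeasure \<mu> K < \<infinity>)"

(* The last conjunct is absolute continuity with respect to the restriction of the Hausdorff
   measure to E. As E need not be Borel, that restriction is used as a set function. *)
definition rectifiable_measure :: "nat \<Rightarrow> 'a::euclidean_space measure \<Rightarrow> bool" where
  "rectifiable_measure k \<mu> \<longleftrightarrow>
     radon_measure \<mu> \<and>
     (\<exists>E. rectifiable_set k E \<and>
        (\<forall>A \<in> sets borel. hausdorff_restriction k E A = 0 \<longrightarrow> emeasure \<mu> A = 0))"

definition class_C1 :: "('a::real_normed_vector \<Rightarrow> 'b::real_normed_vector) \<Rightarrow> bool" where
  "class_C1 g \<longleftrightarrow>
     (\<exists>g' :: 'a \<Rightarrow> 'a \<Rightarrow>\<^sub>L 'b.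
        (\<forall>x. (g has_derivative blinfun_apply (g' x)) (at x)) \<and> continuous_on UNIV g')"

end

theory Submission
  imports Defs "HOL-Complex_Analysis.Great_Picard"
begin

text \<open>Sufficiency of the approximation property. A nonzero finite measure on a Lebesgue null set admits
 C1 vector fields that tend to 0 uniformly and have bounded gradients, while the integrals of their divergences stay
 bounded below: take the potential of the measure, regularised at a scale that varies from point to point
 and is chosen by a stopping rule so that the smeared density is comparable to a large constant. Adding such fields with
 alternating signs gives a Lipschitz function which no C1 function matches on most of the set, unless a set of
 positive measure is a Lipschitz graph over fewer coordinates. Exhaustion then places the measure on graphs over
 coordinate planes, each part being absolutely continuous with respect to the Hausdorff measure of that dimension.

 Necessity. A Lipschitz function coincides with C1 functions on compact sets that cover almost all of the space, the
 C1 functions being limits of near minimisers of an energy. Applied to a parametrisation, this splits a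
 rectifiable set into countably many Lipschitz graphs over coordinate planes and the image of critical points, which is
 null. On a graph a Lipschitz function becomes a function of the coordinates, so the same fact applies; the transfer
 from the whole space to a coordinate plane uses that almost all parallel slices are good. Finally
 finitely many disjoint compact pieces are joined by cutoff functions.\<close>

text \<open>The oscillation argument rests on a conflict of slopes. A function built from the test
  fields has slope near 0 and slope near \<open>a\<close> at interleaved scales, while a C1 function
  that agrees with it on most of the set has locally a single slope \<open>b\<close>. So
  \<open>b\<close> and \<open>b - a\<close>, hence also \<open>a\<close>, are almost orthogonal to
  the chords of a smaller set of positive measure; combined with the graph condition reached so far,
  this removes one coordinate from the graph. Divergences bounded below are produced here for
  measures on Lebesgue null sets. A measure on a set that is null for the Hausdorff measure of
  dimension k is therefore first smeared out in the directions outside its k coordinates. The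
  difficulty in the fields is the uniform bound on their gradients. The stopping rule controls the
  divergence only; the full gradient is controlled in L2, since the field is curl free. Where this
  energy is concentrated the scale is enlarged by a second stopping rule, and a covering argument
  shows that only a small part of the measure is affected.\<close>

notation inner (infixl "<.>" 70) and scaleR (infixr "*." 75) and abs ("<|_|>") and LIMSEQ ("((_)/ ----> (_))" [60, 60] 60)
abbreviation hnull :: "nat => 'a::metric_space set => bool" where "hnull k A == hausdorff_measure k A = 0"
abbreviation nn_lborel :: "('a::euclidean_space => ennreal) => ennreal" (binder "NN " 10) where "nn_lborel f == nn_integral lborel f"
lemmas lint_nonneg = Bochner_Integration.integral_nonneg and lint_cong = Bochner_Integration.integral_cong

section \<open>C1 functions whose gradient is carried along as an explicit vector field\<close>

definition C1_grad :: "('a::euclidean_space => real) => ('a => 'a) => bool" where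
 "C1_grad f G \<longleftrightarrow>
   continuous_on UNIV G & (ALL x. (f has_derivative (%h. G x <.> h)) (at x))"

lemma C1_gradD:
 assumes "C1_grad f G"
 shows "(f has_derivative (%h. G x <.> h)) (at x)" "continuous_on UNIV G" using assms by (auto simp: C1_grad_def)

lemma C1_grad_continuous:
 assumes "C1_grad f G" shows "continuous_on A f" using C1_gradD(1)[OF assms] has_derivative_continuous by (metis continuous_at_imp_continuous_on)

lemma C1_grad_borel [measurable_dest]:
 assumes "C1_grad f G"
 shows "f : borel_measurable borel" "G : borel_measurable borel" using C1_grad_continuous[OF assms, of UNIV] C1_gradD(2)[OF assms]
 by (auto intro: borel_measurable_continuous_onI)

lemma class_C1_iff_C1_grad:
 fixes f :: "'a::euclidean_space => real"
 shows "class_C1 f \<longleftrightarrow> (EX G. C1_grad f G)" proof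
 assume "class_C1 f"
 then obtain g' where g': "!!x. (f has_derivative blinfun_apply (g' x)) (at x)"
  and c: "continuous_on UNIV g'" unfolding class_C1_def by blast
 define G where "G x = (SUM i:Basis. blinfun_apply (g' x) i *. i)" for x
 have "blinfun_apply (g' x) h = G x <.> h" for x h proof -
  have "blinfun_apply (g' x) h = blinfun_apply (g' x) (SUM i:Basis. (h <.> i) *. i)" by (simp add: euclidean_representation)
  also have "... = (SUM i:Basis. (h <.> i) * blinfun_apply (g' x) i)" by (simp add: blinfun.sum_right blinfun.scaleR_right)
  also have "... = G x <.> h" unfolding G_def inner_sum_left inner_scaleR_left by (intro sum.cong) (auto simp: inner_commute)
  finally show ?thesis .
 qed
 hence "blinfun_apply (g' x) = (%h. G x <.> h)" for x by blast
 moreover have "continuous_on UNIV G" unfolding G_def by (intro continuous_intros c)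
 ultimately have "C1_grad f G" unfolding C1_grad_def using g' by simp
 thus "EX G. C1_grad f G" by (rule exI[of _ G])
next
 assume "EX G. C1_grad f G"
 then obtain G where G: "C1_grad f G" ..
 have "continuous_on UNIV (%x. blinfun_inner_left (G x))" using C1_gradD(2)[OF G] by (intro continuous_intros)
 thus "class_C1 f" unfolding class_C1_def using C1_gradD(1)[OF G] by (intro exI[of _ "%x. blinfun_inner_left (G x)"]) (simp add: inner_commute)
qed

lemma C1_grad_const [intro]: "C1_grad (%x. c) (%x. 0)" by (auto simp: C1_grad_def intro!: derivative_eq_intros)

lemma C1_grad_inner [intro]: "C1_grad (%x. x <.> a) (%x. a)" by (auto simp: C1_grad_def inner_commute intro!: derivative_eq_intros)

lemma C1_grad_add [intro]:
 assumes "C1_grad f F" "C1_grad g G"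
 shows "C1_grad (%x. f x + g x) (%x. F x + G x)" using assms unfolding C1_grad_def
 by (auto intro!: derivative_eq_intros continuous_intros simp: inner_add_left)

lemma C1_grad_minus [intro]:
 assumes "C1_grad f F" shows "C1_grad (%x. - f x) (%x. - F x)" using assms unfolding C1_grad_def
 by (auto intro!: derivative_eq_intros continuous_intros simp: inner_add_left)

lemma C1_grad_diff [intro]:
 assumes "C1_grad f F" "C1_grad g G"
 shows "C1_grad (%x. f x - g x) (%x. F x - G x)" using C1_grad_add[OF assms(1) C1_grad_minus[OF assms(2)]] by simp

lemma C1_grad_mult [intro]:
 assumes "C1_grad f F" "C1_grad g G"
 shows "C1_grad (%x. f x * g x) (%x. f x *. G x + g x *. F x)" using assms C1_grad_continuous[OF assms(1)] C1_grad_continuous[OF assms(2)]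
 unfolding C1_grad_def by (auto intro!: derivative_eq_intros continuous_intros simp: inner_add_left algebra_simps)

lemma C1_grad_cmult [intro]:
 assumes "C1_grad f F" shows "C1_grad (%x. c * f x) (%x. c *. F x)" using C1_grad_mult[OF C1_grad_const assms, of c] by simp

lemma C1_grad_sum [intro]:
 assumes "!!i. i : I ==> C1_grad (f i) (F i)"
 shows "C1_grad (%x. SUM i:I. f i x) (%x. SUM i:I. F i x)" using assms by (induction I rule: infinite_finite_induct) (auto intro: C1_grad_const)

lemma C1_grad_compose_real:
 assumes f: "C1_grad f F" and g: "!!t. (g has_real_derivative g' t) (at t)"
  and c: "continuous_on UNIV g'"
 shows "C1_grad (%x. g (f x)) (%x. g' (f x) *. F x)" unfolding C1_grad_def proof (intro conjI allI)
 show "continuous_on UNIV (%x. g' (f x) *. F x)" using C1_grad_continuous[OF f] C1_gradD(2)[OF f] continuous_on_compose2[OF c, of UNIV f]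
  by (intro continuous_intros) auto
 show "((%x. g (f x)) has_derivative (%h. (g' (f x) *. F x) <.> h)) (at x)" for x
  using has_derivative_compose[OF C1_gradD(1)[OF f, of x] g[of "f x", unfolded has_field_derivative_def]] by simp
qed

lemma C1_grad_compose_linear:
 assumes f: "C1_grad f F" and A: "linear A" and adj: "!!x y. A x <.> y = x <.> B y" and B: "linear B"
 shows "C1_grad (%x. f (A x + c)) (%x. B (F (A x + c)))" unfolding C1_grad_def proof (intro conjI allI)
 have cA: "continuous_on UNIV A" and cB: "continuous_on UNIV B" using A B linear_continuous_on linear_conv_bounded_linear by blast+
 have "continuous_on UNIV (%x. F (A x + c))" by (rule continuous_on_compose2[OF C1_gradD(2)[OF f]]) (auto intro!: continuous_intros cA)
 thus "continuous_on UNIV (%x. B (F (A x + c)))" by (rule continuous_on_compose2[OF cB]) auto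
 show "((%x. f (A x + c)) has_derivative (%h. B (F (A x + c)) <.> h)) (at x)" for x proof -
  have "((%x. A x + c) has_derivative A) (at x)" using A by (auto intro!: derivative_eq_intros linear_imp_has_derivative)
  from has_derivative_compose[OF this C1_gradD(1)[OF f]] show ?thesis using adj by (simp add: inner_commute)
 qed
qed

lemma C1_grad_compose_affine:
 assumes f: "C1_grad f F"
 shows "C1_grad (%x. f (r *. x + c)) (%x. r *. F (r *. x + c))" by (rule C1_grad_compose_linear[OF f, of "%x. r *. x" "%x. r *. x"])
   (auto intro!: linear_scaleR linear_compose_scale_right simp: linear_iff algebra_simps)

text \<open>Mean value inequality for \<open>f\<close> minus the linear function with gradient
  \<open>a\<close>. With \<open>a = 0\<close> it is a Lipschitz bound; with \<open>a\<close> the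
  gradient at a point it measures how affine \<open>f\<close> is nearby. Most local estimates below
  are one of these two cases.\<close>

lemma C1_grad_near_affine:
 assumes f: "C1_grad f F" and S: "convex S" "x : S" "y : S"
  and b: "!!z. z : S ==> norm (F z - a) <= e"
 shows "<|f y - f x - a <.> (y - x)|> <= e * norm (y - x)" proof -
 have "norm ((f y - a <.> y) - (f x - a <.> x)) <= e * norm (y - x)" proof (rule differentiable_bound[OF S(1) _ _ S(3,2)])
  fix z assume z: "z : S"
  show "((%y. f y - a <.> y) has_derivative (%h. F z <.> h - a <.> h)) (at z within S)"
   by (auto intro!: derivative_eq_intros has_derivative_at_withinI[OF C1_gradD(1)[OF f]])
  show "onorm (%h. F z <.> h - a <.> h) <= e" proof (rule onorm_le)
   fix h
   have "norm (F z <.> h - a <.> h) = <|(F z - a) <.> h|>" by (simp add: inner_diff_left)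
   also have "... <= norm (F z - a) * norm h" by (rule Cauchy_Schwarz_ineq2)
   also have "... <= e * norm h" using b[OF z] by (simp add: mult_right_mono)
   finally show "norm (F z <.> h - a <.> h) <= e * norm h" .
  qed
 qed
 thus ?thesis by (simp add: inner_diff_right algebra_simps)
qed

lemma C1_grad_lipschitz:
 assumes f: "C1_grad f F" and b: "!!z. norm (F z) <= L"
 shows "L-lipschitz_on UNIV f" proof (rule lipschitz_onI)
 show "0 <= L" using b[of 0] norm_ge_zero order_trans by blast
 show "dist (f x) (f y) <= L * dist x y" for x y using C1_grad_near_affine[OF f, of UNIV y x 0 L] b by (simp add: dist_norm)
qed

text \<open>A displacement along \<open>F x\<close> itself realises the slope
  \<open>norm (F x)\<close>, so a growth bound at the single point \<open>x\<close> controls the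
  gradient there.\<close>

lemma C1_grad_bound_within:
 assumes f: "C1_grad f F" and lip: "!!y. <|f y - f x|> <= L * norm (y - x)"
 shows "norm (F x) <= L" proof (rule ccontr)
 assume "~ norm (F x) <= L"
 hence L: "L < norm (F x)" by simp
 obtain i :: 'a where i: "i : Basis" using nonempty_Basis by blast
 have L0: "0 <= L" using lip[of "x + i"] i by (smt (verit) add_diff_cancel_left' mult_cancel_left1 norm_Basis)
 define e where "e = (norm (F x) - L) / 2"
 have e: "e > 0" using L by (simp add: e_def)
 have "(f has_derivative (%h. F x <.> h)) (at x)" by (rule C1_gradD[OF f])
 then obtain d where d: "d > 0"
  "!!y. norm (y - x) < d ==> norm (f y - f x - F x <.> (y - x)) <= e * norm (y - x)" using e unfolding has_derivative_at_alt by blast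
 \<comment> \<open>The displacement \<open>s *. F x\<close> has length \<open>d / 2\<close>, inside
   the radius where the first order error is at most \<open>e\<close>.\<close>
 define s where "s = d / (2 * norm (F x))"
 have Fx: "norm (F x) > 0" using L L0 by linarith
 have s: "s > 0" using d(1) Fx by (simp add: s_def)
 have n: "norm ((x + s *. F x) - x) = s * norm (F x)" using s by simp
 have "s * norm (F x) < d" using d(1) Fx by (simp add: s_def)
 hence 1: "norm (f (x + s *. F x) - f x - s * (norm (F x))^2) <= e * (s * norm (F x))"
  using d(2)[of "x + s *. F x", unfolded n] by (simp add: power2_norm_eq_inner)
 have 2: "<|f (x + s *. F x) - f x|> <= L * (s * norm (F x))" using lip[of "x + s *. F x", unfolded n] .
 have "s * (norm (F x))^2 <= (L + e) * (s * norm (F x))" using 1 2 by (simp add: abs_le_iff algebra_simps)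
 hence "(s * norm (F x)) * norm (F x) <= (s * norm (F x)) * (L + e)" by (simp add: power2_eq_square algebra_simps)
 hence "norm (F x) <= L + e" using s Fx by (simp add: mult_le_cancel_left_pos)
 thus False using L by (simp add: e_def field_simps)
qed

lemma C1_grad_bound:
 assumes f: "C1_grad f F" and lip: "L-lipschitz_on UNIV f"
 shows "norm (F x) <= L" using lipschitz_onD[OF lip] by (intro C1_grad_bound_within[OF f]) (simp add: dist_norm)

lemma C1_grad_limit:
 fixes f :: "nat => 'a::euclidean_space => real"
 assumes f: "!!n. C1_grad (f n) (F n)" and u: "uniform_limit UNIV F G sequentially"
  and l: "!!x. (%n. f n x) ----> g x"
 shows "C1_grad g G" unfolding C1_grad_def proof (intro conjI allI)
 show "continuous_on UNIV G" using C1_gradD(2)[OF f] by (intro uniform_limit_theorem[OF _ u]) auto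
 have "EX g. ALL x:UNIV. (%n. f n x) ----> g x & (g has_derivative (%h. G x <.> h)) (at x within UNIV)"
 proof (rule has_derivative_sequence[of UNIV f "%n x h. F n x <.> h"])
  show "(%n. f n 0) ----> g 0" by (rule l)
  fix e :: real assume e: "e > 0"
  have "\<forall>\<^sub>F n in sequentially. ALL x:UNIV. dist (F n x) (G x) < e" using u e by (auto simp: uniform_limit_iff)
  thus "\<forall>\<^sub>F n in sequentially. ALL x:UNIV. ALL h. norm (F n x <.> h - G x <.> h) <= e * norm h" proof eventually_elim
   case (elim n)
   show ?case proof safe
    fix x h
    have "norm (F n x <.> h - G x <.> h) <= norm (F n x - G x) * norm h" using Cauchy_Schwarz_ineq2[of "F n x - G x" h] by (simp add: inner_diff_left)
    also have "... <= e * norm h" using elim by (intro mult_right_mono) (auto simp: dist_norm less_imp_le)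
    finally show "norm (F n x <.> h - G x <.> h) <= e * norm h" .
   qed
  qed
 qed (use C1_gradD(1)[OF f] in auto)
 then obtain g' where g': "!!x. (%n. f n x) ----> g' x" "!!x. (g' has_derivative (%h. G x <.> h)) (at x)" by auto
 have "g' = g" using g'(1) l LIMSEQ_unique by blast
 thus "(g has_derivative (%h. G x <.> h)) (at x)" for x using g'(2) by simp
qed

text \<open>Only the gradients are dominated, locally uniformly in \<open>x\<close>; the mean value
  inequality transfers the bound to the difference quotients.\<close>

lemma C1_grad_integral:
 fixes k :: "'a::euclidean_space => 'b => real"
 assumes der: "!!y. y : space M ==> C1_grad (%x. k x y) (%x. G x y)"
  and int: "!!x. integrable M (k x)" and meas: "!!x. G x : borel_measurable M"
  and dom: "!!x0. EX e>0. EX w. integrable M w & (ALL x:ball x0 e. ALL y:space M. norm (G x y) <= w y)"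
 shows "C1_grad (%x. LINT y|M. k x y) (%x. LINT y|M. G x y)" proof -
 have main: "continuous (at x0) (%x. LINT y|M. G x y) &
  ((%x. LINT y|M. k x y) has_derivative (%h. (LINT y|M. G x0 y) <.> h)) (at x0)" for x0 proof -
  obtain e w where e: "e > 0" and w: "integrable M w"
   and b: "!!x y. x : ball x0 e ==> y : space M ==> norm (G x y) <= w y" using dom[of x0] by blast
  have [measurable]: "k x : borel_measurable M" "G x : borel_measurable M" for x
   using int[of x] meas[of x] by (auto dest: borel_measurable_integrable)
  have iG: "integrable M (G x)" if "x : ball x0 e" for x proof (rule Bochner_Integration.integrable_bound[OF w meas])
   show "AE y in M. norm (G x y) <= norm (w y)" proof (rule AE_I2)
    fix y assume "y : space M"
    from b[OF that this] show "norm (G x y) <= norm (w y)" by simp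
   qed
  qed
  have ev: "EX N. ALL n. X (n + N) : ball x0 e" if "X ----> x0" for X proof -
   from metric_LIMSEQ_D[OF that e] obtain N where "ALL n>=N. dist (X n) x0 < e" ..
   thus ?thesis by (intro exI[of _ N]) (simp add: dist_commute)
  qed
  have c: "continuous (at x0) (%x. LINT y|M. G x y)" unfolding continuous_within tendsto_at_iff_sequentially comp_def proof safe
   fix X :: "nat => 'a" assume X: "X ----> x0"
   obtain N where N: "!!n. X (n + N) : ball x0 e" using ev[OF X] by blast
   have "(%n. LINT y|M. G (X (n + N)) y) ----> (LINT y|M. G x0 y)" proof (rule integral_dominated_convergence[OF _ _ w])
    show "AE y in M. (%n. G (X (n + N)) y) ----> G x0 y" proof (rule AE_I2)
     fix y assume "y : space M"
     hence "continuous (at x0) (%x. G x y)" using C1_gradD(2)[OF der] continuous_on_eq_continuous_at[OF open_UNIV] by blast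
     moreover have "(%n. X (n + N)) ----> x0" using X by (rule LIMSEQ_ignore_initial_segment)
     ultimately show "(%n. G (X (n + N)) y) ----> G x0 y" by (rule isCont_tendsto_compose)
    qed
   qed (use meas b N in auto)
   thus "(%n. LINT y|M. G (X n) y) ----> (LINT y|M. G x0 y)" by (rule LIMSEQ_offset)
  qed
  have "((%x. LINT y|M. k x y) has_derivative (%h. (LINT y|M. G x0 y) <.> h)) (at x0)" unfolding has_derivative_iff_norm proof (intro conjI)
   show "bounded_linear ((<.>) (LINT y|M. G x0 y))" by (rule bounded_linear_inner_right)
   show "((%x. norm ((LINT y|M. k x y) - (LINT y|M. k x0 y) - (LINT y|M. G x0 y) <.> (x - x0)) / norm (x - x0)) \<longlongrightarrow> 0) (at x0)"
    unfolding tendsto_at_iff_sequentially comp_def proof safe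
    fix X :: "nat => 'a" assume X: "X ----> x0" and ne: "ALL i. X i : UNIV - {x0}"
    obtain N where N: "!!n. X (n + N) : ball x0 e" using ev[OF X] by blast
    \<comment> \<open>First order error divided by the step. The increment of \<open>k\<close> and
      its linear part are each at most \<open>w y\<close> times the step, so \<open>2 * w y\<close>
      dominates.\<close>
    define q where "q n y = norm (k (X (n + N)) y - k x0 y - G x0 y <.> (X (n + N) - x0)) / norm (X (n + N) - x0)" for n y
    have kb: "<|k x y - k x0 y|> <= w y * norm (x - x0)" if "x : ball x0 e" "y : space M" for x y
     using C1_grad_near_affine[OF der[OF that(2)], of "ball x0 e" x0 x 0 "w y"] that b e by simp
    have qb: "<|q n y|> <= 2 * w y" if y: "y : space M" for n y proof -
     have "norm (k (X (n + N)) y - k x0 y - G x0 y <.> (X (n + N) - x0))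
      <= w y * norm (X (n + N) - x0) + norm (G x0 y) * norm (X (n + N) - x0)"
      using kb[OF N[of n] y] Cauchy_Schwarz_ineq2[of "G x0 y" "X (n + N) - x0"] by simp
     also have "... <= 2 * w y * norm (X (n + N) - x0)" using mult_right_mono[OF b[of x0 y] norm_ge_zero[of "X (n + N) - x0"]] e y by simp
     finally have "q n y <= 2 * w y" using ne unfolding q_def by (simp add: divide_le_eq)
     moreover have "0 <= q n y" unfolding q_def by simp
     ultimately show ?thesis by simp
    qed
    have "(%n. LINT y|M. q n y) ----> (LINT y|M. 0)" proof (rule integral_dominated_convergence[of _ _ _ "%y. 2 * w y"])
     show "q n : borel_measurable M" for n unfolding q_def by measurable
     show "AE y in M. (%n. q n y) ----> 0" proof (rule AE_I2)
      fix y assume "y : space M"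
      hence "((%x. norm (k x y - k x0 y - G x0 y <.> (x - x0)) / norm (x - x0)) \<longlongrightarrow> 0) (at x0)"
       using C1_gradD(1)[OF der] unfolding has_derivative_iff_norm by blast
      from this[unfolded tendsto_at_iff_sequentially, rule_format, of "%n. X (n + N)"]
      show "(%n. q n y) ----> 0" using ne LIMSEQ_ignore_initial_segment[OF X] by (simp add: q_def comp_def)
     qed
    qed (use w qb in auto)
    hence q0: "(%n. LINT y|M. q n y) ----> 0" by simp
    have le: "norm ((LINT y|M. k (X (n+N)) y) - (LINT y|M. k x0 y) - (LINT y|M. G x0 y) <.> (X (n+N) - x0)) / norm (X (n+N) - x0)
      <= (LINT y|M. q n y)" for n proof -
     have iG0: "integrable M (G x0)" using iG e by simp
     have "(LINT y|M. k (X (n+N)) y) - (LINT y|M. k x0 y) - (LINT y|M. G x0 y) <.> (X (n+N) - x0)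
      = (LINT y|M. k (X (n+N)) y - k x0 y - G x0 y <.> (X (n+N) - x0))" using int iG0 by (simp add: Bochner_Integration.integral_diff)
     moreover have "norm ... <= (LINT y|M. norm (k (X (n+N)) y - k x0 y - G x0 y <.> (X (n+N) - x0)))" by (rule integral_norm_bound)
     ultimately show ?thesis unfolding q_def by (simp add: divide_right_mono)
    qed
    have "(%n. norm ((LINT y|M. k (X (n+N)) y) - (LINT y|M. k x0 y) - (LINT y|M. G x0 y) <.> (X (n+N) - x0)) / norm (X (n+N) - x0)) ----> 0"
     by (rule tendsto_sandwich[OF _ _ tendsto_const q0]) (use le in "auto intro!: always_eventually")
    thus "(%n. norm ((LINT y|M. k (X n) y) - (LINT y|M. k x0 y) - (LINT y|M. G x0 y) <.> (X n - x0)) / norm (X n - x0)) ----> 0"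
     by (rule LIMSEQ_offset)
   qed
  qed
  thus ?thesis using c by blast
 qed
 show ?thesis unfolding C1_grad_def continuous_on_eq_continuous_at[OF open_UNIV] using main by blast
qed

section \<open>Mollification\<close>

lemma C1_grad_min_zero:
 assumes f: "C1_grad f F" and m: "!!y. f x <= f y"
 shows "F x = 0" proof -
 have "(%h. F x <.> h) = (%h. 0)" by (rule differential_zero_maxmin[OF _ open_UNIV C1_gradD(1)[OF f]]) (use m in auto)
 hence "F x <.> F x = 0" by meson
 thus ?thesis by simp
qed

lemma C1_grad_max_zero:
 assumes f: "C1_grad f F" and m: "!!y. f y <= f x"
 shows "F x = 0" using C1_grad_min_zero[OF C1_grad_minus[OF f], of x] m by simp

lemma lborel_integral_affine:
 fixes f :: "'a::euclidean_space => 'b::{banach, second_countable_topology}"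
 assumes c: "c ~= 0" and f: "f : borel_measurable borel"
 shows "(LBINT x. f x) = <|c|> ^ DIM('a) *. (LBINT x. f (t + c *. x))" proof -
 have "(LBINT x. f x)
  = (LINT x|density (distr lborel borel (%x. t + c *. x)) (%_. ennreal (<|c|> ^ DIM('a))). f x)"
  by (subst lborel_affine[OF c, of t]) (simp add: ennreal_power)
 also have "... = (LINT x|distr lborel borel (%x. t + c *. x). <|c|> ^ DIM('a) *. f x)" using f by (intro integral_density) auto
 also have "... = (LBINT x. <|c|> ^ DIM('a) *. f (t + c *. x))" using f by (intro integral_distr) auto
 finally show ?thesis by simp
qed

lemma lborel_nn_integral_affine:
 fixes f :: "'a::euclidean_space => ennreal"
 assumes c: "c ~= 0" and f: "f : borel_measurable borel"
 shows "(NN x. f x) = ennreal (<|c|> ^ DIM('a)) * (NN x. f (t + c *. x))" proof -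
 have "(NN x. f x)
  = (\<integral>\<^sup>+x. f x \<partial>density (distr lborel borel (%x. t + c *. x)) (%_. ennreal (<|c|> ^ DIM('a))))"
  by (subst lborel_affine[OF c, of t]) (simp add: ennreal_power)
 also have "... = (\<integral>\<^sup>+x. ennreal (<|c|> ^ DIM('a)) * f x \<partial>distr lborel borel (%x. t + c *. x))"
  using f by (intro nn_integral_density) auto
 also have "... = (NN x. ennreal (<|c|> ^ DIM('a)) * f (t + c *. x))" using f by (intro nn_integral_distr) auto
 also have "... = ennreal (<|c|> ^ DIM('a)) * (NN x. f (t + c *. x))" using f by (intro nn_integral_cmult) auto
 finally show ?thesis .
qed

lemma lborel_integrable_compact_support:
 fixes f :: "'a::euclidean_space => 'b::euclidean_space"
 assumes "continuous_on UNIV f" "!!x. R < norm x ==> f x = 0"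
 shows "integrable lborel f" proof -
 have "integrable lborel (%x. indicator (cball 0 R) x *. f x)" by (rule borel_integrable_compact) (use assms in "auto intro: continuous_on_subset")
 also have "(%x. indicator (cball 0 R) x *. f x) = f" using assms(2) by (auto simp: indicator_def fun_eq_iff)
 finally show ?thesis .
qed

lemma integrable_indicator_bounded:
 fixes A :: "'a::euclidean_space set"
 assumes "bounded A" "A : sets borel"
 shows "integrable lborel (indicator A :: 'a => real)" using emeasure_bounded_finite[OF assms(1)] assms(2) by (intro integrable_real_indicator) auto

text \<open>Squaring the truncated paraboloid makes it C1 across the unit sphere, which is the
  smoothness that a C1 mollification requires.\<close>

definition bump_raw :: "'a::euclidean_space => real" where
 "bump_raw x = (max 0 (1 - x <.> x))^2"

definition bump :: "'a::euclidean_space => real" where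
 "bump x = bump_raw x / (LBINT z. bump_raw (z::'a))"

lemma real_derivative_max_square:
 "((%t. (max 0 t)^2) has_real_derivative 2 * max 0 t) (at t)" proof -
 consider "t < 0" | "t > 0" | "t = 0" by linarith
 thus ?thesis proof cases
  case 1
  have "((%t. 0::real) has_real_derivative 2 * max 0 t) (at t)" using 1 by (auto intro!: derivative_eq_intros)
  thus ?thesis by (rule has_field_derivative_transform_within_open[of _ _ _ "{..<0}"]) (use 1 in auto)
 next
  case 2
  have "((%t. t^2) has_real_derivative 2 * max 0 t) (at t)" using 2 by (auto intro!: derivative_eq_intros)
  thus ?thesis by (rule has_field_derivative_transform_within_open[of _ _ _ "{0<..}"]) (use 2 in auto)
 next
  case 3
  have "((%h. max 0 h) \<longlongrightarrow> max 0 0) (at (0::real))" by (intro tendsto_intros)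
  moreover have "\<forall>\<^sub>F h in at 0. (max 0 h)^2 / h = max 0 (h::real)" by (auto simp: eventually_at_filter max_def power2_eq_square)
  ultimately have "((%h. (max 0 h)^2 / h) \<longlongrightarrow> 0) (at (0::real))" by (simp add: tendsto_cong)
  thus ?thesis using 3 by (simp add: DERIV_def)
 qed
qed

lemma C1_grad_norm_square: "C1_grad (%x. x <.> x) (%x. 2 *. x)" unfolding C1_grad_def
 by (auto intro!: derivative_eq_intros continuous_intros simp: inner_commute)

lemma C1_grad_bump_raw:
 "C1_grad bump_raw (%x. (2 * max 0 (1 - x <.> x)) *. (0 - 2 *. x))" unfolding bump_raw_def[abs_def]
 by (rule C1_grad_compose_real[OF C1_grad_diff[OF C1_grad_const C1_grad_norm_square] real_derivative_max_square])
   (intro continuous_intros)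

lemma bump_raw_nonneg: "0 <= bump_raw x" by (simp add: bump_raw_def)

lemma bump_raw_outside: "1 < norm x ==> bump_raw x = 0"
 by (simp add: bump_raw_def power2_norm_eq_inner[symmetric] max_def one_le_power abs_square_le_1 not_le)

lemma integrable_bump_raw: "integrable lborel (bump_raw :: 'a::euclidean_space => real)"
 by (rule lborel_integrable_compact_support[OF C1_grad_continuous[OF C1_grad_bump_raw], of 1])
   (rule bump_raw_outside)

lemma bump_raw_integral_pos: "0 < (LBINT z. bump_raw (z::'a::euclidean_space))" proof -
 have "0 < measure lborel (ball (0::'a) (1/2)) * (1/4)" by (simp add: content_ball_pos)
 also have "... = (LBINT z. indicator (ball (0::'a) (1/2)) z *. (1/4))" by (subst integral_scaleR_left)
    (auto intro!: integrable_indicator_bounded)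
 also have "... <= (LBINT z. bump_raw (z::'a))" proof (rule integral_mono[OF _ integrable_bump_raw])
  show "integrable lborel (%z. indicator (ball (0::'a) (1/2)) z *. (1/4::real))"
   by (intro integrable_scaleR_left) (auto intro!: integrable_indicator_bounded)
  fix z :: 'a
  show "indicator (ball (0::'a) (1/2)) z *. (1/4) <= bump_raw z" proof (cases "z : ball 0 (1/2)")
   case True
   hence "(norm z)^2 <= (1/2)^2" by (intro power_mono) auto
   hence "z <.> z <= 1/4" unfolding power2_norm_eq_inner by (simp add: power2_eq_square)
   hence "1/2 <= max 0 (1 - z <.> z)" by simp
   hence "(1/2)^2 <= bump_raw z" unfolding bump_raw_def by (rule power_mono) simp
   thus ?thesis using True by (simp add: power2_eq_square)
  qed (simp add: bump_raw_nonneg)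
 qed
 finally show ?thesis .
qed

lemma bump_nonneg: "0 <= bump x" using bump_raw_integral_pos[where 'a='a] by (simp add: bump_def bump_raw_nonneg less_imp_le)

lemma bump_outside: "1 < norm x ==> bump x = 0" by (simp add: bump_def bump_raw_outside)

lemma integrable_bump: "integrable lborel (bump :: 'a::euclidean_space => real)"
 unfolding bump_def[abs_def] by (intro integrable_divide integrable_bump_raw)

lemma bump_integral: "(LBINT z. bump (z::'a::euclidean_space)) = 1" using bump_raw_integral_pos[where 'a='a] unfolding bump_def by simp

lemma C1_grad_bump: obtains B :: "'a::euclidean_space => 'a" where "C1_grad bump B" "!!x. 1 < norm x ==> B x = 0" proof -
 define c where "c = 1 / (LBINT z. bump_raw (z::'a))"
 have "bump = (%x::'a. c * bump_raw x)" by (auto simp: bump_def c_def)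
 then obtain B where B: "C1_grad (bump::'a=>real) B" using C1_grad_cmult[OF C1_grad_bump_raw, of c] by metis
 have "B x = 0" if "1 < norm x" for x by (rule C1_grad_min_zero[OF B]) (use bump_outside[OF that] bump_nonneg in auto)
 with B that show thesis by blast
qed

lemma continuous_bump: "continuous_on A bump" by (rule C1_grad_bump) (rule C1_grad_continuous)

text \<open>Averaging over a fixed unit ball makes the scale an ordinary parameter: locality,
  monotonicity and Lipschitz bounds become pointwise inequalities under the integral.\<close>

definition mollify :: "real => ('a::euclidean_space => real) => 'a => real" where
 "mollify r f x = (LBINT z. f (x + r *. z) * bump z)"

lemma mollify_integrable:
 assumes "continuous_on UNIV f"
 shows "integrable lborel (%z. f (x + r *. z) * bump z)" proof (rule lborel_integrable_compact_support[of _ 1])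
 show "continuous_on UNIV (%z. f (x + r *. z) * bump z)" by (intro continuous_intros continuous_on_compose2[OF assms] continuous_bump) auto
qed (simp add: bump_outside)

lemma mollify_cong:
 assumes "!!y. dist x y <= <|r|> ==> f y = g y"
 shows "mollify r f x = mollify r g x" unfolding mollify_def proof (rule lint_cong[OF refl])
 fix z :: 'a
 show "f (x + r *. z) * bump z = g (x + r *. z) * bump z" proof (cases "norm z <= 1")
  case True
  hence "dist x (x + r *. z) <= <|r|>" by (simp add: dist_norm mult_left_le)
  thus ?thesis using assms by simp
 qed (simp add: bump_outside)
qed

lemma mollify_const: "mollify r (%_. c) x = c" unfolding mollify_def by (simp add: bump_integral)

lemma mollify_mono:
 assumes "continuous_on UNIV f" "continuous_on UNIV g" "!!y. dist x y <= <|r|> ==> f y <= g y"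
 shows "mollify r f x <= mollify r g x" unfolding mollify_def proof (rule integral_mono)
 fix z :: 'a
 show "f (x + r *. z) * bump z <= g (x + r *. z) * bump z" proof (cases "norm z <= 1")
  case True
  hence "dist x (x + r *. z) <= <|r|>" by (simp add: dist_norm mult_left_le)
  thus ?thesis using assms bump_nonneg by (intro mult_right_mono) auto
 qed (simp add: bump_outside)
qed (use assms mollify_integrable in auto)

lemma mollify_lipschitz:
 assumes f: "L-lipschitz_on UNIV f"
 shows "L-lipschitz_on UNIV (mollify r f)" proof (rule lipschitz_onI)
 show "0 <= L" using f by (rule lipschitz_on_nonneg)
 have c: "continuous_on UNIV f" using f by (rule lipschitz_on_continuous_on)
 fix x y :: 'a
 have le: "mollify r f x <= mollify r f y + L * dist x y" for x y proof -
  have "mollify r f x <= (LBINT z. f (y + r *. z) * bump z + L * dist x y * bump z)" unfolding mollify_def proof (rule integral_mono)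
   fix z :: 'a
   have "f (x + r *. z) <= f (y + r *. z) + L * dist x y" using lipschitz_onD[OF f, of "x + r *. z" "y + r *. z"] by (simp add: dist_real_def)
   from mult_right_mono[OF this bump_nonneg[of z]]
   show "f (x + r *. z) * bump z <= f (y + r *. z) * bump z + L * dist x y * bump z" by (simp add: algebra_simps)
  qed (intro Bochner_Integration.integrable_add mollify_integrable[OF c] integrable_mult_right integrable_bump)+
  also have "... = mollify r f y + L * dist x y" unfolding mollify_def by (subst Bochner_Integration.integral_add[OF mollify_integrable[OF c]])
     (auto simp: bump_integral intro!: integrable_mult_right integrable_bump)
  finally show ?thesis .
 qed
 show "dist (mollify r f x) (mollify r f y) <= L * dist x y" using le[of x y] le[of y x] by (simp add: dist_real_def dist_commute abs_le_iff)
qed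

lemma mollify_close:
 assumes f: "L-lipschitz_on UNIV f"
 shows "<|mollify r f x - f x|> <= L * <|r|>" proof -
 have c: "continuous_on UNIV f" using f by (rule lipschitz_on_continuous_on)
 have "dist x y <= <|r|> ==> <|f y - f x|> <= L * <|r|>" for y
  using lipschitz_onD[OF f, of y x] mult_left_mono[of "dist x y" "<|r|>" L] lipschitz_on_nonneg[OF f] by (simp add: dist_real_def dist_commute)
 hence "dist x y <= <|r|> ==> f x - L * <|r|> <= f y & f y <= f x + L * <|r|>" for y by (fastforce simp: abs_le_iff)
 hence "mollify r (%_. f x - L * <|r|>) x <= mollify r f x" "mollify r f x <= mollify r (%_. f x + L * <|r|>) x"
  by (auto intro!: mollify_mono c continuous_intros)
 thus ?thesis by (simp add: mollify_const)
qed

lemma mollify_C1: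
 fixes f :: "'a::euclidean_space => real"
 assumes c: "continuous_on UNIV f" and r: "r > 0"
 shows "EX F. C1_grad (mollify r f) F" proof -
 obtain B :: "'a => 'a" where B: "C1_grad bump B" "!!x. 1 < norm x ==> B x = 0" using C1_grad_bump by blast
 have fm[measurable]: "f : borel_measurable borel" using c by (rule borel_measurable_continuous_onI)
 have bm[measurable]: "bump : borel_measurable (borel::'a measure)" "B : borel_measurable borel" using C1_grad_borel[OF B(1)] by auto
 \<comment> \<open>After the substitution \<open>y = x + r *. z\<close> the argument of
   \<open>bump\<close> is \<open>s *. x + (1 / r) *. y\<close>. Now \<open>x\<close> enters only
   through the C1 kernel, and continuity of \<open>f\<close> is enough.\<close>
 define s where "s = - (1 / r)"
 have s: "s ~= 0" "<|s|> = 1 / r" using r by (auto simp: s_def)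
 define k where "k x y = (f y / r ^ DIM('a)) * bump (s *. x + (1 / r) *. y)" for x y
 define G where "G x y = (f y / r ^ DIM('a)) *. (s *. B (s *. x + (1 / r) *. y))" for x y
 have eq: "mollify r f x = (LBINT y. k x y)" for x proof -
  have "(LBINT y. k x y) = <|r|> ^ DIM('a) *. (LBINT z. k x (x + r *. z))" by (rule lborel_integral_affine) (use r in "auto simp: k_def")
  also have "... = (LBINT z. <|r|> ^ DIM('a) * k x (x + r *. z))" by simp
  also have "... = mollify r f x" unfolding mollify_def using r by (intro lint_cong) (auto simp: k_def s_def algebra_simps)
  finally show ?thesis by simp
 qed
 have out: "1 < norm (s *. x + (1 / r) *. y)" if "norm (y - x) > r" for x y proof -
  have "s *. x + (1 / r) *. y = (1 / r) *. (y - x)" by (simp add: s_def algebra_simps)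
  hence "norm (s *. x + (1 / r) *. y) = norm (y - x) / r" using r by simp
  moreover have "1 < norm (y - x) / r" using that r by simp
  ultimately show ?thesis by simp
 qed
 have nr: "norm (y - x) > r" if "r + norm x < norm y" for x y :: 'a using norm_triangle_ineq2[of y x] that by linarith
 have "C1_grad (%x. LINT y|lborel. k x y) (%x. LINT y|lborel. G x y)" proof (rule C1_grad_integral)
  show "C1_grad (%x. k x y) (%x. G x y)" for y unfolding k_def G_def by (intro C1_grad_cmult C1_grad_compose_affine B)
  show "G x : borel_measurable lborel" for x unfolding G_def by measurable
  show "integrable lborel (k x)" for x proof (rule lborel_integrable_compact_support[of _ "r + norm x"])
   have "continuous_on UNIV (%y. bump (s *. x + (1 / r) *. y))" by (intro continuous_on_compose2[OF continuous_bump[of UNIV]] continuous_intros) auto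
   thus "continuous_on UNIV (k x)" unfolding k_def[abs_def] using r by (intro continuous_intros c) auto
   show "k x y = 0" if "r + norm x < norm y" for y using bump_outside[OF out[OF nr[OF that]]] by (simp add: k_def)
  qed
  fix x0 :: 'a
  have cB: "continuous_on UNIV B" by (rule C1_gradD[OF B(1)])
  have "compact (f ` cball 0 (r + norm x0 + 1))" "compact (B ` cball 0 1)"
   by (auto intro!: compact_continuous_image continuous_on_subset[OF c] continuous_on_subset[OF cB])
  hence "bounded (f ` cball 0 (r + norm x0 + 1))" "bounded (B ` cball 0 1)" by (auto dest: compact_imp_bounded)
  then obtain b1 b2 where b1: "ALL y:f ` cball 0 (r + norm x0 + 1). norm y <= b1"
   and b2': "ALL y:B ` cball 0 1. norm y <= b2" unfolding bounded_iff by metis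
  have b20: "b2 >= 0" using order_trans[OF norm_ge_zero b2'[rule_format, of "B 0"]] by simp
  hence b2: "norm (B y) <= b2" for y using b2' B(2)[of y] by (cases "norm y <= 1") auto
  define w where "w y = indicator (cball 0 (r + norm x0 + 1)) y *. (b1 / r ^ DIM('a) * <|s|> * b2)" for y :: 'a
  have "integrable lborel w" unfolding w_def by (intro integrable_scaleR_left) (auto intro!: integrable_indicator_bounded)
  moreover have "norm (G x y) <= w y" if x: "x : ball x0 1" for x y proof (cases "norm y <= r + norm x0 + 1")
   case True
   have "norm (G x y) = (<|f y|> / r ^ DIM('a)) * <|s|> * norm (B (s *. x + (1 / r) *. y))" using r by (simp add: G_def abs_mult)
   also have "... <= b1 / r ^ DIM('a) * <|s|> * b2" proof (intro mult_mono divide_right_mono b2)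
    show "<|f y|> <= b1" using b1 True by simp
    thus "0 <= b1 / r ^ DIM('a)" "0 <= b1 / r ^ DIM('a) * <|s|>" using r by auto
   qed (use r in auto)
   finally show ?thesis using True by (simp add: w_def)
  next
   case False
   have "norm x <= norm x0 + 1" using x norm_triangle_ineq2[of x x0] by (simp add: dist_norm norm_minus_commute)
   hence "r + norm x < norm y" using False by simp
   thus ?thesis using False B(2)[OF out[OF nr]] by (simp add: G_def w_def)
  qed
  ultimately show "EX e>0. EX w. integrable lborel w & (ALL x:ball x0 e. ALL y:space lborel. norm (G x y) <= w y)"
   by (intro exI[of _ 1] conjI exI[of _ w]) auto
 qed
 thus ?thesis unfolding eq[abs_def] by blast
qed

lemma C1_approx_lipschitz:
 assumes f: "L-lipschitz_on UNIV f" and e: "e > 0"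
 obtains g G where "C1_grad g G" "L-lipschitz_on UNIV g" "!!x. <|g x - f x|> <= e" proof -
 have L: "L >= 0" using f by (rule lipschitz_on_nonneg)
 \<comment> \<open>The summand 1 covers the case \<open>L = 0\<close>.\<close>
 define r where "r = e / (L + 1)"
 have r: "r > 0" using e L by (simp add: r_def)
 have "L * r <= e" using e L by (simp add: r_def field_simps)
 hence "<|mollify r f x - f x|> <= e" for x using mollify_close[OF f, of r x] r by simp
 moreover obtain G where "C1_grad (mollify r f) G" using mollify_C1[OF lipschitz_on_continuous_on[OF f] r] by blast
 ultimately show ?thesis using that mollify_lipschitz[OF f] by blast
qed

section \<open>Cutoff functions and extension from compact sets\<close>

lemma infdist_lipschitz: "1-lipschitz_on UNIV (%x. infdist x A)" proof (rule lipschitz_onI)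
 fix x y :: 'a
 show "dist (infdist x A) (infdist y A) <= 1 * dist x y" using infdist_triangle[of x A y] infdist_triangle[of y A x]
  by (simp add: dist_real_def dist_commute)
qed simp

text \<open>The clamped distance function is 1 up to distance \<open>r / 3\<close> and 0 from
  \<open>2 * r / 3\<close> on. Mollification at radius \<open>r / 6\<close> keeps the slope bound
  \<open>3 / r\<close> and shrinks both regions by \<open>r / 6\<close>, on which the values stay
  exact.\<close>

lemma C1_cutoff_infdist:
 fixes A :: "'a::euclidean_space set"
 assumes r: "r > 0"
 obtains tht Tht where "C1_grad tht Tht" "!!x. 0 <= tht x" "!!x. tht x <= 1" "!!x. norm (Tht x) <= 3 / r"
  "!!x. infdist x A <= r / 6 ==> tht x = 1" "!!x. r * (5 / 6) <= infdist x A ==> tht x = 0" proof -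
 define f where "f x = max 0 (min 1 (2 - (3 / r) * infdist x A))" for x
 have mm: "<|max 0 (min 1 (2 - a)) - max 0 (min 1 (2 - b))|> <= <|a - b|>" for a b :: real by (auto simp: max_def min_def)
 have lip: "(3/r)-lipschitz_on UNIV f" proof (rule lipschitz_onI)
  fix x y :: 'a
  have "dist (f x) (f y) <= <|(3 / r) * infdist x A - (3 / r) * infdist y A|>" unfolding f_def dist_real_def by (rule mm)
  also have "... = (3 / r) * dist (infdist x A) (infdist y A)" unfolding dist_real_def right_diff_distrib[symmetric] abs_mult using r by simp
  also have "... <= (3 / r) * dist x y" using r lipschitz_onD[OF infdist_lipschitz[of A], of x y] by (intro mult_left_mono) auto
  finally show "dist (f x) (f y) <= 3 / r * dist x y" .
 qed (use r in simp)
 have cont: "continuous_on UNIV f" using lip by (rule lipschitz_on_continuous_on)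
 define tht where "tht = mollify (r / 6) f"
 obtain Tht where Tht: "C1_grad tht Tht" using mollify_C1[OF cont, of "r / 6"] r unfolding tht_def by auto
 have near: "<|infdist y A - infdist x A|> <= r / 6" if "dist x y <= <|r / 6|>" for x y
  using lipschitz_onD[OF infdist_lipschitz[of A], of y x] that r by (simp add: dist_real_def dist_commute)
 show ?thesis proof (rule that[OF Tht])
  show "norm (Tht x) <= 3 / r" for x using C1_grad_bound[OF Tht] mollify_lipschitz[OF lip] unfolding tht_def by blast
  have "mollify (r/6) (%_. 0) x <= tht x" "tht x <= mollify (r/6) (%_. 1) x" for x
   unfolding tht_def by (rule mollify_mono; use cont in "auto simp: f_def")+
  thus "0 <= tht x" "tht x <= 1" for x by (simp_all add: mollify_const)
  show "tht x = 1" if x: "infdist x A <= r / 6" for x proof -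
   have "f y = 1" if "dist x y <= <|r / 6|>" for y proof -
    have "infdist y A <= r / 3" using near[OF that] x by linarith
    hence "(3 / r) * infdist y A <= 1" using r by (simp add: field_simps)
    thus ?thesis by (simp add: f_def)
   qed
   hence "tht x = mollify (r/6) (%_. 1) x" unfolding tht_def by (rule mollify_cong)
   thus ?thesis by (simp add: mollify_const)
  qed
  show "tht x = 0" if x: "r * (5 / 6) <= infdist x A" for x proof -
   have "f y = 0" if "dist x y <= <|r / 6|>" for y proof -
    have "r * (2 / 3) <= infdist y A" using near[OF that] x by linarith
    hence "2 <= (3 / r) * infdist y A" using r by (simp add: field_simps)
    thus ?thesis by (simp add: f_def)
   qed
   hence "tht x = mollify (r/6) (%_. 0) x" unfolding tht_def by (rule mollify_cong)
   thus ?thesis by (simp add: mollify_const)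
  qed
 qed
qed

lemma compact_infdist_subset_open:
 fixes K :: "'a::euclidean_space set"
 assumes "compact K" "open S" "K <= S" "K ~= {}"
 obtains r where "r > 0" "!!x. infdist x K < r ==> x : S" proof (cases "S = UNIV")
 case True
 thus ?thesis using that[of 1] by auto
next
 case False
 define r where "r = setdist K (- S)"
 have r: "r > 0" unfolding r_def using assms False by (subst setdist_gt_0_compact_closed) auto
 show ?thesis proof (rule that[OF r])
  fix x assume x: "infdist x K < r"
  show "x : S" proof (rule ccontr)
   assume "x \<notin> S"
   hence "r <= setdist K {x}" unfolding r_def by (intro setdist_subset_right) auto
   also have "... = infdist x K" using assms by (simp add: infdist_eq_setdist setdist_sym)
   finally show False using x by simp
  qed
 qed
qed

text \<open>The gradient vanishes wherever the cutoff is 0 or 1, because these are its extreme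
  values. Hence multiplying by the cutoff changes no gradients on \<open>K\<close>.\<close>

lemma C1_cutoff:
 fixes K :: "'a::euclidean_space set"
 assumes "compact K" "open S" "K <= S"
 obtains tht Tht T where "C1_grad tht Tht" "!!x. 0 <= tht x" "!!x. tht x <= 1"
  "bounded (range Tht)" "closed T" "T <= S" "!!x. x \<notin> T ==> tht x = 0" "!!x. x : K ==> tht x = 1"
  "!!x. tht x = 0 \<or> tht x = 1 ==> Tht x = 0" proof (cases "K = {}")
 case True
 show ?thesis by (rule that[of "%_. 0" "%_. 0" "{}"]) (use True C1_grad_const in auto)
next
 case False
 obtain r where r: "r > 0" "!!x. infdist x K < r ==> x : S" using compact_infdist_subset_open[OF assms False] by metis
 obtain tht Tht where tht: "C1_grad tht Tht" "!!x. 0 <= tht x" "!!x. tht x <= 1" "!!x. norm (Tht x) <= 3 / r"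
  "!!x. infdist x K <= r / 6 ==> tht x = 1" "!!x. r * (5 / 6) <= infdist x K ==> tht x = 0" by (rule C1_cutoff_infdist[OF r(1), of K]) (rule that)
 define T where "T = {x. infdist x K <= r * (5 / 6)}"
 show ?thesis proof (rule that[OF tht(1-3)])
  show "bounded (range Tht)" unfolding bounded_iff using tht(4) by blast
  show "closed T" unfolding T_def by (intro closed_Collect_le continuous_intros)
  show "T <= S" unfolding T_def using r by force
  show "tht x = 0" if "x \<notin> T" for x using tht(6)[of x] that by (simp add: T_def)
  show "tht x = 1" if "x : K" for x using tht(5)[of x] that r by simp
  show "Tht x = 0" if "tht x = 0 \<or> tht x = 1" for x
   using C1_grad_min_zero[OF tht(1), of x] C1_grad_max_zero[OF tht(1), of x] tht(2,3) that by auto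
 qed
qed

text \<open>McShane's extension: the infimum of the cones \<open>f a + L * dist x a\<close> with
  apex over \<open>A\<close>.\<close>

lemma lipschitz_extension_real:
 fixes f :: "'a::metric_space => real"
 assumes f: "L-lipschitz_on A f"
 obtains g where "L-lipschitz_on UNIV g" "!!x. x : A ==> g x = f x" proof (cases "A = {}")
 case True
 show ?thesis by (rule that[of "%_. 0"]) (use True lipschitz_on_nonneg[OF f] in "auto intro!: lipschitz_onI")
next
 case False
 have L: "L >= 0" using f by (rule lipschitz_on_nonneg)
 define g where "g x = (INF a\<in>A. f a + L * dist x a)" for x
 have low: "f b - L * dist x b <= f a + L * dist x a" if "a : A" "b : A" for a b x proof -
  have "f b - f a <= L * dist b a" using lipschitz_onD[OF f that(2,1)] by (simp add: dist_real_def)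
  also have "... <= L * (dist x b + dist x a)" using L by (intro mult_left_mono) (metis dist_commute dist_triangle)
  finally show ?thesis by (simp add: algebra_simps)
 qed
 have bdd: "bdd_below ((%a. f a + L * dist x a) ` A)" for x using low False unfolding bdd_below_def by (metis (no_types, lifting) ex_in_conv imageE)
 have gle: "g x <= g y + L * dist x y" for x y proof -
  have "g x - L * dist x y <= f a + L * dist y a" if "a : A" for a proof -
   have "g x <= f a + L * dist x a" unfolding g_def by (rule cINF_lower[OF bdd that])
   also have "... <= f a + L * (dist x y + dist y a)" using L by (intro add_left_mono mult_left_mono dist_triangle)
   finally show ?thesis by (simp add: algebra_simps)
  qed
  hence "g x - L * dist x y <= g y" unfolding g_def[of y] by (intro cINF_greatest[OF False])
  thus ?thesis by simp
 qed
 show ?thesis proof (rule that)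
  show "L-lipschitz_on UNIV g" proof (rule lipschitz_onI[OF _ L])
   fix x y show "dist (g x) (g y) <= L * dist x y" using gle[of x y] gle[of y x] by (simp add: dist_real_def dist_commute abs_le_iff)
  qed
  fix x assume x: "x : A"
  have "g x <= f x + L * dist x x" unfolding g_def by (rule cINF_lower[OF bdd x])
  moreover have "f x <= g x" unfolding g_def using low[OF _ x, of _ x] by (intro cINF_greatest[OF False]) auto
  ultimately show "g x = f x" by simp
 qed
qed

text \<open>Away from \<open>A\<close> the function is replaced by a mollified Lipschitz extension; at the
 scale where the two are glued they differ by at most the scale times \<open>eta\<close>.\<close>

lemma C1_small_gradient_extension:
 fixes A :: "'a::euclidean_space set"
 assumes A: "compact A" "A ~= {}" and d: "C1_grad d D" and e: "eta > 0"
  and D: "!!x. x : A ==> norm (D x) <= eta" and lip: "eta-lipschitz_on A d"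
 obtains p P where "C1_grad p P" "!!x. x : A ==> p x = d x" "!!x. norm (P x) <= 16 * eta" proof -
 define S where "S = {x. norm (D x) < 2 * eta}"
 have "open S" unfolding S_def by (intro open_Collect_less continuous_intros C1_gradD(2)[OF d])
 moreover have "A <= S" unfolding S_def using D e by fastforce
 ultimately obtain r where r: "r > 0" "!!x. infdist x A < r ==> x : S" using compact_infdist_subset_open[OF A(1) _ _ A(2)] by metis
 obtain d1 where d1: "eta-lipschitz_on UNIV d1" "!!x. x : A ==> d1 x = d x" using lipschitz_extension_real[OF lip] by metis
 have "eta * r > 0" using e r by simp
 then obtain d2 D2 where d2: "C1_grad d2 D2" "eta-lipschitz_on UNIV d2" "!!x. <|d2 x - d1 x|> <= eta * r" using C1_approx_lipschitz[OF d1(1)] by metis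
 obtain tht Tht where tht: "C1_grad tht Tht" "!!x. 0 <= tht x" "!!x. tht x <= 1" "!!x. norm (Tht x) <= 3 / r"
  "!!x. infdist x A <= r / 6 ==> tht x = 1" "!!x. r * (5 / 6) <= infdist x A ==> tht x = 0" by (rule C1_cutoff_infdist[OF r(1), of A]) (rule that)
 define p where "p x = d2 x + tht x * (d x - d2 x)" for x
 define P where "P x = D2 x + (tht x *. (D x - D2 x) + (d x - d2 x) *. Tht x)" for x
 have D2: "norm (D2 x) <= eta" for x by (rule C1_grad_bound[OF d2(1,2)])
 show ?thesis proof (rule that)
  show "C1_grad p P" unfolding p_def P_def by (intro C1_grad_add C1_grad_mult C1_grad_diff tht d d2)
  show "p x = d x" if "x : A" for x using tht(5)[of x] that r by (simp add: p_def)
  fix x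
  show "norm (P x) <= 16 * eta" proof (cases "infdist x A < r")
   \<comment> \<open>Within distance \<open>r\<close> of \<open>A\<close> three contributions make
     up 16: \<open>eta\<close> from \<open>D2\<close>, \<open>3 * eta\<close> from the interpolated
     gradients, and \<open>12 * eta\<close> from the cutoff, whose gradient is at most
     \<open>3 / r\<close> where \<open>d\<close> and \<open>d2\<close> differ by at most
     \<open>4 * (eta * r)\<close>.\<close>
   case True
   obtain a where a: "a : A" "infdist x A = dist x a" using infdist_attains_inf[OF compact_imp_closed[OF A(1)] A(2)] by metis
   have ball: "z : S" if "z : ball a r" for z using infdist_le[OF a(1), of z] that r(2)[of z] by (simp add: dist_commute)
   have "<|d x - d a - 0 <.> (x - a)|> <= (2 * eta) * norm (x - a)" by (rule C1_grad_near_affine[OF d convex_ball[of a r]])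
      (use ball True a(2) r(1) in "auto simp: S_def dist_commute less_imp_le")
   moreover have "<|d1 x - d1 a|> <= eta * norm (x - a)" using lipschitz_onD[OF d1(1), of x a] by (simp add: dist_norm)
   moreover have "d1 a = d a" by (rule d1(2)[OF a(1)])
   moreover have "eta * norm (x - a) <= eta * r" using True a(2) e by (intro mult_left_mono) (auto simp: dist_norm)
   ultimately have dd: "<|d x - d2 x|> <= 4 * (eta * r)" using d2(3)[of x] by (simp add: abs_le_iff)
   have "x : S" using r(2)[OF True] .
   hence Dx: "norm (D x) <= 2 * eta" by (simp add: S_def)
   have 1: "norm (tht x *. (D x - D2 x)) <= 3 * eta" proof -
    have "norm (tht x *. (D x - D2 x)) <= 1 * norm (D x - D2 x)" unfolding norm_scaleR using tht(2,3)[of x] by (intro mult_right_mono) auto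
    also have "... <= 3 * eta" using norm_triangle_ineq4[of "D x" "D2 x"] Dx D2[of x] by linarith
    finally show ?thesis .
   qed
   have 2: "norm ((d x - d2 x) *. Tht x) <= 12 * eta" proof -
    have "norm ((d x - d2 x) *. Tht x) <= (4 * (eta * r)) * (3 / r)" unfolding norm_scaleR using dd tht(4)[of x] by (intro mult_mono) auto
    also have "... = 12 * eta" using r by simp
    finally show ?thesis .
   qed
   have "norm (P x) <= norm (D2 x) + (norm (tht x *. (D x - D2 x)) + norm ((d x - d2 x) *. Tht x))"
    unfolding P_def by (intro norm_triangle_le add_left_mono norm_triangle_ineq)
   thus ?thesis using 1 2 D2[of x] by simp
  next
   case False
   hence "tht x = 0" using tht(6)[of x] r by simp
   moreover from this have "Tht x = 0" using C1_grad_min_zero[OF tht(1), of x] tht(2) by simp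
   ultimately show ?thesis using D2[of x] e by (simp add: P_def)
  qed
 qed
qed

text \<open>A substitute for Whitney's extension theorem. Each increment is known to be small only
  on \<open>A\<close>; replacing it by a function with the same values on \<open>A\<close> and a
  small gradient everywhere makes the telescoping series of gradients converge uniformly on the
  whole space.\<close>

lemma C1_from_lipschitz_cauchy:
 fixes A :: "'a::euclidean_space set" and g :: "nat => 'a => real"
 assumes A: "compact A" and c: "c > 0" and g: "!!i. C1_grad (g i) (G i)"
  and lip: "!!i. (c / 2 ^ i)-lipschitz_on A (%x. g (Suc i) x - g i x)"
  and grad: "!!i x. x : A ==> norm (G (Suc i) x - G i x) <= c / 2 ^ i"
  and lim: "!!x. x : A ==> (%i. g i x) ----> f x"
 obtains p P where "C1_grad p P" "!!x. x : A ==> p x = f x" proof (cases "A = {}")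
 case True
 thus ?thesis using that[OF C1_grad_const] by auto
next
 case False
 then obtain a where a: "a : A" by auto
 have "EX p P. C1_grad p P & (ALL x:A. p x = g (Suc i) x - g i x) & (ALL x. norm (P x) <= 16 * (c / 2 ^ i))" for i proof -
  have "c / 2 ^ i > 0" using c by simp
  from C1_small_gradient_extension[OF A False C1_grad_diff[OF g[of "Suc i"] g[of i]] this grad lip]
  show ?thesis by metis
 qed
 then obtain p P where p: "!!i. C1_grad (p i) (P i)" and pA: "!!i x. x : A ==> p i x = g (Suc i) x - g i x"
  and P: "!!i x. norm (P i x) <= 16 * (c / 2 ^ i)" by metis
 define h where "h n x = g 0 x + (\<Sum>i<n. p i x)" for n x
 define H where "H n x = G 0 x + (\<Sum>i<n. P i x)" for n x
 have hA: "h n x = g n x" if "x : A" for n x by (induction n) (use that in "auto simp: h_def pA")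
 have sum: "summable (%i. C * (c / 2 ^ i))" for C proof -
  have "summable (%i. (C * c) * (1 / 2) ^ i)" by (intro summable_mult summable_geometric) simp
  thus ?thesis by (simp add: power_one_over field_simps)
 qed
 have "uniform_limit UNIV (%n x. \<Sum>i<n. P i x) (%x. \<Sum>i. P i x) sequentially" by (rule Weierstrass_m_test[OF _ sum[of 16]]) (use P in auto)
 hence ul: "uniform_limit UNIV H (%x. G 0 x + (\<Sum>i. P i x)) sequentially" unfolding H_def[abs_def] by (intro uniform_limit_intros)
 have cg: "C1_grad (h n) (H n)" for n unfolding h_def[abs_def] H_def[abs_def] by (intro C1_grad_add g C1_grad_sum p)
 \<comment> \<open>Away from \<open>A\<close> only the increments relative to a base point
   \<open>a\<close> of \<open>A\<close> are summable; at \<open>a\<close> itself the values converge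
   by assumption.\<close>
 have cv: "convergent (%n. h n x)" for x proof -
  have "<|p i x - p i a|> <= (16 * norm (x - a)) * (c / 2 ^ i)" for i
   using lipschitz_onD[OF C1_grad_lipschitz[OF p P], of x a i] by (simp add: dist_norm algebra_simps)
  hence "summable (%i. p i x - p i a)" by (intro summable_comparison_test[OF _ sum[of "16 * norm (x - a)"]]) auto
  hence "(%n. \<Sum>i<n. p i x - p i a) ----> (\<Sum>i. p i x - p i a)" by (rule summable_LIMSEQ)
  moreover have "(%n. h n a) ----> f a" using lim[OF a] hA[OF a] by simp
  ultimately have "(%n. (g 0 x - g 0 a) + (h n a + (\<Sum>i<n. p i x - p i a)))
   ----> (g 0 x - g 0 a) + (f a + (\<Sum>i. p i x - p i a))" by (intro tendsto_intros)
  also have "(%n. (g 0 x - g 0 a) + (h n a + (\<Sum>i<n. p i x - p i a))) = (%n. h n x)" by (auto simp: h_def sum_subtractf)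
  finally show ?thesis by (rule convergentI)
 qed
 have "C1_grad (%x. lim (%n. h n x)) (%x. G 0 x + (\<Sum>i. P i x))"
  by (rule C1_grad_limit[of h H, OF cg ul]) (use cv in "simp add: convergent_LIMSEQ_iff")
 moreover have "lim (%n. h n x) = f x" if "x : A" for x using lim[OF that] by (intro limI) (simp add: hA[OF that])
 ultimately show ?thesis by (rule that)
qed

section \<open>Gliding hump\<close>

definition lusin_C1 :: "'a::euclidean_space measure => bool" where
 "lusin_C1 M \<longleftrightarrow> (ALL f :: 'a => real. (EX L. L-lipschitz_on UNIV f) -->
   (ALL e>0. EX g G. C1_grad g G & emeasure M {x. g x ~= f x} < ennreal e))"

text \<open>The point is uniformity in \<open>b\<close> and \<open>A\<close>. If no
  \<open>rho\<close> worked, counterexamples for \<open>rho = 1 / Suc n\<close> would have a limit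
  slope and a limit set. The limit set is flat on all chords shorter than \<open>d\<close>, and sets
  far out in the sequence lie in it up to small measure, so it serves as \<open>A'\<close>.\<close>

lemma flat_compactness:
 fixes M :: "'a::euclidean_space measure" and K :: "'a set"
 assumes fin: "finite_measure M" and sets[simp]: "sets M = sets borel"
  and K: "compact K" and e: "e > 0" and eta: "eta > 0"
 shows "EX rho>0. ALL b A. norm b <= B --> compact A --> A <= K -->
  (ALL x:A. ALL y:A. rho <= dist x y --> dist x y < d --> <|b <.> (y - x)|> <= c * dist x y) -->
  (EX A'. compact A' & (ALL x:A'. ALL y:A'. dist x y < d --> <|b <.> (y - x)|> <= (c + eta) * dist x y) &
    measure M (A - A') < e)" proof -
 interpret finite_measure M by (rule fin)
 define fl where "fl rho b A \<longleftrightarrow> (ALL x:A. ALL y:A. rho <= dist x y --> dist x y < d --> <|b <.> (y - x)|> <= c * dist x y)"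
  for rho and b :: 'a and A
 define good where "good b A \<longleftrightarrow> (EX A'. compact A' & (ALL x:A'. ALL y:A'. dist x y < d --> <|b <.> (y - x)|> <= (c + eta) * dist x y) &
    measure M (A - A') < e)" for b A
 have "EX rho>0. ALL b A. norm b <= B --> compact A --> A <= K --> fl rho b A --> good b A" proof (rule ccontr)
 assume neg: "~ ?thesis"
 have "EX b A. norm b <= B & compact A & A <= K & fl (1 / Suc n) b A & ~ good b A" for n proof -
  have "1 / real (Suc n) > 0" by simp
  thus ?thesis using neg by blast
 qed
 then obtain b A where bA: "!!n. norm (b n) <= B & compact (A n) & A n <= K & fl (1 / Suc n) (b n) (A n) & ~ good (b n) (A n)" by metis
 have bB: "b n : cball 0 B" and Ac: "compact (A n)" and AK: "A n <= K"
  and Afl: "!!x y. x : A n ==> y : A n ==> 1 / Suc n <= dist x y ==> dist x y < d ==> <|b n <.> (y - x)|> <= c * dist x y"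
  and Ano: "!!A'. compact A' ==> (!!x y. x:A' ==> y:A' ==> dist x y < d ==> <|b n <.> (y - x)|> <= (c + eta) * dist x y) ==>
    ~ measure M (A n - A') < e" for n using bA[of n] unfolding fl_def good_def by auto
 have Ane: "A n ~= {}" for n using Ano[of "{}" n] e by auto
 obtain s where s: "strict_mono s" and bl: "EX l. (b \<circ> s) ----> l" using compact_cball[of "0::'a" B] bB unfolding compact_def by (meson)
 then obtain l where l: "(b \<circ> s) ----> l" by blast
 obtain a where a: "!!x. x : K ==> norm x <= a" using compact_imp_bounded[OF K] unfolding bounded_iff by blast
 \<comment> \<open>Distance functions are 1-Lipschitz and uniformly bounded on \<open>K\<close>, so
   Arzela-Ascoli applies; the zero set \<open>C\<close> of the limit plays the part of a limit of
   the sets.\<close>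
 define D where "D n x = infdist x (A (s n))" for n x
 have Dlip: "<|D n x - D n y|> <= dist x y" for n x y
  using lipschitz_onD[OF infdist_lipschitz[of "A (s n)"], of x y] by (simp add: D_def dist_real_def)
 obtain g k where g: "continuous_on K g" and k: "strict_mono (k::nat=>nat)"
  and lim: "!!e. 0 < e ==> EX N. ALL n x. n >= N & x : K --> norm (D (k n) x - g x) < e" proof (rule Arzela_Ascoli[OF K, of D "2 * a"])
  fix n x assume x: "x : K"
  obtain z where z: "z : A (s n)" using Ane by blast
  have "D n x <= dist x z" unfolding D_def by (rule infdist_le[OF z])
  also have "... <= norm x + norm z" unfolding dist_norm by (rule norm_triangle_ineq4)
  also have "... <= 2 * a" using a[OF x] a[of z] AK[of "s n"] z by auto
  finally show "norm (D n x) <= 2 * a" by (simp add: D_def infdist_nonneg)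
 next
  fix x e assume "0 < (e::real)"
  thus "EX d>0. ALL n y. y : K & norm (x - y) < d --> norm (D n x - D n y) < e"
   using le_less_trans[OF Dlip] by (intro exI[of _ e]) (simp add: dist_norm)
 qed blast
 define t where "t n = s (k n)" for n
 have t: "strict_mono t" unfolding t_def using s k by (auto simp: strict_mono_def)
 have tb: "(%n. b (t n)) ----> l" using LIMSEQ_subseq_LIMSEQ[OF l k] by (simp add: t_def comp_def)
 have Dt: "D (k n) x = infdist x (A (t n))" for n x by (simp add: D_def t_def)
 define C where "C = {x:K. g x <= 0}"
 have Cc: "compact C" proof -
  have "closed C" unfolding C_def by (rule continuous_on_closed_Collect_le[OF g continuous_on_const compact_imp_closed[OF K]])
  moreover have "C = K Int C" by (auto simp: C_def)
  ultimately show ?thesis using compact_Int_closed[OF K, of C] by simp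
 qed
 \<comment> \<open>A chord of \<open>C\<close> is a limit of chords of the sets
   \<open>A (t n)\<close>, whose lengths eventually exceed the vanishing lower bound
   \<open>1 / Suc (t n)\<close>.\<close>
 have flatC: "<|l <.> (y - x)|> <= c * dist x y" if x: "x : C" and y: "y : C" and xy: "dist x y < d" for x y proof (cases "x = y")
  case False
  have appr: "EX z. (ALL n. z n : A (t n)) & z ----> x" if "x : C" for x proof -
   have "EX z. z : A (t n) & infdist x (A (t n)) = dist x z" for n using infdist_attains_inf[OF compact_imp_closed[OF Ac] Ane] by metis
   then obtain z where z: "!!n. z n : A (t n)" "!!n. infdist x (A (t n)) = dist x (z n)" by metis
   have "z ----> x" proof (rule metric_LIMSEQ_I)
    fix r :: real assume "r > 0"
    then obtain N where N: "ALL n x. n >= N & x : K --> norm (D (k n) x - g x) < r" using lim by blast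
    have "dist (z n) x < r" if "n >= N" for n
     using N[rule_format, of n x] that \<open>x : C\<close> z(2)[of n] by (auto simp: C_def Dt dist_commute abs_less_iff)
    thus "EX no. ALL n>=no. dist (z n) x < r" by blast
   qed
   with z(1) show ?thesis by blast
  qed
  obtain z w where z: "!!n. z n : A (t n)" "z ----> x" and w: "!!n. w n : A (t n)" "w ----> y" using appr[OF x] appr[OF y] by metis
  have dl: "(%n. dist (z n) (w n)) ----> dist x y" by (intro tendsto_intros z w)
  have "(%n. inverse (real (Suc n))) ----> 0" by (rule LIMSEQ_inverse_real_of_nat)
  hence "(%n. inverse (real (Suc (t n)))) ----> 0" using LIMSEQ_subseq_LIMSEQ[OF _ t] by (simp add: comp_def)
  hence "\<forall>\<^sub>F n in sequentially. inverse (real (Suc (t n))) < dist x y / 2" using False by (intro order_tendstoD) auto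
  moreover have "\<forall>\<^sub>F n in sequentially. dist x y / 2 < dist (z n) (w n)" using False by (intro order_tendstoD[OF dl]) auto
  moreover have "\<forall>\<^sub>F n in sequentially. dist (z n) (w n) < d" using xy by (intro order_tendstoD[OF dl]) auto
  ultimately have "\<forall>\<^sub>F n in sequentially. <|b (t n) <.> (w n - z n)|> <= c * dist (z n) (w n)" proof eventually_elim
   case (elim n)
   thus ?case using Afl[OF z(1)[of n] w(1)[of n]] by (simp add: inverse_eq_divide)
  qed
  moreover have "(%n. <|b (t n) <.> (w n - z n)|>) ----> <|l <.> (y - x)|>" by (intro tendsto_intros tb z w)
  moreover have "(%n. c * dist (z n) (w n)) ----> c * dist x y" by (intro tendsto_intros dl)
  ultimately show ?thesis by (intro tendsto_le[OF sequentially_bot]) auto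
 qed simp
 \<comment> \<open>Neighbourhoods of \<open>C\<close> with \<open>C\<close> removed: they decrease
   to the empty set, so one has measure below \<open>e\<close>, and it contains
   \<open>A (t n) - C\<close> once the distance functions are uniformly close to their
   limit.\<close>
 define S where "S n = {x:K. g x <= 1 / Suc n} - C" for n :: nat
 have Sm: "S n : sets M" for n proof -
  have "closed {x:K. g x <= 1 / Suc n}" by (rule continuous_on_closed_Collect_le[OF g continuous_on_const compact_imp_closed[OF K]])
  thus ?thesis using compact_imp_closed[OF Cc] unfolding S_def by simp
 qed
 have "(%n. measure M (S n)) ----> measure M (INT n. S n)" proof (rule finite_Lim_measure_decseq)
  show "decseq S" unfolding S_def decseq_def by (auto intro: order_trans[OF _ divide_left_mono])
 qed (use Sm in auto)
 moreover have "(INT n. S n) = {}" proof -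
  have "g x <= 0" if "!!n. g x <= 1 / real (Suc n)" for x proof (rule LIMSEQ_le_const[of "%n. inverse (real (Suc n))"])
   show "(%n. inverse (real (Suc n))) ----> 0" by (rule LIMSEQ_inverse_real_of_nat)
  qed (use that in "auto simp: inverse_eq_divide")
  thus ?thesis by (auto simp: S_def C_def)
 qed
 ultimately have "(%n. measure M (S n)) ----> 0" by simp
 hence "\<forall>\<^sub>F n in sequentially. measure M (S n) < e" using e by (intro order_tendstoD) auto
 then obtain m where m: "measure M (S m) < e" by (auto simp: eventually_sequentially)
 obtain N1 where N1: "ALL n x. n >= N1 & x : K --> norm (D (k n) x - g x) < 1 / Suc m" using lim[of "1 / Suc m"] by auto
 obtain N2 where N2: "ALL n>=N2. dist (b (t n)) l < eta" using metric_LIMSEQ_D[OF tb eta] by blast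
 define n where "n = max N1 N2"
 have "A (t n) - C <= S m" proof
  fix x assume x: "x : A (t n) - C"
  hence "x : K" using AK by auto
  moreover have "D (k n) x = 0" unfolding Dt using x by simp
  ultimately have "g x <= 1 / Suc m" using N1[rule_format, of n x] by (simp add: n_def)
  thus "x : S m" using x \<open>x : K\<close> by (simp add: S_def)
 qed
 hence "measure M (A (t n) - C) <= measure M (S m)" using Sm by (intro finite_measure_mono) auto
 hence "measure M (A (t n) - C) < e" using m by simp
 moreover have "<|b (t n) <.> (y - x)|> <= (c + eta) * dist x y" if "x : C" "y : C" "dist x y < d" for x y proof -
  have "b (t n) <.> (y - x) = l <.> (y - x) + (b (t n) - l) <.> (y - x)" by (simp add: inner_diff_left)
  moreover have "<|(b (t n) - l) <.> (y - x)|> <= norm (b (t n) - l) * norm (y - x)" by (rule Cauchy_Schwarz_ineq2)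
  moreover have "... <= eta * dist x y" using N2[rule_format, of n] eta by (intro mult_mono) (auto simp: n_def dist_norm norm_minus_commute)
  ultimately show ?thesis using flatC[OF that] by (simp add: algebra_simps abs_le_iff)
 qed
 ultimately show False using Ano[OF Cc, of "t n"] by blast
 qed
 thus ?thesis unfolding fl_def good_def .
qed

text \<open>Used to pass to a piece of small diameter without losing positivity of the
  measure.\<close>

lemma positive_measure_cball:
 fixes M :: "'a::euclidean_space measure"
 assumes sets[simp]: "sets M = sets borel" and K: "compact K" "emeasure M K > 0" and r: "r > 0"
 obtains x where "x : K" "emeasure M (K Int cball x r) > 0" proof (rule ccontr)
 assume "~ thesis"
 hence z: "emeasure M (K Int cball x r) = 0" if "x : K" for x
  using that \<open>!!x. x : K ==> 0 < emeasure M (K Int cball x r) ==> thesis\<close> zero_less_iff_neq_zero by blast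
 have "K <= (UN x:K. ball x r)" using r by auto
 then obtain T where T: "T <= K" "finite T" "K <= (UN x:T. ball x r)" using compactE_image[OF K(1), of K "%x. ball x r"] by auto
 have "(UN x:T. K Int cball x r) : null_sets M" proof (rule null_sets_UN'[OF countable_finite[OF T(2)]])
  fix x assume "x : T"
  thus "K Int cball x r : null_sets M" using z T(1) compact_imp_closed[OF K(1)] by (auto simp: null_sets_def)
 qed
 moreover have "K <= (UN x:T. K Int cball x r)" proof
  fix y assume "y : K"
  then obtain x where "x : T" "y : ball x r" using T(3) by blast
  thus "y : (UN x:T. K Int cball x r)" using \<open>y : K\<close> ball_subset_cball by blast
 qed
 ultimately have "emeasure M K <= 0" using emeasure_mono[of K "UN x:T. K Int cball x r" M] by (auto simp: null_sets_def)
 thus False using K(2) by simp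
qed

text \<open>The perturbations alternately add and subtract almost the same gradient \<open>w\<close> on \<open>K\<close>.
 Each one is cut off to the region where the current gradient is close to its value on \<open>K\<close>,
 so the Lipschitz constants stay bounded although infinitely many perturbations are used.\<close>

lemma oscillating_lipschitz_function:
 fixes K :: "'a::euclidean_space set" and phi :: "nat => 'a => real"
  and FP :: "nat => real => real => bool"
 assumes K: "compact K" "K ~= {}" and phi: "!!m. C1_grad (phi m) (Phi m)"
  and L: "!!m x. norm (Phi m x) <= L" and phi0: "uniform_limit UNIV phi (%_. 0) sequentially"
  and Phiw: "uniform_limit K Phi w sequentially" and wa: "!!x. x : K ==> norm (w x - a) <= eta"
  and eta: "0 < eta" "eta <= 1" and FP: "!!j d. d > 0 ==> EX rho>0. FP j d rho"
 obtains f and c :: "nat => real" where "!!j. c j = (if even j then 0 else 1)" "(2 * L + 8)-lipschitz_on UNIV f"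
  "!!j. EX d>0. EX rho>0. FP j d rho & (EX g. (ALL x. <|f x - g x|> <= eta * rho / 2) &
   (ALL x:K. ALL y. dist x y < d --> <|g y - g x - (c j *. a) <.> (y - x)|> <= 3 * eta * dist x y))" proof -
 define c where "c j = (if even j then 0 else 1 :: real)" for j :: nat
 have c01: "<|c j|> <= 1" for j by (simp add: c_def)
 have wL: "norm (w x) <= L" if "x : K" for x proof (rule Lim_norm_ubound[OF sequentially_bot tendsto_uniform_limitI[OF Phiw that]])
  show "\<forall>\<^sub>F n in sequentially. norm (Phi n x) <= L" using L by simp
 qed
 obtain x1 where x1: "x1 : K" using K by auto
 have aL: "norm a <= L + 1" using norm_triangle_sub[of a "w x1"] wL[OF x1] wa[OF x1] eta by (simp add: norm_minus_commute)
 have L0: "L >= 0" using L[of 0 0] norm_ge_zero order_trans by blast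
 define loc where "loc g G d \<longleftrightarrow> (ALL x:K. ALL y. dist x y < d --> <|g y - g x - G x <.> (y - x)|> <= eta * dist x y)"
  for g :: "'a => real" and G :: "'a => 'a" and d :: real
 have locex: "EX d>0. loc g G d" if g: "C1_grad g G" for g G proof -
  obtain M where M: "!!x. x : K ==> norm x <= M" using compact_imp_bounded[OF K(1)] unfolding bounded_iff by blast
  have "uniformly_continuous_on (cball 0 (M + 1)) G" by (rule compact_uniformly_continuous) (auto intro: continuous_on_subset[OF C1_gradD(2)[OF g]])
  then obtain d where d: "d > 0" "!!x y. x : cball 0 (M + 1) ==> y : cball 0 (M + 1) ==> dist y x < d ==> dist (G y) (G x) < eta"
   using eta(1) unfolding uniformly_continuous_on_def by metis
  have "loc g G (min d 1)" unfolding loc_def proof (intro ballI allI impI)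
   fix x y assume x: "x : K" and xy: "dist x y < min d 1"
   have "<|g y - g x - G x <.> (y - x)|> <= eta * norm (y - x)" proof (rule C1_grad_near_affine[OF g convex_ball[of x "min d 1"]])
    fix z assume z: "z : ball x (min d 1)"
    have "norm z <= norm x + dist x z" by (metis dist_norm norm_minus_commute norm_triangle_sub)
    hence "z : cball 0 (M + 1)" using M[OF x] z by simp
    moreover have "x : cball 0 (M + 1)" using M[OF x] by simp
    ultimately have "dist (G z) (G x) < eta" using d(2)[of x z] z by (simp add: dist_commute)
    thus "norm (G z - G x) <= eta" by (simp add: dist_norm)
   qed (use xy d in auto)
   thus "<|g y - g x - G x <.> (y - x)|> <= eta * dist x y" by (simp add: dist_norm norm_minus_commute)
  qed
  thus ?thesis using d(1) by (intro exI[of _ "min d 1"]) auto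
 qed
 \<comment> \<open>In a state \<open>(g, G, R)\<close> the number \<open>R\<close> is the budget for
   all later changes of \<open>g\<close>. Keeping it below \<open>eta * rho / 2\<close> preserves
   the slope seen at stage \<open>j\<close> on chords of length at least \<open>rho\<close>. The
   factor \<open>1 - (1/2)^j\<close> is the sum of the errors made on \<open>K\<close> so
   far.\<close>
 define P where "P j s \<longleftrightarrow> (case s of (g, G, R) => C1_grad g G & (ALL x. norm (G x) <= 2 * L + 8) &
   (ALL x:K. norm (G x - c j *. w x) <= (1 - (1/2)^j) * eta) & R > 0 &
   (EX d>0. EX rho>0. FP j d rho & R <= eta * rho / 2 & loc g G d))"
  for j and s :: "('a => real) \<times> ('a => 'a) \<times> real"
 define Q where "Q s s' \<longleftrightarrow> (case s of (g, G, R) => case s' of (g', G', R') =>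
   R' <= R / 2 & (ALL x. <|g' x - g x|> <= R / 2))"
  for s s' :: "('a => real) \<times> ('a => 'a) \<times> real"
 have complete: "EX R. R <= r & P j (g, G, R)" if g: "C1_grad g G" "!!x. norm (G x) <= 2 * L + 8"
  "!!x. x : K ==> norm (G x - c j *. w x) <= (1 - (1/2)^j) * eta" and r: "r > 0" for g G j r proof -
  obtain d where d: "d > 0" "loc g G d" using locex[OF g(1)] by blast
  obtain rho where rho: "rho > 0" "FP j d rho" using FP[OF d(1)] by blast
  define R where "R = min r (eta * rho / 2)"
  have "R <= eta * rho / 2" "R <= r" "R > 0" using r rho eta by (auto simp: R_def)
  hence "P j (g, G, R)" unfolding P_def prod.case using d rho g by blast
  thus ?thesis using \<open>R <= r\<close> by blast
 qed
 have "EX s. ALL j. P j (s j) & Q (s j) (s (Suc j))" proof (rule dependent_nat_choice)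
  have "EX R. R <= 1 & P 0 (%_. 0, %_. 0, R)" by (rule complete) (use L0 in "auto simp: c_def")
  thus "EX s. P 0 s" by blast
 next
  fix s j assume Ps: "P j s"
  obtain g G R where s: "s = (g, G, R)" by (cases s)
  have g: "C1_grad g G" "!!x. norm (G x) <= 2 * L + 8" and R: "R > 0"
   and gK: "!!x. x : K ==> norm (G x - c j *. w x) <= (1 - (1/2)^j) * eta" using Ps unfolding P_def s by auto
  \<comment> \<open>Perturbations are confined to where the gradient is within
    \<open>3 * eta\<close> of \<open>c j *. a\<close>. There it is at most \<open>L + 4\<close>, and
    the perturbation adds at most \<open>L + 1\<close>, independently of the history; elsewhere
    nothing changes.\<close>
  define S where "S = {x. norm (G x - c j *. a) < 3 * eta}"
  have "open S" unfolding S_def by (intro open_Collect_less continuous_intros C1_gradD(2)[OF g(1)])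
  moreover have "K <= S" proof
   fix x assume x: "x : K"
   have "norm (G x - c j *. a) <= norm (G x - c j *. w x) + norm (c j *. (w x - a))"
    using norm_triangle_ineq[of "G x - c j *. w x" "c j *. (w x - a)"] by (simp add: algebra_simps)
   also have "norm (G x - c j *. w x) <= eta" proof -
    have "(1 - (1/2)^j) * eta <= 1 * eta" using eta by (intro mult_right_mono) auto
    thus ?thesis using gK[OF x] by simp
   qed
   also have "norm (c j *. (w x - a)) <= 1 * eta" unfolding norm_scaleR using c01 wa[OF x] by (intro mult_mono) auto
   finally show "x : S" using eta by (simp add: S_def)
  qed
  ultimately obtain tht Tht T where tht: "C1_grad tht Tht" "!!x. 0 <= tht x" "!!x. tht x <= 1"
   "bounded (range Tht)" "closed T" "T <= S" "!!x. x \<notin> T ==> tht x = 0" "!!x. x : K ==> tht x = 1"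
   "!!x. tht x = 0 \<or> tht x = 1 ==> Tht x = 0" by (rule C1_cutoff[OF K(1)]) (rule that)
  obtain t where t: "t > 0" "!!x. norm (Tht x) <= t" using tht(4) unfolding bounded_pos by auto
  \<comment> \<open>\<open>R / 2\<close> respects the budget; \<open>1 / t\<close> keeps the term
    with the gradient of the cutoff at most 1.\<close>
  define r where "r = min (R / 2) (1 / t)"
  have r: "r > 0" using R t by (simp add: r_def)
  have e: "(1/2)^Suc j * eta > 0" using eta by simp
  have "\<forall>\<^sub>F m in sequentially. (ALL x:UNIV. dist (phi m x) 0 < r) & (ALL x:K. dist (Phi m x) (w x) < (1/2)^Suc j * eta)"
   using uniform_limitD[OF phi0 r] uniform_limitD[OF Phiw e] by (rule eventually_conj)
  then obtain m where m: "!!x. <|phi m x|> < r" "!!x. x : K ==> norm (Phi m x - w x) < (1/2)^Suc j * eta"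
   by (auto simp: eventually_sequentially dist_norm)
  define sg where "sg = c (Suc j) - c j"
  have sg: "<|sg|> = 1" by (simp add: sg_def c_def)
  define g' where "g' x = g x + sg * (tht x * phi m x)" for x
  define G' where "G' x = G x + sg *. (tht x *. Phi m x + phi m x *. Tht x)" for x
  have g': "C1_grad g' G'" unfolding g'_def G'_def by (intro C1_grad_add C1_grad_cmult C1_grad_mult g tht phi)
  have "EX R'. R' <= R / 2 & P (Suc j) (g', G', R')" proof (rule complete[OF g'])
   fix x
   show "norm (G' x) <= 2 * L + 8" proof (cases "x : S")
    case True
    have 1: "norm (G x) <= L + 4" proof -
     have "norm (G x) <= norm (G x - c j *. a) + norm (c j *. a)" using norm_triangle_ineq[of "G x - c j *. a" "c j *. a"] by simp
     moreover have "norm (c j *. a) <= 1 * norm a" unfolding norm_scaleR using c01 by (intro mult_right_mono) auto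
     ultimately show ?thesis using True aL eta by (simp add: S_def)
    qed
    have 2: "norm (tht x *. Phi m x) <= 1 * L" unfolding norm_scaleR using tht(2,3)[of x] L by (intro mult_mono) auto
    have 3: "norm (phi m x *. Tht x) <= 1" proof -
     have "norm (phi m x *. Tht x) <= (1 / t) * t" unfolding norm_scaleR using m(1)[of x] t by (intro mult_mono) (auto simp: r_def)
     thus ?thesis using t by simp
    qed
    have "norm (G' x) <= norm (G x) + <|sg|> * norm (tht x *. Phi m x + phi m x *. Tht x)"
     unfolding G'_def using norm_triangle_ineq by (metis norm_scaleR)
    also have "norm (tht x *. Phi m x + phi m x *. Tht x) <= norm (tht x *. Phi m x) + norm (phi m x *. Tht x)" by (rule norm_triangle_ineq)
    finally show ?thesis using 1 2 3 sg by simp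
   next
    case False
    hence "tht x = 0" using tht(6,7) by blast
    thus ?thesis using tht(9)[of x] g(2)[of x] by (simp add: G'_def)
   qed
  next
   fix x assume x: "x : K"
   have "G' x - c (Suc j) *. w x = (G x - c j *. w x) + sg *. (Phi m x - w x)"
    using tht(8)[OF x] tht(9)[of x] by (simp add: G'_def sg_def algebra_simps)
   hence "norm (G' x - c (Suc j) *. w x) <= norm (G x - c j *. w x) + <|sg|> * norm (Phi m x - w x)" by (metis norm_scaleR norm_triangle_ineq)
   thus "norm (G' x - c (Suc j) *. w x) <= (1 - (1/2)^Suc j) * eta" using gK[OF x] m(2)[OF x] sg by (simp add: algebra_simps)
  qed (use R in auto)
  then obtain R' where R': "R' <= R / 2" "P (Suc j) (g', G', R')" by blast
  have "<|g' x - g x|> <= R / 2" for x proof -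
   have "<|g' x - g x|> = tht x * <|phi m x|>" using sg tht(2)[of x] by (simp add: g'_def abs_mult)
   also have "... <= 1 * (R / 2)" using m(1)[of x] tht(2,3)[of x] by (intro mult_mono) (auto simp: r_def)
   finally show ?thesis by simp
  qed
  hence "Q s (g', G', R')" unfolding Q_def s prod.case using R'(1) by blast
  thus "EX s'. P (Suc j) s' & Q s s'" using R'(2) by blast
 qed
 then obtain s where s: "!!j. P j (s j)" "!!j. Q (s j) (s (Suc j))" by blast
 define g where "g j = fst (s j)" for j
 define G where "G j = fst (snd (s j))" for j
 define R where "R j = snd (snd (s j))" for j
 have sj: "s j = (g j, G j, R j)" for j by (simp add: g_def G_def R_def)
 have g: "C1_grad (g j) (G j)" "norm (G j x) <= 2 * L + 8" and R: "R j > 0"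
  and gK: "!!x. x : K ==> norm (G j x - c j *. w x) <= (1 - (1/2)^j) * eta"
  and ex: "EX d>0. EX rho>0. FP j d rho & R j <= eta * rho / 2 & loc (g j) (G j) d" for j x using s(1)[of j] unfolding P_def sj by auto
 have step: "R (Suc j) <= R j / 2" "<|g (Suc j) x - g j x|> <= R j / 2" for j x using s(2)[of j] unfolding Q_def sj by auto
 \<comment> \<open>As the budget at least halves, \<open>R j - R (Suc j)\<close> is at least
   \<open>R j / 2\<close>, the size of one change; the sum telescopes.\<close>
 have tele: "<|g (j + k) x - g j x|> <= R j - R (j + k)" for j k x proof (induction k)
  case (Suc k)
  thus ?case using step(1)[of "j + k"] step(2)[of "j + k" x] unfolding add_Suc_right by linarith
 qed simp
 have Rle: "R j <= R 0 * (1/2)^j" for j proof (induction j)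
  case (Suc j)
  thus ?case using step(1)[of j] by simp
 qed simp
 have "(%j. R 0 * (1/2)^j) ----> R 0 * 0" by (intro tendsto_intros LIMSEQ_power_zero) simp
 hence R1: "(%j. R 0 * (1/2)^j) ----> 0" by simp
 have R0: "R ----> 0" proof (rule tendsto_sandwich[OF _ _ tendsto_const R1])
  show "\<forall>\<^sub>F j in sequentially. 0 <= R j" using less_imp_le[OF R] by simp
  show "\<forall>\<^sub>F j in sequentially. R j <= R 0 * (1/2)^j" using Rle by simp
 qed
 have "Cauchy (%j. g j x)" for x proof (rule metric_CauchyI)
  fix e :: real assume "e > 0"
  hence "\<forall>\<^sub>F j in sequentially. R j < e / 2" by (intro order_tendstoD[OF R0]) simp
  then obtain N where N: "R N < e / 2" by (auto simp: eventually_sequentially)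
  have near: "dist (g m x) (g N x) < e / 2" if "m >= N" for m using tele[of N "m - N" x] R[of m] that N by (simp add: dist_real_def)
  have "dist (g m x) (g n x) < e" if "m >= N" "n >= N" for m n using dist_triangle_half_l[OF near near] that by blast
  thus "EX M. ALL m>=M. ALL n>=M. dist (g m x) (g n x) < e" by blast
 qed
 hence "convergent (%j. g j x)" for x by (simp add: Cauchy_convergent_iff)
 then obtain f where f: "!!x. (%j. g j x) ----> f x" unfolding convergent_def by metis
 have close: "<|f x - g j x|> <= R j" for j x proof (rule tendsto_upperbound[OF _ _ sequentially_bot])
  show "(%k. <|g (j + k) x - g j x|>) ----> <|f x - g j x|>"
   using LIMSEQ_ignore_initial_segment[OF f[of x], of j] by (intro tendsto_intros) (simp add: add.commute)
  show "\<forall>\<^sub>F k in sequentially. <|g (j + k) x - g j x|> <= R j" proof (intro always_eventually allI)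
   show "<|g (j + k) x - g j x|> <= R j" for k using tele[of j k x] R[of "j + k"] by linarith
  qed
 qed
 show ?thesis proof (rule that)
  show "c j = (if even j then 0 else 1)" for j by (simp add: c_def)
  show "(2 * L + 8)-lipschitz_on UNIV f" proof (rule lipschitz_onI)
   fix x y
   show "dist (f x) (f y) <= (2 * L + 8) * dist x y" proof (rule tendsto_upperbound[OF _ _ sequentially_bot])
    show "(%j. dist (g j x) (g j y)) ----> dist (f x) (f y)" by (intro tendsto_intros f)
    show "\<forall>\<^sub>F j in sequentially. dist (g j x) (g j y) <= (2 * L + 8) * dist x y"
     by (intro always_eventually allI lipschitz_onD[OF C1_grad_lipschitz[OF g]]) auto
   qed
  qed (use L0 in simp)
  fix j
  obtain d rho where d: "d > 0" "rho > 0" "FP j d rho" "R j <= eta * rho / 2" "loc (g j) (G j) d" using ex by blast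
  show "EX d>0. EX rho>0. FP j d rho & (EX g. (ALL x. <|f x - g x|> <= eta * rho / 2) &
   (ALL x:K. ALL y. dist x y < d --> <|g y - g x - (c j *. a) <.> (y - x)|> <= 3 * eta * dist x y))" proof (intro exI conjI)
   show "ALL x. <|f x - g j x|> <= eta * rho / 2" using close d(4) order_trans by blast
   show "ALL x:K. ALL y. dist x y < d --> <|g j y - g j x - (c j *. a) <.> (y - x)|> <= 3 * eta * dist x y" proof (intro ballI allI impI)
    fix x y assume x: "x : K" and xy: "dist x y < d"
    have 1: "<|g j y - g j x - G j x <.> (y - x)|> <= eta * dist x y" using d(5) x xy unfolding loc_def by blast
    have "norm (G j x - c j *. a) <= norm (G j x - c j *. w x) + norm (c j *. (w x - a))"
     using norm_triangle_ineq[of "G j x - c j *. w x" "c j *. (w x - a)"] by (simp add: algebra_simps)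
    moreover have "norm (G j x - c j *. w x) <= 1 * eta" using gK[OF x, of j] eta by (elim order_trans) (intro mult_right_mono, auto)
    moreover have "norm (c j *. (w x - a)) <= 1 * eta" unfolding norm_scaleR using c01 wa[OF x] by (intro mult_mono) auto
    ultimately have 2: "norm (G j x - c j *. a) <= 2 * eta" by simp
    have "<|(G j x - c j *. a) <.> (y - x)|> <= norm (G j x - c j *. a) * norm (y - x)" by (rule Cauchy_Schwarz_ineq2)
    also have "... <= (2 * eta) * dist x y" using 2 eta by (intro mult_mono) (auto simp: dist_norm norm_minus_commute)
    finally have 3: "<|(G j x - c j *. a) <.> (y - x)|> <= (2 * eta) * dist x y" .
    show "<|g j y - g j x - (c j *. a) <.> (y - x)|> <= 3 * eta * dist x y" using 1 3 by (simp add: inner_diff_left abs_le_iff algebra_simps)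
   qed
  qed (use d in auto)
 qed
qed


text \<open>Where a C1 function coincides with the oscillating function and has nearly constant
  gradient \<open>b\<close>, stage \<open>j\<close> forces \<open>b - c j *. a\<close> to be almost
  orthogonal to all chords of intermediate length. Compactness removes the lower bound on the
  length, and two consecutive stages give \<open>b\<close> and \<open>b - a\<close>.\<close>

lemma lusin_C1_flat:
 fixes M :: "'a::euclidean_space measure" and phi :: "nat => 'a => real"
 assumes fin: "finite_measure M" and sets[simp]: "sets M = sets borel" and lus: "lusin_C1 M"
  and K: "compact K" "emeasure M K > 0" and phi: "!!m. C1_grad (phi m) (Phi m)"
  and L: "!!m x. norm (Phi m x) <= L" and phi0: "uniform_limit UNIV phi (%_. 0) sequentially"
  and Phiw: "uniform_limit K Phi w sequentially" and wa: "!!x. x : K ==> norm (w x - a) <= eta"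
  and eta: "0 < eta" "eta <= 1"
 obtains A where "compact A" "A <= K" "emeasure M A > 0"
  "!!x y. x : A ==> y : A ==> <|a <.> (y - x)|> <= 12 * eta * dist x y" proof -
 interpret finite_measure M by (rule fin)
 have K0: "K ~= {}" using K(2) by auto
 \<comment> \<open>\<open>j\<close> bounds the slope and fixes the permitted loss of measure, so
   \<open>rho\<close> can be chosen while \<open>f\<close> is under construction, before the C1
   function with its slope and its set is available.\<close>
 define FP where "FP j d rho \<longleftrightarrow> (ALL b A. norm b <= real j --> compact A --> A <= K -->
  (ALL x:A. ALL y:A. rho <= dist x y --> dist x y < d --> <|b <.> (y - x)|> <= 5 * eta * dist x y) -->
  (EX A'. compact A' & (ALL x:A'. ALL y:A'. dist x y < d --> <|b <.> (y - x)|> <= (5 * eta + eta) * dist x y) &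
    measure M (A - A') < (1/2)^j))"
  for j :: nat and d rho :: real
 have FP: "EX rho>0. FP j d rho" for j d unfolding FP_def by (rule flat_compactness[OF fin sets K(1) _ eta(1)]) simp
 obtain f c where c: "!!j. c j = (if even j then 0 else 1 :: real)" and lip: "(2 * L + 8)-lipschitz_on UNIV f"
  and osc: "!!j. EX d>0. EX rho>0. FP j d rho & (EX g. (ALL x. <|f x - g x|> <= eta * rho / 2) &
   (ALL x:K. ALL y. dist x y < d --> <|g y - g x - (c j *. a) <.> (y - x)|> <= 3 * eta * dist x y))"
  by (rule oscillating_lipschitz_function[where FP = FP, OF K(1) K0 phi L phi0 Phiw _ eta FP])
    (erule wa, rule that)
 have mK: "measure M K > 0" using K(2) by (simp add: emeasure_eq_measure)
 obtain g G where g: "C1_grad g G" "emeasure M {x. g x ~= f x} < ennreal (measure M K)" using lus lip mK unfolding lusin_C1_def by blast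
 have cf: "continuous_on UNIV f" using lip by (rule lipschitz_on_continuous_on)
 have cg: "continuous_on UNIV g" by (rule C1_grad_continuous[OF g(1)])
 have cl: "closed {x. g x = f x}" by (intro closed_Collect_eq cf cg)
 define A0 where "A0 = K Int {x. g x = f x}"
 have A0c: "compact A0" unfolding A0_def by (rule compact_Int_closed[OF K(1) cl])
 have A0m: "A0 : sets M" using compact_imp_closed[OF A0c] by simp
 have neq: "{x. g x ~= f x} : sets M" using cl by (simp add: Collect_neg_eq[symmetric] open_Collect_neq cf cg)
 have A0pos: "emeasure M A0 > 0" proof (rule ccontr)
  assume "~ emeasure M A0 > 0"
  hence z: "emeasure M A0 = 0" by simp
  have "emeasure M K <= emeasure M (A0 Un {x. g x ~= f x})" proof (rule emeasure_mono)
   show "A0 Un {x. g x ~= f x} : sets M" using A0m neq by (rule sets.Un)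
  qed (auto simp: A0_def)
  also have "... <= emeasure M A0 + emeasure M {x. g x ~= f x}" using A0m neq by (rule emeasure_subadditive)
  also have "... < ennreal (measure M K)" using z g(2) by simp
  finally show False by (simp add: emeasure_eq_measure)
 qed
 obtain r where r: "r > 0" "!!x y. x : K ==> y : cball x r ==> norm (G y - G x) <= eta" proof -
  obtain B where B: "!!x. x : K ==> norm x <= B" using compact_imp_bounded[OF K(1)] unfolding bounded_iff by blast
  have "uniformly_continuous_on (cball 0 (B + 1)) G"
   by (rule compact_uniformly_continuous) (auto intro: continuous_on_subset[OF C1_gradD(2)[OF g(1)]])
  then obtain d where d: "d > 0" "!!x y. x : cball 0 (B + 1) ==> y : cball 0 (B + 1) ==> dist y x < d ==> dist (G y) (G x) < eta"
   using eta(1) unfolding uniformly_continuous_on_def by metis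
  show ?thesis proof (rule that[of "min (d / 2) 1"])
   fix x y assume x: "x : K" and y: "y : cball x (min (d / 2) 1)"
   have "norm y <= norm x + dist x y" by (metis dist_norm norm_minus_commute norm_triangle_sub)
   hence "y : cball 0 (B + 1)" "x : cball 0 (B + 1)" using B[OF x] y by auto
   hence "dist (G y) (G x) < eta" using d(2)[of x y] y d(1) by (simp add: dist_commute)
   thus "norm (G y - G x) <= eta" by (simp add: dist_norm)
  qed (use d in auto)
 qed
 obtain x0 where x0: "x0 : A0" "emeasure M (A0 Int cball x0 r) > 0" by (rule positive_measure_cball[OF sets A0c A0pos r(1)]) (rule that)
 define b where "b = G x0"
 define A1 where "A1 = A0 Int cball x0 r"
 have A1: "compact A1" "A1 <= K" unfolding A1_def by (intro compact_Int A0c compact_cball) (auto simp: A0_def)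
 have A1pos: "measure M A1 > 0" using x0(2) unfolding A1_def by (simp add: emeasure_eq_measure)
 have fb: "<|f y - f x - b <.> (y - x)|> <= eta * dist x y" if "x : A1" "y : A1" for x y proof -
  have "<|g y - g x - b <.> (y - x)|> <= eta * norm (y - x)" by (rule C1_grad_near_affine[OF g(1) convex_cball[of x0 r]])
     (use that r(2) x0(1) in "auto simp: A1_def A0_def b_def")
  thus ?thesis using that by (simp add: A1_def A0_def dist_norm norm_minus_commute)
 qed
 have stage: "EX A'. compact A' & measure M (A - A') < (1/2)^j &
   (EX d>0. ALL x:A'. ALL y:A'. dist x y < d --> <|(b - c j *. a) <.> (y - x)|> <= 6 * eta * dist x y)"
  if A: "compact A" "A <= A1" and bj: "norm (b - c j *. a) <= real j" for A j proof -
  obtain d rho g where d: "d > 0" "rho > 0" "FP j d rho" "!!x. <|f x - g x|> <= eta * rho / 2"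
   "!!x y. x : K ==> dist x y < d ==> <|g y - g x - (c j *. a) <.> (y - x)|> <= 3 * eta * dist x y" using osc[of j] by blast
  \<comment> \<open>The 5 is made up of 1 for \<open>f\<close> against the slope \<open>b\<close>, 3
    for \<open>g\<close> against \<open>c j *. a\<close>, and 1 for the two errors
    \<open>eta * rho / 2\<close> between \<open>f\<close> and \<open>g\<close>, absorbed by chords
    of length at least \<open>rho\<close>.\<close>
  have "<|(b - c j *. a) <.> (y - x)|> <= 5 * eta * dist x y"
   if xy: "x : A" "y : A" "rho <= dist x y" "dist x y < d" for x y proof -
   have 1: "<|f y - f x - b <.> (y - x)|> <= eta * dist x y" using fb xy A by blast
   have 2: "<|g y - g x - (c j *. a) <.> (y - x)|> <= 3 * eta * dist x y" using d(5)[of x y] xy A A1 by blast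
   have 3: "eta * rho <= eta * dist x y" using xy(3) eta by simp
   have "(b - c j *. a) <.> (y - x) = b <.> (y - x) - (c j *. a) <.> (y - x)" by (rule inner_diff_left)
   thus ?thesis using 1 2 3 d(4)[of x] d(4)[of y] unfolding abs_le_iff by argo
  qed
  then obtain A' where "compact A'" "measure M (A - A') < (1/2)^j"
   "ALL x:A'. ALL y:A'. dist x y < d --> <|(b - c j *. a) <.> (y - x)|> <= (5 * eta + eta) * dist x y"
   using d(3)[unfolded FP_def, rule_format, OF bj A(1)] A(2) A1(2) by blast
  thus ?thesis using d(1) by (intro exI[of _ A']) (auto intro!: exI[of _ d])
 qed
 \<comment> \<open>\<open>N1\<close> brings both slopes below the bound \<open>real j\<close> in
   \<open>FP\<close>; \<open>N2\<close> makes each of the two losses less than half of the measure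
   of \<open>A1\<close>. Evenness of \<open>J\<close> gives \<open>c J = 0\<close> and
   \<open>c (Suc J) = 1\<close>.\<close>
 obtain N1 :: nat where N1: "norm b + norm a <= real N1" using real_arch_simple by blast
 obtain N2 :: nat where N2: "(1/2)^N2 < measure M A1 / 2" using real_arch_pow_inv[of "measure M A1 / 2" "1/2"] A1pos by auto
 define J where "J = 2 * max N1 N2"
 have J: "even J" "N1 <= J" "N2 <= J" by (auto simp: J_def)
 have pow: "(1/2)^J < measure M A1 / 2" "(1/2)^Suc J < measure M A1 / 2" proof -
  have "(1/2::real)^J <= (1/2)^N2" "(1/2::real)^Suc J <= (1/2)^N2" using J(3) by (intro power_decreasing; simp)+
  thus "(1/2)^J < measure M A1 / 2" "(1/2)^Suc J < measure M A1 / 2" using N2 by linarith+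
 qed
 have RJ: "real N1 <= real J" using J(2) by simp
 have "norm (b - c J *. a) = norm b" using J(1) by (simp add: c)
 hence b1: "norm (b - c J *. a) <= real J" using N1 RJ norm_ge_zero[of a] by linarith
 have "norm (b - c (Suc J) *. a) = norm (b - a)" using J(1) by (simp add: c)
 hence b2: "norm (b - c (Suc J) *. a) <= real (Suc J)" using N1 RJ norm_triangle_ineq4[of b a] by linarith
 obtain A2 d2 where A2: "compact A2" "measure M (A1 - A2) < (1/2)^J" "d2 > 0"
  "!!x y. x : A2 ==> y : A2 ==> dist x y < d2 ==> <|b <.> (y - x)|> <= 6 * eta * dist x y" using stage[OF A1(1) order_refl b1] J(1) by (auto simp: c)
 obtain A3 d3 where A3: "compact A3" "measure M (A1 - A3) < (1/2)^Suc J" "d3 > 0"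
  "!!x y. x : A3 ==> y : A3 ==> dist x y < d3 ==> <|(b - a) <.> (y - x)|> <= 6 * eta * dist x y"
  using stage[OF A1(1) order_refl b2] J(1) by (auto simp: c)
 define A4 where "A4 = A1 Int A2 Int A3"
 have A4c: "compact A4" unfolding A4_def by (intro compact_Int A1 A2 A3)
 have clos: "A1 : sets M" "A2 : sets M" "A3 : sets M" "A4 : sets M" using A1 A2 A3 A4c by (auto dest: compact_imp_closed)
 have "measure M A1 <= measure M (A4 Un ((A1 - A2) Un (A1 - A3)))" using clos by (intro finite_measure_mono) (auto simp: A4_def)
 also have "... <= measure M A4 + measure M ((A1 - A2) Un (A1 - A3))" using clos by (intro measure_Un_le) auto
 also have "measure M ((A1 - A2) Un (A1 - A3)) <= measure M (A1 - A2) + measure M (A1 - A3)" using clos by (intro measure_Un_le) auto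
 finally have "measure M A4 > 0" using A2(2) A3(2) pow by linarith
 hence A4pos: "emeasure M A4 > 0" by (simp add: emeasure_eq_measure)
 \<comment> \<open>Flatness is known for chords shorter than \<open>d2\<close> and
   \<open>d3\<close>; a piece of diameter below both has no other chords.\<close>
 have dd: "min d2 d3 / 3 > 0" using A2(3) A3(3) by simp
 obtain z where z: "z : A4" "emeasure M (A4 Int cball z (min d2 d3 / 3)) > 0" by (rule positive_measure_cball[OF sets A4c A4pos dd]) (rule that)
 show ?thesis proof (rule that)
  show "compact (A4 Int cball z (min d2 d3 / 3))" by (intro compact_Int A4c compact_cball)
  show "A4 Int cball z (min d2 d3 / 3) <= K" using A1 by (auto simp: A4_def)
  fix x y assume x: "x : A4 Int cball z (min d2 d3 / 3)" and y: "y : A4 Int cball z (min d2 d3 / 3)"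
  have "dist x y <= dist z x + dist z y" by (rule dist_triangle3)
  hence "dist x y < min d2 d3" using x y A2(3) A3(3) by auto
  hence "<|b <.> (y - x)|> <= 6 * eta * dist x y" "<|(b - a) <.> (y - x)|> <= 6 * eta * dist x y"
   using A2(4)[of x y] A3(4)[of x y] x y by (auto simp: A4_def)
  thus "<|a <.> (y - x)|> <= 12 * eta * dist x y" unfolding inner_diff_left[of b a] abs_le_iff by argo
 qed (use z in auto)
qed

section \<open>Integration by parts\<close>

lemma C1_grad_unique:
 assumes "C1_grad f F" "C1_grad f G" shows "F x = G x" proof -
 have "(%h. F x <.> h) = (%h. G x <.> h)" by (rule has_derivative_unique[OF C1_gradD(1)[OF assms(1)] C1_gradD(1)[OF assms(2)]])
 hence "F x <.> (F x - G x) = G x <.> (F x - G x)" by meson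
 hence "(F x - G x) <.> (F x - G x) = 0" by (simp add: inner_diff_left)
 thus ?thesis by simp
qed

lemma C1_grad_outside:
 assumes f: "C1_grad f F" and z: "!!x. R < norm x ==> f x = 0" and x: "R < norm x"
 shows "F x = 0" proof -
 have op: "open {x. R < norm x}" by (intro open_Collect_less continuous_intros)
 have "((%_. 0) has_derivative (%h. F x <.> h)) (at x)" by (rule has_derivative_transform_within_open[OF C1_gradD(1)[OF f] op]) (use z x in auto)
 hence "(%h. F x <.> h) = (%h. 0)" by (rule has_derivative_unique) simp
 hence "F x <.> F x = 0" by meson
 thus ?thesis by simp
qed

lemma bounded_compact_support:
 fixes f :: "'a::euclidean_space => 'b::euclidean_space"
 assumes c: "continuous_on UNIV f" and z: "!!x. R < norm x ==> f x = 0"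
 obtains B where "B >= 0" "!!x. norm (f x) <= B" proof -
 have "compact (f ` cball 0 R)" by (intro compact_continuous_image continuous_on_subset[OF c]) auto
 then obtain B where B: "ALL y:f ` cball 0 R. norm y <= B" using compact_imp_bounded bounded_iff by metis
 show ?thesis proof (rule that[of "max B 0"])
  show "norm (f x) <= max B 0" for x using B z[of x] by (cases "norm x <= R") (auto simp: le_max_iff_disj)
 qed simp
qed

text \<open>Compact support of either factor is allowed, because both cases arise when a derivative
  is moved from one factor to the other.\<close>

lemma C1_grad_integral_translate:
 fixes p :: "'a::euclidean_space => real" and w :: "'a => real"
 assumes p: "C1_grad p P" and w: "continuous_on UNIV w"
  and z: "(ALL x. R < norm x --> p x = 0) \<or> (ALL x. R < norm x --> w x = 0)"
 shows "C1_grad (%x. LINT y|lborel. p (y + x) * w y) (%x. LINT y|lborel. w y *. P (y + x))" proof (rule C1_grad_integral)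
 have cp: "continuous_on UNIV p" "continuous_on UNIV P" using C1_grad_continuous[OF p] C1_gradD(2)[OF p] by auto
 have zP: "w y *. P (y + x) = 0" "p (y + x) * w y = 0" if "<|R|> + norm x < norm y" for x y proof -
  have "R < norm (y + x)" "R < norm y" using norm_diff_ineq[of y x] that norm_ge_zero[of x] by linarith+
  thus "w y *. P (y + x) = 0" "p (y + x) * w y = 0" using z C1_grad_outside[OF p, of R "y + x"] by auto
 qed
 have c1: "continuous_on UNIV (%y. p (y + x) * w y)" "continuous_on UNIV (%y. w y *. P (y + x))" for x
  by (intro continuous_intros w continuous_on_compose2[OF cp(1)] continuous_on_compose2[OF cp(2)]; simp)+
 show "C1_grad (%x. p (y + x) * w y) (%x. w y *. P (y + x))" for y
  using C1_grad_cmult[OF C1_grad_compose_affine[OF p, of 1 y], of "w y"] by (simp add: add.commute mult.commute)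
 show "integrable lborel (%y. p (y + x) * w y)" for x by (rule lborel_integrable_compact_support[OF c1(1) zP(2)])
 show "(%y. w y *. P (y + x)) : borel_measurable lborel" for x using borel_measurable_continuous_onI[OF c1(2)] by simp
 fix x0 :: 'a
 define B where "B = <|R|> + norm x0 + 1"
 have B0: "B >= 0" by (simp add: B_def)
 have "compact ((%(y,x). w y *. P (y + x)) ` (cball 0 B \<times> cball x0 1))" by (intro compact_continuous_image compact_Times compact_cball)
    (auto simp: case_prod_unfold intro!: continuous_intros continuous_on_compose2[OF w] continuous_on_compose2[OF cp(2)])
 from compact_imp_bounded[OF this, unfolded bounded_iff]
 obtain b where b: "ALL v:(%(y,x). w y *. P (y + x)) ` (cball 0 B \<times> cball x0 1). norm v <= b" ..
 define W where "W y = indicator (cball 0 B) y *. b" for y :: 'a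
 have "integrable lborel W" unfolding W_def by (intro integrable_scaleR_left) (auto intro!: integrable_indicator_bounded)
 moreover have "norm (w y *. P (y + x)) <= W y" if x: "x : ball x0 1" for x y proof (cases "norm y <= B")
  case True
  thus ?thesis using b[rule_format, of "w y *. P (y + x)"] x by (force simp: W_def)
 next
  case False
  have "norm x <= norm x0 + 1" using x norm_triangle_ineq2[of x x0] by (simp add: dist_norm norm_minus_commute)
  thus ?thesis using False zP(1)[of x y] by (auto simp: B_def W_def)
 qed
 ultimately show "EX e>0. EX W. integrable lborel W & (ALL x:ball x0 e. ALL y:space lborel. norm (w y *. P (y + x)) <= W y)"
  by (intro exI[of _ 1] conjI exI[of _ W]) auto
qed

lemma lborel_integral_translate:
 fixes f :: "'a::euclidean_space => 'b::{banach, second_countable_topology}"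
 assumes "f : borel_measurable borel"
 shows "(LBINT y. f (y + x)) = (LBINT y. f y)" using lborel_integral_affine[of 1 f x] assms by (simp add: add.commute)

text \<open>By translation invariance the integral of \<open>f (y + x)\<close> over \<open>y\<close>
  is constant in \<open>x\<close>; its gradient at 0 is the integral of \<open>F\<close>.\<close>

lemma C1_grad_integral_zero:
 fixes f :: "'a::euclidean_space => real"
 assumes f: "C1_grad f F" and z: "!!x. R < norm x ==> f x = 0"
 shows "(LBINT x. F x) = 0" proof -
 have "C1_grad (%x. LINT y|lborel. f (y + x) * 1) (%x. LINT y|lborel. 1 *. F (y + x))"
  by (rule C1_grad_integral_translate[OF f, of _ R]) (use z in auto)
 moreover have "(%x. LINT y|lborel. f (y + x) * 1) = (%x. LINT y|lborel. f y)" using lborel_integral_translate[OF C1_grad_borel(1)[OF f]] by simp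
 ultimately have "C1_grad (%x. LINT y|lborel. f y) (%x. LINT y|lborel. F (y + x))" by simp
 from C1_grad_unique[OF this C1_grad_const, of 0] show ?thesis by simp
qed

lemma C1_grad_integral_by_parts:
 fixes p q :: "'a::euclidean_space => real"
 assumes p: "C1_grad p P" and q: "C1_grad q Q" and z: "!!x. R < norm x ==> p x = 0"
 shows "(LBINT x. p x *. Q x) = - (LBINT x. q x *. P x)" proof -
 note c = C1_grad_continuous[OF p, of UNIV] C1_grad_continuous[OF q, of UNIV] C1_gradD(2)[OF p] C1_gradD(2)[OF q]
 have "integrable lborel (%x. p x *. Q x)" by (rule lborel_integrable_compact_support[of _ R]) (use z in "auto intro!: continuous_intros c")
 moreover have "integrable lborel (%x. q x *. P x)" by (rule lborel_integrable_compact_support[of _ R])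
    (use C1_grad_outside[OF p z] in "auto intro!: continuous_intros c")
 moreover have "(LBINT x. p x *. Q x + q x *. P x) = 0" by (rule C1_grad_integral_zero[OF C1_grad_mult[OF p q], of R]) (use z in auto)
 ultimately show ?thesis by (simp add: eq_neg_iff_add_eq_0)
qed

text \<open>Both sides are the gradient at \<open>0\<close> of \<open>x \<mapsto> \<integral> p(y + x) (\<partial>\<^sub>i q)(y) dy\<close>, computed before
 and after integrating by parts; this avoids second derivatives.\<close>

lemma C1_grad_integral_exchange:
 fixes p q :: "'a::euclidean_space => real"
 assumes p: "C1_grad p P" and q: "C1_grad q Q" and z: "!!x. R < norm x ==> p x = 0"
 shows "(LBINT y. (Q y <.> i) *. P y) = (LBINT y. (P y <.> i) *. Q y)" proof -
 note c = C1_grad_continuous[OF p, of UNIV] C1_grad_continuous[OF q, of UNIV] C1_gradD(2)[OF p] C1_gradD(2)[OF q]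
 have zP: "R < norm x ==> P x = 0" for x by (rule C1_grad_outside[OF p z])
 have 1: "C1_grad (%x. LINT y|lborel. p (y + x) * (Q y <.> i)) (%x. LINT y|lborel. (Q y <.> i) *. P (y + x))"
  by (rule C1_grad_integral_translate[OF p, of _ R]) (use z in "auto intro!: continuous_intros c")
 have 2: "C1_grad (%x. LINT y|lborel. q (y + x) * (P y <.> i)) (%x. LINT y|lborel. (P y <.> i) *. Q (y + x))"
  by (rule C1_grad_integral_translate[OF q, of _ R]) (use zP in "auto intro!: continuous_intros c")
 have eq: "(LBINT y. p (y + x) * (Q y <.> i)) = - (LBINT y. q (y - x) * (P y <.> i))" for x proof -
  have px: "C1_grad (%y. p (y + x)) (%y. P (y + x))" using C1_grad_compose_affine[OF p, of 1 x] by simp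
  have zx: "p (y + x) = 0" "P (y + x) = 0" if "<|R|> + norm x < norm y" for y proof -
   have "R < norm (y + x)" using norm_diff_ineq[of y x] that by linarith
   thus "p (y + x) = 0" "P (y + x) = 0" using z zP by auto
  qed
  have i1: "integrable lborel (%y. p (y + x) *. Q y)" by (rule lborel_integrable_compact_support[of _ "<|R|> + norm x"])
     (use zx in "auto intro!: continuous_intros c continuous_on_compose2[OF c(1)]")
  have i2: "integrable lborel (%y. q y *. P (y + x))" by (rule lborel_integrable_compact_support[of _ "<|R|> + norm x"])
     (use zx in "auto intro!: continuous_intros c continuous_on_compose2[OF c(3)]")
  have "(LBINT y. p (y + x) * (Q y <.> i)) = (LBINT y. (p (y + x) *. Q y) <.> i)" by simp
  also have "... = (LBINT y. p (y + x) *. Q y) <.> i" by (rule integral_inner_left) (use i1 in blast)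
  also have "... = - ((LBINT y. q y *. P (y + x)) <.> i)" by (subst C1_grad_integral_by_parts[OF px q, of "<|R|> + norm x"]) (use zx in auto)
  also have "(LBINT y. q y *. P (y + x)) <.> i = (LBINT y. (q y *. P (y + x)) <.> i)" by (rule integral_inner_left[symmetric]) (use i2 in blast)
  also have "(LBINT y. (q y *. P (y + x)) <.> i) = (LBINT y. q y * (P (y + x) <.> i))" by simp
  also have "... = (LBINT y. q (y + - x) * (P (y + - x + x) <.> i))" proof (rule lborel_integral_translate[symmetric])
   have "continuous_on UNIV (%y. q y * (P (y + x) <.> i))" by (intro continuous_intros c continuous_on_compose2[OF c(3)]) auto
   thus "(%y. q y * (P (y + x) <.> i)) : borel_measurable borel" by (rule borel_measurable_continuous_onI)
  qed
  finally show ?thesis by simp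
 qed
 have "C1_grad (%x. - (LBINT y. q (y + (-1) *. x) * (P y <.> i)))
   (%x. - ((-1) *. (LBINT y. (P y <.> i) *. Q (y + (-1) *. x))))" using C1_grad_minus[OF C1_grad_compose_affine[OF 2, of "-1" 0]] by simp
 hence "C1_grad (%x. LINT y|lborel. p (y + x) * (Q y <.> i)) (%x. LINT y|lborel. (P y <.> i) *. Q (y - x))" by (simp add: eq)
 from C1_grad_unique[OF 1 this, of 0] show ?thesis by simp
qed

text \<open>Exchanging derivatives turns the mixed products into products of diagonal terms. With a
  symmetric derivative matrix one side is its squared Frobenius norm, the other the squared
  divergence. So the explicit divergence of a potential field bounds its whole derivative in
  L2.\<close>

lemma C1_curl_free_energy:
 fixes p :: "'a::euclidean_space => 'a => real"
 assumes p: "!!i. i : Basis ==> C1_grad (p i) (P i)" and z: "!!i x. i : Basis ==> R < norm x ==> p i x = 0"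
  and sym: "!!i j x. i : Basis ==> j : Basis ==> P i x <.> j = P j x <.> i"
 shows "(LBINT x. (SUM i:Basis. (norm (P i x))^2)) = (LBINT x. (SUM i:Basis. P i x <.> i)^2)" proof -
 have zP: "R < norm x ==> P i x = 0" if "i : Basis" for i x by (rule C1_grad_outside[OF p[OF that] z[OF that]])
 have int: "integrable lborel (%x. (P i x <.> k) * (P j x <.> l))" "integrable lborel (%x. (P i x <.> k) *. P j x)"
  if "i : Basis" "j : Basis" for i j k l by (rule lborel_integrable_compact_support[of _ R];
    use zP that C1_gradD(2)[OF p] in "auto intro!: continuous_intros")+
 have ex: "(LBINT x. (P i x <.> j) * (P j x <.> i)) = (LBINT x. (P i x <.> i) * (P j x <.> j))"
  if ij: "i : Basis" "j : Basis" for i j proof -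
  have "(LBINT x. (P i x <.> j) * (P j x <.> i)) = (LBINT x. (P i x <.> j) *. P j x) <.> i"
   using integral_inner_left[of i lborel "%x. (P i x <.> j) *. P j x"] int(2)[OF ij] by simp
  also have "... = (LBINT x. (P j x <.> j) *. P i x) <.> i" by (subst C1_grad_integral_exchange[OF p[OF ij(2)] p[OF ij(1)] z[OF ij(2)]]) auto
  also have "... = (LBINT x. (P i x <.> i) * (P j x <.> j))"
   using integral_inner_left[of i lborel "%x. (P j x <.> j) *. P i x"] int(2)[OF ij(2,1)] by (simp add: mult.commute)
  finally show ?thesis .
 qed
 have "(SUM i:Basis. (norm (P i x))^2) = (SUM i:Basis. SUM j:Basis. (P i x <.> j) * (P j x <.> i))" for x
  using sym by (intro sum.cong refl) (simp add: power2_norm_eq_inner euclidean_inner[of "P _ x" "P _ x"])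
 hence "(LBINT x. (SUM i:Basis. (norm (P i x))^2))
  = (SUM i:Basis. SUM j:Basis. (LBINT x. (P i x <.> j) * (P j x <.> i)))" using int by (simp add: Bochner_Integration.integral_sum)
 also have "... = (SUM i:Basis. SUM j:Basis. (LBINT x. (P i x <.> i) * (P j x <.> j)))" using ex by simp
 also have "... = (LBINT x. (SUM i:Basis. SUM j:Basis. (P i x <.> i) * (P j x <.> j)))" using int by (simp add: Bochner_Integration.integral_sum)
 also have "... = (LBINT x. (SUM i:Basis. P i x <.> i)^2)" by (simp add: power2_eq_square sum_product)
 finally show ?thesis .
qed

text \<open>The square of \<open>p\<close> is integrated by parts against a single coordinate
  function, which is at most \<open>R\<close> on the support; Young's inequality lets half of the
  left side be absorbed.\<close>

lemma C1_poincare: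
 fixes p :: "'a::euclidean_space => real"
 assumes p: "C1_grad p P" and z: "!!x. R < norm x ==> p x = 0" and R: "R >= 0"
 shows "(LBINT x. (p x)^2) <= 4 * R^2 * (LBINT x. (norm (P x))^2)" proof -
 obtain i :: 'a where i: "i : Basis" using nonempty_Basis by blast
 note c = C1_grad_continuous[OF p, of UNIV] C1_gradD(2)[OF p]
 have zP: "R < norm x ==> P x = 0" for x by (rule C1_grad_outside[OF p z])
 have i1: "integrable lborel (%x. (p x)^2)" "integrable lborel (%x. (norm (P x))^2)"
  "integrable lborel (%x. (p x * p x) *. i)" "integrable lborel (%x. (x <.> i) *. (p x *. P x + p x *. P x))"
  "integrable lborel (%x. 2 * p x * (x <.> i) * (P x <.> i))"
  by (rule lborel_integrable_compact_support[of _ R]; use z zP in "auto intro!: continuous_intros c")+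
 have "(LBINT x. (p x)^2) = (LBINT x. (p x * p x) *. i) <.> i"
  using integral_inner_left[of i lborel "%x. (p x * p x) *. i"] i1(3) i by (simp add: power2_eq_square)
 also have "... = - ((LBINT x. (x <.> i) *. (p x *. P x + p x *. P x)) <.> i)"
  by (subst C1_grad_integral_by_parts[OF C1_grad_mult[OF p p] C1_grad_inner, of R]) (use z in auto)
 also have "... = (LBINT x. - (2 * p x * (x <.> i) * (P x <.> i)))"
  using integral_inner_left[of i lborel "%x. (x <.> i) *. (p x *. P x + p x *. P x)"] i1(4) by (simp add: inner_add_left algebra_simps)
 also have "... <= (LBINT x. (p x)^2 / 2 + 2 * R^2 * (norm (P x))^2)" proof (rule integral_mono)
  fix x
  show "- (2 * p x * (x <.> i) * (P x <.> i)) <= (p x)^2 / 2 + 2 * R^2 * (norm (P x))^2" proof (cases "norm x <= R")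
   case True
   have "<|x <.> i|> <= R" using True Basis_le_norm[OF i, of x] by simp
   moreover have "<|P x <.> i|> <= norm (P x)" by (rule Basis_le_norm[OF i])
   ultimately have "<|x <.> i|> * <|P x <.> i|> <= R * norm (P x)" using R by (intro mult_mono) auto
   hence "<|p x|> * (<|x <.> i|> * <|P x <.> i|>) <= <|p x|> * (R * norm (P x))" by (rule mult_left_mono) simp
   moreover have "0 <= (<|p x|> - 2 * (R * norm (P x)))^2" by simp
   hence "2 * <|p x|> * (R * norm (P x)) <= (p x)^2 / 2 + 2 * R^2 * (norm (P x))^2" unfolding power2_diff power_mult_distrib power2_abs by simp
   moreover have "- (2 * p x * (x <.> i) * (P x <.> i)) <= <|2 * p x * (x <.> i) * (P x <.> i)|>" by (rule abs_ge_minus_self)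
   moreover have "<|2 * p x * (x <.> i) * (P x <.> i)|> = 2 * (<|p x|> * (<|x <.> i|> * <|P x <.> i|>))" by (simp add: abs_mult)
   ultimately show ?thesis by linarith
  qed (use z in simp)
 next
  show "integrable lborel (%x. (p x)^2 / 2 + 2 * R^2 * (norm (P x))^2)" using i1(1,2) by simp
  show "integrable lborel (%x. - (2 * p x * (x <.> i) * (P x <.> i)))" using i1(5) by simp
 qed
 also have "... = (LBINT x. (p x)^2) / 2 + 2 * R^2 * (LBINT x. (norm (P x))^2)" using i1(1,2) by simp
 finally show ?thesis by simp
qed

section \<open>Averages at variable scale\<close>

text \<open>The \<open>m\<close>-mass of the disjoint balls selected by Vitali's lemma pays for the
  \<open>nu\<close>-mass of their enlargements. A ball about \<open>y\<close> lies in the ball of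
  radius \<open>5 * r z\<close> about a selected \<open>z\<close>, so its \<open>a\<close>-dilate
  lies in the ball of radius \<open>(5 + 5 * a) * r z\<close>.\<close>

lemma vitali_dilated_cover:
 fixes m nu :: "'a::euclidean_space measure" and r :: "'a => real"
 assumes [simp]: "sets m = sets borel" "sets nu = sets borel" and a: "a >= 0"
  and r: "!!y. y : Y ==> 0 < r y & r y <= B"
  and m: "!!y. y : Y ==> ennreal (r y ^ DIM('a)) <= emeasure m (cball y (r y))"
  and nu: "!!y. y : Y ==> emeasure nu (cball y ((5 + 5 * a) * r y)) <= ennreal (c * r y ^ DIM('a))"
  and c: "c >= 0"
 obtains W where "W : sets borel" "(UN y:Y. cball y (a * r y)) <= W" "emeasure nu W <= ennreal c * emeasure m UNIV" proof -
 obtain C where C: "countable C" "C <= Y" "pairwise (%i j. disjnt (cball i (r i)) (cball j (r j))) C"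
  "!!i. i : Y ==> EX j. j : C & ~ disjnt (cball i (r i)) (cball j (r j)) & cball i (r i) <= ball j (5 * r j)"
  using Vitali_covering_lemma_cballs_balls[of Y r B "%x. x"] r by auto
 define W where "W = (UN y:C. cball y ((5 + 5 * a) * r y))"
 define T where "T i = (if i : to_nat_on C ` C then cball (from_nat_into C i) ((5 + 5 * a) * r (from_nat_into C i)) else {})" for i
 define D where "D i = (if i : to_nat_on C ` C then cball (from_nat_into C i) (r (from_nat_into C i)) else {})" for i
 have fn: "from_nat_into C (to_nat_on C y) = y" if "y : C" for y using C(1) that by simp
 have WT: "W = (UN i. T i)" unfolding W_def T_def using fn by (force split: if_splits)
 have disj: "disjoint_family D" unfolding disjoint_family_on_def proof safe
  fix i j :: nat and x assume ij: "i ~= j" and x: "x : D i" "x : D j"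
  then obtain y z where y: "y : C" "i = to_nat_on C y" and z: "z : C" "j = to_nat_on C z" by (auto simp: D_def split: if_splits)
  hence "x : cball y (r y)" "x : cball z (r z)" using x by (auto simp: D_def fn)
  moreover have "y ~= z" using ij y z by auto
  ultimately show "x : {}" using C(3) y z unfolding pairwise_def disjnt_def by blast
 qed
 have "emeasure nu W <= (\<Sum>i. emeasure nu (T i))" unfolding WT by (rule emeasure_subadditive_countably) (auto simp: T_def)
 also have "... <= (\<Sum>i. ennreal c * emeasure m (D i))" proof (rule suminf_le)
  fix i
  show "emeasure nu (T i) <= ennreal c * emeasure m (D i)" proof (cases "i : to_nat_on C ` C")
   case True
   then obtain y where y: "y : C" "i = to_nat_on C y" by auto
   have yY: "y : Y" using y C(2) by auto
   have "emeasure nu (T i) <= ennreal (c * r y ^ DIM('a))" using nu[OF yY] True y by (simp add: T_def fn)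
   also have "... = ennreal c * ennreal (r y ^ DIM('a))" using c r[OF yY] by (simp add: ennreal_mult)
   also have "... <= ennreal c * emeasure m (D i)" using m[OF yY] True y by (intro mult_left_mono) (auto simp: D_def fn)
   finally show ?thesis .
  qed (simp add: T_def)
 qed auto
 also have "... = ennreal c * (\<Sum>i. emeasure m (D i))" by simp
 also have "(\<Sum>i. emeasure m (D i)) = emeasure m (UN i. D i)" by (rule suminf_emeasure[OF _ disj]) (auto simp: D_def)
 also have "ennreal c * ... <= ennreal c * emeasure m UNIV" by (intro mult_left_mono emeasure_mono) auto
 finally have "emeasure nu W <= ennreal c * emeasure m UNIV" .
 moreover have "W : sets borel" unfolding W_def using C(1) by (intro sets.countable_UN') auto
 moreover have "(UN y:Y. cball y (a * r y)) <= W" proof safe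
  fix y x assume y: "y : Y" and x: "x : cball y (a * r y)"
  obtain z where z: "z : C" "cball y (r y) <= ball z (5 * r z)" using C(4)[OF y] by blast
  have rz: "0 < r z" using z C(2) r by auto
  have ry: "0 < r y" using r[OF y] by simp
  have "cball y (r y) <= cball z (5 * r z)" using z(2) by auto
  hence 1: "dist y z + r y <= 5 * r z" using ry by (simp add: cball_subset_cball_iff)
  have "a * r y <= a * (5 * r z)" using 1 a zero_le_dist[of y z] by (intro mult_left_mono) linarith+
  hence "dist z x <= (5 + 5 * a) * r z" using 1 ry dist_triangle[of z x y] x by (simp add: dist_commute algebra_simps)
  thus "x : W" unfolding W_def using z(1) by auto
 qed
 ultimately show ?thesis using that by blast
qed

text \<open>The last scale at which \<open>m\<close> has mean density at least 1, mass being
  compared with the plain power of the radius. Larger balls are sparse, which bounds averages; balls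
  of nearly this radius are dense, which bounds exceptional sets through Vitali's lemma.\<close>

definition stop_radius :: "'a::euclidean_space measure => 'a => real" where
 "stop_radius m x = Sup {r. 0 <= r & r ^ DIM('a) <= measure m (cball x r)}"

lemma stop_radius:
 fixes m :: "'a::euclidean_space measure"
 assumes fin: "finite_measure m" and [simp]: "sets m = sets borel" and d: "d > 0" "measure m UNIV < d ^ DIM('a)"
 shows "0 <= stop_radius m x" "stop_radius m x <= d"
  "stop_radius m x <= r ==> 0 <= r ==> measure m (cball x r) <= r ^ DIM('a)"
  "0 < stop_radius m x ==> EX r. stop_radius m x / 2 < r & r <= stop_radius m x & r ^ DIM('a) <= measure m (cball x r)" proof -
 interpret finite_measure m by (rule fin)
 let ?S = "{r. 0 <= r & r ^ DIM('a) <= measure m (cball x r)}"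
 have sp: "space m = UNIV" using sets_eq_imp_space_eq[of m borel] by simp
 have ub: "r < d" if "r : ?S" for r proof (rule ccontr)
  assume "~ r < d"
  hence "d ^ DIM('a) <= r ^ DIM('a)" using d by (intro power_mono) auto
  also have "... <= measure m UNIV" using that bounded_measure[of "cball x r"] sp by simp
  finally show False using d by simp
 qed
 have bdd: "bdd_above ?S" using ub by (intro bdd_aboveI[of _ d]) (auto intro: less_imp_le)
 have 0: "0 : ?S" by (simp add: power_0_left)
 show S0: "0 <= stop_radius m x" unfolding stop_radius_def by (rule cSup_upper[OF 0 bdd])
 show "stop_radius m x <= d" unfolding stop_radius_def by (rule cSup_least) (use 0 ub in "auto intro: less_imp_le")
 have gt: "measure m (cball x r) < r ^ DIM('a)" if "stop_radius m x < r" for r proof (rule ccontr)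
  assume "~ measure m (cball x r) < r ^ DIM('a)"
  hence "r : ?S" using that S0 by simp
  hence "r <= stop_radius m x" unfolding stop_radius_def by (rule cSup_upper[OF _ bdd])
  thus False using that by simp
 qed
 \<comment> \<open>Above the supremum the inequality holds by definition; at the supremum itself it
   follows by letting the radii decrease to \<open>r\<close>.\<close>
 show "measure m (cball x r) <= r ^ DIM('a)" if r: "stop_radius m x <= r" "0 <= r" proof (rule tendsto_lowerbound[where F = "at_right r"])
  show "((%t. t ^ DIM('a)) \<longlongrightarrow> r ^ DIM('a)) (at_right r)" by (intro tendsto_intros)
  have "measure m (cball x r) <= t ^ DIM('a)" if "t > r" for t using gt[of t] finite_measure_mono[OF subset_cball, of r t x] that r by simp
  thus "\<forall>\<^sub>F t in at_right r. measure m (cball x r) <= t ^ DIM('a)" using eventually_at_right_less[of r] by (auto elim: eventually_mono)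
 qed auto
 show "EX r. stop_radius m x / 2 < r & r <= stop_radius m x & r ^ DIM('a) <= measure m (cball x r)" if "0 < stop_radius m x" proof -
  have "stop_radius m x / 2 < Sup ?S" using that unfolding stop_radius_def by simp
  then obtain r where r: "r : ?S" "stop_radius m x / 2 < r" using less_cSup_iff[OF _ bdd] 0 by blast
  hence "r <= stop_radius m x" unfolding stop_radius_def by (intro cSup_upper[OF _ bdd])
  thus ?thesis using r by auto
 qed
qed

text \<open>For bounded \<open>S\<close>, its least \<open>k\<close>-Lipschitz majorant. A radius
  that varies slowly keeps overlapping averages at comparable scales.\<close>

definition sup_conv :: "real => ('a::metric_space => real) => 'a => real" where
 "sup_conv k S x = (SUP y. S y - k * dist x y)"

lemma sup_conv:
 fixes S :: "'a::metric_space => real"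
 assumes k: "k > 0" and S: "!!y. S y <= B"
 shows "S x <= sup_conv k S x" "S y - k * dist x y <= sup_conv k S x" "sup_conv k S x <= B" "k-lipschitz_on UNIV (sup_conv k S)"
  "e < sup_conv k S x ==> EX y. e < S y - k * dist x y" proof -
 have le: "S y - k * dist x y <= B" for x y using S[of y] mult_nonneg_nonneg[OF less_imp_le[OF k] zero_le_dist[of x y]] by linarith
 have bdd: "bdd_above (range (%y. S y - k * dist x y))" for x using le by (intro bdd_aboveI[of _ B]) auto
 show up: "S y - k * dist x y <= sup_conv k S x" for x y unfolding sup_conv_def by (intro cSUP_upper bdd) simp
 show "S x <= sup_conv k S x" using up[of x x] by simp
 show "sup_conv k S x <= B" unfolding sup_conv_def by (intro cSUP_least le) simp
 have l: "sup_conv k S x <= sup_conv k S z + k * dist x z" for x z unfolding sup_conv_def[of k S x] proof (rule cSUP_least)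
  fix y
  have "k * dist z y <= k * (dist x z + dist x y)" using k by (intro mult_left_mono) (auto simp: dist_triangle3)
  thus "S y - k * dist x y <= sup_conv k S z + k * dist x z" using up[of y z] by (simp add: algebra_simps)
 qed simp
 show "k-lipschitz_on UNIV (sup_conv k S)" proof (rule lipschitz_onI)
  fix x y show "dist (sup_conv k S x) (sup_conv k S y) <= k * dist x y" using l[of x y] l[of y x] by (simp add: dist_real_def dist_commute abs_le_iff)
 qed (use k in simp)
 show "EX y. e < S y - k * dist x y" if "e < sup_conv k S x" using that less_cSUP_iff[OF _ bdd[of x]] unfolding sup_conv_def by auto
qed

text \<open>The constant is forced by \<open>pot_grad_div\<close>: with it, \<open>tent\<close> is
  exactly the divergence of the regularised radial field at scale 1.\<close>

definition tent :: "'a::euclidean_space => real" where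
 "tent x = real DIM('a) * (1 + real DIM('a) / 2) * max 0 (1 - x <.> x)"

definition tent_scaled :: "real => 'a::euclidean_space => real" where
 "tent_scaled s x = tent ((1 / s) *. x) / s ^ DIM('a)"

abbreviation tent_max :: "'a::euclidean_space itself => real" where
 "tent_max _ \<equiv> real DIM('a) * (1 + real DIM('a) / 2)"

lemma continuous_tent: "continuous_on A tent" unfolding tent_def by (intro continuous_intros)

lemma tent_borel [measurable]: "tent : borel_measurable borel" by (rule borel_measurable_continuous_onI[OF continuous_tent])

lemma tent_scaled_borel [measurable]:
 assumes [measurable]: "s : borel_measurable M" "f : borel_measurable M"
 shows "(%x. tent_scaled (s x) (f x)) : borel_measurable M" unfolding tent_scaled_def by measurable

lemma tent_nonneg: "0 <= tent x" by (simp add: tent_def)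

lemma tent_le: "tent (x::'a::euclidean_space) <= tent_max TYPE('a)" proof -
 have "tent x <= tent_max TYPE('a) * 1" unfolding tent_def by (intro mult_left_mono) auto
 thus ?thesis by simp
qed

lemma tent_outside: "1 <= norm x ==> tent x = 0" using one_le_power[of "norm x" 2] by (simp add: tent_def power2_norm_eq_inner max_def)

lemma integrable_tent: "integrable lborel tent" by (rule lborel_integrable_compact_support[OF continuous_tent, of 1]) (simp add: tent_outside)

lemma tent_scaled_nonneg: "0 < s ==> 0 <= tent_scaled s x" by (simp add: tent_scaled_def tent_nonneg)

lemma tent_scaled_le: "0 < s ==> tent_scaled s (x::'a::euclidean_space) <= tent_max TYPE('a) / s ^ DIM('a)"
 unfolding tent_scaled_def by (intro divide_right_mono tent_le) simp

lemma tent_scaled_outside: "0 < s ==> s <= norm x ==> tent_scaled s x = 0" unfolding tent_scaled_def by (subst tent_outside) (auto simp: divide_simps)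

definition tent_mass :: "'a::euclidean_space itself => real" where
 "tent_mass _ = (LBINT z. tent (z::'a))"

lemma tent_mass_pos: "0 < tent_mass TYPE('a::euclidean_space)" proof -
 have "0 < measure lborel (ball (0::'a) (1/2)) * (1/2)" by (simp add: content_ball_pos)
 also have "... = (LBINT z. indicator (ball (0::'a) (1/2)) z *. (1/2))" by (subst integral_scaleR_left) (auto intro!: integrable_indicator_bounded)
 also have "... <= tent_mass TYPE('a)" unfolding tent_mass_def proof (rule integral_mono[OF _ integrable_tent])
  show "integrable lborel (%z. indicator (ball (0::'a) (1/2)) z *. (1/2::real))"
   by (intro integrable_scaleR_left) (auto intro!: integrable_indicator_bounded)
  fix z :: 'a
  show "indicator (ball (0::'a) (1/2)) z *. (1/2) <= tent z" proof (cases "z : ball 0 (1/2)")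
   case True
   hence "(norm z)^2 <= (1/2)^2" by (intro power_mono) auto
   hence "z <.> z <= 1/4" unfolding power2_norm_eq_inner by (simp add: power2_eq_square)
   hence 1: "1/2 <= max 0 (1 - z <.> z)" by simp
   have D: "1 * 1 <= real DIM('a) * (1 + real DIM('a) / 2)" using DIM_positive[where 'a='a] by (intro mult_mono) auto
   have "(1 * 1) * (1/2) <= tent z" unfolding tent_def by (rule mult_mono[OF D 1]) auto
   thus ?thesis using True by simp
  qed (simp add: tent_nonneg)
 qed
 finally show ?thesis .
qed

lemma nn_integral_tent_average:
 fixes f :: "'a::euclidean_space => ennreal"
 assumes s: "0 < s" and [measurable]: "f : borel_measurable borel"
 shows "(NN y. f y * ennreal (tent_scaled s (y - x))) = (NN z. f (x + s *. z) * ennreal (tent z))"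
proof -
 have "(NN y. f y * ennreal (tent_scaled s (y - x)))
  = ennreal (<|s|> ^ DIM('a)) * (NN z. f (x + s *. z) * ennreal (tent_scaled s ((x + s *. z) - x)))"
  by (rule lborel_nn_integral_affine) (use s in auto)
 also have "... = (NN z. ennreal (<|s|> ^ DIM('a)) * (f (x + s *. z) * ennreal (tent_scaled s ((x + s *. z) - x))))"
  by (rule nn_integral_cmult[symmetric]) measurable
 also have "... = (NN z. f (x + s *. z) * ennreal (tent z))" proof (rule nn_integral_cong)
  fix z :: 'a
  have "ennreal (<|s|> ^ DIM('a)) * ennreal (tent_scaled s ((x + s *. z) - x)) = ennreal (tent z)"
   using s by (subst ennreal_mult[symmetric]) (auto simp: tent_scaled_def tent_nonneg)
  thus "ennreal (<|s|> ^ DIM('a)) * (f (x + s *. z) * ennreal (tent_scaled s ((x + s *. z) - x))) = f (x + s *. z) * ennreal (tent z)"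
   by (metis mult.left_commute)
 qed
 finally show ?thesis .
qed

lemma nn_integral_tent: "(NN z. ennreal (tent (z::'a::euclidean_space))) = ennreal (tent_mass TYPE('a))"
 unfolding tent_mass_def using integrable_tent by (rule nn_integral_eq_integral) (simp add: tent_nonneg)

abbreviation tent_mean :: "('a::euclidean_space => real) => ('a => real) => 'a => real"
 where "tent_mean s f x == LBINT z. f (x + s x *. z) * tent z"
abbreviation nn_spread :: "'a measure => ('a::euclidean_space => real) => 'a => ennreal"
 where "nn_spread m s y == \<integral>\<^sup>+x. ennreal (tent_scaled (s x) (y - x)) \<partial>m"
abbreviation nn_mean :: "('a::euclidean_space => real) => ('a => real) => 'a => ennreal"
 where "nn_mean s p x == \<integral>\<^sup>+z. ennreal ((p (x + s x *. z))^2) * ennreal (tent z) \<partial>lborel"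

text \<open>If \<open>y\<close> is within \<open>s x\<close> of \<open>x\<close>, the Lipschitz
  constant 1/4 puts \<open>s x\<close> between \<open>4/5 * s y\<close> and
  \<open>4/3 * s y\<close>. All contributing \<open>x\<close> lie in the larger ball, each
  contributes at most the height at the smaller scale, and the ratio of the two radii is
  5/3.\<close>

lemma tent_variable_bound:
 fixes s :: "'a::euclidean_space => real" and m :: "'a measure"
 assumes [simp]: "sets m = sets borel" and lip: "(1/4)-lipschitz_on UNIV s" and s: "!!x. 0 < s x"
  and m: "!!r. s y <= r ==> emeasure m (cball y r) <= ennreal (c * r ^ DIM('a))" and c: "c >= 0"
 shows "nn_spread m s y <= ennreal (tent_max TYPE('a) * (5/3) ^ DIM('a) * c)" proof -
 define b where "b = tent_max TYPE('a) / ((4/5) * s y) ^ DIM('a)"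
 have b0: "b >= 0" using s[of y] by (simp add: b_def)
 have le: "ennreal (tent_scaled (s x) (y - x)) <= ennreal b * indicator (cball y ((4/3) * s y)) x" for x proof (cases "norm (y - x) < s x")
  case True
  have "<|s x - s y|> <= (1/4) * norm (y - x)" using lipschitz_onD[OF lip, of x y] by (simp add: dist_norm norm_minus_commute)
  hence sx: "(4/5) * s y <= s x" "s x <= (4/3) * s y" using True by linarith+
  have "tent_scaled (s x) (y - x) <= tent_max TYPE('a) / s x ^ DIM('a)" by (rule tent_scaled_le[OF s])
  also have "... <= b" unfolding b_def using sx s[of x] s[of y] by (intro divide_left_mono power_mono mult_pos_pos) auto
  finally show ?thesis using True sx by (simp add: dist_norm ennreal_leI)
 qed (simp add: tent_scaled_outside[OF s])
 have "nn_spread m s y <= (\<integral>\<^sup>+x. ennreal b * indicator (cball y ((4/3) * s y)) x \<partial>m)"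
  by (intro nn_integral_mono le)
 also have "... = ennreal b * emeasure m (cball y ((4/3) * s y))" by (rule nn_integral_cmult_indicator) simp
 also have "... <= ennreal b * ennreal (c * ((4/3) * s y) ^ DIM('a))" by (intro mult_left_mono m) (use s[of y] in auto)
 also have "... = ennreal (b * (c * ((4/3) * s y) ^ DIM('a)))" using b0 c s[of y] by (simp add: ennreal_mult)
 also have "b * (c * ((4/3) * s y) ^ DIM('a)) = tent_max TYPE('a) * (5/3) ^ DIM('a) * c" proof -
  have "((4/3) * s y) ^ DIM('a) = (5/3) ^ DIM('a) * ((4/5) * s y) ^ DIM('a)" by (simp add: power_mult_distrib[symmetric])
  thus ?thesis using s[of y] by (simp add: b_def)
 qed
 finally show ?thesis .
qed

section \<open>Regularised radial fields and their superposition\<close>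

lemma DERIV_if_le:
 fixes f g :: "real => real"
 assumes f: "(f has_real_derivative d) (at a)" and g: "(g has_real_derivative d) (at a)" and eq: "f a = g a"
 shows "((%x. if x <= a then f x else g x) has_real_derivative d) (at a)" unfolding has_field_derivative_iff proof (rule filterlim_split_at)
 let ?q = "%y. ((if y <= a then f y else g y) - (if a <= a then f a else g a)) / (y - a)"
 have F: "((%y. (f y - f a) / (y - a)) \<longlongrightarrow> d) (at_left a)" "((%y. (g y - g a) / (y - a)) \<longlongrightarrow> d) (at_right a)"
  using f g by (auto simp: has_field_derivative_iff intro: tendsto_within_subset)
 show "(?q \<longlongrightarrow> d) (at_left a)" by (rule Lim_transform_eventually[OF F(1)]) (simp add: eventually_at_filter)
 show "(?q \<longlongrightarrow> d) (at_right a)" by (rule Lim_transform_eventually[OF F(2)]) (simp add: eventually_at_filter eq)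
qed

text \<open>As a function of the squared radius, the factor of \<open>x\<close> in the field
  \<open>x / norm x ^ n\<close>, continued below 1 by its tangent line at 1. The field becomes C1
  and is unchanged outside the unit ball.\<close>

definition profile :: "real => real => real" where
 "profile n q = (if q <= 1 then 1 + (n / 2) * (1 - q) else q powr (- (n / 2)))"

definition profile' :: "real => real => real" where
 "profile' n q = (if q <= 1 then - (n / 2) else - (n / 2) * q powr (- (n / 2) - 1))"

lemma profile_DERIV: "(profile n has_real_derivative profile' n q) (at q)" proof -
 have lin: "((%q. 1 + (n / 2) * (1 - q)) has_real_derivative - (n / 2)) (at q)" for q by (auto intro!: derivative_eq_intros)
 have pow: "((%q. q powr (- (n / 2))) has_real_derivative - (n / 2) * q powr (- (n / 2) - 1)) (at q)" if "q > 0" for q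
  using that by (auto intro!: derivative_eq_intros)
 consider "q < 1" | "q > 1" | "q = 1" by linarith
 thus ?thesis proof cases
  case 1
  show ?thesis by (rule has_field_derivative_transform_within_open[of _ _ _ "{..<1}"])
     (use 1 lin in "auto simp: profile_def profile'_def")
 next
  case 2
  show ?thesis by (rule has_field_derivative_transform_within_open[of _ _ _ "{1<..}"])
     (use 2 pow[of q] in "auto simp: profile_def profile'_def")
 next
  case 3
  have "((%q. if q <= 1 then 1 + (n / 2) * (1 - q) else q powr (- (n / 2))) has_real_derivative - (n / 2)) (at 1)"
   by (rule DERIV_if_le[OF lin]) (use pow[of 1] in auto)
  thus ?thesis using 3 by (simp add: profile_def[abs_def] profile'_def)
 qed
qed

lemma profile'_continuous: "continuous_on UNIV (profile' n)" proof -
 have "continuous_on ({..1} Un {1..}) (%q::real. if q <= 1 then - (n / 2) else - (n / 2) * q powr (- (n / 2) - 1))"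
  by (rule continuous_on_cases) (auto intro!: continuous_intros)
 moreover have "{..1} Un {1..} = (UNIV :: real set)" by auto
 ultimately show ?thesis by (simp add: profile'_def[abs_def])
qed

lemma profile_bounds:
 assumes "0 <= q" "0 <= n"
 shows "<|profile n q|> <= 1 + n / 2" "<|2 * profile' n q|> * q <= n" proof -
 have p: "q powr (- (n / 2)) <= 1" if "q > 1" using powr_mono[of "- (n/2)" 0 q] that assms by simp
 show "<|profile n q|> <= 1 + n / 2" proof (cases "q <= 1")
  case True
  hence "(n / 2) * (1 - q) <= (n / 2) * 1" "0 <= (n / 2) * (1 - q)" using assms by (intro mult_left_mono mult_nonneg_nonneg; simp)+
  thus ?thesis using True by (simp add: profile_def)
 qed (use p assms in "auto simp: profile_def")
 show "<|2 * profile' n q|> * q <= n" proof (cases "q <= 1")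
  case True
  thus ?thesis using assms by (simp add: profile'_def mult_left_le)
 next
  case False
  hence "q powr (- (n / 2) - 1) * q = q powr (- (n / 2))" by (simp add: powr_diff)
  moreover have "n * q powr (- (n / 2)) <= n * 1" using p False assms by (intro mult_left_mono) auto
  ultimately show ?thesis using False assms by (simp add: profile'_def abs_mult mult.assoc)
 qed
qed

text \<open>Component \<open>i\<close> of the field at scale \<open>s\<close>: up to a constant, the
  gradient of the fundamental solution of the Laplacian, regularised inside radius \<open>s\<close>.
  The power of \<open>s\<close> makes the far field independent of \<open>s\<close>.\<close>

definition pot :: "real => 'a::euclidean_space => 'a => real" where
 "pot s i x = profile DIM('a) ((x <.> x) / s^2) / s ^ DIM('a) * (x <.> i)"

definition pot_grad :: "real => 'a::euclidean_space => 'a => 'a" where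
 "pot_grad s i x = (profile DIM('a) ((x <.> x) / s^2) / s ^ DIM('a)) *. i
   + ((x <.> i) * (2 * profile' DIM('a) ((x <.> x) / s^2) / (s ^ DIM('a) * s^2))) *. x"

lemma C1_grad_pot: "C1_grad (pot s i) (pot_grad s i)" proof -
 define c where "c = 1 / s^2"
 have "C1_grad (%x. profile DIM('a) (c * (x <.> x))) (%x::'a. profile' DIM('a) (c * (x <.> x)) *. (c *. (2 *. x)))"
  by (rule C1_grad_compose_real[OF C1_grad_cmult[OF C1_grad_norm_square] profile_DERIV profile'_continuous])
 from C1_grad_mult[OF C1_grad_cmult[OF this, of "1 / s ^ DIM('a)"] C1_grad_inner, of i]
 have "C1_grad (%x. 1 / s ^ DIM('a) * profile (real DIM('a)) (c * (x <.> x)) * (x <.> i))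
  (%x::'a. (1 / s ^ DIM('a) * profile (real DIM('a)) (c * (x <.> x))) *. i +
    (x <.> i) *. (1 / s ^ DIM('a)) *. profile' (real DIM('a)) (c * (x <.> x)) *. c *. 2 *. x)" .
 moreover have "pot s i = (%x::'a. 1 / s ^ DIM('a) * profile (real DIM('a)) (c * (x <.> x)) * (x <.> i))" by (auto simp: pot_def c_def)
 moreover have "pot_grad s i = (%x::'a. (1 / s ^ DIM('a) * profile (real DIM('a)) (c * (x <.> x))) *. i +
    (x <.> i) *. (1 / s ^ DIM('a)) *. profile' (real DIM('a)) (c * (x <.> x)) *. c *. 2 *. x)" by (auto simp: pot_grad_def c_def)
 ultimately show ?thesis by simp
qed

lemma pot_grad_sym: "pot_grad s i x <.> j = pot_grad s j x <.> i"
 unfolding pot_grad_def inner_add_left inner_scaleR_left by (simp add: inner_commute[of i j])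

lemma pot_far:
 fixes x :: "'a::euclidean_space"
 assumes s: "0 < s" "s <= norm x"
 shows "pot s i x = (x <.> i) / norm x ^ DIM('a)" proof -
 have x: "norm x > 0" using s by linarith
 have q: "(x <.> x) / s^2 = (norm x / s)^2" by (simp add: power2_norm_eq_inner power_divide)
 have 1: "1 <= norm x / s" using s by simp
 have "profile n (t^2) = (t^2) powr (- (n / 2))" if "1 <= t" for n t :: real proof (cases "t = 1")
  case False
  hence "1 < t^2" using that by (simp add: one_less_power)
  thus ?thesis by (simp add: profile_def)
 qed (simp add: profile_def)
 from this[OF 1] have "profile DIM('a) ((norm x / s)^2) = ((norm x / s)^2) powr (- (real DIM('a) / 2))" .
 also have "(norm x / s)^2 = (norm x / s) powr 2" using s x by (simp add: powr_numeral)
 also have "... powr (- (real DIM('a) / 2)) = (norm x / s) powr (- real DIM('a))" by (simp add: powr_powr)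
 also have "... = 1 / (norm x / s) ^ DIM('a)" using s x by (simp add: powr_minus powr_realpow divide_inverse)
 finally show ?thesis using s x by (simp add: pot_def q power_divide)
qed

lemma pot_grad_div:
 fixes x :: "'a::euclidean_space"
 assumes s: "0 < s"
 shows "(SUM i:Basis. pot_grad s i x <.> i) = tent_scaled s x" proof -
 define q where "q = (x <.> x) / s^2"
 define n where "n = real DIM('a)"
 have "(SUM i:Basis. pot_grad s i x <.> i) = (SUM i:Basis. profile n q / s ^ DIM('a)
   + (2 * profile' n q / (s ^ DIM('a) * s^2)) * ((x <.> i) * (x <.> i)))" by (intro sum.cong refl) (simp add: pot_grad_def inner_add_left q_def n_def)
 also have "... = n * (profile n q / s ^ DIM('a)) + (2 * profile' n q / (s ^ DIM('a) * s^2)) * (x <.> x)"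
  unfolding sum.distrib euclidean_inner[of x x] sum_distrib_left by (simp add: n_def)
 also have "... = (n * profile n q + 2 * profile' n q * q) / s ^ DIM('a)" using s by (simp add: q_def add_divide_distrib)
 also have "n * profile n q + 2 * profile' n q * q = n * (1 + n / 2) * max 0 (1 - q)" proof (cases "q <= 1")
  case True
  thus ?thesis by (simp add: profile_def profile'_def field_simps)
 next
  case False
  hence "q powr (- (n / 2) - 1) * q = q powr (- (n / 2))" by (simp add: powr_diff)
  thus ?thesis using False by (simp add: profile_def profile'_def mult.assoc)
 qed
 also have "... / s ^ DIM('a) = tent_scaled s x" by (simp add: tent_scaled_def tent_def n_def q_def power2_eq_square)
 finally show ?thesis .
qed

lemma pot_bounds:
 fixes x i :: "'a::euclidean_space"
 assumes s: "0 < s" and i: "i : Basis"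
 shows "norm (pot_grad s i x) <= (1 + 3 * real DIM('a) / 2) / s ^ DIM('a)"
  "<|pot s i x|> <= (1 + real DIM('a) / 2) / s ^ DIM('a) * norm x" proof -
 define q where "q = (x <.> x) / s^2"
 define n where "n = real DIM('a)"
 have q: "0 <= q" "0 <= n" by (auto simp: q_def n_def)
 have xi: "<|x <.> i|> <= norm x" by (rule Basis_le_norm[OF i])
 have 1: "<|profile n q / s ^ DIM('a)|> <= (1 + n / 2) / s ^ DIM('a)" using profile_bounds(1)[OF q] s by (simp add: abs_divide divide_right_mono)
 show "<|pot s i x|> <= (1 + real DIM('a) / 2) / s ^ DIM('a) * norm x"
  unfolding pot_def abs_mult using 1 xi q s unfolding n_def q_def by (intro mult_mono) auto
 have "norm (pot_grad s i x) <= <|profile n q / s ^ DIM('a)|> * norm i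
   + <|(x <.> i) * (2 * profile' n q / (s ^ DIM('a) * s^2))|> * norm x"
  unfolding pot_grad_def n_def[symmetric] q_def[symmetric] by (metis norm_scaleR norm_triangle_ineq)
 also have "<|(x <.> i) * (2 * profile' n q / (s ^ DIM('a) * s^2))|> * norm x <= n / s ^ DIM('a)" proof -
  have "<|(x <.> i) * (2 * profile' n q / (s ^ DIM('a) * s^2))|> * norm x
   = (<|x <.> i|> * norm x) * (<|2 * profile' n q|> / (s ^ DIM('a) * s^2))" using s by (simp add: abs_mult)
  also have "... <= (norm x * norm x) * (<|2 * profile' n q|> / (s ^ DIM('a) * s^2))" using xi s by (intro mult_right_mono) auto
  also have "... = (<|2 * profile' n q|> * q) / s ^ DIM('a)"
   using s by (simp add: q_def power2_norm_eq_inner[symmetric] power2_eq_square mult.commute mult.left_commute)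
  also have "... <= n / s ^ DIM('a)" using profile_bounds(2)[OF q] s by (intro divide_right_mono) auto
  finally show ?thesis .
 qed
 finally show "norm (pot_grad s i x) <= (1 + 3 * real DIM('a) / 2) / s ^ DIM('a)" using 1 i by (simp add: n_def add_divide_distrib)
qed

lemma profile_borel [measurable]: "profile n : borel_measurable borel" "profile' n : borel_measurable borel"
 using profile'_continuous[of n] DERIV_continuous_on[of UNIV "profile n", OF has_field_derivative_at_within[OF profile_DERIV]]
 by (auto intro: borel_measurable_continuous_onI)

text \<open>The vector field is a superposition of radial fields, each centred at a point \<open>y\<close>
 and regularised at scale \<open>s y\<close>; being radial, they are curl free.\<close>

lemma regularised_potential:
 fixes nu :: "'a::euclidean_space measure" and s :: "'a => real"
 assumes fin: "finite_measure nu" and sets[measurable_cong, simp]: "sets nu = sets borel"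
  and R: "AE x in nu. norm x <= R" and s: "continuous_on UNIV s" "0 < s0" "!!x. s0 <= s x" "!!x. s x <= 1"
 obtains p P where "!!i. i : Basis ==> C1_grad (p i) (P i)"
  "!!i x. i : Basis ==> R + 1 < norm x ==> p i x = 0"
  "!!i j x. i : Basis ==> j : Basis ==> P i x <.> j = P j x <.> i"
  "!!x. (SUM i:Basis. P i x <.> i) = (LINT y|nu. tent_scaled (s y) (x - y)) - (LINT y|nu. tent_scaled 1 (x - y))" proof -
 interpret finite_measure nu by (rule fin)
 have [measurable]: "s : borel_measurable borel" using s(1) by (rule borel_measurable_continuous_onI)
 have spos: "0 < s x" for x using s(2) s(3)[of x] by linarith
 \<comment> \<open>Subtracting the field at scale 1 cancels the far field, as both agree at distance
   1 and beyond. This produces compact support at the price of the second term in the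
   divergence.\<close>
 define k where "k i x y = pot (s y) i (x - y) - pot 1 i (x - y)" for i x y :: 'a
 define G where "G i x y = pot_grad (s y) i (x - y) - pot_grad 1 i (x - y)" for i x y :: 'a
 define p where "p i x = (LINT y|nu. k i x y)" for i x
 define P where "P i x = (LINT y|nu. G i x y)" for i x
 define b where "b = 1 + 3 * real DIM('a) / 2"
 have mk[measurable]: "(%y. k i x y) : borel_measurable borel" for i x unfolding k_def pot_def by measurable
 have mG[measurable]: "(%y. G i x y) : borel_measurable borel" for i x unfolding G_def pot_grad_def by measurable
 have inv: "1 / s y ^ DIM('a) <= 1 / s0 ^ DIM('a)" for y using s(2) s(3)[of y] spos[of y] by (intro divide_left_mono power_mono mult_pos_pos) auto
 have Gb: "norm (G i x y) <= b / s0 ^ DIM('a) + b" if i: "i : Basis" for i x y proof -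
  have "norm (G i x y) <= norm (pot_grad (s y) i (x - y)) + norm (pot_grad 1 i (x - y))" unfolding G_def by (rule norm_triangle_ineq4)
  also have "... <= b / s y ^ DIM('a) + b / 1 ^ DIM('a)" unfolding b_def by (intro add_mono pot_bounds spos i) simp
  also have "b / s y ^ DIM('a) <= b / s0 ^ DIM('a)" using mult_left_mono[OF inv[of y], of b] by (simp add: b_def)
  finally show ?thesis by simp
 qed
 have far: "k i x y = 0" if "1 <= norm (x - y)" for i x y proof -
  have "s y <= norm (x - y)" using s(4)[of y] that by linarith
  thus ?thesis using pot_far[OF spos, of y "x - y" i] pot_far[of 1 "x - y" i] that by (simp add: k_def)
 qed
 have kb: "<|k i x y|> <= b / s0 ^ DIM('a) + b" if i: "i : Basis" for i x y proof (cases "1 <= norm (x - y)")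
  case True
  thus ?thesis using far[OF True] s(2) by (simp add: b_def)
 next
  case False
  have le: "<|pot t i (x - y)|> <= b / t ^ DIM('a)" if "0 < t" for t proof -
   have "<|pot t i (x - y)|> <= (1 + real DIM('a) / 2) / t ^ DIM('a) * norm (x - y)" by (rule pot_bounds(2)[OF that i])
   also have "... <= (1 + real DIM('a) / 2) / t ^ DIM('a) * 1" using False that by (intro mult_left_mono) auto
   also have "... <= b / t ^ DIM('a)" using that by (simp add: b_def divide_right_mono)
   finally show ?thesis .
  qed
  have "<|k i x y|> <= b / s y ^ DIM('a) + b / 1 ^ DIM('a)" using le[OF spos[of y]] le[of 1] unfolding k_def by linarith
  also have "b / s y ^ DIM('a) <= b / s0 ^ DIM('a)" using mult_left_mono[OF inv[of y], of b] by (simp add: b_def)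
  finally show ?thesis by simp
 qed
 have iG: "integrable nu (G i x)" if "i : Basis" for i x by (rule integrable_const_bound[of _ "b / s0 ^ DIM('a) + b"]) (use Gb[OF that] in auto)
 show ?thesis proof (rule that)
  show "C1_grad (p i) (P i)" if i: "i : Basis" for i unfolding p_def P_def proof (rule C1_grad_integral)
   show "C1_grad (%x. k i x y) (%x. G i x y)" for y
    using C1_grad_diff[OF C1_grad_compose_affine[OF C1_grad_pot[of "s y" i], of 1 "- y"] C1_grad_compose_affine[OF C1_grad_pot[of 1 i], of 1 "- y"]]
    by (simp add: k_def G_def)
   show "integrable nu (k i x)" for x by (rule integrable_const_bound[of _ "b / s0 ^ DIM('a) + b"]) (use kb[OF i] in auto)
   show "EX e>0. EX w. integrable nu w & (ALL x:ball x0 e. ALL y:space nu. norm (G i x y) <= w y)" for x0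
    using Gb[OF i] by (intro exI[of _ 1] conjI exI[of _ "%_. b / s0 ^ DIM('a) + b"]) auto
  qed auto
  show "p i x = 0" if i: "i : Basis" and x: "R + 1 < norm x" for i x unfolding p_def proof (rule integral_eq_zero_AE)
   show "AE y in nu. k i x y = 0" using R proof eventually_elim
    case (elim y)
    have "1 <= norm (x - y)" using norm_triangle_ineq2[of x y] x elim by linarith
    thus ?case by (rule far)
   qed
  qed
  have Pin: "P i x <.> j = (LINT y|nu. G i x y <.> j)" if "i : Basis" for i j x
   unfolding P_def using iG[OF that] by (intro integral_inner_left[symmetric]) auto
  have Gsym: "G i x y <.> j = G j x y <.> i" for i j x y unfolding G_def inner_diff_left by (intro arg_cong2[where f = "(-)"] pot_grad_sym)
  show "P i x <.> j = P j x <.> i" if "i : Basis" "j : Basis" for i j x unfolding Pin[OF that(1)] Pin[OF that(2)] by (simp only: Gsym)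
  fix x
  have "(SUM i:Basis. P i x <.> i) = (SUM i:Basis. (LINT y|nu. G i x y <.> i))" by (intro sum.cong refl Pin)
  also have "... = (LINT y|nu. (SUM i:Basis. G i x y <.> i))" by (rule Bochner_Integration.integral_sum[symmetric]) (use iG in auto)
  also have "... = (LINT y|nu. tent_scaled (s y) (x - y) - tent_scaled 1 (x - y))" proof (rule lint_cong[OF refl])
   fix y
   show "(SUM i:Basis. G i x y <.> i) = tent_scaled (s y) (x - y) - tent_scaled 1 (x - y)"
    unfolding G_def inner_diff_left sum_subtractf pot_grad_div[OF spos] pot_grad_div[OF zero_less_one] ..
  qed
  also have "... = (LINT y|nu. tent_scaled (s y) (x - y)) - (LINT y|nu. tent_scaled 1 (x - y))" proof (rule Bochner_Integration.integral_diff)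
   have c: "<|tent_scaled t z|> <= tent_max TYPE('a) / s0 ^ DIM('a)" if "s0 <= t" for t and z :: 'a proof -
    have "tent_scaled t z <= tent_max TYPE('a) / t ^ DIM('a)" using that s(2) by (intro tent_scaled_le) auto
    also have "... <= tent_max TYPE('a) / s0 ^ DIM('a)" using that s(2) by (intro divide_left_mono power_mono mult_pos_pos) auto
    finally show ?thesis using tent_scaled_nonneg[of t z] that s(2) by simp
   qed
   have s01: "s0 <= 1" using s(3,4) order_trans by blast
   show "integrable nu (%y. tent_scaled (s y) (x - y))" "integrable nu (%y. tent_scaled 1 (x - y))"
    by (rule integrable_const_bound[of _ "tent_max TYPE('a) / s0 ^ DIM('a)"]; use c s(3) s01 in simp)+
  qed
  finally show "(SUM i:Basis. P i x <.> i) = (LINT y|nu. tent_scaled (s y) (x - y)) - (LINT y|nu. tent_scaled 1 (x - y))" .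
 qed
qed

text \<open>Spreads each point \<open>x\<close> over the ball of radius \<open>s x\<close>, giving a
  singular measure a density. It is adjoint to \<open>tent_mean\<close>, which averages a function
  over the ball of radius \<open>s x\<close> about \<open>x\<close>.\<close>

definition tent_spread :: "'a::euclidean_space measure => ('a => real) => 'a => real" where
 "tent_spread m s y = (LINT x|m. tent_scaled (s x) (y - x))"

abbreviation tent_const :: "'a::euclidean_space itself => real" where
 "tent_const T \<equiv> tent_max T * (5/3) ^ DIM('a)"

lemma nn_integral_tent_pairing:
 fixes s :: "'a::euclidean_space => real" and m :: "'a measure"
 assumes m: "sigma_finite_measure m" and sets[measurable_cong, simp]: "sets m = sets borel"
  and s: "continuous_on UNIV s" "!!x. 0 < s x" and [measurable]: "f : borel_measurable borel"
 shows "(\<integral>\<^sup>+x. (NN z. f (x + s x *. z) * ennreal (tent z)) \<partial>m)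
  = (NN y. f y * nn_spread m s y)" proof -
 interpret m: sigma_finite_measure m by (rule m)
 interpret pair_sigma_finite lborel m ..
 have [measurable]: "s : borel_measurable borel" using s(1) by (rule borel_measurable_continuous_onI)
 have "(\<integral>\<^sup>+x. (NN z. f (x + s x *. z) * ennreal (tent z)) \<partial>m)
  = (\<integral>\<^sup>+x. (NN y. f y * ennreal (tent_scaled (s x) (y - x))) \<partial>m)"
  using s(2) by (intro nn_integral_cong nn_integral_tent_average[symmetric]) auto
 also have "... = (NN y. (\<integral>\<^sup>+x. f y * ennreal (tent_scaled (s x) (y - x)) \<partial>m))"
  by (rule Fubini') measurable
 also have "... = (NN y. f y * nn_spread m s y)"
  by (intro nn_integral_cong nn_integral_cmult) measurable
 finally show ?thesis .
qed

text \<open>The growth condition on balls bounds the density pointwise; its integral is the mass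
  times \<open>tent_mass\<close>; the L2 bound is the product of the two.\<close>

lemma tent_spread:
 fixes s :: "'a::euclidean_space => real" and m :: "'a measure"
 assumes fin: "finite_measure m" and sets[measurable_cong, simp]: "sets m = sets borel"
  and lip: "(1/4)-lipschitz_on UNIV s" and s: "!!x. 0 < s x"
  and m: "ALL y r. s y <= r --> measure m (cball y r) <= c * r ^ DIM('a)" and c: "c >= 0"
 shows "tent_spread m s : borel_measurable borel" "0 <= tent_spread m s y"
  "ennreal (tent_spread m s y) = nn_spread m s y"
  "tent_spread m s y <= tent_const TYPE('a) * c"
  "integrable lborel (tent_spread m s)" "(LBINT y. tent_spread m s y) = tent_mass TYPE('a) * measure m UNIV"
  "integrable lborel (%y. (tent_spread m s y)^2)"
  "(LBINT y. (tent_spread m s y)^2) <= tent_const TYPE('a) * c * (tent_mass TYPE('a) * measure m UNIV)" proof -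
 interpret finite_measure m by (rule fin)
 have sc: "continuous_on UNIV s" using lip by (rule lipschitz_on_continuous_on)
 have [measurable]: "s : borel_measurable borel" using sc by (rule borel_measurable_continuous_onI)
 have cc: "0 <= tent_const TYPE('a) * c" using c by simp
 have bd: "nn_spread m s y <= ennreal (tent_const TYPE('a) * c)" for y
  using m by (intro tent_variable_bound[OF sets lip s _ c]) (simp add: emeasure_eq_measure ennreal_leI)
 have int: "integrable m (%x. tent_scaled (s x) (y - x))" for y
  using bd[of y] tent_scaled_nonneg[OF s] by (intro integrableI_nonneg) (auto simp: le_less_trans)
 show eq: "ennreal (tent_spread m s y) = nn_spread m s y" for y
  unfolding tent_spread_def using tent_scaled_nonneg[OF s] by (intro nn_integral_eq_integral[symmetric] int) auto
 show nn: "0 <= tent_spread m s y" for y unfolding tent_spread_def by (rule lint_nonneg) (rule tent_scaled_nonneg[OF s])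
 show ub: "tent_spread m s y <= tent_const TYPE('a) * c" for y using bd[of y] cc unfolding eq[symmetric] by simp
 show [measurable]: "tent_spread m s : borel_measurable borel" unfolding tent_spread_def by measurable
 have "(NN y. ennreal (tent_spread m s y)) = (NN y. 1 * nn_spread m s y)"
  by (simp add: eq)
 also have "... = (\<integral>\<^sup>+x. (NN z. 1 * ennreal (tent (z::'a))) \<partial>m)"
  by (rule nn_integral_tent_pairing[symmetric, where f = "%_. 1"]) (use sc s sigma_finite_measure_axioms in auto)
 also have "... = ennreal (tent_mass TYPE('a) * measure m UNIV)" using tent_mass_pos[where 'a='a] sets_eq_imp_space_eq[OF sets]
  by (simp add: nn_integral_tent emeasure_eq_measure ennreal_mult)
 finally have tot: "(NN y. ennreal (tent_spread m s y)) = ennreal (tent_mass TYPE('a) * measure m UNIV)" .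
 show int1: "integrable lborel (tent_spread m s)" using tot nn by (intro integrableI_nonneg) auto
 show tot': "(LBINT y. tent_spread m s y) = tent_mass TYPE('a) * measure m UNIV"
  using tot nn tent_mass_pos[where 'a='a] by (subst integral_eq_nn_integral) auto
 have sq: "(tent_spread m s y)^2 <= tent_const TYPE('a) * c * tent_spread m s y" for y
  unfolding power2_eq_square using ub nn by (intro mult_right_mono) auto
 show int2: "integrable lborel (%y. (tent_spread m s y)^2)"
  by (rule Bochner_Integration.integrable_bound[OF integrable_mult_right[OF int1, of "tent_const TYPE('a) * c"]])
    (use sq nn cc in "auto intro!: always_eventually")
 have "(LBINT y. (tent_spread m s y)^2) <= (LBINT y. tent_const TYPE('a) * c * tent_spread m s y)"
  by (intro integral_mono int2 sq integrable_mult_right int1)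
 also have "... = tent_const TYPE('a) * c * (tent_mass TYPE('a) * measure m UNIV)" using tot' by simp
 finally show "(LBINT y. (tent_spread m s y)^2) <= tent_const TYPE('a) * c * (tent_mass TYPE('a) * measure m UNIV)" .
qed

lemma tent_average_integrable:
 fixes f :: "'a::euclidean_space => real"
 assumes [measurable]: "f : borel_measurable borel" and b: "!!y. <|f y|> <= b"
 shows "integrable lborel (%z. f (x + t *. z) * tent z)"
proof (rule Bochner_Integration.integrable_bound[OF integrable_mult_right[OF integrable_tent, of b]])
 show "AE z in lborel. norm (f (x + t *. z) * tent z) <= norm (b * tent z)" proof (rule AE_I2)
  fix z :: 'a
  have "<|f (x + t *. z)|> * tent z <= <|b|> * tent z" using b[of "x + t *. z"] by (intro mult_right_mono tent_nonneg) linarith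
  thus "norm (f (x + t *. z) * tent z) <= norm (b * tent z)" by (simp add: abs_mult tent_nonneg)
 qed
qed measurable

lemma tent_pairing:
 fixes s :: "'a::euclidean_space => real" and m :: "'a measure" and f :: "'a => real"
 assumes fin: "finite_measure m" and sets[measurable_cong, simp]: "sets m = sets borel"
  and lip: "(1/4)-lipschitz_on UNIV s" and s: "!!x. 0 < s x"
  and m: "ALL y r. s y <= r --> measure m (cball y r) <= c * r ^ DIM('a)" and c: "c >= 0"
  and fm[measurable]: "f : borel_measurable borel" and f: "!!y. 0 <= f y" "!!y. f y <= b"
 shows "integrable m (%x. tent_mean s f x)"
  "integrable lborel (%y. f y * tent_spread m s y)"
  "(LINT x|m. tent_mean s f x) = (LBINT y. f y * tent_spread m s y)" proof -
 interpret finite_measure m by (rule fin)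
 note cs = tent_spread[OF fin sets lip s m c]
 note cs(1)[measurable]
 have sc: "continuous_on UNIV s" using lip by (rule lipschitz_on_continuous_on)
 have [measurable]: "s : borel_measurable borel" using sc by (rule borel_measurable_continuous_onI)
 have b0: "0 <= b" using f order_trans by blast
 have fb: "<|f y|> <= b" for y using f[of y] by simp
 have nn: "0 <= tent_mean s f x" for x by (rule lint_nonneg) (simp add: f(1) tent_nonneg)
 show int: "integrable lborel (%y. f y * tent_spread m s y)" by (rule Bochner_Integration.integrable_bound[OF integrable_mult_right[OF cs(5), of b]])
    (use f b0 cs(2) in "auto intro!: always_eventually mult_right_mono simp: abs_mult")
 have eq: "ennreal (tent_mean s f x) = (NN z. ennreal (f (x + s x *. z)) * ennreal (tent z))" for x
 proof -
  have "ennreal (tent_mean s f x) = (NN z. ennreal (f (x + s x *. z) * tent z))"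
   by (rule nn_integral_eq_integral[symmetric, OF tent_average_integrable[OF fm fb]]) (simp add: f(1) tent_nonneg)
  thus ?thesis by (simp add: ennreal_mult f(1) tent_nonneg)
 qed
 have main: "(\<integral>\<^sup>+x. ennreal (tent_mean s f x) \<partial>m) = ennreal (LBINT y. f y * tent_spread m s y)" proof -
  have "(\<integral>\<^sup>+x. ennreal (tent_mean s f x) \<partial>m)
   = (NN y. ennreal (f y) * nn_spread m s y)"
   unfolding eq by (rule nn_integral_tent_pairing[OF sigma_finite_measure_axioms sets sc s]) measurable
  also have "... = (NN y. ennreal (f y * tent_spread m s y))"
   using f(1) cs(2) by (simp add: cs(3)[symmetric] ennreal_mult)
  also have "... = ennreal (LBINT y. f y * tent_spread m s y)" using f(1) cs(2) by (intro nn_integral_eq_integral int) auto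
  finally show ?thesis .
 qed
 show int2: "integrable m (%x. tent_mean s f x)" using main nn by (intro integrableI_nonneg) auto
 show "(LINT x|m. tent_mean s f x) = (LBINT y. f y * tent_spread m s y)"
  using main nn f(1) cs(2) by (subst integral_eq_nn_integral) (auto intro!: always_eventually)
qed

text \<open>Since the radius depends on \<open>x\<close>, the chain rule adds a term in the
  direction \<open>S x\<close>. It is at most a quarter of the size of \<open>P\<close>, because
  \<open>tent\<close> lives in the unit ball and \<open>norm (S x) <= 1/4\<close>.\<close>

lemma C1_tent_average:
 fixes p s :: "'a::euclidean_space => real"
 assumes p: "C1_grad p P" and z: "!!x. R < norm x ==> p x = 0" and s: "C1_grad s S" "!!x. norm (S x) <= 1/4"
 shows "C1_grad (%x. tent_mean s p x)
  (%x. LINT z|lborel. tent z *. (P (x + s x *. z) + (P (x + s x *. z) <.> z) *. S x))"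
  "integrable lborel (%z. tent z *. (P (x + s x *. z) + (P (x + s x *. z) <.> z) *. S x))" proof -
 have zP: "P x = 0" if "R < norm x" for x using C1_grad_outside[OF p z that] .
 obtain B where B: "B >= 0" "!!x. norm (P x) <= B" by (rule bounded_compact_support[OF C1_gradD(2)[OF p] zP]) (assumption, rule that)
 note c = C1_gradD(2)[OF p] C1_grad_continuous[OF s(1), of UNIV] C1_gradD(2)[OF s(1)] C1_grad_continuous[OF p, of UNIV]
 define G where "G x z = tent z *. (P (x + s x *. z) + (P (x + s x *. z) <.> z) *. S x)" for x z
 have Gc: "continuous_on UNIV (G x)" for x unfolding G_def[abs_def] by (intro continuous_intros continuous_tent continuous_on_compose2[OF c(1)]) auto
 have Gi: "integrable lborel (G x)" for x by (rule lborel_integrable_compact_support[OF Gc, of 1]) (simp add: G_def tent_outside)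
 thus "integrable lborel (%z. tent z *. (P (x + s x *. z) + (P (x + s x *. z) <.> z) *. S x))" unfolding G_def .
 have "C1_grad (%x. tent_mean s p x) (%x. LINT z|lborel. G x z)" proof (rule C1_grad_integral)
  show "C1_grad (%x. p (x + s x *. z) * tent z) (%x. G x z)" for z proof -
   have "C1_grad (%x. p (x + s x *. z)) (%x. P (x + s x *. z) + (P (x + s x *. z) <.> z) *. S x)" unfolding C1_grad_def proof (intro conjI allI)
    show "continuous_on UNIV (%x. P (x + s x *. z) + (P (x + s x *. z) <.> z) *. S x)"
     by (intro continuous_intros c continuous_on_compose2[OF c(1)]) auto
    fix x
    have "((%x. x + s x *. z) has_derivative (%h. h + (S x <.> h) *. z)) (at x)" by (auto intro!: derivative_eq_intros C1_gradD(1)[OF s(1)])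
    from has_derivative_compose[OF this C1_gradD(1)[OF p]]
    show "((%x. p (x + s x *. z)) has_derivative (%h. (P (x + s x *. z) + (P (x + s x *. z) <.> z) *. S x) <.> h)) (at x)"
     by (simp add: inner_add_left inner_add_right mult.commute)
   qed
   from C1_grad_cmult[OF this, of "tent z"] show ?thesis by (simp add: G_def mult.commute)
  qed
  show "integrable lborel (%z. p (x + s x *. z) * tent z)" for x by (rule lborel_integrable_compact_support[of _ 1])
     (auto simp: tent_outside intro!: continuous_intros continuous_tent continuous_on_compose2[OF c(4)])
  show "G x : borel_measurable lborel" for x using borel_measurable_continuous_onI[OF Gc[of x]] by simp
  fix x0 :: 'a
  have "norm (G x z) <= 2 * B * tent z" for x z proof (cases "norm z <= 1")
   case True
   have "norm ((P (x + s x *. z) <.> z) *. S x) <= (B * 1) * 1" unfolding norm_scaleR proof (intro mult_mono)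
    have "<|P (x + s x *. z) <.> z|> <= norm (P (x + s x *. z)) * norm z" by (rule Cauchy_Schwarz_ineq2)
    also have "... <= B * 1" using B True by (intro mult_mono) auto
    finally show "<|P (x + s x *. z) <.> z|> <= B * 1" .
    show "norm (S x) <= 1" using s(2)[of x] by simp
   qed (use B in auto)
   hence "norm (P (x + s x *. z) + (P (x + s x *. z) <.> z) *. S x) <= 2 * B"
    using B(2)[of "x + s x *. z"] norm_triangle_ineq[of "P (x + s x *. z)" "(P (x + s x *. z) <.> z) *. S x"] by linarith
   hence "tent z * norm (P (x + s x *. z) + (P (x + s x *. z) <.> z) *. S x) <= tent z * (2 * B)" by (rule mult_left_mono) (rule tent_nonneg)
   thus ?thesis unfolding G_def norm_scaleR by (simp add: tent_nonneg mult.commute)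
  qed (simp add: G_def tent_outside)
  thus "EX e>0. EX w. integrable lborel w & (ALL x:ball x0 e. ALL z:space lborel. norm (G x z) <= w z)"
   using integrable_mult_right[OF integrable_tent, of "2 * B"] by (intro exI[of _ 1]) auto
 qed
 thus "C1_grad (%x. tent_mean s p x)
  (%x. LINT z|lborel. tent z *. (P (x + s x *. z) + (P (x + s x *. z) <.> z) *. S x))" unfolding G_def .
qed

section \<open>Test fields for singular measures\<close>

text \<open>Mollifying a 1/4-Lipschitz function at radius \<open>tau\<close> moves it by at most
  \<open>tau / 4\<close>. Adding this amount restores the majorant and, for nonnegative
  \<open>S\<close>, keeps the radius positive.\<close>

definition smooth_radius :: "real => ('a::euclidean_space => real) => 'a => real" where
 "smooth_radius tau S x = mollify tau (sup_conv (1/4) S) x + tau / 4"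

lemma smooth_radius:
 fixes S :: "'a::euclidean_space => real"
 assumes tau: "tau > 0" and S: "!!y. 0 <= S y" "!!y. S y <= B"
 shows "EX G. C1_grad (smooth_radius tau S) G & (ALL x. norm (G x) <= 1/4)" "(1/4)-lipschitz_on UNIV (smooth_radius tau S)"
  "sup_conv (1/4) S x <= smooth_radius tau S x" "smooth_radius tau S x <= sup_conv (1/4) S x + tau / 2"
  "S x <= smooth_radius tau S x" "tau / 4 <= smooth_radius tau S x" proof -
 note sc = sup_conv[of "1/4" S B]
 have lip: "(1/4)-lipschitz_on UNIV (sup_conv (1/4) S)" using sc(4) S by simp
 have mlip: "(1/4)-lipschitz_on UNIV (mollify tau (sup_conv (1/4) S))" by (rule mollify_lipschitz[OF lip])
 show lip': "(1/4)-lipschitz_on UNIV (smooth_radius tau S)"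
  using mlip unfolding smooth_radius_def[abs_def] lipschitz_on_def by (simp add: dist_real_def)
 obtain G where G: "C1_grad (mollify tau (sup_conv (1/4) S)) G" using mollify_C1[OF lipschitz_on_continuous_on[OF lip] tau] by blast
 have G': "C1_grad (smooth_radius tau S) G" using C1_grad_add[OF G C1_grad_const[of "tau / 4"]] by (simp add: smooth_radius_def[abs_def])
 show "EX G. C1_grad (smooth_radius tau S) G & (ALL x. norm (G x) <= 1/4)" using G' C1_grad_bound[OF G' lip'] by blast
 have cl: "<|mollify tau (sup_conv (1/4) S) x - sup_conv (1/4) S x|> <= tau / 4" for x using mollify_close[OF lip, of tau x] tau by simp
 show 1: "sup_conv (1/4) S x <= smooth_radius tau S x" and "smooth_radius tau S x <= sup_conv (1/4) S x + tau / 2"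
  using cl[of x] unfolding smooth_radius_def by linarith+
 have "S x <= sup_conv (1/4) S x" using sc(1) S by simp
 with 1 show "S x <= smooth_radius tau S x" by linarith
 have "0 <= sup_conv (1/4) S y" for y using order_trans[OF S(1) sc(1)[OF _ S(2)]] by simp
 hence "mollify tau (%_. 0) x <= mollify tau (sup_conv (1/4) S) x" using lipschitz_on_continuous_on[OF lip] by (intro mollify_mono) auto
 thus "tau / 4 <= smooth_radius tau S x" by (simp add: smooth_radius_def mollify_const)
qed

text \<open>Where the radius is not negligible, a nearby \<open>y\<close> has stopping radius at
  least comparable to both the radius at \<open>x\<close> and the distance of \<open>x\<close> from
  \<open>y\<close>: the ball about \<open>x\<close> lies within 8 stopping radii of
  \<open>y\<close>. A dense ball about \<open>y\<close> has at least half the stopping radius,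
  whence the dilation 16 and the Vitali factor \<open>5 + 5 * 16 = 85\<close>.\<close>

lemma smooth_radius_cover:
 fixes m :: "'a::euclidean_space measure"
 assumes fin: "finite_measure m" and [simp]: "sets m = sets borel" and d: "d > 0" "measure m UNIV < d ^ DIM('a)" and tau: "tau > 0"
 obtains W where "W : sets borel" "emeasure lborel W <= ennreal (unit_ball_vol DIM('a) * 85 ^ DIM('a) * measure m UNIV)"
  "!!x. tau / 2 <= sup_conv (1/4) (stop_radius m) x ==> cball x (smooth_radius tau (stop_radius m) x) <= W" proof -
 interpret finite_measure m by (rule fin)
 let ?S = "stop_radius m"
 note sr = stop_radius[OF fin assms(2) d]
 have "EX r. ?S y / 2 < r & r <= ?S y & r ^ DIM('a) <= measure m (cball y r)" if "0 < ?S y" for y using sr(4)[OF that] .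
 then obtain r where r: "!!y. 0 < ?S y ==> ?S y / 2 < r y & r y <= ?S y & r y ^ DIM('a) <= measure m (cball y (r y))" by metis
 have rpos: "0 < r y" if "0 < ?S y" for y using r[OF that] that by linarith
 obtain W where W: "W : sets borel" "(UN y:{y. 0 < ?S y}. cball y (16 * r y)) <= W"
  "emeasure lborel W <= ennreal (unit_ball_vol DIM('a) * 85 ^ DIM('a)) * emeasure m UNIV"
 proof (rule vitali_dilated_cover[where m = m and nu = lborel and r = r and Y = "{y. 0 < ?S y}" and a = 16 and B = d
   and c = "unit_ball_vol DIM('a) * 85 ^ DIM('a)"])
  fix y assume y: "y : {y. 0 < ?S y}"
  show "0 < r y & r y <= d" using r[of y] rpos[of y] sr(2)[of y] y by auto
  show "ennreal (r y ^ DIM('a)) <= emeasure m (cball y (r y))" using r[of y] y by (simp add: emeasure_eq_measure ennreal_leI)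
  have "emeasure lborel (cball y (85 * r y)) = ennreal (unit_ball_vol DIM('a) * (85 * r y) ^ DIM('a))"
   using rpos[of y] y by (intro emeasure_cball) auto
  thus "emeasure lborel (cball y ((5 + 5 * 16) * r y)) <= ennreal (unit_ball_vol DIM('a) * 85 ^ DIM('a) * r y ^ DIM('a))"
   by (simp add: power_mult_distrib mult.assoc)
 qed (auto simp: )
 show ?thesis proof (rule that[OF W(1)])
  show "emeasure lborel W <= ennreal (unit_ball_vol DIM('a) * 85 ^ DIM('a) * measure m UNIV)"
   using W(3) by (simp add: emeasure_eq_measure ennreal_mult)
  fix x assume x: "tau / 2 <= sup_conv (1/4) ?S x"
  let ?T = "sup_conv (1/4) ?S x"
  have Tp: "?T > 0" using x tau by linarith
  hence "?T / 2 < ?T" by simp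
  then obtain y where y: "?T / 2 < ?S y - (1/4) * dist x y" using sup_conv(5)[of "1/4" ?S d "?T / 2" x] sr(2) by auto
  have sy: "0 < ?S y" using y Tp zero_le_dist[of x y] by linarith
  have "smooth_radius tau ?S x <= ?T + tau / 2" using smooth_radius(4)[OF tau sr(1,2)] .
  hence "smooth_radius tau ?S x + dist x y <= 8 * ?S y" using x y sy by linarith
  hence "smooth_radius tau ?S x + dist x y <= 16 * r y" using r[OF sy] by linarith
  hence "cball x (smooth_radius tau ?S x) <= cball y (16 * r y)" by (simp add: cball_subset_cball_iff add.commute)
  thus "cball x (smooth_radius tau ?S x) <= W" using W(2) sy by blast
 qed
qed

text \<open>A change of the smoothed radius at \<open>x\<close> comes from some \<open>y\<close>
  with \<open>S y < stop_radius m y\<close> within a fixed multiple of that stopping radius. The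
  enlarged balls about such \<open>y\<close> have radius at least \<open>S y\<close>, so the growth
  condition bounds their \<open>nu\<close>-mass, and Vitali's lemma bounds the sum by the mass of
  \<open>m\<close>.\<close>

lemma smooth_radius_change:
 fixes m nu :: "'a::euclidean_space measure"
 assumes fin: "finite_measure m" and [simp]: "sets m = sets borel" and d: "d > 0" "measure m UNIV < d ^ DIM('a)" and tau: "tau > 0"
  and fin': "finite_measure nu" and [simp]: "sets nu = sets borel" and S: "!!y. 0 <= S y" "!!y. S y <= d"
  and nu: "!!y r. S y <= r ==> measure nu (cball y r) <= c * r ^ DIM('a)" and c: "c >= 0"
  and A: "!!x. x : A ==> tau / 2 <= sup_conv (1/4) S x"
   "!!x. x : A ==> smooth_radius tau (%x. max (S x) (stop_radius m x)) x ~= smooth_radius tau S x"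
 shows "measure nu A <= c * 85 ^ DIM('a) * measure m UNIV" proof -
 interpret finite_measure m by (rule fin)
 interpret nu: finite_measure nu by (rule fin')
 let ?S = "stop_radius m"
 note sr = stop_radius[OF fin assms(2) d]
 have "EX r. ?S y / 2 < r & r <= ?S y & r ^ DIM('a) <= measure m (cball y r)" if "0 < ?S y" for y using sr(4)[OF that] .
 then obtain r where r: "!!y. 0 < ?S y ==> ?S y / 2 < r y & r y <= ?S y & r y ^ DIM('a) <= measure m (cball y (r y))" by metis
 have rpos: "0 < r y" if "S y < ?S y" for y using r[of y] S(1)[of y] that by linarith
 obtain W where W: "W : sets borel" "(UN y:{y. S y < ?S y}. cball y (16 * r y)) <= W"
  "emeasure nu W <= ennreal (c * 85 ^ DIM('a)) * emeasure m UNIV"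
 proof (rule vitali_dilated_cover[where m = m and nu = nu and r = r and Y = "{y. S y < ?S y}" and a = 16 and B = d
   and c = "c * 85 ^ DIM('a)"])
  fix y assume y: "y : {y. S y < ?S y}"
  hence sy: "0 < ?S y" using S(1)[of y] by simp
  show "0 < r y & r y <= d" using r[OF sy] rpos[of y] sr(2)[of y] y by auto
  show "ennreal (r y ^ DIM('a)) <= emeasure m (cball y (r y))" using r[OF sy] by (simp add: emeasure_eq_measure ennreal_leI)
  have "S y <= 85 * r y" using r[OF sy] y by auto
  from nu[OF this] show "emeasure nu (cball y ((5 + 5 * 16) * r y)) <= ennreal (c * 85 ^ DIM('a) * r y ^ DIM('a))"
   by (simp add: nu.emeasure_eq_measure ennreal_leI power_mult_distrib mult.assoc)
 qed (use c in auto)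
 have "A <= W" proof
  fix x assume x: "x : A"
  have "EX z. dist x z <= <|tau|> & sup_conv (1/4) (%x. max (S x) (?S x)) z ~= sup_conv (1/4) S z" proof (rule ccontr)
   assume "~ ?thesis"
   hence "mollify tau (sup_conv (1/4) (%x. max (S x) (?S x))) x = mollify tau (sup_conv (1/4) S) x" by (intro mollify_cong) blast
   thus False using A(2)[OF x] by (simp add: smooth_radius_def)
  qed
  then obtain z where z: "dist x z <= tau" "sup_conv (1/4) (%x. max (S x) (?S x)) z ~= sup_conv (1/4) S z" using tau by auto
  have mx: "max (S y) (?S y) <= d" for y using S sr(2) by simp
  have "sup_conv (1/4) S z <= sup_conv (1/4) (%x. max (S x) (?S x)) z" unfolding sup_conv_def[of _ S] proof (rule cSUP_least)
   fix y show "S y - 1/4 * dist z y <= sup_conv (1/4) (%x. max (S x) (?S x)) z" using sup_conv(2)[of "1/4" "%x. max (S x) (?S x)" d y z] mx by simp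
  qed simp
  hence "sup_conv (1/4) S z < sup_conv (1/4) (%x. max (S x) (?S x)) z" using z(2) by simp
  then obtain y where y: "sup_conv (1/4) S z < max (S y) (?S y) - (1/4) * dist z y"
   using sup_conv(5)[of "1/4" "%x. max (S x) (?S x)" d "sup_conv (1/4) S z" z] mx by auto
  have "S y - (1/4) * dist z y <= sup_conv (1/4) S z" using sup_conv(2)[of "1/4" S d y z] S by simp
  hence lt: "S y < ?S y" using y by linarith
  have y': "sup_conv (1/4) S z < ?S y - (1/4) * dist z y" using y lt by simp
  have "(1/4)-lipschitz_on UNIV (sup_conv (1/4) S)" using sup_conv(4)[of "1/4" S d] S by simp
  from lipschitz_onD[OF this UNIV_I UNIV_I, of x z]
  have "sup_conv (1/4) S x <= sup_conv (1/4) S z + (1/4) * dist x z" unfolding dist_real_def by linarith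
  hence "tau / 4 <= sup_conv (1/4) S z" using A(1)[OF x] z(1) by linarith
  hence "dist x z + dist z y <= 8 * ?S y" using y' z(1) sr(1)[of y] by linarith
  moreover have "?S y <= 2 * r y" using r[of y] lt S(1)[of y] by linarith
  ultimately have "dist y x <= 16 * r y" using dist_triangle[of x y z] by (simp add: dist_commute)
  hence "x : cball y (16 * r y)" by simp
  thus "x : W" using W(2) lt by blast
 qed
 hence "emeasure nu A <= emeasure nu W" using W(1) by (intro emeasure_mono) auto
 also have "... <= ennreal (c * 85 ^ DIM('a) * measure m UNIV)" using W(3) c by (simp add: emeasure_eq_measure ennreal_mult)
 finally show ?thesis using c by (simp add: nu.emeasure_eq_measure)
qed

section \<open>Estimates for restricted measures, spreads, energies and averages\<close>

lemma finite_density_indicator: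
 fixes nu :: "'a::euclidean_space measure"
 assumes "finite_measure nu" and [measurable_cong, simp]: "sets nu = sets borel" and [measurable]: "A : sets borel"
 shows "finite_measure (density nu (indicator A))" "sets (density nu (indicator A)) = sets borel"
  "B : sets borel ==> measure (density nu (indicator A)) B = measure nu (A Int B)"
  "f : borel_measurable borel ==> (LINT x|density nu (indicator A). f x) = (LINT x|nu. indicator A x * (f x :: real))" proof -
 interpret finite_measure nu by (rule assms)
 have em: "emeasure (density nu (indicator A)) B = emeasure nu (A Int B)" if [measurable]: "B : sets borel" for B by (rule emeasure_restricted) auto
 have sp: "space nu = UNIV" using sets_eq_imp_space_eq[of nu borel] by simp
 show "finite_measure (density nu (indicator A))" by (rule finite_measureI) (use em[of UNIV] sp in "simp add: emeasure_eq_measure")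
 show "sets (density nu (indicator A)) = sets borel" by simp
 show "measure (density nu (indicator A)) B = measure nu (A Int B)" if "B : sets borel" using em[OF that] by (simp add: measure_def)
 have ind: "density nu (indicator A) = density nu (%x. ennreal (indicator A x))" by (simp add: ennreal_indicator)
 show "(LINT x|density nu (indicator A). f x) = (LINT x|nu. indicator A x * f x)" if [measurable]: "f : borel_measurable borel"
  unfolding ind by (subst integral_density) auto
qed

lemma energy_density:
 fixes e :: "'a::euclidean_space => real" and t :: real
 assumes [measurable]: "e : borel_measurable borel" and i: "integrable lborel (%x. (e x)^2)"
 defines "m \<equiv> density lborel (%x. ennreal ((e x)^2 / t^2))"
 shows "sets m = sets borel" "finite_measure m" "A : sets borel ==> measure m A = (LBINT x. indicator A x * (e x)^2) / t^2" proof -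
 show sm: "sets m = sets borel" by (simp add: m_def)
 have eA: "emeasure m A = ennreal (LBINT x. indicator A x * ((e x)^2 / t^2))" if [measurable]: "A : sets borel" for A proof -
  have j: "integrable lborel (%x. indicator A x * ((e x)^2 / t^2))"
   by (rule Bochner_Integration.integrable_bound[OF integrable_divide[OF i, of "t^2"]]) (auto simp: indicator_def)
  have "emeasure m A = (NN x. ennreal (indicator A x * ((e x)^2 / t^2)))"
   unfolding m_def by (subst emeasure_density) (auto intro!: nn_integral_cong simp: indicator_def)
  also have "... = ennreal (LBINT x. indicator A x * ((e x)^2 / t^2))" by (rule nn_integral_eq_integral[OF j]) simp
  finally show ?thesis .
 qed
 show "finite_measure m" by (rule finite_measureI) (use eA[of UNIV] in "simp add: sets_eq_imp_space_eq[OF sm]")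
 show "measure m A = (LBINT x. indicator A x * (e x)^2) / t^2" if "A : sets borel"
  unfolding measure_def eA[OF that] by (simp add: lint_nonneg)
qed

text \<open>A given mass confined to a set of small volume has large L2 norm. Expanding the square
  of \<open>tent_spread m s y - t\<close> on \<open>W\<close> is the Cauchy-Schwarz bound with
  \<open>t\<close> left free for optimisation.\<close>

lemma tent_spread_energy_lower:
 fixes s :: "'a::euclidean_space => real" and m :: "'a measure"
 assumes fin: "finite_measure m" and sets[measurable_cong, simp]: "sets m = sets borel"
  and lip: "(1/4)-lipschitz_on UNIV s" and s: "!!x. 0 < s x"
  and m: "ALL y r. s y <= r --> measure m (cball y r) <= c * r ^ DIM('a)" and c: "c >= 0"
  and W[measurable]: "W : sets borel" "AE x in m. cball x (s x) <= W" "emeasure lborel W <= ennreal w" and w: "w >= 0"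
 shows "2 * t * (tent_mass TYPE('a) * measure m UNIV) - t^2 * w <= (LBINT y. (tent_spread m s y)^2)" proof -
 interpret finite_measure m by (rule fin)
 note ts = tent_spread[OF fin sets lip s m c]
 note ts(1)[measurable]
 have pair: "(LINT x|m. tent_mean s (indicator W) x) = (LBINT y. indicator W y * tent_spread m s y)"
  "integrable lborel (%y. indicator W y * tent_spread m s y)" by (rule tent_pairing[OF fin sets lip s m c, where b = 1]; simp)+
 have "(LINT x|m. tent_mean s (indicator W) x) = (LINT x|m. tent_mass TYPE('a))" proof (rule integral_cong_AE)
  have "continuous_on UNIV s" using lip by (rule lipschitz_on_continuous_on)
  hence [measurable]: "s : borel_measurable borel" by (rule borel_measurable_continuous_onI)
  show "(%x. tent_mean s (indicator W) x) : borel_measurable m" by measurable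
  show "AE x in m. tent_mean s (indicator W) x = tent_mass TYPE('a)" using W(2) proof eventually_elim
   case (elim x)
   have "indicator W (x + s x *. z) * tent z = tent z" for z proof (cases "norm z <= 1")
    case True
    hence "dist x (x + s x *. z) <= s x" using s[of x] by (simp add: dist_norm mult_left_le)
    hence "x + s x *. z : W" using elim by auto
    thus ?thesis by simp
   qed (simp add: tent_outside)
   hence eq: "(%z. indicator W (x + s x *. z) * tent z) = tent" by blast
   show ?case unfolding eq tent_mass_def ..
  qed
 qed simp
 also have "... = tent_mass TYPE('a) * measure m UNIV" using sets_eq_imp_space_eq[OF sets] by simp
 finally have mass: "(LBINT y. indicator W y * tent_spread m s y) = tent_mass TYPE('a) * measure m UNIV" using pair(1) by simp
 have Wf: "emeasure lborel W < \<infinity>" using W(3) by (rule le_less_trans) simp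
 have iW: "integrable lborel (indicator W :: 'a => real)" by (rule integrable_real_indicator) (use Wf in auto)
 have mW: "measure lborel W <= w" using W(3) w by (simp add: measure_def enn2real_leI)
 have "2 * t * (tent_mass TYPE('a) * measure m UNIV) - t^2 * w
  <= (LBINT y. 2 * t * (indicator W y * tent_spread m s y) - t^2 * indicator W y)" using pair(2) iW mass mW by (simp add: mult_left_mono)
 also have "... <= (LBINT y. (tent_spread m s y)^2)" proof (rule integral_mono[OF _ ts(7)])
  show "integrable lborel (%y. 2 * t * (indicator W y * tent_spread m s y) - t^2 * indicator W y)" using pair(2) iW by simp
  fix y
  have "0 <= (tent_spread m s y - t)^2" by simp
  thus "2 * t * (indicator W y * tent_spread m s y) - t^2 * indicator W y <= (tent_spread m s y)^2"
   by (cases "y : W") (simp_all add: power2_diff algebra_simps)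
 qed
 finally show ?thesis .
qed

text \<open>Mean energy at most \<open>b^2\<close> over the ball gives a gradient of order
  \<open>b\<close>, by integrating \<open>e <= b / 2 + e^2 / (2 * b)\<close>. The factor 5/8 is half
  of the 5/4 that accounts for the varying radius.\<close>

lemma tent_average_gradient_bound:
 fixes P :: "'a::euclidean_space => 'a"
 assumes e: "continuous_on UNIV e" "!!y. norm (P y) <= e y" and s: "0 < s" and S: "norm S <= 1/4" and b: "0 < b"
  and le: "(LBINT y. indicator (cball x s) y * (e y)^2) <= b^2 * s ^ DIM('a)"
  and int: "integrable lborel (%z. tent z *. (P (x + s *. z) + (P (x + s *. z) <.> z) *. S))"
 shows "norm (LBINT z. tent z *. (P (x + s *. z) + (P (x + s *. z) <.> z) *. S))
  <= (5/8) * tent_max TYPE('a) * b * (unit_ball_vol DIM('a) + 1)" proof -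
 let ?E = "tent_max TYPE('a)"
 have e0: "0 <= e y" for y using e(2)[of y] norm_ge_zero order_trans by blast
 have em: "e : borel_measurable borel" using e(1) by (rule borel_measurable_continuous_onI)
 have ie: "integrable lborel (%z. indicator (cball 0 1) z *. (e (x + s *. z))^2)"
  by (rule borel_integrable_compact) (auto intro!: continuous_intros continuous_on_compose2[OF e(1)])
 have ic: "integrable lborel (%z. indicator (cball (0::'a) 1) z *. (b / 2))" by (rule borel_integrable_compact) auto
 have "norm (LBINT z. tent z *. (P (x + s *. z) + (P (x + s *. z) <.> z) *. S))
  <= (LBINT z. norm (tent z *. (P (x + s *. z) + (P (x + s *. z) <.> z) *. S)))" by (rule integral_norm_bound)
 also have "... <= (LBINT z. (5/4 * ?E) * (indicator (cball 0 1) z *. (b / 2) + (1 / (2 * b)) * (indicator (cball 0 1) z *. (e (x + s *. z))^2)))"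
 proof (rule integral_mono)
  show "integrable lborel (%z. norm (tent z *. (P (x + s *. z) + (P (x + s *. z) <.> z) *. S)))" using int by (rule integrable_norm)
  show "integrable lborel (%z. (5/4 * ?E) * (indicator (cball 0 1) z *. (b / 2) + (1 / (2 * b)) * (indicator (cball 0 1) z *. (e (x + s *. z))^2)))"
   by (intro integrable_mult_right Bochner_Integration.integrable_add ic ie)
  fix z :: 'a
  show "norm (tent z *. (P (x + s *. z) + (P (x + s *. z) <.> z) *. S))
   <= (5/4 * ?E) * (indicator (cball 0 1) z *. (b / 2) + (1 / (2 * b)) * (indicator (cball 0 1) z *. (e (x + s *. z))^2))" proof (cases "norm z <= 1")
   case True
   let ?P = "P (x + s *. z)" and ?e = "e (x + s *. z)"
   have "<|?P <.> z|> <= ?e * 1" using Cauchy_Schwarz_ineq2[of ?P z] mult_mono[OF e(2)[of "x + s *. z"] True e0 norm_ge_zero] by linarith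
   hence "norm ((?P <.> z) *. S) <= (?e * 1) * (1/4)" unfolding norm_scaleR using S e0 by (intro mult_mono) auto
   hence "norm (?P + (?P <.> z) *. S) <= 5/4 * ?e" using norm_triangle_ineq[of ?P "(?P <.> z) *. S"] e(2)[of "x + s *. z"] by simp
   hence "tent z * norm (?P + (?P <.> z) *. S) <= ?E * (5/4 * ?e)" by (intro mult_mono tent_le) (auto simp: e0)
   also have "?E * (5/4 * ?e) = (5/4 * ?E) * ?e" by (simp only: mult_ac)
   also have "(5/4 * ?E) * ?e <= (5/4 * ?E) * (b / 2 + (1 / (2 * b)) * ?e^2)" proof (rule mult_left_mono)
   show "?e <= b / 2 + (1 / (2 * b)) * ?e^2" proof -
    have "0 <= (?e - b)^2 / (2 * b)" using b by simp
    also have "(?e - b)^2 / (2 * b) = b / 2 + (1 / (2 * b)) * ?e^2 - ?e" using b by (simp add: power2_eq_square field_simps)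
    finally show ?thesis by simp
   qed
   qed simp
   finally have "tent z * norm (?P + (?P <.> z) *. S) <= (5/4 * ?E) * (b / 2 + (1 / (2 * b)) * ?e^2)" .
   moreover have "indicator (cball 0 1) z = (1::real)" using True by simp
   ultimately show ?thesis unfolding norm_scaleR by (simp only: abs_of_nonneg[OF tent_nonneg] scaleR_one)
  qed (simp add: tent_outside)
 qed
 also have "... = (5/4 * ?E) * (unit_ball_vol DIM('a) * (b / 2) + (1 / (2 * b)) * (LBINT z. indicator (cball 0 1) z *. (e (x + s *. z))^2))" proof -
  have "(LBINT z. indicator (cball (0::'a) 1) z *. (b / 2)) = unit_ball_vol DIM('a) * (b / 2)"
   by (subst integral_scaleR_left) (auto intro!: integrable_indicator_bounded simp: content_cball)
  thus ?thesis using Bochner_Integration.integral_add[OF ic integrable_mult_right[OF ie, of "1 / (2 * b)"]] by simp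
 qed
 also have "(LBINT z. indicator (cball 0 1) z *. (e (x + s *. z))^2) <= b^2" proof -
  have "(LBINT y. indicator (cball x s) y * (e y)^2)
   = <|s|> ^ DIM('a) *. (LBINT z. indicator (cball x s) (x + s *. z) * (e (x + s *. z))^2)" proof (rule lborel_integral_affine)
   show "s ~= 0" using s by simp
   show "(%y. indicator (cball x s) y * (e y)^2) : borel_measurable borel"
    by (intro borel_measurable_times borel_measurable_indicator borel_measurable_power em) simp
  qed
  also have "(%z. indicator (cball x s) (x + s *. z) * (e (x + s *. z))^2) = (%z. indicator (cball 0 1) z *. (e (x + s *. z))^2)"
   using s by (auto simp: fun_eq_iff indicator_def dist_norm)
  finally have "s ^ DIM('a) * (LBINT z. indicator (cball 0 1) z *. (e (x + s *. z))^2) <= s ^ DIM('a) * b^2" using le s by (simp add: mult.commute)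
  thus ?thesis using s by (simp add: mult_le_cancel_left_pos)
 qed
 finally have "norm (LBINT z. tent z *. (P (x + s *. z) + (P (x + s *. z) <.> z) *. S))
  <= (5/4 * ?E) * (unit_ball_vol DIM('a) * (b / 2) + (1 / (2 * b)) * b^2)" using b by (simp add: mult_left_mono divide_right_mono)
 also have "... = (5/8) * ?E * b * (unit_ball_vol DIM('a) + 1)" using b by (simp add: power2_eq_square field_simps)
 finally show ?thesis .
qed

text \<open>Jensen's inequality for the weight \<open>tent\<close> reduces this to averages of the
  square; pairing with Lebesgue measure moves the variable radius into
  \<open>nn_spread lborel s\<close>, which is bounded.\<close>

lemma tent_average_L2:
 fixes p s :: "'a::euclidean_space => real"
 assumes p: "continuous_on UNIV p" and z: "!!x. R < norm x ==> p x = 0"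
  and lip: "(1/4)-lipschitz_on UNIV s" and s: "!!x. 0 < s x"
 shows "integrable lborel (%x. tent_mean s p x^2)"
  "(LBINT x. tent_mean s p x^2)
   <= tent_mass TYPE('a) * (tent_const TYPE('a) * unit_ball_vol DIM('a)) * (LBINT x. (p x)^2)" proof -
 let ?c = "tent_mass TYPE('a)" and ?E = "tent_const TYPE('a) * unit_ball_vol DIM('a)"
 have c: "?c > 0" by (rule tent_mass_pos)
 have sc: "continuous_on UNIV s" using lip by (rule lipschitz_on_continuous_on)
 have [measurable]: "s : borel_measurable borel" "p : borel_measurable borel" using sc p by (auto intro: borel_measurable_continuous_onI)
 obtain B where B: "B >= 0" "!!x. norm (p x) <= B" by (rule bounded_compact_support[OF p z]) (assumption, rule that)
 have i1: "integrable lborel (%z. p (x + s x *. z) * tent z)" for x by (rule tent_average_integrable[of _ B]) (use B in auto)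
 have "(p x)^2 <= B^2" for x using power_mono[OF B(2)[of x] norm_ge_zero, of 2] by simp
 hence i2: "integrable lborel (%z. (p (x + s x *. z))^2 * tent z)" for x by (intro tent_average_integrable[of "%x. (p x)^2" "B^2"]) auto
 have jensen: "tent_mean s p x^2 <= ?c * (LBINT z. (p (x + s x *. z))^2 * tent z)" for x proof -
  define I where "I = tent_mean s p x"
  define a where "a = I / ?c"
  have "0 <= (LBINT z. (p (x + s x *. z) - a)^2 * tent z)" by (rule lint_nonneg) (simp add: tent_nonneg)
  also have "(%z. (p (x + s x *. z) - a)^2 * tent z)
   = (%z. ((p (x + s x *. z))^2 * tent z - (2 * a) * (p (x + s x *. z) * tent z)) + a^2 * tent z)"
   by (auto simp: fun_eq_iff power2_diff algebra_simps)
  also have "(LBINT z. ((p (x + s x *. z))^2 * tent z - (2 * a) * (p (x + s x *. z) * tent z)) + a^2 * tent z)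
   = ((LBINT z. (p (x + s x *. z))^2 * tent z) - (2 * a) * I) + a^2 * ?c"
   using i1[of x] i2[of x] integrable_tent[where 'a='a] by (simp add: I_def tent_mass_def)
  also have "... = (LBINT z. (p (x + s x *. z))^2 * tent z) - I^2 / ?c" using c by (simp add: a_def power2_eq_square field_simps)
  finally show ?thesis using c by (simp add: I_def field_simps)
 qed
 have ip: "integrable lborel (%x. (p x)^2)" by (rule lborel_integrable_compact_support[of _ R]) (use z in "auto intro!: continuous_intros p")
 have "(NN x. nn_mean s p x)
  = (NN y. ennreal ((p y)^2) * nn_spread lborel s y)"
  by (rule nn_integral_tent_pairing[OF _ _ sc s]) (auto intro: lborel.sigma_finite_measure_axioms)
 also have "... <= (NN y. ennreal ((p y)^2) * ennreal ?E)" proof (intro nn_integral_mono mult_left_mono)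
  fix y :: 'a
  show "nn_spread lborel s y <= ennreal ?E" proof (rule tent_variable_bound[OF _ lip s])
   show "emeasure lborel (cball y r) <= ennreal (unit_ball_vol (real DIM('a)) * r ^ DIM('a))" if "s y <= r" for r
    using s[of y] that by (subst emeasure_cball) auto
  qed auto
 qed auto
 also have "... = (NN y. ennreal ((p y)^2)) * ennreal ?E" by (rule nn_integral_multc) measurable
 also have "(NN y. ennreal ((p y)^2)) = ennreal (LBINT x. (p x)^2)" by (rule nn_integral_eq_integral[OF ip]) simp
 finally have inner: "(NN x. nn_mean s p x)
  <= ennreal (LBINT x. (p x)^2) * ennreal ?E" .
 have "(NN x. ennreal (tent_mean s p x^2))
  <= (NN x. ennreal ?c * nn_mean s p x)"
 proof (rule nn_integral_mono)
  fix x
  have "nn_mean s p x = (NN z. ennreal ((p (x + s x *. z))^2 * tent z))"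
   by (simp add: ennreal_mult tent_nonneg)
  also have "... = ennreal (LBINT z. (p (x + s x *. z))^2 * tent z)" by (rule nn_integral_eq_integral[OF i2]) (simp add: tent_nonneg)
  finally have "ennreal ?c * nn_mean s p x
   = ennreal (?c * (LBINT z. (p (x + s x *. z))^2 * tent z))" using c by (simp add: ennreal_mult')
  thus "ennreal (tent_mean s p x^2)
   <= ennreal ?c * nn_mean s p x"
   using jensen[of x] by (simp add: ennreal_leI)
 qed
 also have "... = ennreal ?c * (NN x. nn_mean s p x)"
  by (rule nn_integral_cmult) measurable
 also have "... <= ennreal ?c * (ennreal (LBINT x. (p x)^2) * ennreal ?E)" by (intro mult_left_mono inner) simp
 also have "... = ennreal (?c * ?E * (LBINT x. (p x)^2))" proof -
  have "?E >= 0" by simp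
  moreover have "(LBINT x. (p x)^2) >= 0" by (rule lint_nonneg) simp
  moreover have "ennreal a * (ennreal b * ennreal d) = ennreal (a * d * b)" if "0 <= a" "0 <= b" "0 <= d" for a b d
   using that by (simp add: ennreal_mult mult_ac)
  ultimately show ?thesis using c by (metis less_imp_le)
 qed
 finally have main: "(NN x. ennreal (tent_mean s p x^2)) <= ennreal (?c * ?E * (LBINT x. (p x)^2))" .
 show int: "integrable lborel (%x. tent_mean s p x^2)" proof (rule integrableI_nonneg)
  show "(NN x. ennreal (tent_mean s p x^2)) < \<infinity>" by (rule le_less_trans[OF main]) simp
 qed auto
 have "(LBINT x. (p x)^2) >= 0" by (rule lint_nonneg) simp
 thus "(LBINT x. tent_mean s p x^2) <= ?c * ?E * (LBINT x. (p x)^2)"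
  using main c by (subst (asm) nn_integral_eq_integral[OF int]) auto
qed

abbreviation vitali_const :: "'a::euclidean_space itself => real" where
 "vitali_const T \<equiv> unit_ball_vol DIM('a) * 85 ^ DIM('a)"

text \<open>The optimum over \<open>t\<close> in \<open>tent_spread_energy_lower\<close>, per unit
  of mass and of density, when the volume of \<open>W\<close> is at most
  \<open>2 * vitali_const\<close> times the mass over the density.\<close>

definition energy_const :: "'a::euclidean_space itself => real" where
 "energy_const T = (tent_mass T)^2 / (2 * vitali_const T)"

text \<open>Chosen so that the points affected by the second stopping rule account for at most 1/64
  of the energy.\<close>

definition cut_level :: "'a::euclidean_space itself => real" where
 "cut_level T = sqrt (128 * tent_const T * tent_mass T * 85 ^ DIM('a))"

text \<open>The bound of \<open>tent_average_gradient_bound\<close> at level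
  \<open>lam * cut_level\<close>, after division by the normalising factor
  \<open>lam * tent_mass\<close>; the density \<open>lam\<close> cancels.\<close>

definition field_bound :: "'a::euclidean_space itself => real" where
 "field_bound T = (5/8) * tent_max T * cut_level T * (unit_ball_vol DIM('a) + 1) / tent_mass T"

lemma constants_pos:
 "0 < energy_const TYPE('a::euclidean_space)" "0 < cut_level TYPE('a)" "0 < field_bound TYPE('a)"
 "0 < tent_max TYPE('a)" "0 < vitali_const TYPE('a)" proof -
 have v: "0 < unit_ball_vol (real DIM('a))" by simp
 show m: "0 < tent_max TYPE('a)" using DIM_positive[where 'a='a] by (intro mult_pos_pos) auto
 show w: "0 < vitali_const TYPE('a)" using v by simp
 show "0 < energy_const TYPE('a)" unfolding energy_const_def using tent_mass_pos[where 'a='a] w by simp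
 show c: "0 < cut_level TYPE('a)" unfolding cut_level_def using tent_mass_pos[where 'a='a] m by simp
 show "0 < field_bound TYPE('a)" unfolding field_bound_def using tent_mass_pos[where 'a='a] m c v
  by (intro divide_pos_pos mult_pos_pos add_pos_pos) auto
qed

lemma tent_spread_density:
 fixes nu :: "'a::euclidean_space measure" and s :: "'a => real"
 assumes "finite_measure nu" and "sets nu = sets borel" and "A : sets borel" and s: "continuous_on UNIV s"
 shows "tent_spread (density nu (indicator A)) s y = (LINT x|nu. indicator A x * tent_scaled (s x) (y - x))" proof -
 have [measurable]: "s : borel_measurable borel" using s by (rule borel_measurable_continuous_onI)
 show ?thesis unfolding tent_spread_def by (rule finite_density_indicator(4)[OF assms(1-3)]) measurable
qed

text \<open>At density level \<open>lam\<close> the spread \<open>u\<close> of the measure has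
  energy \<open>U\<close> of order \<open>lam * M\<close>. The potential field \<open>p\<close> has
  divergence \<open>u - u1\<close> and total energy at most \<open>2 * U\<close>. Averaging
  \<open>p\<close> at radius \<open>s2\<close> bounds its gradient, and by adjointness its
  divergence integrates against the measure to the pairing of \<open>u\<close> with a second spread
  \<open>v\<close>, up to smaller terms. Dividing by \<open>lam * c\<close> makes the bounds
  independent of \<open>lam\<close>, while the L2 norm of the result decays.\<close>

lemma singular_test_field_scale:
 fixes nu :: "'a::euclidean_space measure"
 defines "M \<equiv> measure nu UNIV" and "n \<equiv> DIM('a)" and "c \<equiv> tent_mass TYPE('a)" and "E \<equiv> tent_const TYPE('a)"
 assumes fin: "finite_measure nu" and sets[measurable_cong, simp]: "sets nu = sets borel"
  and R: "AE x in nu. norm x <= R" "0 <= R" and M: "0 < M" and lam_pos: "0 < lam"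
  and lam1: "M < lam * (1/2) ^ n" and lam2: "16 * (E * c * M) <= lam * energy_const TYPE('a)"
  and pos: "AE x in nu. 0 < sup_conv (1/4) (stop_radius (scale_measure (ennreal (1 / lam)) nu)) x"
 shows "EX phi Phi. (ALL i:Basis. C1_grad (phi i) (Phi i) & (ALL x. norm (Phi i x) <= field_bound TYPE('a)) &
   integrable lborel (%x. (phi i x)^2) &
   (LBINT x. (phi i x)^2) <= 8 * E^2 * unit_ball_vol n * (R + 1)^2 * M / lam) &
  energy_const TYPE('a) / (10 * c) * M <= (LINT x|nu. (SUM i:Basis. Phi i x <.> i))" proof -
 interpret finite_measure nu by (rule fin)
 define ec where "ec = energy_const TYPE('a)"
 define t where "t = cut_level TYPE('a)"
 define D where "D = field_bound TYPE('a)"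
 have cpos: "0 < c" unfolding c_def by (rule tent_mass_pos)
 have Epos: "0 < E" unfolding E_def using constants_pos(4)[where 'a='a] by simp
 have ecpos: "0 < ec" "0 < t" "0 < D" unfolding ec_def t_def D_def by (rule constants_pos)+
 have npos: "0 < real n" unfolding n_def by simp
 have sp: "space nu = UNIV" using sets_eq_imp_space_eq[of nu borel] by simp
 \<comment> \<open>Mass in units of \<open>lam\<close>, so that the stopping radius marks the scale
   at which \<open>nu\<close> has density about \<open>lam\<close>.\<close>
 define m1 where "m1 = scale_measure (ennreal (1 / lam)) nu"
 have m1: "finite_measure m1" "sets m1 = sets borel" "!!A. measure m1 A = measure nu A / lam" proof -
  show "finite_measure m1" unfolding m1_def by (rule finite_measureI) (simp add: emeasure_eq_measure ennreal_mult_eq_top_iff)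
  show "sets m1 = sets borel" by (simp add: m1_def)
  show "measure m1 A = measure nu A / lam" for A using lam_pos by (simp add: m1_def measure_def enn2real_mult)
 qed
 have half: "(0::real) < 1/2" by simp
 have m1small: "measure m1 UNIV < (1/2) ^ DIM('a)" using lam1 lam_pos by (simp add: m1(3) M_def[symmetric] n_def divide_less_eq mult.commute)
 define S1 where "S1 = stop_radius m1"
 note sr1 = stop_radius[OF m1(1,2) half m1small, folded S1_def]
 define T1 where "T1 = sup_conv (1/4) S1"
 have T1lip: "(1/4)-lipschitz_on UNIV T1" unfolding T1_def using sup_conv(4)[of "1/4" S1 "1/2"] sr1(2) by simp
 have T1c: "continuous_on UNIV T1" using T1lip by (rule lipschitz_on_continuous_on)
 have [measurable]: "T1 : borel_measurable borel" using T1c by (rule borel_measurable_continuous_onI)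
 have ball1: "measure nu (cball y r) <= lam * r ^ n" if "S1 y <= r" for y r proof -
  have "0 <= r" using sr1(1)[of y] that by linarith
  hence "measure m1 (cball y r) <= r ^ DIM('a)" using sr1(3)[OF that] by simp
  thus ?thesis using lam_pos by (simp add: m1(3) n_def divide_le_eq mult.commute)
 qed
 \<comment> \<open>On the discarded set \<open>- K0\<close> the divergence is only known to be at
   most \<open>n * D\<close> in size; this fraction limits the loss to half of the gain
   \<open>ec / (5 * c) * M\<close>. The alternative 1/2 ensures \<open>M <= 2 * M0\<close>.\<close>
 define dl where "dl = min (1/2) (ec / (10 * c * real n * D))"
 have dl: "0 < dl" "dl <= 1/2" "dl <= ec / (10 * c * real n * D)" using ecpos cpos npos by (auto simp: dl_def)
 obtain tau where tau: "0 < tau" "tau <= 1" "measure nu {x. T1 x < tau / 2} < dl * M" proof -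
  define A where "A k = {x. T1 x < 1 / (2 * real (Suc k))}" for k
  have Am: "A k : sets nu" for k unfolding A_def by measurable
  have "(%k. measure nu (A k)) ----> measure nu (INT k. A k)" proof (rule finite_Lim_measure_decseq)
   show "decseq A" unfolding A_def decseq_def proof safe
    fix i j :: nat and x assume "i <= j" "T1 x < 1 / (2 * real (Suc j))"
    moreover have "1 / (2 * real (Suc j)) <= 1 / (2 * real (Suc i))" using \<open>i <= j\<close> by (intro divide_left_mono) auto
    ultimately show "T1 x < 1 / (2 * real (Suc i))" by linarith
   qed
  qed (use Am in auto)
  moreover have "measure nu (INT k. A k) = 0" proof -
   have "AE x in nu. x \<notin> (INT k. A k)" using pos proof eventually_elim
    case (elim x)
    hence "0 < T1 x" by (simp add: T1_def S1_def m1_def)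
    then obtain k where "inverse (real (Suc k)) < T1 x" using reals_Archimedean by blast
    moreover have "1 / (2 * real (Suc k)) <= inverse (real (Suc k))" by (simp add: divide_simps)
    ultimately have "x \<notin> A k" by (simp add: A_def)
    thus ?case by blast
   qed
   hence "emeasure nu {x : space nu. x : (INT k. A k)} = 0" by (rule emeasure_eq_0_AE)
   moreover have "{x : space nu. x : (INT k. A k)} = (INT k. A k)" using sp by auto
   ultimately have "emeasure nu (INT k. A k) = 0" by simp
   thus ?thesis by (simp add: measure_def)
  qed
  ultimately have "(%k. measure nu (A k)) ----> 0" by simp
  hence "\<forall>\<^sub>F k in sequentially. measure nu (A k) < dl * M" using dl(1) M by (intro order_tendstoD) auto
  then obtain k where k: "measure nu (A k) < dl * M" by (auto simp: eventually_sequentially)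
  show ?thesis by (rule that[of "1 / real (Suc k)"]) (use k in "simp_all add: A_def mult.commute")
 qed
 define K0 where "K0 = {x. tau / 2 <= T1 x}"
 have K0m[measurable]: "K0 : sets borel" unfolding K0_def by measurable
 have K0c: "measure nu (- K0) < dl * M" proof -
  have "- K0 = {x. T1 x < tau / 2}" by (auto simp: K0_def)
  thus ?thesis using tau(3) by simp
 qed
 define nu0 where "nu0 = density nu (indicator K0)"
 note d0 = finite_density_indicator[OF fin sets K0m, folded nu0_def]
 define M0 where "M0 = measure nu0 UNIV"
 have M0: "M <= 2 * M0" "M0 <= M" proof -
  have "measure nu UNIV = measure nu K0 + measure nu (- K0)" using finite_measure_Union[of K0 "- K0"] by simp
  moreover have "M0 = measure nu K0" by (simp add: M0_def d0(3))
  moreover have "dl * M <= 1/2 * M" using dl(2) M by (intro mult_right_mono) auto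
  ultimately show "M <= 2 * M0" "M0 <= M" using K0c measure_nonneg[of nu "- K0"] unfolding M_def by linarith+
 qed
 have M0pos: "0 < M0" using M0 M by linarith
 define s1 where "s1 = smooth_radius tau S1"
 note sm1 = smooth_radius[where S = S1, OF tau(1) sr1(1,2), folded s1_def T1_def]
 have s1pos: "0 < s1 x" "tau / 4 <= s1 x" "s1 x <= 1" for x proof -
  show "tau / 4 <= s1 x" by (rule sm1(6))
  thus "0 < s1 x" using tau(1) by linarith
  have "T1 x <= 1/2" unfolding T1_def using sup_conv(3)[of "1/4" S1 "1/2" x] sr1(2) by simp
  thus "s1 x <= 1" using sm1(4)[of x] tau(2) by linarith
 qed
 have s1c: "continuous_on UNIV s1" using sm1(2) by (rule lipschitz_on_continuous_on)
 have sub: "measure (density nu (indicator A)) (cball y r) <= measure nu (cball y r)" if "A : sets borel" for A y r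
  using finite_density_indicator(3)[OF fin sets that] by (simp add: finite_measure_mono)
 have ballA: "measure (density nu (indicator A)) (cball y r) <= lam * r ^ DIM('a)" if "A : sets borel" "S1 y <= r" for A y r
  using sub[OF that(1), of y r] ball1[OF that(2)] unfolding n_def by linarith
 have lam_nonneg: "0 <= lam" using lam_pos by simp
 define u where "u = tent_spread nu0 s1"
 have b1: "ALL y r. s1 y <= r --> measure nu0 (cball y r) <= lam * r ^ DIM('a)" unfolding nu0_def using order_trans[OF sm1(5)] by (auto intro!: ballA)
 note ts1 = tent_spread[where s = s1, OF d0(1,2) sm1(2) s1pos(1) b1 lam_nonneg, folded u_def M0_def c_def E_def]
 \<comment> \<open>This spread comes from the compensating field at unit scale. Its energy bound
   \<open>C0\<close> does not grow with \<open>lam\<close>, whereas \<open>U\<close> does.\<close>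
 define u1 where "u1 = tent_spread nu0 (%_. 1)"
 have b2: "ALL y r. 1 <= r --> measure nu0 (cball y r) <= M0 * r ^ DIM('a)" proof (intro allI impI)
  fix y r assume r: "1 <= (r::real)"
  interpret nu0: finite_measure nu0 by (rule d0(1))
  have "measure nu0 (cball y r) <= M0 * 1" using nu0.finite_measure_mono[of "cball y r" UNIV] d0(2) by (simp add: M0_def)
  also have "... <= M0 * r ^ DIM('a)" using r M0pos by (intro mult_left_mono) auto
  finally show "measure nu0 (cball y r) <= M0 * r ^ DIM('a)" .
 qed
 have lip1: "(1/4)-lipschitz_on UNIV (%_::'a. 1::real)" by (rule lipschitz_onI) auto
 note tsu = tent_spread[where s = "%_. 1", OF d0(1,2) lip1 zero_less_one b2 less_imp_le[OF M0pos], folded u1_def M0_def c_def E_def]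
 define U where "U = (LBINT y. (u y)^2)"
 define C0 where "C0 = E * c * M0^2"
 have U1: "(LBINT y. (u1 y)^2) <= C0" using tsu(8) by (simp add: C0_def power2_eq_square mult_ac)
 have Uupper: "U <= E * lam * (c * M0)" unfolding U_def by (rule ts1(8))
 obtain W where W: "W : sets borel" "emeasure lborel W <= ennreal (vitali_const TYPE('a) * measure m1 UNIV)"
  "!!x. tau / 2 <= T1 x ==> cball x (s1 x) <= W"
  using smooth_radius_cover[OF m1(1,2) half m1small tau(1), folded S1_def, folded s1_def T1_def] by metis
 have Ulower: "ec * lam * M0 <= U" proof -
  define w where "w = vitali_const TYPE('a) * M / lam"
  \<comment> \<open>The maximiser of the quadratic lower bound once \<open>w\<close> has been
    replaced by its bound in terms of \<open>2 * M0\<close>.\<close>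
  define th where "th = lam * c / (2 * vitali_const TYPE('a))"
  have V: "0 < vitali_const TYPE('a)" by (rule constants_pos)
  have "2 * th * (c * M0) - th^2 * w <= U" unfolding U_def u_def c_def M0_def
  proof (rule tent_spread_energy_lower[OF d0(1,2) sm1(2) s1pos(1) b1 lam_nonneg W(1)])
   show "AE x in nu0. cball x (s1 x) <= W" unfolding nu0_def by (subst AE_density) (use W(3) in "auto simp: K0_def indicator_def")
   show "emeasure lborel W <= ennreal w" using W(2) by (simp add: w_def m1(3) M_def)
   show "0 <= w" using V lam_pos M by (simp add: w_def)
  qed
  moreover have "th^2 * w <= th^2 * (vitali_const TYPE('a) * (2 * M0) / lam)"
   unfolding w_def using V lam_pos M0 by (intro mult_left_mono divide_right_mono) auto
  moreover have "2 * th * (c * M0) - th^2 * (vitali_const TYPE('a) * (2 * M0) / lam) = ec * lam * M0" proof -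
   have "2 * (lam * c / (2 * V)) * (c * M0) - (lam * c / (2 * V))^2 * (V * (2 * M0) / lam) = c^2 / (2 * V) * lam * M0" if "0 < V" for V
    using that lam_pos by (simp add: power2_eq_square field_simps)
   from this[OF V] show ?thesis unfolding th_def ec_def energy_const_def c_def .
  qed
  ultimately show ?thesis by linarith
 qed
 have C0U: "16 * C0 <= U" proof -
  have "16 * C0 = (16 * (E * c * M0)) * M0" by (simp add: C0_def power2_eq_square)
  also have "... <= (16 * (E * c * M)) * M0" using M0 Epos cpos M0pos by (intro mult_right_mono mult_left_mono) auto
  also have "... <= (lam * ec) * M0" using lam2 M0pos unfolding ec_def by (intro mult_right_mono) auto
  finally show ?thesis using Ulower by (simp add: mult_ac)
 qed
 have Upos: "0 < U" using Ulower mult_pos_pos[OF mult_pos_pos[OF ecpos(1) lam_pos] M0pos] by linarith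
 have R0: "AE x in nu0. norm x <= R" unfolding nu0_def by (subst AE_density) (use R(1) in "auto elim: eventually_mono")
 have tau4: "0 < tau / 4" using tau(1) by simp
 obtain p P where p: "!!i. i : Basis ==> C1_grad (p i) (P i)"
  and pz: "!!i x. i : Basis ==> R + 1 < norm x ==> p i x = 0"
  and Psym: "!!i j x. i : Basis ==> j : Basis ==> P i x <.> j = P j x <.> i"
  and Pdiv0: "!!x. (SUM i:Basis. P i x <.> i) = (LINT y|nu0. tent_scaled (s1 y) (x - y)) - (LINT y|nu0. tent_scaled 1 (x - y))"
  by (rule regularised_potential[where s = s1, OF d0(1,2) R0 s1c tau4 s1pos(2,3)]) (rule that)
 have Pdiv: "(SUM i:Basis. P i x <.> i) = u x - u1 x" for x unfolding Pdiv0 by (simp add: u_def u1_def tent_spread_def)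
 have Pz: "P i x = 0" if "i : Basis" "R + 1 < norm x" for i x by (rule C1_grad_outside[OF p[OF that(1)] pz[OF that(1)] that(2)])
 define e where "e y = L2_set (%i. norm (P i y)) Basis" for y
 have e2: "(e y)^2 = (SUM i:Basis. (norm (P i y))^2)" for y unfolding e_def L2_set_def by (simp add: sum_nonneg)
 have e0: "0 <= e y" for y unfolding e_def by (rule L2_set_nonneg)
 have eP: "norm (P i y) <= e y" if "i : Basis" for i y unfolding e_def by (rule member_le_L2_set) (use that in auto)
 have ec': "continuous_on UNIV e" unfolding e_def L2_set_def by (intro continuous_intros C1_gradD(2)[OF p])
 have ez: "e y = 0" if "R + 1 < norm y" for y unfolding e_def L2_set_def using Pz[OF _ that] by simp
 have em[measurable]: "e : borel_measurable borel" using ec' by (rule borel_measurable_continuous_onI)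
 obtain B where B: "0 <= B" "!!y. norm (e y) <= B" by (rule bounded_compact_support[OF ec' ez]) (assumption, rule that)
 have ei: "integrable lborel (%y. (e y)^2)" by (rule lborel_integrable_compact_support[of _ "R + 1"]) (use ez in "auto intro!: continuous_intros ec'")
 define F where "F = (LBINT y. (e y)^2)"
 have F: "F <= U + C0" proof -
  have "F = (LBINT y. (u y - u1 y)^2)" unfolding F_def e2 using C1_curl_free_energy[OF p pz Psym] by (simp add: Pdiv)
  also have "... <= (LBINT y. (u y)^2 + (u1 y)^2)" proof (rule integral_mono)
   show le: "(u y - u1 y)^2 <= (u y)^2 + (u1 y)^2" for y
    using mult_nonneg_nonneg[OF ts1(2)[of y] tsu(2)[of y]] by (simp add: power2_diff mult.commute)
   show "integrable lborel (%y. (u y)^2 + (u1 y)^2)" by (intro Bochner_Integration.integrable_add ts1(7) tsu(7))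
   thus "integrable lborel (%y. (u y - u1 y)^2)" by (rule Bochner_Integration.integrable_bound) (use le ts1(1) tsu(1) in auto)
  qed
  also have "... = U + (LBINT y. (u1 y)^2)" unfolding U_def using ts1(7) tsu(7) by simp
  finally show ?thesis using U1 by simp
 qed
 have F2: "F <= 2 * U" using F C0U Upos by linarith
 have F0: "0 <= F" unfolding F_def by (rule lint_nonneg) simp
 \<comment> \<open>Second stopping rule: the energy of the potential field in units of
   \<open>(lam * t)^2\<close>. At radii at least \<open>stop_radius mP\<close> the mean energy is at
   most this unit, as the gradient bound requires.\<close>
 define mP where "mP = density lborel (%y. ennreal ((e y)^2 / (lam * t)^2))"
 have lt: "0 < lam * t" using lam_pos ecpos by simp
 note mPs = energy_density(1)[OF em ei, of "lam * t", folded mP_def] and mPf = energy_density(2)[OF em ei, of "lam * t", folded mP_def]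
  and mPA = energy_density(3)[OF em ei, where t = "lam * t", folded mP_def]
 have mPU: "measure mP UNIV = F / (lam * t)^2" using mPA[of UNIV] by (simp add: F_def)
 have t2: "t^2 = 128 * E * c * 85 ^ n"
  unfolding t_def cut_level_def E_def c_def n_def using constants_pos(4)[where 'a='a] tent_mass_pos[where 'a='a] by simp
 have mPle: "measure mP UNIV <= 2 * U / (lam * t)^2" unfolding mPU using F2 by (intro divide_right_mono) auto
 have mPsmall: "measure mP UNIV < (1/2) ^ DIM('a)" proof -
  have "2 * U / (lam * t)^2 <= 2 * (E * lam * (c * M0)) / (lam * t)^2" using Uupper by (intro divide_right_mono) auto
  also have "... = M0 / (64 * 85 ^ n * lam)" using Epos cpos lam_pos unfolding power_mult_distrib t2 by (simp add: power2_eq_square field_simps)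
  also have "... <= M0 / (1 * lam)" proof (intro divide_left_mono mult_right_mono)
   have "(1::real) <= 85 ^ n" by simp
   thus "(1::real) <= 64 * 85 ^ n" by linarith
  qed (use lam_pos M0pos in auto)
  also have "... < (1/2) ^ n" using lam1 M0(2) lam_pos by (simp add: divide_less_eq mult.commute)
  finally show ?thesis using mPle by (simp add: n_def)
 qed
 define SP where "SP = stop_radius mP"
 note srP = stop_radius[OF mPf mPs half mPsmall, folded SP_def]
 define S2 where "S2 x = max (S1 x) (SP x)" for x
 have S2: "0 <= S2 x" "S2 x <= 1/2" "S1 x <= S2 x" "SP x <= S2 x" for x using sr1(1,2)[of x] srP(1,2)[of x] by (auto simp: S2_def)
 define s2 where "s2 = smooth_radius tau S2"
 note sm2 = smooth_radius[where S = S2, OF tau(1) S2(1,2), folded s2_def]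
 have s2pos: "0 < s2 x" for x using sm2(6)[of x] tau(1) by linarith
 have s2c: "continuous_on UNIV s2" using sm2(2) by (rule lipschitz_on_continuous_on)
 have [measurable]: "s1 : borel_measurable borel" "s2 : borel_measurable borel" using s1c s2c by (auto intro: borel_measurable_continuous_onI)
 obtain G2 where G2: "C1_grad s2 G2" "!!x. norm (G2 x) <= 1/4" using sm2(1) by blast
 \<comment> \<open>The points of \<open>K0\<close> whose radius is changed by the second
   rule.\<close>
 define Bad where "Bad = {x : K0. s2 x ~= s1 x}"
 have Badm[measurable]: "Bad : sets borel" unfolding Bad_def by measurable
 have Bad: "measure nu Bad <= lam * 85 ^ n * measure mP UNIV" unfolding n_def
 proof (rule smooth_radius_change[where S = S1, OF mPf mPs half mPsmall tau(1) fin sets sr1(1,2) _ lam_nonneg])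
  show "measure nu (cball y r) <= lam * r ^ DIM('a)" if "S1 y <= r" for y r using ball1[OF that] by (simp add: n_def)
  show "tau / 2 <= sup_conv (1 / 4) S1 x" if "x : Bad" for x using that by (simp add: Bad_def K0_def T1_def)
  show "smooth_radius tau (%x. max (S1 x) (stop_radius mP x)) x ~= smooth_radius tau S1 x" if "x : Bad" for x
   using that by (simp add: Bad_def s1_def s2_def S2_def[abs_def] SP_def)
 qed
 have BadU: "E * lam * (c * measure nu Bad) <= U / 64" proof -
  have "E * lam * (c * measure nu Bad) <= E * lam * (c * (lam * 85 ^ n * (2 * U / (lam * t)^2)))"
   using Bad mPle Epos lam_pos cpos by (intro mult_left_mono order_trans[OF Bad]) auto
  also have "... = U / 64" using Epos cpos lam_pos unfolding power_mult_distrib t2 by (simp add: power2_eq_square field_simps)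
  finally show ?thesis .
 qed
 define v where "v = tent_spread nu0 s2"
 have S12: "S1 y <= s2 y" for y using order_trans[OF S2(3) sm2(5)] .
 have b3: "ALL y r. s2 y <= r --> measure nu0 (cball y r) <= lam * r ^ DIM('a)" unfolding nu0_def using order_trans[OF S12] by (auto intro!: ballA)
 note ts2 = tent_spread[where s = s2, OF d0(1,2) sm2(2) s2pos b3 lam_nonneg, folded v_def]
 define Good where "Good = K0 - Bad"
 have Goodm[measurable]: "Good : sets borel" unfolding Good_def by measurable
 \<comment> \<open>On the good part both radii agree, so \<open>u\<close> and \<open>v\<close> share
   the contribution \<open>ug\<close>; they differ only by \<open>ub\<close> and \<open>vb\<close>,
   which are small in L2.\<close>
 define ub where "ub = tent_spread (density nu (indicator Bad)) s1"
 define vb where "vb = tent_spread (density nu (indicator Bad)) s2"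
 define ug where "ug = tent_spread (density nu (indicator Good)) s1"
 note dB = finite_density_indicator[OF fin sets Badm]
 have bB1: "ALL y r. s1 y <= r --> measure (density nu (indicator Bad)) (cball y r) <= lam * r ^ DIM('a)"
  using order_trans[OF sm1(5)] by (auto intro!: ballA)
 have bB2: "ALL y r. s2 y <= r --> measure (density nu (indicator Bad)) (cball y r) <= lam * r ^ DIM('a)"
  using order_trans[OF S12] by (auto intro!: ballA)
 note tsub = tent_spread[where s = s1, OF dB(1,2) sm1(2) s1pos(1) bB1 lam_nonneg, folded ub_def c_def E_def]
 note tsvb = tent_spread[where s = s2, OF dB(1,2) sm2(2) s2pos bB2 lam_nonneg, folded vb_def c_def E_def]
 have ub2: "(LBINT y. (ub y)^2) <= U / 64" and vb2: "(LBINT y. (vb y)^2) <= U / 64" using tsub(8) tsvb(8) BadU by (simp_all add: dB(3))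
 have split: "tent_spread nu0 s y = tent_spread (density nu (indicator Good)) s y + tent_spread (density nu (indicator Bad)) s y"
  if s: "continuous_on UNIV s" "!!x. tau / 4 <= s x" for s y proof -
  have sm: "s : borel_measurable borel" using s(1) by (rule borel_measurable_continuous_onI)
  have bd: "<|indicator A x * tent_scaled (s x) (y - x)|> <= tent_max TYPE('a) / (tau / 4) ^ DIM('a)" for A x proof -
   have sx: "0 < s x" using s(2)[of x] tau(1) by linarith
   have "<|indicator A x * tent_scaled (s x) (y - x)|> <= tent_scaled (s x) (y - x)" using tent_scaled_nonneg[OF sx] by (simp add: indicator_def)
   also have "... <= tent_max TYPE('a) / s x ^ DIM('a)" by (rule tent_scaled_le[OF sx])
   also have "... <= tent_max TYPE('a) / (tau / 4) ^ DIM('a)" using s(2)[of x] tau(1) sx by (intro divide_left_mono power_mono mult_pos_pos) auto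
   finally show ?thesis .
  qed
  have i: "integrable nu (%x. indicator A x * tent_scaled (s x) (y - x))" if [measurable]: "A : sets borel" for A
  proof (rule integrable_const_bound[of _ "tent_max TYPE('a) / (tau / 4) ^ DIM('a)"])
   show "(%x. indicator A x * tent_scaled (s x) (y - x)) : borel_measurable nu" using sm by measurable
  qed (use bd in simp)
  have "tent_spread nu0 s y = (LINT x|nu. indicator K0 x * tent_scaled (s x) (y - x))"
   unfolding nu0_def by (rule tent_spread_density[OF fin sets K0m s(1)])
  also have "... = (LINT x|nu. indicator Good x * tent_scaled (s x) (y - x) + indicator Bad x * tent_scaled (s x) (y - x))"
   by (intro lint_cong) (auto simp: Good_def Bad_def indicator_def)
  also have "... = tent_spread (density nu (indicator Good)) s y + tent_spread (density nu (indicator Bad)) s y"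
   using Bochner_Integration.integral_add[OF i[OF Goodm] i[OF Badm]] by (simp add: tent_spread_density[OF fin sets _ s(1)])
  finally show ?thesis .
 qed
 have u_split: "u y = ug y + ub y" for y unfolding u_def ug_def ub_def by (rule split[OF s1c s1pos(2)])
 have v_split: "v y = ug y + vb y" for y proof -
  have "v y = tent_spread (density nu (indicator Good)) s2 y + vb y" unfolding v_def vb_def by (rule split[OF s2c sm2(6)])
  also have "tent_spread (density nu (indicator Good)) s2 y = ug y"
   unfolding ug_def tent_spread_density[OF fin sets Goodm s2c] tent_spread_density[OF fin sets Goodm s1c]
   by (intro lint_cong) (auto simp: Good_def Bad_def indicator_def)
  finally show ?thesis .
 qed
 have ug0: "0 <= ug y" for y unfolding ug_def tent_spread_def by (rule lint_nonneg) (rule tent_scaled_nonneg[OF s1pos(1)])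
 note pu = tent_pairing[where s = s2, OF d0(1,2) sm2(2) s2pos b3 lam_nonneg, folded v_def]
 have iuv: "integrable lborel (%y. u y * v y)"
  and puv: "integrable nu0 (%x. tent_mean s2 u x)"
   "(LINT x|nu0. tent_mean s2 u x) = (LBINT y. u y * v y)" using pu[OF ts1(1,2,4)] by auto
 have iu1v: "integrable lborel (%y. u1 y * v y)"
  and pu1v: "integrable nu0 (%x. tent_mean s2 u1 x)"
   "(LINT x|nu0. tent_mean s2 u1 x) = (LBINT y. u1 y * v y)" using pu[OF tsu(1,2,4)] by auto
 have eB: "e y <= B" for y using B(2)[of y] by simp
 have iev: "integrable lborel (%y. e y * v y)"
  and pev: "integrable nu0 (%x. tent_mean s2 e x)"
   "(LINT x|nu0. tent_mean s2 e x) = (LBINT y. e y * v y)" using pu[OF em e0 eB] by auto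
 \<comment> \<open>The loss \<open>u * ub\<close> is absorbed as \<open>u^2 / 16 + 4 * ub^2\<close>;
   integrated, this is at most \<open>U / 16 + U / 16\<close>.\<close>
 have gain1: "7/8 * U <= (LBINT y. u y * v y)" proof -
  have "7/8 * U <= 15/16 * U - 4 * (LBINT y. (ub y)^2)" using ub2 by linarith
  also have "... = (LBINT y. 15/16 * (u y)^2 - 4 * (ub y)^2)" unfolding U_def using ts1(7) tsub(7) by simp
  also have "... <= (LBINT y. u y * v y)" proof (rule integral_mono[OF _ iuv])
   show "integrable lborel (%y. 15/16 * (u y)^2 - 4 * (ub y)^2)" using ts1(7) tsub(7) by simp
   fix y
   have "u y * (u y - ub y) <= u y * v y" using u_split[of y] v_split[of y] tsvb(2)[of y] ts1(2)[of y] by (intro mult_left_mono) auto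
   moreover have "0 <= (u y / 4 - 2 * ub y)^2" by simp
   hence "u y * ub y <= (u y)^2 / 16 + 4 * (ub y)^2" by (simp add: power2_eq_square algebra_simps)
   ultimately show "15/16 * (u y)^2 - 4 * (ub y)^2 <= u y * v y" by (simp add: power2_eq_square algebra_simps)
  qed
  finally show ?thesis .
 qed
 have gain2: "(LBINT y. u1 y * v y) <= C0" proof -
  have "(LBINT y. u1 y * v y) <= (LBINT y. (E * M0) * v y)"
   using tsu(4) ts2(2) by (intro integral_mono iu1v integrable_mult_right ts2(5) mult_right_mono) auto
  also have "... = C0" using ts2(6) by (simp add: C0_def M0_def c_def power2_eq_square)
  finally show ?thesis .
 qed
 have gain3: "(LBINT y. e y * v y) <= F / 2 + U + U / 64" proof -
  have "(LBINT y. e y * v y) <= (LBINT y. (e y)^2 / 2 + ((u y)^2 + (vb y)^2))" proof (rule integral_mono[OF iev])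
   show "integrable lborel (%y. (e y)^2 / 2 + ((u y)^2 + (vb y)^2))" using ei ts1(7) tsvb(7) by simp
   fix y
   have "0 <= (e y - v y)^2" by simp
   hence 1: "e y * v y <= (e y)^2 / 2 + (v y)^2 / 2" by (simp add: power2_eq_square algebra_simps)
   have "0 <= (ug y - vb y)^2" by simp
   hence 2: "(v y)^2 / 2 <= (ug y)^2 + (vb y)^2" unfolding v_split by (simp add: power2_eq_square algebra_simps)
   have "(ug y)^2 <= (u y)^2" using u_split[of y] tsub(2)[of y] ug0[of y] by (intro power_mono) auto
   thus "e y * v y <= (e y)^2 / 2 + ((u y)^2 + (vb y)^2)" using 1 2 by linarith
  qed
  also have "... = F / 2 + (U + (LBINT y. (vb y)^2))" unfolding F_def U_def using ei ts1(7) tsvb(7) by simp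
  finally show ?thesis using vb2 by simp
 qed
 define q where "q i x = tent_mean s2 (p i) x" for i x
 define Q where "Q i x = (LBINT z. tent z *. (P i (x + s2 x *. z) + (P i (x + s2 x *. z) <.> z) *. G2 x))" for i x
 have qQ: "C1_grad (q i) (Q i)" and Qi: "integrable lborel (%z. tent z *. (P i (x + s2 x *. z) + (P i (x + s2 x *. z) <.> z) *. G2 x))"
  if i: "i : Basis" for i x unfolding q_def Q_def by (rule C1_tent_average[OF p[OF i] pz[OF i] G2]; assumption)+
 have Qb: "norm (Q i x) <= lam * (D * c)" if i: "i : Basis" for i x proof -
  have "SP x <= s2 x" using sm2(5)[of x] S2(4)[of x] by linarith
  hence "measure mP (cball x (s2 x)) <= s2 x ^ DIM('a)" using srP(3) s2pos[of x] by simp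
  hence "(LBINT y. indicator (cball x (s2 x)) y * (e y)^2) <= (lam * t)^2 * s2 x ^ DIM('a)"
   unfolding mPA[OF borel_closed[OF closed_cball]] pos_divide_le_eq[OF zero_less_power[OF lt]] by (simp only: mult.commute)
  from tent_average_gradient_bound[OF ec' eP[OF i] s2pos G2(2) lt this Qi[OF i]]
  have "norm (Q i x) <= (5/8) * tent_max TYPE('a) * (lam * t) * (unit_ball_vol DIM('a) + 1)" by (simp add: Q_def)
  also have "... = lam * (D * c)" using cpos by (simp add: D_def field_bound_def t_def c_def)
  finally show ?thesis .
 qed
 \<comment> \<open>The average of the divergence \<open>u - u1\<close>, plus the effect of the
   varying radius, which Cauchy-Schwarz over the basis bounds by a quarter of the average of
   \<open>e\<close>.\<close>
 have divQ: "tent_mean s2 u x - tent_mean s2 u1 x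
   - (1/4) * tent_mean s2 e x <= (SUM i:Basis. Q i x <.> i)" for x proof -
  have abs_b: "<|u y|> <= E * lam" "<|u1 y|> <= E * M0" for y using ts1(2,4)[of y] tsu(2,4)[of y] by auto
  have i: "integrable lborel (%z. u (x + s2 x *. z) * tent z)" "integrable lborel (%z. u1 (x + s2 x *. z) * tent z)"
   "integrable lborel (%z. e (x + s2 x *. z) * tent z)" using tent_average_integrable[OF ts1(1) abs_b(1)] tent_average_integrable[OF tsu(1) abs_b(2)]
    tent_average_integrable[OF em, of B] B(2) by auto
  have Qint: "integrable lborel (%z. (tent z *. (P i (x + s2 x *. z) + (P i (x + s2 x *. z) <.> z) *. G2 x)) <.> i)"
   if "i : Basis" for i by (rule integrable_inner_left) (use Qi[OF that] in simp)
  have "(SUM i:Basis. Q i x <.> i)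
   = (SUM i:Basis. (LBINT z. (tent z *. (P i (x + s2 x *. z) + (P i (x + s2 x *. z) <.> z) *. G2 x)) <.> i))"
   unfolding Q_def by (intro sum.cong refl integral_inner_left[symmetric]) (use Qi in auto)
  also have "... = (LBINT z. (SUM i:Basis. (tent z *. (P i (x + s2 x *. z) + (P i (x + s2 x *. z) <.> z) *. G2 x)) <.> i))"
   by (rule Bochner_Integration.integral_sum[symmetric]) (rule Qint)
  also have "... >= (LBINT z. u (x + s2 x *. z) * tent z - u1 (x + s2 x *. z) * tent z - (1/4) * (e (x + s2 x *. z) * tent z))"
  proof (rule integral_mono)
   show "integrable lborel (%z. u (x + s2 x *. z) * tent z - u1 (x + s2 x *. z) * tent z - (1/4) * (e (x + s2 x *. z) * tent z))" using i by simp
   show "integrable lborel (%z. (SUM i:Basis. (tent z *. (P i (x + s2 x *. z) + (P i (x + s2 x *. z) <.> z) *. G2 x)) <.> i))"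
    by (intro Bochner_Integration.integrable_sum Qint)
   fix z :: 'a
   let ?y = "x + s2 x *. z"
   show "u ?y * tent z - u1 ?y * tent z - (1/4) * (e ?y * tent z)
    <= (SUM i:Basis. (tent z *. (P i ?y + (P i ?y <.> z) *. G2 x)) <.> i)" proof (cases "norm z <= 1")
    case True
    have "<|SUM i:Basis. (P i ?y <.> z) * (G2 x <.> i)|> <= (SUM i:Basis. <|P i ?y <.> z|> * <|G2 x <.> i|>)"
     by (rule order_trans[OF sum_abs]) (simp add: abs_mult)
    also have "... <= L2_set (%i. P i ?y <.> z) Basis * L2_set (%i. G2 x <.> i) Basis" by (rule L2_set_mult_ineq)
    also have "... <= e ?y * (1/4)" proof (rule mult_mono)
     have "L2_set (%i. <|P i ?y <.> z|>) Basis <= e ?y" unfolding e_def proof (rule L2_set_mono)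
      fix i :: 'a
      have "<|P i ?y <.> z|> <= norm (P i ?y) * norm z" by (rule Cauchy_Schwarz_ineq2)
      also have "... <= norm (P i ?y) * 1" using True by (intro mult_left_mono) auto
      finally show "<|P i ?y <.> z|> <= norm (P i ?y)" by simp
     qed simp
     thus "L2_set (%i. P i ?y <.> z) Basis <= e ?y" unfolding L2_set_def by simp
     show "L2_set (%i. G2 x <.> i) Basis <= 1/4" using G2(2)[of x] unfolding euclidean_dist_l2[of _ 0, simplified] norm_eq_sqrt_inner L2_set_def
      by (simp add: euclidean_inner[of "G2 x" "G2 x"] power2_eq_square)
    qed (use e0 in "auto simp: L2_set_nonneg")
    finally have 1: "- (1/4) * e ?y <= (SUM i:Basis. (P i ?y <.> z) * (G2 x <.> i))" by (simp add: abs_le_iff)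
    have "(SUM i:Basis. (tent z *. (P i ?y + (P i ?y <.> z) *. G2 x)) <.> i)
     = tent z * ((SUM i:Basis. P i ?y <.> i) + (SUM i:Basis. (P i ?y <.> z) * (G2 x <.> i)))"
     by (simp add: inner_add_left sum_distrib_left sum.distrib algebra_simps)
    also have "... >= tent z * ((u ?y - u1 ?y) + - (1/4) * e ?y)" unfolding Pdiv using 1 by (intro mult_left_mono add_left_mono tent_nonneg)
    finally show ?thesis by (simp add: algebra_simps)
   qed (simp add: tent_outside)
  qed
  finally show ?thesis using i by simp
 qed
 define phi where "phi i x = 1 / (lam * c) * q i x" for i x
 define Phi where "Phi i x = (1 / (lam * c)) *. Q i x" for i x
 have lc: "0 < lam * c" using lam_pos cpos by simp
 have Phib: "norm (Phi i x) <= D" if "i : Basis" for i x using Qb[OF that, of x] lc by (simp add: Phi_def divide_le_eq mult_ac)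
 define f where "f x = (SUM i:Basis. Phi i x <.> i)" for x
 have fQ: "f x = (1 / (lam * c)) * (SUM i:Basis. Q i x <.> i)" for x by (simp add: f_def Phi_def sum_distrib_left)
 have fm[measurable]: "f : borel_measurable borel" proof -
  have "continuous_on UNIV (Phi i)" if "i : Basis" for i unfolding Phi_def by (intro continuous_intros C1_gradD(2)[OF qQ[OF that]])
  hence "continuous_on UNIV f" unfolding f_def by (intro continuous_intros)
  thus ?thesis by (rule borel_measurable_continuous_onI)
 qed
 have fb: "<|f x|> <= real n * D" for x proof -
  have "<|f x|> <= (SUM i:(Basis::'a set). D)" unfolding f_def proof (rule order_trans[OF sum_abs sum_mono])
   fix i :: 'a assume i: "i : Basis"
   have "<|Phi i x <.> i|> <= norm (Phi i x)" by (rule Basis_le_norm[OF i])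
   thus "<|Phi i x <.> i|> <= D" using Phib[OF i, of x] by linarith
  qed
  thus ?thesis by (simp add: n_def)
 qed
 have main0: "2/5 * U / (lam * c) <= (LINT x|nu0. f x)" proof -
  interpret nu0: finite_measure nu0 by (rule d0(1))
  have fnu: "f : borel_measurable nu0" using fm unfolding measurable_cong_sets[OF d0(2) refl] .
  \<comment> \<open>With \<open>C0 <= U / 16\<close> and \<open>F <= U + C0\<close> the right side
    is at least \<open>0.42 * U\<close>. The radius must vary slowly for this: with Lipschitz
    constant 1/4 the last term does not eat up the gain.\<close>
  have "2/5 * U <= 7/8 * U - C0 - (1/4) * (F / 2 + U + U / 64)" using F C0U Upos by argo
  also have "... <= (LBINT y. u y * v y) - (LBINT y. u1 y * v y) - (1/4) * (LBINT y. e y * v y)" using gain1 gain2 gain3 by argo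
  also have "... = (LINT x|nu0. tent_mean s2 u x - tent_mean s2 u1 x
   - (1/4) * tent_mean s2 e x)" using puv pu1v pev by simp
  also have "... <= (LINT x|nu0. (lam * c) * f x)" proof (rule integral_mono)
   show "integrable nu0 (%x. (lam * c) * f x)" by (intro integrable_mult_right nu0.integrable_const_bound[of _ "real n * D"]) (use fb fnu in auto)
   show "integrable nu0 (%x. tent_mean s2 u x - tent_mean s2 u1 x
     - (1/4) * tent_mean s2 e x)" using puv pu1v pev by simp
   show "tent_mean s2 u x - tent_mean s2 u1 x
     - (1/4) * tent_mean s2 e x <= (lam * c) * f x" for x proof -
    have "(lam * c) * f x = (SUM i:Basis. Q i x <.> i)" unfolding fQ using lam_pos cpos by simp
    thus ?thesis using divQ[of x] by simp
   qed
  qed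
  finally have "2/5 * U <= (lam * c) * (LINT x|nu0. f x)" by simp
  thus ?thesis using lc by (simp add: divide_le_eq mult.commute)
 qed
 have main: "ec / (10 * c) * M <= (LINT x|nu. f x)" proof -
  have if1: "integrable nu (%x. indicator A x * f x)" if [measurable]: "A : sets borel" for A proof (rule integrable_const_bound[of _ "real n * D"])
   show "AE x in nu. norm (indicator A x * f x) <= real n * D" using fb order_trans[OF abs_ge_zero fb] by (intro AE_I2) (auto simp: indicator_def)
  qed measurable
  have "(LINT x|nu. f x) = (LINT x|nu. indicator K0 x * f x + indicator (- K0) x * f x)"
   by (intro lint_cong) (auto simp: indicator_def)
  also have "... = (LINT x|nu0. f x) + (LINT x|nu. indicator (- K0) x * f x)"
   using Bochner_Integration.integral_add[OF if1[OF K0m] if1[of "- K0"]] d0(4)[OF fm] by simp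
  finally have sp': "(LINT x|nu. f x) = (LINT x|nu0. f x) + (LINT x|nu. indicator (- K0) x * f x)" .
  have "(LINT x|nu. - (real n * D) * indicator (- K0) x) <= (LINT x|nu. indicator (- K0) x * f x)" proof (rule integral_mono)
   show "integrable nu (%x. - (real n * D) * indicator (- K0) x)"
    by (intro integrable_mult_right integrable_real_indicator) (auto simp: emeasure_eq_measure)
   show "- (real n * D) * indicator (- K0) x <= indicator (- K0) x * f x" for x using fb[of x] by (auto simp: indicator_def abs_le_iff)
  qed (use if1 in auto)
  hence "- (real n * D) * measure nu (- K0) <= (LINT x|nu. indicator (- K0) x * f x)" by simp
  moreover have "(real n * D) * measure nu (- K0) <= (real n * D) * (ec / (10 * c * real n * D) * M)"
   using K0c mult_right_mono[OF dl(3), of M] M npos ecpos by (intro mult_left_mono) auto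
  moreover have "(real n * D) * (ec / (10 * c * real n * D) * M) = ec / (10 * c) * M" using npos ecpos(3) by (simp add: field_simps)
  moreover have "ec / (5 * c) * M <= 2/5 * U / (lam * c)" proof -
   have "ec / (5 * c) * M = ec * M / (5 * c)" by simp
   also have "... <= ec * (2 * M0) / (5 * c)" using M0 ecpos cpos by (intro divide_right_mono mult_left_mono) auto
   also have "... = 2/5 * (ec * lam * M0) / (lam * c)" using lam_pos cpos by (simp add: field_simps)
   also have "... <= 2/5 * U / (lam * c)" using Ulower lc by (intro divide_right_mono mult_left_mono) auto
   finally show ?thesis .
  qed
  moreover have "ec / (5 * c) * M = ec / (10 * c) * M + ec / (10 * c) * M" by simp
  ultimately show ?thesis using main0 sp' unfolding mult_minus_left by argo
 qed
 have L2: "integrable lborel (%x. (phi i x)^2) & (LBINT x. (phi i x)^2) <= 8 * E^2 * unit_ball_vol n * (R + 1)^2 * M / lam"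
  if i: "i : Basis" for i proof
  note av = tent_average_L2[OF C1_grad_continuous[OF p[OF i]] pz[OF i] sm2(2) s2pos, folded q_def c_def E_def n_def]
  show "integrable lborel (%x. (phi i x)^2)" unfolding phi_def power_mult_distrib by (rule integrable_mult_right[OF av(1)])
  have "(LBINT x. (p i x)^2) <= 4 * (R + 1)^2 * (LBINT x. (norm (P i x))^2)" by (rule C1_poincare[OF p[OF i] pz[OF i]]) (use R(2) in auto)
  also have "(LBINT x. (norm (P i x))^2) <= F" unfolding F_def proof (rule integral_mono[OF _ ei])
   show "integrable lborel (%x. (norm (P i x))^2)" by (rule lborel_integrable_compact_support[of _ "R + 1"])
      (use Pz[OF i] in "auto intro!: continuous_intros C1_gradD(2)[OF p[OF i]]")
   show "(norm (P i x))^2 <= (e x)^2" for x using eP[OF i] by (intro power_mono) auto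
  qed
  finally have pF: "(LBINT x. (p i x)^2) <= 4 * (R + 1)^2 * F" by (simp add: mult_left_mono)
  have "(LBINT x. (p i x)^2) <= 4 * (R + 1)^2 * (2 * (E * lam * (c * M)))" proof -
   have "U <= E * lam * (c * M)" proof -
    have "(E * lam * c) * M0 <= (E * lam * c) * M" using M0(2) Epos lam_pos cpos by (intro mult_left_mono) auto
    thus ?thesis using Uupper by (simp add: mult_ac)
   qed
   hence "F <= 2 * (E * lam * (c * M))" using F2 by linarith
   hence "4 * (R + 1)^2 * F <= 4 * (R + 1)^2 * (2 * (E * lam * (c * M)))" by (intro mult_left_mono) auto
   thus ?thesis using pF by linarith
  qed
  hence "c * (E * unit_ball_vol n) * (LBINT x. (p i x)^2) <= c * (E * unit_ball_vol n) * (4 * (R + 1)^2 * (2 * (E * lam * (c * M))))"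
   using cpos Epos by (intro mult_left_mono) auto
  hence q2: "(LBINT x. (q i x)^2) <= c * (E * unit_ball_vol n) * (4 * (R + 1)^2 * (2 * (E * lam * (c * M))))" using av(2)[of "R + 1"] by linarith
  have "(LBINT x. (phi i x)^2) = (1 / (lam * c))^2 * (LBINT x. (q i x)^2)" unfolding phi_def power_mult_distrib by (rule integral_mult_right_zero)
  also have "... <= (1 / (lam * c))^2 * (c * (E * unit_ball_vol n) * (4 * (R + 1)^2 * (2 * (E * lam * (c * M)))))"
   using q2 by (rule mult_left_mono) simp
  also have "... = 8 * E^2 * unit_ball_vol n * (R + 1)^2 * M / lam" using lam_pos cpos by (simp add: power2_eq_square field_simps)
  finally show "(LBINT x. (phi i x)^2) <= 8 * E^2 * unit_ball_vol n * (R + 1)^2 * M / lam" .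
 qed
 have "C1_grad (phi i) (Phi i)" if "i : Basis" for i unfolding phi_def Phi_def by (rule C1_grad_cmult[OF qQ[OF that]])
 thus ?thesis using Phib L2 main unfolding D_def ec_def f_def by blast
qed

text \<open>Where balls have bounded density the measure is absolutely continuous, by Vitali's lemma
  applied inside an open neighbourhood of small volume. It ensures that the regularised stopping
  radius is positive almost everywhere for a measure on a Lebesgue null set.\<close>

lemma null_low_density:
 fixes nu :: "'a::euclidean_space measure"
 assumes [simp]: "sets nu = sets borel" and A: "A : sets borel" "emeasure lborel A = 0" and lam: "0 <= lam"
  and low: "!!x r. x : A ==> 0 <= r ==> emeasure nu (cball x r) <= ennreal (lam * r ^ DIM('a))"
 shows "emeasure nu A = 0" proof -
 define v where "v = unit_ball_vol (real DIM('a))"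
 have v: "0 < v" by (simp add: v_def)
 have bound: "emeasure nu A <= ennreal e" if e: "e > 0" for e :: real proof -
  define d where "d = e * v / (lam * 5 ^ DIM('a) + 1)"
  have pp: "0 < lam * 5 ^ DIM('a) + 1" using lam by (intro add_nonneg_pos mult_nonneg_nonneg) auto
  have d: "d > 0" using e v pp by (simp add: d_def)
  obtain U where U: "open U" "A <= U" "emeasure lebesgue (U - A) < ennreal d" using sets_lebesgue_outer_open[of A d] A d by auto
  have "emeasure lborel U <= emeasure lborel (A Un (U - A))" using A U(1) by (intro emeasure_mono) auto
  also have "... <= emeasure lborel A + emeasure lborel (U - A)" using A U(1) by (intro emeasure_subadditive) auto
  also have "... = emeasure lebesgue (U - A)" using A U(1) by (simp add: emeasure_completion)
  finally have Ud: "emeasure lborel U <= ennreal d" using U(3) by simp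
  define m where "m = scale_measure (ennreal (1 / v)) (density lborel (indicator U))"
  have mU: "emeasure m B = ennreal (1 / v) * emeasure lborel (U Int B)" if "B : sets borel" for B
   unfolding m_def using that U(1) by (simp add: emeasure_restricted)
  have "EX r. 0 < r & r <= 1 & cball y r <= U" if y: "y : A" for y proof -
   have "y : U" using U(2) y by (rule subsetD)
   then obtain r where r: "r > 0" "cball y r <= U" using open_contains_cball_eq[OF U(1)] by meson
   have "cball y (min r 1) <= U" by (rule order_trans[OF subset_cball r(2)]) simp
   thus ?thesis using r(1) by (intro exI[of _ "min r 1"]) simp
  qed
  hence "EX r. ALL y:A. 0 < r y & r y <= 1 & cball y (r y) <= U" by (intro bchoice) auto
  then obtain r where r: "!!y. y : A ==> 0 < r y & r y <= 1 & cball y (r y) <= U" by auto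
  obtain W where W: "W : sets borel" "(UN y:A. cball y (0 * r y)) <= W" "emeasure nu W <= ennreal (lam * 5 ^ DIM('a)) * emeasure m UNIV"
  proof (rule vitali_dilated_cover[of m nu 0 A r 1 "lam * 5 ^ DIM('a)"])
   show "ennreal (r y ^ DIM('a)) <= emeasure m (cball y (r y))" if "y : A" for y proof -
    have "U Int cball y (r y) = cball y (r y)" using r[OF that] by auto
    hence "emeasure m (cball y (r y)) = ennreal (1 / v) * ennreal (v * r y ^ DIM('a))" using r[OF that] by (simp add: mU emeasure_cball v_def)
    also have "... = ennreal (r y ^ DIM('a))" using v r[OF that] by (subst ennreal_mult[symmetric]) auto
    finally show ?thesis by simp
   qed
   show "emeasure nu (cball y ((5 + 5 * 0) * r y)) <= ennreal (lam * 5 ^ DIM('a) * r y ^ DIM('a))" if "y : A" for y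
    using low[OF that, of "5 * r y"] r[OF that] by (simp add: power_mult_distrib mult.assoc)
  qed (use r lam in "auto simp: m_def")
  have "emeasure nu A <= emeasure nu W" using W(1,2) by (intro emeasure_mono) auto
  also have "... <= ennreal (lam * 5 ^ DIM('a)) * (ennreal (1 / v) * ennreal d)"
   by (rule order_trans[OF W(3)], intro mult_left_mono, simp add: mU, intro mult_left_mono Ud) auto
  also have "... = ennreal (lam * 5 ^ DIM('a) * (1 / v * d))" using lam v d by (simp add: ennreal_mult'[symmetric])
  also have "... <= ennreal e" proof (rule ennreal_leI)
   have "lam * 5 ^ DIM('a) * (1 / v * d) = e * (lam * 5 ^ DIM('a) / (lam * 5 ^ DIM('a) + 1))" unfolding d_def using v by simp
   also have "... <= e * 1" using e pp by (intro mult_left_mono) (auto simp: divide_le_eq)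
   finally show "lam * 5 ^ DIM('a) * (1 / v * d) <= e" by simp
  qed
  finally show ?thesis .
 qed
 show ?thesis proof (rule ccontr)
  assume "emeasure nu A ~= 0"
  hence "0 < min (emeasure nu A) 1" by (simp add: zero_less_iff_neq_zero)
  then obtain z where z: "0 < z" "z < min (emeasure nu A) 1" using dense by blast
  hence "z < top" by (simp add: order_less_trans[OF _ ennreal_one_less_top])
  then obtain e where e: "z = ennreal e" "0 <= e" by (cases z) auto
  thus False using bound[of e] z by auto
 qed
qed

text \<open>A \<open>D\<close>-Lipschitz function exceeding \<open>r\<close> at a point stays above
  \<open>r / 2\<close> on the ball of radius \<open>r / (2 * D)\<close>.\<close>

lemma lipschitz_L2_sup_bound:
 fixes phi :: "'a::euclidean_space => real"
 assumes phi: "C1_grad phi Phi" "!!x. norm (Phi x) <= D" and D: "0 < D" and i: "integrable lborel (%x. (phi x)^2)"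
  and r: "0 < r" and small: "(LBINT x. (phi x)^2) < (r / 2)^2 * (unit_ball_vol DIM('a) * (r / (2 * D)) ^ DIM('a))"
 shows "<|phi x|> <= r" proof (rule ccontr)
 assume c: "~ <|phi x|> <= r"
 let ?B = "cball x (r / (2 * D))"
 have lip: "D-lipschitz_on UNIV phi" by (rule C1_grad_lipschitz[OF phi(1)]) (use phi(2) D in auto)
 have "(r / 2)^2 * measure lborel ?B = (LBINT y. (r / 2)^2 * indicator ?B y)" by simp
 also have "... <= (LBINT y. (phi y)^2)" proof (rule integral_mono)
  show "integrable lborel (%y. (r / 2)^2 * indicator ?B y)" using emeasure_lborel_cball_finite[of x "r / (2 * D)"]
   by (intro integrable_mult_right integrable_real_indicator) simp_all
  show "(r / 2)^2 * indicator ?B y <= (phi y)^2" for y proof (cases "y : ?B")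
   case True
   hence "D * dist x y <= D * (r / (2 * D))" using D by (intro mult_left_mono) auto
   hence "<|phi x - phi y|> <= r / 2" using lipschitz_onD[OF lip, of x y] D by (simp add: dist_real_def)
   hence "r / 2 <= <|phi y|>" using c by linarith
   hence "(r / 2)^2 <= <|phi y|>^2" using r by (intro power_mono) auto
   thus ?thesis using True by simp
  qed simp
 qed (rule i)
 finally show False using small D r by (simp add: content_cball)
qed

text \<open>The density level is taken large: the L2 bounds decay like \<open>1 / lam\<close>, and
  the Lipschitz bound turns this into uniform smallness. The gradient bound and the lower bound for
  the divergence do not depend on \<open>r\<close>.\<close>

theorem singular_test_fields:
 fixes nu :: "'a::euclidean_space measure"
 assumes fin: "finite_measure nu" and sets[measurable_cong, simp]: "sets nu = sets borel"
  and K: "compact K" "emeasure lborel K = 0" "AE x in nu. x : K" and M: "0 < measure nu UNIV" and r: "0 < r"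
 shows "EX phi Phi. (ALL i:Basis. C1_grad (phi i) (Phi i) & (ALL x. norm (Phi i x) <= field_bound TYPE('a) & <|phi i x|> <= r)) &
  energy_const TYPE('a) / (10 * tent_mass TYPE('a)) * measure nu UNIV <= (LINT x|nu. (SUM i:Basis. Phi i x <.> i))" proof -
 interpret finite_measure nu by (rule fin)
 define D where "D = field_bound TYPE('a)"
 define n where "n = DIM('a)"
 define E c M where "E = tent_const TYPE('a)" and "c = tent_mass TYPE('a)" and "M = measure nu UNIV"
 note cp = constants_pos[where 'a='a]
 obtain R where R: "0 < R" "!!x. x : K ==> norm x <= R" using compact_imp_bounded[OF K(1)] unfolding bounded_pos by auto
 define q where "q = (r / 2)^2 * (unit_ball_vol (real n) * (r / (2 * D)) ^ n)"
 have Dp: "D > 0" using cp by (simp add: D_def)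
 have q: "q > 0" using r Dp by (simp add: q_def)
 have "\<forall>\<^sub>F lam in at_top. (0::real) < lam" by (rule eventually_gt_at_top)
 moreover have "\<forall>\<^sub>F lam in at_top. M * 2 ^ n < lam" by (rule eventually_gt_at_top)
 moreover have "\<forall>\<^sub>F lam in at_top. 16 * (E * c * M) / energy_const TYPE('a) <= lam" by (rule eventually_ge_at_top)
 moreover have "\<forall>\<^sub>F lam in at_top. (8 * E^2 * unit_ball_vol n * (R + 1)^2 * M) / q < lam" by (rule eventually_gt_at_top)
 ultimately have "\<forall>\<^sub>F lam in at_top. (0::real) < lam & M * 2 ^ n < lam & 16 * (E * c * M) / energy_const TYPE('a) <= lam & (8 * E^2 * unit_ball_vol n * (R + 1)^2 * M) / q < lam"
  by (intro eventually_conj)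
 from eventually_happens[OF this] obtain lam where lam: "0 < lam" "M * 2 ^ n < lam" "16 * (E * c * M) / energy_const TYPE('a) <= lam" "(8 * E^2 * unit_ball_vol n * (R + 1)^2 * M) / q < lam"
  by (auto simp del: divide_le_eq)
 define m where "m = scale_measure (ennreal (1 / lam)) nu"
 define S where "S = stop_radius m"
 have sm: "sets m = sets borel" by (simp add: m_def)
 have mm: "measure m B = measure nu B / lam" for B using lam(1) by (simp add: m_def measure_scale_measure)
 have fm: "finite_measure m" unfolding m_def by (rule finite_measureI) (simp add: ennreal_mult_eq_top_iff)
 have lam1: "M < lam * (1/2) ^ n" using lam(2) by (simp add: power_one_over field_simps)
 have mU: "measure m UNIV < (1/2) ^ DIM('a)" using lam1 lam(1) by (simp add: mm M_def n_def divide_less_eq mult.commute)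
 have q4: "(0::real) < 1/4" "(0::real) < 1/2" by auto
 note sr = stop_radius[OF fm sm q4(2) mU, folded S_def]
 have Sb: "S y <= 1/2" for y using sr(2) .
 note sc = sup_conv[of "1/4" S "1/2", OF q4(1) Sb]
 have cont: "continuous_on UNIV (sup_conv (1/4) S)" by (rule lipschitz_on_continuous_on[OF sc(4)])
 define A where "A = K Int {x. sup_conv (1/4) S x <= 0}"
 have clA: "A : sets borel"
  unfolding A_def using K(1) by (intro borel_closed closed_Int compact_imp_closed closed_Collect_le cont continuous_on_const)
 have "emeasure nu A = 0" proof (rule null_low_density[of nu A lam])
  have "emeasure lborel A <= emeasure lborel K" using borel_compact[OF K(1)] by (intro emeasure_mono) (auto simp: A_def)
  thus "emeasure lborel A = 0" using K(2) by simp
  fix x :: 'a and rho :: real assume x: "x : A" and rho: "0 <= rho"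
  have "S x <= rho" using sc(1)[of x] x rho by (simp add: A_def)
  hence "measure m (cball x rho) <= rho ^ DIM('a)" using sr(3)[of x rho] rho by simp
  thus "emeasure nu (cball x rho) <= ennreal (lam * rho ^ DIM('a))"
   using lam(1) by (simp add: mm emeasure_eq_measure ennreal_leI divide_le_eq mult.commute)
 qed (use clA lam in auto)
 hence "AE x in nu. x \<notin> A" using clA by (intro AE_not_in) (auto simp: null_sets_def)
 hence pos: "AE x in nu. 0 < sup_conv (1/4) S x" using K(3) by eventually_elim (auto simp: A_def)
 have Rae: "AE x in nu. norm x <= R" using K(3) by eventually_elim (rule R(2))
 have "EX phi Phi. (ALL i:Basis. C1_grad (phi i) (Phi i) & (ALL x. norm (Phi i x) <= field_bound TYPE('a)) &
   integrable lborel (%x. (phi i x)^2) &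
   (LBINT x. (phi i x)^2) <= 8 * E^2 * unit_ball_vol n * (R + 1)^2 * M / lam) &
  energy_const TYPE('a) / (10 * c) * M <= (LINT x|nu. (SUM i:Basis. Phi i x <.> i))" unfolding E_def c_def M_def n_def
 proof (rule singular_test_field_scale[OF fin sets Rae])
  show "16 * (tent_const TYPE('a) * tent_mass TYPE('a) * measure nu UNIV) <= lam * energy_const TYPE('a)"
   using lam(3) cp by (simp add: divide_le_eq E_def c_def M_def)
 qed (use M lam1 lam(1) R(1) pos in "auto simp: S_def m_def M_def n_def")
 then obtain phi Phi where p: "!!i. i : Basis ==> C1_grad (phi i) (Phi i)" "!!i x. i : Basis ==> norm (Phi i x) <= D"
   "!!i. i : Basis ==> integrable lborel (%x. (phi i x)^2)"
   "!!i. i : Basis ==> (LBINT x. (phi i x)^2) <= 8 * E^2 * unit_ball_vol n * (R + 1)^2 * M / lam"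
  and div: "energy_const TYPE('a) / (10 * c) * M <= (LINT x|nu. (SUM i:Basis. Phi i x <.> i))" unfolding D_def by blast
 have "<|phi i x|> <= r" if i: "i : Basis" for i x proof (rule lipschitz_L2_sup_bound[OF p(1,2)[OF i] _ p(3)[OF i] r])
  have "8 * E^2 * unit_ball_vol n * (R + 1)^2 * M / lam < q" using lam(1,4) q by (simp add: divide_less_eq mult.commute)
  thus "(LBINT x. (phi i x)^2) < (r / 2)^2 * (unit_ball_vol DIM('a) * (r / (2 * D)) ^ DIM('a))" using p(4)[OF i] unfolding q_def n_def by linarith
 qed (rule Dp)
 thus ?thesis using p div unfolding D_def c_def M_def by blast
qed

section \<open>Lipschitz and C1 functions\<close>

text \<open>Near minimisers of the energy over a decreasing sequence of midpoint convex families form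
 a Cauchy sequence by the parallelogram law; this replaces a weak compactness argument.\<close>

lemma convex_energy_selection:
 fixes M :: "'a::euclidean_space measure" and G :: "'c => 'a => 'a"
 assumes [measurable_cong]: "sets M = sets borel" and C: "!!i. C i ~= {}" "!!i. C (Suc i) <= C i"
  and mid: "!!i p q. p : C i ==> q : C i ==> EX r:C i. ALL x. G r x = (1/2) *. (G p x + G q x)"
  and G: "!!i p. p : C i ==> continuous_on UNIV (G p)"
  and int: "!!i p. p : C i ==> integrable M (%x. (norm (G p x))^2)"
  and B: "!!i p. p : C i ==> (LINT x|M. (norm (G p x))^2) <= B" and tol: "!!i. 0 < tol i"
 shows "EX p. ALL i. p i : C i & integrable M (%x. (norm (G (p i) x - G (p (Suc i)) x))^2) &
  (LINT x|M. (norm (G (p i) x - G (p (Suc i)) x))^2) <= tol i" proof -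
 define en where "en p = (LINT x|M. (norm (G p x))^2)" for p
 define m where "m i = (INF p\<in>C i. en p)" for i
 have en0: "0 <= en p" for p unfolding en_def by (rule lint_nonneg) simp
 have bdd: "bdd_below (en ` C i)" for i using en0 by (intro bdd_belowI[of _ 0]) auto
 have mle: "m i <= en p" if "p : C i" for i p unfolding m_def by (rule cINF_lower[OF bdd that])
 have mono: "i <= j ==> C j <= C i" for i j by (rule lift_Suc_antimono_le[of C, OF C(2)])
 have minc: "incseq m" unfolding incseq_def m_def using mono C(1) by (intro allI impI cINF_superset_mono bdd) auto
 have mB: "m i <= B" for i proof -
  obtain p where "p : C i" using C(1)[of i] by auto
  thus ?thesis using mle[of p i] B[of p i] unfolding en_def by linarith
 qed
 obtain m' where m': "m ----> m'" "!!i. m i <= m'" using incseq_convergent[OF minc, of B] mB by auto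
 define t where "t i = Min (tol ` {..i}) / 8" for i
 have t: "0 < t i" for i using tol unfolding t_def by auto
 have tSuc: "t (Suc i) <= t i" for i unfolding t_def by (intro divide_right_mono Min_antimono) auto
 have ttol: "8 * t i <= tol i" for i unfolding t_def by simp
 have "EX j>=i. m' - m j < t i" for i proof -
  have "\<forall>\<^sub>F j in sequentially. m' - t i < m j" using m'(1) t[of i] by (intro order_tendstoD) auto
  then obtain N where "!!j. j >= N ==> m' - t i < m j" unfolding eventually_sequentially by auto
  from this[of "max i N"] show ?thesis by (intro exI[of _ "max i N"]) auto
 qed
 then obtain k where k: "!!i. k i >= i & m' - m (k i) < t i" by metis
 \<comment> \<open>At index \<open>N i\<close> the infimum is within \<open>t i\<close> of its
   limit, and a midpoint has energy at least \<open>m (N i)\<close>; the parallelogram law then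
   bounds the squared distance by \<open>6 * t i\<close>. The maximum makes \<open>N\<close>
   increasing, so that consecutive choices lie in a common family.\<close>
 define N where "N i = Max (k ` {..i})" for i
 have kN: "k i <= N i" for i unfolding N_def by (intro Max_ge) auto
 have NS: "N i <= N (Suc i)" for i unfolding N_def by (intro Max_mono) auto
 have iN: "i <= N i" for i using k[of i] kN[of i] by linarith
 have mN: "m' - m (N i) < t i" for i using incseqD[OF minc kN[of i]] k[of i] by linarith
 have "EX p:C (N i). en p < m (N i) + t i" for i proof -
  have "Inf (en ` C (N i)) < m (N i) + t i" using t[of i] by (simp add: m_def)
  thus ?thesis using cInf_less_iff[of "en ` C (N i)", OF _ bdd] C(1) by auto
 qed
 then obtain p where p: "!!i. p i : C (N i)" "!!i. en (p i) < m (N i) + t i" by metis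
 have par: "(norm (u - v))^2 = 2 * (norm u)^2 + 2 * (norm v)^2 - 4 * (norm ((1/2) *. (u + v)))^2" for u v :: 'a
  unfolding power2_norm_eq_inner by (simp add: inner_add inner_diff inner_commute field_simps)
 have "p i : C i & integrable M (%x. (norm (G (p i) x - G (p (Suc i)) x))^2) &
  (LINT x|M. (norm (G (p i) x - G (p (Suc i)) x))^2) <= tol i" for i proof -
  have a: "p i : C (N i)" "p (Suc i) : C (N i)" using p(1) mono[OF NS[of i]] by auto
  obtain r where r: "r : C (N i)" "!!x. G r x = (1/2) *. (G (p i) x + G (p (Suc i)) x)" using mid[OF a] by auto
  have eq: "(%x. (norm (G (p i) x - G (p (Suc i)) x))^2) =
   (%x. 2 * (norm (G (p i) x))^2 + 2 * (norm (G (p (Suc i)) x))^2 - 4 * (norm (G r x))^2)" unfolding r(2) by (rule ext) (rule par)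
  have I: "(LINT x|M. (norm (G (p i) x - G (p (Suc i)) x))^2) = 2 * en (p i) + 2 * en (p (Suc i)) - 4 * en r"
   unfolding eq en_def using int[OF a(1)] int[OF a(2)] int[OF r(1)] by simp
  also have "... <= tol i" using p(2)[of i] p(2)[of "Suc i"] mle[OF r(1)] mN[of i] m'(2)[of "N (Suc i)"] tSuc[of i] ttol[of i] t[of i] by linarith
  finally show ?thesis using a mono[OF iN[of i]] int[OF a(1)] int[OF a(2)] int[OF r(1)] by (auto simp: eq)
 qed
 thus ?thesis by blast
qed

definition midpoint_pair :: "('a::euclidean_space => real) \<times> ('a => 'a) => ('a => real) \<times> ('a => 'a) => ('a => real) \<times> ('a => 'a)" where
 "midpoint_pair p q = (%x. (1/2) * (fst p x + fst q x), %x. (1/2) *. (snd p x + snd q x))"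

lemma midpoint_pair:
 "C1_grad (fst p) (snd p) ==> C1_grad (fst q) (snd q) ==> C1_grad (fst (midpoint_pair p q)) (snd (midpoint_pair p q))"
 "norm (snd p x) <= L ==> norm (snd q x) <= L ==> norm (snd (midpoint_pair p q) x) <= L"
 "<|fst p x - c|> <= d ==> <|fst q x - c|> <= d ==> <|fst (midpoint_pair p q) x - c|> <= d"
 "snd (midpoint_pair p q) x = (1/2) *. (snd p x + snd q x)" proof -
 show "norm (snd (midpoint_pair p q) x) <= L" if "norm (snd p x) <= L" "norm (snd q x) <= L"
  using norm_triangle_ineq[of "snd p x" "snd q x"] that by (simp add: midpoint_pair_def del: scaleR_add_right)
 show "C1_grad (fst (midpoint_pair p q)) (snd (midpoint_pair p q))" if "C1_grad (fst p) (snd p)" "C1_grad (fst q) (snd q)"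
  using C1_grad_cmult[OF C1_grad_add[OF that], of "1/2"] by (simp add: midpoint_pair_def del: scaleR_add_right)
qed (auto simp: midpoint_pair_def abs_le_iff field_simps)

text \<open>Chebyshev's inequality turns closeness in L2 into uniform closeness off a small open
  set: tolerance \<open>e / 2 * (1/8) ^ i\<close> against the squared threshold
  \<open>(1/4) ^ i\<close> leaves measure \<open>e / 2 * (1/2) ^ i\<close>, with sum
  \<open>e\<close>.\<close>

lemma convex_gradient_selection:
 fixes M :: "'a::euclidean_space measure" and G :: "'c => 'a => 'a"
 assumes fin: "finite_measure M" and sets[measurable_cong, simp]: "sets M = sets borel"
  and C: "!!i. C i ~= {}" "!!i. C (Suc i) <= C i"
  and mid: "!!i p q. p : C i ==> q : C i ==> EX r:C i. ALL x. G r x = (1/2) *. (G p x + G q x)"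
  and G: "!!i p. p : C i ==> continuous_on UNIV (G p)" and L: "!!i p x. p : C i ==> norm (G p x) <= L" and e: "0 < e"
 obtains p B where "!!i. p i : C i" "closed B" "measure M (- B) <= e"
  "!!i x. x : B ==> norm (G (p i) x - G (p (Suc i)) x) <= (1/2) ^ i" proof -
 interpret finite_measure M by (rule fin)
 have I: "integrable M (%x. (norm (G p x))^2)" if "p : C i" for i p proof (rule integrable_const_bound[of _ "L^2"])
  show "(%x. (norm (G p x))^2) : borel_measurable M" unfolding measurable_cong_sets[OF sets refl]
   by (intro borel_measurable_continuous_onI continuous_intros G[OF that])
 qed (use power_mono[OF L[OF that]] in auto)
 have "EX p. ALL i. p i : C i & integrable M (%x. (norm (G (p i) x - G (p (Suc i)) x))^2) &
  (LINT x|M. (norm (G (p i) x - G (p (Suc i)) x))^2) <= e / 2 * (1/8) ^ i"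
 proof (rule convex_energy_selection[where C = C and G = G and M = M and B = "LINT x|M. L^2", OF sets C mid G I])
  show "(LINT x|M. (norm (G p x))^2) <= (LINT x|M. L^2)" if "p : C i" for i p
   by (rule integral_mono[OF I[OF that]]) (auto intro: power_mono L[OF that])
 qed (use e in auto)
 then obtain p where p: "!!i. p i : C i" "!!i. integrable M (%x. (norm (G (p i) x - G (p (Suc i)) x))^2)"
  "!!i. (LINT x|M. (norm (G (p i) x - G (p (Suc i)) x))^2) <= e / 2 * (1/8) ^ i" by blast
 let ?d = "%i x. norm (G (p i) x - G (p (Suc i)) x)"
 define V where "V i = {x. (1/2) ^ i < ?d i x}" for i
 have oV: "open (V i)" for i unfolding V_def by (intro open_Collect_less continuous_intros G[OF p(1)])
 have Vm: "measure M (V i) <= e / 2 * (1/2) ^ i" for i proof -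
  have "(1/4) ^ i * measure M (V i) = (LINT x|M. (1/4) ^ i * indicator (V i) x)" using oV by simp
  also have "... <= (LINT x|M. (?d i x)^2)" proof (rule integral_mono[OF _ p(2)])
   show "integrable M (%x. (1/4) ^ i * indicator (V i) x :: real)"
    using oV by (intro integrable_mult_right integrable_real_indicator) (auto simp: emeasure_eq_measure)
   have "((1/2) ^ i)^2 = (1/4 :: real) ^ i" by (simp add: power_mult[symmetric] mult.commute[of i] power2_eq_square power_mult_distrib[symmetric])
   thus "(1/4) ^ i * indicator (V i) x <= (?d i x)^2" for x using power_mono[of "(1/2) ^ i" "?d i x" 2] by (auto simp: V_def indicator_def)
  qed
  also have "... <= e / 2 * (1/8) ^ i" by (rule p(3))
  also have "... = (1/4) ^ i * (e / 2 * (1/2) ^ i)" by (simp add: power_mult_distrib[symmetric])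
  finally show ?thesis by (rule mult_left_le_imp_le) simp
 qed
 have "(%i. e / 2 * (1/2) ^ i) sums (e / 2 * (1 / (1 - 1/2)))" by (intro sums_mult geometric_sums) simp
 hence s: "(%i. e / 2 * (1/2) ^ i) sums e" by simp
 have sV: "summable (%i. measure M (V i))" by (rule summable_comparison_test'[OF sums_summable[OF s]]) (use Vm in auto)
 have "measure M (UN i. V i) <= (\<Sum>i. measure M (V i))" by (rule finite_measure_subadditive_countably[OF _ sV]) (use oV in auto)
 also have "... <= e" using suminf_le[OF Vm sV sums_summable[OF s]] sums_unique[OF s] by simp
 finally have m: "measure M (UN i. V i) <= e" .
 show thesis proof (rule that[OF p(1)])
  show "closed (- (UN i. V i))" using oV by auto
  show "measure M (- (- (UN i. V i))) <= e" using m by simp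
  show "?d i x <= (1/2) ^ i" if "x : - (UN i. V i)" for i x using that by (auto simp: V_def not_less)
 qed
qed

definition maximal_const :: "'a::euclidean_space itself => real" where
 "maximal_const T = (5/8) * tent_max T * (unit_ball_vol DIM('a) + 1) / tent_mass T"

text \<open>A weak type bound in the role of the maximal function. \<open>Z\<close> is where the
  gradient is at most \<open>t\<close> and the regularised stopping radius of the energy at level
  \<open>t^2\<close> vanishes; its complement is small by Vitali's lemma. Averages of
  \<open>h\<close> at the smoothed radius are Lipschitz everywhere with constant of order
  \<open>t\<close> and reproduce \<open>h\<close> on \<open>Z\<close> in the limit.\<close>

lemma C1_maximal_estimate:
 fixes h :: "'a::euclidean_space => real"
 assumes h: "C1_grad h H" and z: "!!x. R < norm x ==> h x = 0" and t: "0 < t"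
 obtains Z where "closed Z" "!!x. x : Z ==> norm (H x) <= t" "(maximal_const TYPE('a) * t)-lipschitz_on Z h"
  "emeasure lborel (- Z) <= ennreal ((vitali_const TYPE('a) + 1) * ((LBINT x. (norm (H x))^2) / t^2))" proof -
 define e where "e x = norm (H x)" for x
 define F where "F = (LBINT x. (e x)^2)"
 have zH: "H x = 0" if "R < norm x" for x using C1_grad_outside[OF h z that] .
 have ec: "continuous_on UNIV e" unfolding e_def by (intro continuous_intros C1_gradD(2)[OF h])
 have em[measurable]: "e : borel_measurable borel" by (rule borel_measurable_continuous_onI[OF ec])
 have ei: "integrable lborel (%x. (e x)^2)"
  by (rule lborel_integrable_compact_support[of _ R]) (use zH ec in "auto simp: e_def intro!: continuous_intros")
 have eit: "integrable lborel (%x. (e x)^2 / t^2)" using ei by simp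
 obtain B where B: "B >= 0" "!!x. norm (H x) <= B" by (rule bounded_compact_support[OF C1_gradD(2)[OF h] zH]) (assumption, rule that)
 have hl: "B-lipschitz_on UNIV h" by (rule C1_grad_lipschitz[OF h B(2)])
 define m where "m = density lborel (%x. ennreal ((e x)^2 / t^2))"
 note sm = energy_density(1)[OF em ei, of t, folded m_def] and fm = energy_density(2)[OF em ei, of t, folded m_def]
  and mA = energy_density(3)[OF em ei, where t = t, folded m_def]
 have mU: "measure m UNIV = F / t^2" using mA[of UNIV] by (simp add: F_def)
 define d where "d = F / t^2 + 1"
 have F0: "0 <= F" unfolding F_def by (rule lint_nonneg) simp
 have d1: "1 <= d" using F0 by (simp add: d_def)
 have "d <= d ^ DIM('a)" using d1 by (intro self_le_power) auto
 hence md: "measure m UNIV < d ^ DIM('a)" using mU by (simp add: d_def)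
 have dp: "0 < d" using d1 by simp
 define S where "S = stop_radius m"
 note sr = stop_radius[OF fm sm dp md, folded S_def]
 have q: "(0::real) < 1/4" by simp
 define T where "T = sup_conv (1/4) S"
 note sc = sup_conv[where S = S, OF q sr(2), folded T_def]
 have Tc: "continuous_on UNIV T" by (rule lipschitz_on_continuous_on[OF sc(4)])
 define Z where "Z = {x. T x <= 0} Int {x. e x <= t}"
 define V where "V = {x. t < e x}"
 define A where "A j = {x. 1 / real (Suc j) <= T x}" for j
 have oV: "open V" unfolding V_def by (intro open_Collect_less continuous_on_const ec)
 have cA: "closed (A j)" for j unfolding A_def by (intro closed_Collect_le continuous_on_const Tc)
 define b where "b = vitali_const TYPE('a) * (F / t^2)"
 have Ab: "emeasure lborel (A j) <= ennreal b" for j proof -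
  \<comment> \<open>Chosen because \<open>smooth_radius_cover\<close> works from
    \<open>tau / 2 = 1 / real (Suc j)\<close> on.\<close>
  have tau: "(0::real) < 2 / real (Suc j)" by simp
  obtain W where W: "W : sets borel" "emeasure lborel W <= ennreal (vitali_const TYPE('a) * measure m UNIV)"
   "!!x. 2 / real (Suc j) / 2 <= sup_conv (1/4) S x ==> cball x (smooth_radius (2 / real (Suc j)) S x) <= W"
   by (rule smooth_radius_cover[OF fm sm dp md tau, folded S_def]) (rule that)
  have "A j <= W" proof
   fix x assume x: "x : A j"
   have "2 / real (Suc j) / 2 = 1 / real (Suc j)" by (simp add: field_simps)
   hence "cball x (smooth_radius (2 / real (Suc j)) S x) <= W" using x W(3)[of x] unfolding A_def T_def mem_Collect_eq by argo
   moreover have "0 <= smooth_radius (2 / real (Suc j)) S x" using smooth_radius(5)[where S = S, OF tau sr(1,2), of x] sr(1)[of x] by linarith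
   ultimately show "x : W" by auto
  qed
  hence "emeasure lborel (A j) <= emeasure lborel W" using W(1) by (intro emeasure_mono) auto
  thus ?thesis using W(2) by (simp add: mU b_def)
 qed
 have "incseq A" proof (intro incseq_SucI subsetI)
  fix j x assume "x : A j"
  moreover have "1 / real (Suc (Suc j)) <= 1 / real (Suc j)" by (simp add: field_simps)
  ultimately show "x : A (Suc j)" unfolding A_def by simp
 qed
 hence "emeasure lborel (UN j. A j) = (SUP j. emeasure lborel (A j))" using cA by (intro SUP_emeasure_incseq[symmetric]) auto
 hence UA: "emeasure lborel (UN j. A j) <= ennreal b" using Ab by (auto intro: SUP_least)
 have Vb: "emeasure lborel V <= ennreal (F / t^2)" proof -
  have "emeasure lborel V = (NN x. indicator V x)" using oV by simp
  also have "... <= (NN x. ennreal ((e x)^2 / t^2))" proof (rule nn_integral_mono)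
   fix x
   have "1 <= (e x)^2 / t^2" if "t < e x" using that t power_mono[of t "e x" 2] by (simp add: le_divide_eq)
   thus "indicator V x <= ennreal ((e x)^2 / t^2)" by (auto simp: V_def indicator_def)
  qed
  also have "... = ennreal (F / t^2)" by (subst nn_integral_eq_integral[OF eit]) (simp_all add: F_def)
  finally show ?thesis .
 qed
 have "- Z <= (UN j. A j) Un V" proof
  fix x assume "x : - Z"
  then consider "0 < T x" | "t < e x" by (auto simp: Z_def)
  thus "x : (UN j. A j) Un V" proof cases
   case 1
   then obtain j where "1 / real (Suc j) < T x" using reals_Archimedean by (auto simp: inverse_eq_divide)
   thus ?thesis by (auto simp: A_def intro: less_imp_le)
  qed (auto simp: V_def)
 qed
 hence "emeasure lborel (- Z) <= emeasure lborel ((UN j. A j) Un V)" using cA oV by (intro emeasure_mono) auto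
 also have "... <= emeasure lborel (UN j. A j) + emeasure lborel V" using cA oV by (intro emeasure_subadditive) auto
 also have "... <= ennreal b + ennreal (F / t^2)" by (intro add_mono UA Vb)
 also have "... = ennreal ((vitali_const TYPE('a) + 1) * (F / t^2))"
  using F0 constants_pos(5)[where 'a='a] unfolding b_def distrib_right by (subst ennreal_plus) auto
 finally have bound: "emeasure lborel (- Z) <= ennreal ((vitali_const TYPE('a) + 1) * (F / t^2))" .
 define c where "c = tent_mass TYPE('a)"
 have cpos: "0 < c" unfolding c_def by (rule tent_mass_pos)
 define C where "C = maximal_const TYPE('a) * t"
 have C0: "0 <= C" unfolding C_def maximal_const_def using t cpos constants_pos(4)[where 'a='a] by (simp add: c_def)
 have lip: "C-lipschitz_on Z h" proof (rule lipschitz_onI[OF _ C0])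
  fix x y assume xy: "x : Z" "y : Z"
  \<comment> \<open>On \<open>Z\<close> the radius is at most \<open>tau / 2\<close>, so the average
    equals \<open>c * h\<close> up to a multiple of \<open>tau\<close>, while its Lipschitz constant
    does not involve \<open>tau\<close>. Afterwards \<open>tau\<close> tends to 0.\<close>
  have *: "c * <|h x - h y|> <= c * C * dist x y + tau * (B * c)" if tau: "0 < tau" for tau proof -
   define s where "s = smooth_radius tau S"
   note ss = smooth_radius[where S = S, OF tau sr(1,2), folded s_def T_def]
   obtain G where G: "C1_grad s G" "!!x. norm (G x) <= 1/4" using ss(1) by auto
   have spos: "0 < s x" for x using ss(6)[of x] tau by linarith
   define q where "q x = tent_mean s h x" for x
   define Q where "Q x = (LBINT z. tent z *. (H (x + s x *. z) + (H (x + s x *. z) <.> z) *. G x))" for x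
   have qQ: "C1_grad q Q" and Qi: "integrable lborel (%z. tent z *. (H (x + s x *. z) + (H (x + s x *. z) <.> z) *. G x))" for x
    unfolding q_def Q_def by (rule C1_tent_average[OF h z G]; assumption)+
   have eH: "norm (H x) <= e x" for x by (simp add: e_def)
   have "norm (Q x) <= c * C" for x proof -
    have "measure m (cball x (s x)) <= s x ^ DIM('a)" using sr(3)[OF ss(5)] spos[of x] by (simp add: less_imp_le)
    hence "(LBINT y. indicator (cball x (s x)) y * (e y)^2) <= t^2 * s x ^ DIM('a)"
     unfolding mA[OF borel_closed[OF closed_cball]] pos_divide_le_eq[OF zero_less_power[OF t]] by (simp only: mult.commute)
    from tent_average_gradient_bound[OF ec eH spos G(2) t this Qi]
    have "norm (Q x) <= (5/8) * tent_max TYPE('a) * t * (unit_ball_vol DIM('a) + 1)" by (simp add: Q_def)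
    also have "... = c * C" using cpos by (simp add: C_def maximal_const_def c_def)
    finally show ?thesis .
   qed
   hence ql: "(c * C)-lipschitz_on UNIV q" by (rule C1_grad_lipschitz[OF qQ])
   have close: "<|q x - c * h x|> <= tau / 2 * (B * c)" if "x : Z" for x proof -
    have sx: "s x <= tau / 2" using ss(4)[of x] that by (simp add: Z_def)
    obtain B' where B': "!!x. norm (h x) <= B'" by (rule bounded_compact_support[OF C1_grad_continuous[OF h] z]) (assumption, rule that)
    have i1: "integrable lborel (%z. h (x + s x *. z) * tent z)" by (rule tent_average_integrable[OF C1_grad_borel(1)[OF h]]) (use B' in auto)
    have i2: "integrable lborel (%z. h x * tent (z::'a))" by (intro integrable_mult_right integrable_tent)
    have "q x - c * h x = (LBINT z. h (x + s x *. z) * tent z - h x * tent z)" using i1 i2 by (simp add: q_def c_def tent_mass_def)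
    also have "<|...|> <= (LBINT z. norm (h (x + s x *. z) * tent z - h x * tent z))"
     using integral_norm_bound[of lborel "%z. h (x + s x *. z) * tent z - h x * tent z"] by simp
    also have "... <= (LBINT z. (B * (tau / 2)) * tent (z::'a))" proof (rule integral_mono)
     show "norm (h (x + s x *. z) * tent z - h x * tent z) <= (B * (tau / 2)) * tent z" for z proof (cases "1 <= norm z")
      case False
      have "<|h (x + s x *. z) - h x|> <= B * (s x * norm z)" using lipschitz_onD[OF hl, of "x + s x *. z" x] spos[of x] by (simp add: dist_norm)
      also have "... <= B * (tau / 2 * 1)" using False sx B(1) tau by (intro mult_left_mono mult_mono) auto
      finally have "<|h (x + s x *. z) - h x|> * tent z <= B * (tau / 2) * tent z" by (intro mult_right_mono tent_nonneg) simp
      thus ?thesis by (simp add: left_diff_distrib[symmetric] abs_mult tent_nonneg)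
     qed (simp add: tent_outside)
    qed (use i1 i2 in "auto intro!: integrable_mult_right integrable_tent")
    also have "... = tau / 2 * (B * c)" by (simp add: c_def tent_mass_def)
    finally show ?thesis .
   qed
   have "<|q x - q y|> <= c * C * dist x y" using lipschitz_onD[OF ql, of x y] by (simp add: dist_real_def)
   moreover have "c * <|h x - h y|> = <|c * h x - c * h y|>" using cpos by (simp add: abs_mult right_diff_distrib[symmetric])
   moreover have "<|c * h x - c * h y|> <= <|q x - c * h x|> + <|q x - q y|> + <|q y - c * h y|>" by linarith
   moreover have "tau / 2 * (B * c) + tau / 2 * (B * c) = tau * (B * c)" by simp
   ultimately show ?thesis using close[OF xy(1)] close[OF xy(2)] by linarith
  qed
  have "c * <|h x - h y|> <= c * C * dist x y" proof (rule field_le_epsilon)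
   fix u :: real assume u: "0 < u"
   have Bc: "0 <= B * c" using B(1) cpos by simp
   have "u / (B * c + 1) * (B * c) <= u" using u Bc by (simp add: divide_le_eq algebra_simps)
   thus "c * <|h x - h y|> <= c * C * dist x y + u" using *[of "u / (B * c + 1)"] u Bc by fastforce
  qed
  thus "dist (h x) (h y) <= C * dist x y" using cpos by (simp add: dist_real_def mult.assoc)
 qed
 show thesis proof (rule that[of Z])
  show "closed Z" unfolding Z_def by (intro closed_Int closed_Collect_le continuous_on_const Tc ec)
  show "norm (H x) <= t" if "x : Z" for x using that by (simp add: Z_def e_def)
 qed (use lip bound in "auto simp: C_def F_def e_def")
qed

section \<open>Lipschitz functions agree with C1 functions off small sets\<close>

lemma suminf_ennreal_half:
 assumes "0 <= e" shows "(\<Sum>i. ennreal (e * (1/2) ^ i)) = ennreal (2 * e)" proof -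
 have "(\<Sum>i. e * (1/2) ^ i) = 2 * e" by (subst suminf_mult) (auto simp: suminf_geometric)
 thus ?thesis using assms by (subst suminf_ennreal2) (auto intro!: summable_mult summable_geometric)
qed

lemma maximal_const_nonneg: "0 <= maximal_const TYPE('a::euclidean_space)"
 unfolding maximal_const_def using constants_pos(4)[where 'a='a] tent_mass_pos[where 'a='a] by simp

text \<open>The function is clamped between plus and minus a cone that dominates it on the ball of
  radius \<open>R\<close> and vanishes beyond radius \<open>R + 1\<close>.\<close>

lemma lipschitz_truncation:
 fixes F :: "'a::real_normed_vector => real"
 assumes F: "L-lipschitz_on UNIV F" and R: "0 <= R"
 obtains K F0 where "K-lipschitz_on UNIV F0" "!!x. norm x <= R ==> F0 x = F x" "!!x. R + 1 <= norm x ==> F0 x = 0" proof -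
 define B where "B = <|F 0|> + L * R"
 define psi where "psi x = max 0 (B * (R + 1 - norm x))" for x :: 'a
 define F0 where "F0 x = max (- psi x) (min (F x) (psi x))" for x
 have L0: "0 <= L" by (rule lipschitz_on_nonneg[OF F])
 have B0: "0 <= B" using L0 R by (simp add: B_def)
 show thesis proof (rule that[of "L + B" F0])
  show "(L + B)-lipschitz_on UNIV F0" proof (rule lipschitz_onI)
   fix x y :: 'a
   have "<|norm x - norm y|> <= dist x y" by (simp add: dist_norm norm_triangle_ineq3)
   hence "<|B * (norm x - norm y)|> <= B * dist x y" using B0 by (simp add: abs_mult mult_left_mono)
   moreover have "B * (R + 1 - norm x) - B * (R + 1 - norm y) = - (B * (norm x - norm y))" by (simp add: algebra_simps)
   ultimately have "<|psi x - psi y|> <= B * dist x y" unfolding psi_def by linarith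
   moreover have "<|F x - F y|> <= L * dist x y" using lipschitz_onD[OF F, of x y] by (simp add: dist_real_def)
   moreover have "0 <= B * dist x y" "0 <= L * dist x y" using B0 L0 by auto
   ultimately have "<|F0 x - F0 y|> <= L * dist x y + B * dist x y" unfolding F0_def by linarith
   thus "dist (F0 x) (F0 y) <= (L + B) * dist x y" by (simp add: dist_real_def distrib_right)
  qed (use L0 B0 in simp)
  show "F0 x = F x" if "norm x <= R" for x proof -
   have "<|F x - F 0|> <= L * norm x" using lipschitz_onD[OF F, of x 0] by (simp add: dist_real_def)
   moreover have "L * norm x <= L * R" by (rule mult_left_mono[OF that L0])
   ultimately have "<|F x|> <= B" unfolding B_def by linarith
   moreover have "B * 1 <= B * (R + 1 - norm x)" using that B0 by (intro mult_left_mono) auto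
   ultimately show ?thesis unfolding F0_def psi_def by linarith
  qed
  show "F0 x = 0" if "R + 1 <= norm x" for x proof -
   have "B * (R + 1 - norm x) <= 0" using B0 that by (simp add: mult_nonneg_nonpos)
   hence "psi x = 0" by (simp add: psi_def)
   thus ?thesis by (simp add: F0_def)
  qed
 qed
qed

text \<open>The families consist of C1 functions within \<open>(1/2) ^ i\<close> of the truncated
  function and with the same Lipschitz bound. Closeness of consecutive gradients in L2 is upgraded
  by the maximal estimate to small Lipschitz constants on large closed sets, the form of convergence
  that \<open>C1_from_lipschitz_cauchy\<close> needs.\<close>

lemma lipschitz_C1_on_compact:
 fixes F :: "'a::euclidean_space => real"
 assumes F: "L-lipschitz_on UNIV F" and R: "0 <= R" and e: "0 < e"
 shows "EX A g G. compact A & A <= cball 0 R & C1_grad g G & (ALL x:A. g x = F x) & emeasure lborel (cball 0 R - A) <= ennreal e" proof -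
 obtain K F0 where K: "K-lipschitz_on UNIV F0" and F0: "!!x. norm x <= R ==> F0 x = F x" "!!x. R + 1 <= norm x ==> F0 x = 0"
  by (rule lipschitz_truncation[OF F R]) (rule that)
 have K0: "0 <= K" by (rule lipschitz_on_nonneg[OF K])
 define C where "C i = {(g, G). C1_grad g G & (ALL x. norm (G x) <= K) & (ALL x. <|g x - F0 x|> <= (1/2) ^ i) & (ALL x. R + 2 < norm x --> g x = 0)}" for i
 have CD: "C1_grad (fst p) (snd p)" "norm (snd p x) <= K" "<|fst p x - F0 x|> <= (1/2) ^ i" "R + 2 < norm x ==> fst p x = 0" if "p : C i" for p i x
  using that by (auto simp: C_def)
 have Ci: "integrable lborel (%x. (norm (snd p x))^2)" if "p : C i" for p i by (rule lborel_integrable_compact_support[of _ "R + 2"])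
    (use C1_grad_outside[OF CD(1,4)[OF that]] in "auto intro!: continuous_intros C1_gradD(2)[OF CD(1)[OF that]]")
 define v where "v = vitali_const TYPE('a) + 1"
 have v: "0 < v" using constants_pos(5)[where 'a='a] unfolding v_def by linarith
 \<comment> \<open>Divided by the squared threshold \<open>((1/2) ^ i)^2\<close> and multiplied by
   \<open>v\<close>, this leaves \<open>e / 2 * (1/2) ^ i\<close>, with sum
   \<open>e\<close>.\<close>
 define tol where "tol i = e / (2 * v) * ((1/2) ^ i * ((1/2) ^ i)^2)" for i :: nat
 have "EX p. ALL i. p i : C i & integrable lborel (%x. (norm (snd (p i) x - snd (p (Suc i)) x))^2) &
  (LBINT x. (norm (snd (p i) x - snd (p (Suc i)) x))^2) <= tol i"
 proof (rule convex_energy_selection[where C = C and G = snd and B = "LINT x|lborel. K^2 * indicator (cball (0::'a) (R + 2)) x"])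
  show "C i ~= {}" for i proof -
   define r where "r = (1/2) ^ i / (K + 1)"
   have r: "0 < r" using K0 by (simp add: r_def)
   have "(1/2) ^ i <= (1::real)" by (simp add: power_le_one)
   moreover have "r <= (1/2) ^ i" using K0 by (simp add: r_def divide_le_eq)
   ultimately have r1: "r <= 1" by linarith
   have Kr: "K * <|r|> <= (1/2) ^ i" using r K0 by (simp add: r_def divide_le_eq algebra_simps)
   obtain G where G: "C1_grad (mollify r F0) G" using mollify_C1[OF lipschitz_on_continuous_on[OF K] r] by auto
   have "mollify r F0 x = 0" if x: "R + 2 < norm x" for x proof -
    have "mollify r F0 x = mollify r (%_. 0) x" proof (rule mollify_cong)
     fix y assume "dist x y <= <|r|>"
     hence "norm x - norm y <= 1" using r r1 norm_triangle_ineq2[of x y] by (simp add: dist_norm)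
     thus "F0 y = 0" using x by (intro F0(2)) linarith
    qed
    thus ?thesis by (simp add: mollify_const)
   qed
   hence "(mollify r F0, G) : C i" using G C1_grad_bound[OF G mollify_lipschitz[OF K]] order_trans[OF mollify_close[OF K] Kr] by (auto simp: C_def)
   thus ?thesis by auto
  qed
  show "C (Suc i) <= C i" for i proof
   fix p assume p: "p : C (Suc i)"
   have "(1/2) ^ Suc i <= (1/2 :: real) ^ i" by simp
   hence "<|fst p x - F0 x|> <= (1/2) ^ i" for x using CD(3)[OF p, of x] by linarith
   thus "p : C i" using p unfolding C_def by auto
  qed
  show "EX r:C i. ALL x. snd r x = (1/2) *. (snd p x + snd q x)" if p: "p : C i" and q: "q : C i" for i p q
  proof (rule bexI[of _ "midpoint_pair p q"])
   show "midpoint_pair p q : C i" using midpoint_pair(1)[OF CD(1)[OF p] CD(1)[OF q]] midpoint_pair(2)[OF CD(2)[OF p] CD(2)[OF q]]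
     midpoint_pair(3)[OF CD(3)[OF p] CD(3)[OF q]] CD(4)[OF p] CD(4)[OF q] unfolding C_def by (auto simp: midpoint_pair_def)
  qed (simp add: midpoint_pair(4))
  show "(LBINT x. (norm (snd p x))^2) <= (LBINT x. K^2 * indicator (cball (0::'a) (R + 2)) x)" if "p : C i" for i p
  proof (rule integral_mono[OF Ci[OF that]])
   show "(norm (snd p x))^2 <= K^2 * indicator (cball 0 (R + 2)) x" for x
    using CD(2)[OF that, of x] C1_grad_outside[OF CD(1)[OF that] CD(4)[OF that]] by (auto simp: indicator_def not_le intro!: power_mono)
  qed (auto intro!: integrable_mult_right integrable_indicator_bounded)
  show "0 < tol i" for i using e v by (simp add: tol_def)
 qed (use Ci C1_gradD(2)[OF CD(1)] in auto)
 then obtain p where p: "!!i. p i : C i" "!!i. (LBINT x. (norm (snd (p i) x - snd (p (Suc i)) x))^2) <= tol i" by blast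
 define g where "g i = fst (p i)" for i
 define G where "G i = snd (p i)" for i
 have gG: "C1_grad (g i) (G i)" for i unfolding g_def G_def by (rule CD(1)[OF p(1)])
 have "EX Z. closed Z & (ALL x:Z. norm (G (Suc i) x - G i x) <= (1/2) ^ i) & (maximal_const TYPE('a) * (1/2) ^ i)-lipschitz_on Z (%x. g (Suc i) x - g i x)
  & emeasure lborel (- Z) <= ennreal (e / 2 * (1/2) ^ i)" for i proof -
  have z: "g (Suc i) x - g i x = 0" if "R + 2 < norm x" for x using CD(4)[OF p(1) that] by (simp add: g_def)
  have t: "(0::real) < (1/2) ^ i" by simp
  obtain Z where Z: "closed Z" "!!x. x : Z ==> norm (G (Suc i) x - G i x) <= (1/2) ^ i"
   "(maximal_const TYPE('a) * (1/2) ^ i)-lipschitz_on Z (%x. g (Suc i) x - g i x)"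
   "emeasure lborel (- Z) <= ennreal (v * ((LBINT x. (norm (G (Suc i) x - G i x))^2) / ((1/2) ^ i)^2))"
   by (rule C1_maximal_estimate[OF C1_grad_diff[OF gG[of "Suc i"] gG[of i]] z t, folded v_def]) (assumption, rule that)
  have "(LBINT x. (norm (G (Suc i) x - G i x))^2) <= tol i" using p(2)[of i] by (simp add: G_def norm_minus_commute)
  hence "v * ((LBINT x. (norm (G (Suc i) x - G i x))^2) / ((1/2) ^ i)^2) <= v * (tol i / ((1/2) ^ i)^2)"
   using v by (intro mult_left_mono divide_right_mono) auto
  also have "... = e / 2 * (1/2) ^ i" using v by (simp add: tol_def)
  finally have "emeasure lborel (- Z) <= ennreal (e / 2 * (1/2) ^ i)" by (intro order_trans[OF Z(4)] ennreal_leI)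
  thus ?thesis using Z(1-3) by blast
 qed
 hence "ALL i. EX Z. closed Z & (ALL x:Z. norm (G (Suc i) x - G i x) <= (1/2) ^ i) & (maximal_const TYPE('a) * (1/2) ^ i)-lipschitz_on Z (%x. g (Suc i) x - g i x)
  & emeasure lborel (- Z) <= ennreal (e / 2 * (1/2) ^ i)" ..
 from choice[OF this]
 obtain Z where Z: "!!i. closed (Z i)" "!!i x. x : Z i ==> norm (G (Suc i) x - G i x) <= (1/2) ^ i"
  "!!i. (maximal_const TYPE('a) * (1/2) ^ i)-lipschitz_on (Z i) (%x. g (Suc i) x - g i x)"
  "!!i. emeasure lborel (- Z i) <= ennreal (e / 2 * (1/2) ^ i)" by blast
 define A where "A = cball 0 R Int (INT i. Z i)"
 define c where "c = maximal_const TYPE('a) + 1"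
 have mc: "0 <= maximal_const TYPE('a)" by (rule maximal_const_nonneg)
 have h: "c / 2 ^ i = maximal_const TYPE('a) * (1/2) ^ i + (1/2) ^ i" for i by (simp add: c_def power_one_over add_divide_distrib)
 have cA: "compact A" unfolding A_def using Z(1) by (intro compact_Int_closed compact_cball closed_INT) auto
 have "EX q Q. C1_grad q Q & (ALL x:A. q x = F0 x)" proof (rule C1_from_lipschitz_cauchy[where A = A and g = g and G = G and f = F0 and c = c])
  show "compact A" by (rule cA)
  show "c > 0" using mc by (simp add: c_def)
  show "C1_grad (g i) (G i)" for i by (rule gG)
  show "(c / 2 ^ i)-lipschitz_on A (%x. g (Suc i) x - g i x)" for i by (rule lipschitz_on_mono[OF Z(3)[of i]]) (auto simp: A_def h)
  show "norm (G (Suc i) x - G i x) <= c / 2 ^ i" if "x : A" for i x proof -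
   have "norm (G (Suc i) x - G i x) <= (1/2) ^ i" using that by (intro Z(2)) (simp add: A_def)
   moreover have "0 <= maximal_const TYPE('a) * (1/2) ^ i" using mc by simp
   ultimately show ?thesis unfolding h by linarith
  qed
  show "(%i. g i x) ----> F0 x" for x proof -
   have "(%i. g i x - F0 x) ----> 0"
    by (rule Lim_null_comparison[of _ "%i. (1/2) ^ i"]) (use CD(3)[OF p(1)] in "auto simp: g_def intro!: LIMSEQ_realpow_zero")
   thus ?thesis by (simp add: LIM_zero_cancel)
  qed
 qed blast
 then obtain q Q where q: "C1_grad q Q" "!!x. x : A ==> q x = F0 x" by blast
 have "emeasure lborel (cball 0 R - A) <= emeasure lborel (UN i. - Z i)" using Z(1) by (intro emeasure_mono) (auto simp: A_def)
 also have "... <= (\<Sum>i. emeasure lborel (- Z i))" using Z(1) by (intro emeasure_subadditive_countably) auto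
 also have "... <= (\<Sum>i. ennreal (e / 2 * (1/2) ^ i))" by (intro suminf_le Z(4)) auto
 also have "... = ennreal e" by (rule trans[OF suminf_ennreal_half]) (use e in simp_all)
 finally have "emeasure lborel (cball 0 R - A) <= ennreal e" .
 moreover have "A <= cball 0 R" by (auto simp: A_def)
 moreover have "ALL x:A. q x = F x" using q(2) F0(1) by (auto simp: A_def)
 ultimately show ?thesis using cA q(1) by blast
qed

text \<open>Finitely many functions share the compact sets, because they will be the components of
  one map.\<close>

lemma lipschitz_C1_cover:
 fixes F :: "'b => 'a::euclidean_space => real"
 assumes B: "finite B" and F: "!!b. b : B ==> EX L. L-lipschitz_on UNIV (F b)"
 obtains A g G where "!!j::nat. compact (A j)" "!!j b. b : B ==> C1_grad (g j b) (G j b)" "!!j b x. b : B ==> x : A j ==> g j b x = F b x"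
  "emeasure lborel (- (UN j. A j)) = 0" proof -
 have "EX A g G. compact A & A <= cball 0 (real R) & (ALL b:B. C1_grad (g b) (G b) & (ALL x:A. g b x = F b x)) &
  emeasure lborel (cball 0 (real R) - A) <= ennreal (1 / real (Suc m))" for R m proof -
  define e where "e = 1 / (real (Suc m) * (real (card B) + 1))"
  have e: "0 < e" by (simp add: e_def)
  have "EX A g G. compact A & A <= cball 0 (real R) & C1_grad g G & (ALL x:A. g x = F b x) & emeasure lborel (cball 0 (real R) - A) <= ennreal e"
   if "b : B" for b using F[OF that] lipschitz_C1_on_compact[of _ "F b" "real R" e] e by auto
  then obtain A g G where A: "!!b. b : B ==> compact (A b) & A b <= cball 0 (real R) & C1_grad (g b) (G b) & (ALL x:A b. g b x = F b x)
   & emeasure lborel (cball 0 (real R) - A b) <= ennreal e" by metis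
  have cl: "closed (A b)" if "b : B" for b using A[OF that] compact_imp_closed by blast
  show ?thesis proof (intro exI conjI)
   show "compact (cball 0 (real R) Int (INT b:B. A b))" using cl by (intro compact_Int_closed compact_cball closed_INT) auto
   show "ALL b:B. C1_grad (g b) (G b) & (ALL x:cball 0 (real R) Int (INT b:B. A b). g b x = F b x)" using A by auto
   have "emeasure lborel (cball 0 (real R) - cball 0 (real R) Int (INT b:B. A b)) <= emeasure lborel (UN b:B. cball 0 (real R) - A b)"
   proof (rule emeasure_mono)
    show "(UN b:B. cball 0 (real R) - A b) : sets lborel" using cl by (intro sets.finite_UN B) auto
   qed auto
   also have "... <= (SUM b:B. emeasure lborel (cball 0 (real R) - A b))" using cl B by (intro emeasure_subadditive_finite) auto
   also have "... <= (SUM b:B. ennreal e)" using A by (intro sum_mono) auto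
   also have "... = ennreal (real (card B) * e)" using e by (simp add: ennreal_mult ennreal_of_nat_eq_real_of_nat)
   also have "... <= ennreal (1 / real (Suc m))" proof (rule ennreal_leI)
    have "real (card B) * e <= (real (card B) + 1) * e" using e by (intro mult_right_mono) auto
    also have "... = 1 / real (Suc m)" unfolding e_def by (simp add: divide_simps)
    finally show "real (card B) * e <= 1 / real (Suc m)" .
   qed
   finally show "emeasure lborel (cball 0 (real R) - cball 0 (real R) Int (INT b:B. A b)) <= ennreal (1 / real (Suc m))" .
  qed auto
 qed
 then obtain A g G where A: "!!R m. compact (A R m)" "!!R m b. b : B ==> C1_grad (g R m b) (G R m b)"
   "!!R m b x. b : B ==> x : A R m ==> g R m b x = F b x"
   "!!R m. emeasure lborel (cball 0 (real R) - A R m) <= ennreal (1 / real (Suc m))" by metis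
 have "(UN j. A (fst (prod_decode j)) (snd (prod_decode j))) = (\<Union>R m. A R m)" proof (intro set_eqI iffI)
  fix x assume "x : (\<Union>R m. A R m)"
  then obtain R m where "x : A R m" by auto
  thus "x : (UN j. A (fst (prod_decode j)) (snd (prod_decode j)))" by (intro UN_I[of "prod_encode (R, m)"]) auto
 qed auto
 moreover have "emeasure lborel (- (\<Union>R m. A R m)) = 0" proof -
  define U where "U = (\<Union>R m. A R m)"
  have Um: "U : sets borel" unfolding U_def using A(1) by (intro sets.countable_UN) (auto intro: borel_compact)
  have "emeasure lborel (cball 0 (real R) - U) = 0" for R proof -
   have "emeasure lborel (cball 0 (real R) - U) <= ennreal (1 / real (Suc m))" for m
    by (rule order_trans[OF emeasure_mono A(4)[of R m]]) (use borel_compact[OF A(1)] in "auto simp: U_def")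
   moreover have "(%m. ennreal (1 / real (Suc m))) ----> ennreal 0" by (intro tendsto_ennrealI LIMSEQ_Suc lim_1_over_n)
   ultimately have "emeasure lborel (cball 0 (real R) - U) <= ennreal 0" by (intro LIMSEQ_le_const) auto
   thus ?thesis by simp
  qed
  hence "(UN R. cball 0 (real R) - U) : null_sets lborel" using Um by (intro null_sets_UN) (auto intro!: null_setsI)
  moreover have "- U = (UN R. cball 0 (real R) - U)" using real_arch_simple by auto
  ultimately show ?thesis unfolding U_def[symmetric] by auto
 qed
 ultimately show thesis using that[of "%j. A (fst (prod_decode j)) (snd (prod_decode j))" "%j. g (fst (prod_decode j)) (snd (prod_decode j))"
   "%j. G (fst (prod_decode j)) (snd (prod_decode j))"] A by auto
qed

section \<open>Hausdorff null sets\<close>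

lemma hausdorff_null_iff:
 "hnull k A \<longleftrightarrow> (ALL dl>0. ALL e>0. EX U::nat => 'a::metric_space set. A <= (UN i. U i) &
   (ALL i. bounded (U i) & diameter (U i) <= dl) & (\<Sum>i. hausdorff_weight k (U i)) <= ennreal e)" proof (intro iffI allI impI)
 fix dl e :: real assume H: "hnull k A" and dl: "0 < dl" and e: "0 < e"
 have "hausdorff_premeasure k dl A <= hausdorff_measure k A" unfolding hausdorff_measure_def using dl by (intro SUP_upper) auto
 hence "hausdorff_premeasure k dl A < ennreal e" using H e by simp
 thus "EX U. A <= (UN i. U i) & (ALL i. bounded (U i) & diameter (U i) <= dl) & (\<Sum>i. hausdorff_weight k (U i)) <= ennreal e"
  unfolding hausdorff_premeasure_def INF_less_iff using less_imp_le by blast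
next
 assume R: "ALL dl>0. ALL e>0. EX U. A <= (UN i. U i) & (ALL i. bounded (U i) & diameter (U i) <= dl) & (\<Sum>i. hausdorff_weight k (U i)) <= ennreal e"
 have "hausdorff_premeasure k dl A <= 0" if d: "dl : {0<..}" for dl proof (rule ennreal_le_epsilon)
  fix e :: real assume "0 < e"
  then obtain U where "A <= (UN i. U i)" "ALL i. bounded (U i) & diameter (U i) <= dl" "(\<Sum>i. hausdorff_weight k (U i)) <= ennreal e"
   using R[rule_format, of dl e] d by auto
  thus "hausdorff_premeasure k dl A <= 0 + ennreal e" unfolding hausdorff_premeasure_def by (intro INF_lower2[of U]) auto
 qed
 hence "hausdorff_measure k A <= 0" unfolding hausdorff_measure_def by (intro SUP_least)
 thus "hnull k A" by simp
qed

lemma hausdorff_null_subset: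
 assumes "hnull k B" "A <= B"
 shows "hnull k A" proof -
 have "hausdorff_measure k A <= hausdorff_measure k B" unfolding hausdorff_measure_def hausdorff_premeasure_def
  by (intro SUP_mono' INF_superset_mono) (use assms(2) in auto)
 thus ?thesis using assms(1) by simp
qed

lemma hausdorff_null_UN:
 fixes A :: "nat => 'a::metric_space set"
 assumes A: "!!i. hnull k (A i)"
 shows "hnull k (UN i. A i)" unfolding hausdorff_null_iff proof (intro allI impI)
 fix dl e :: real assume dl: "0 < dl" and e: "0 < e"
 have "EX U. A i <= (\<Union>j::nat. U j) & (ALL j. bounded (U j) & diameter (U j) <= dl) & (\<Sum>j. hausdorff_weight k (U j)) <= ennreal (e / 2 * (1/2) ^ i)" for i
  using A[of i] dl e unfolding hausdorff_null_iff by simp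
 hence "EX U. ALL i. A i <= (\<Union>j::nat. U i j) & (ALL j. bounded (U i j) & diameter (U i j) <= dl) & (\<Sum>j. hausdorff_weight k (U i j)) <= ennreal (e / 2 * (1/2) ^ i)"
  by (intro choice allI)
 then obtain U where U: "!!i. A i <= (\<Union>j::nat. U i j)" "!!i j. bounded (U i j)" "!!i j. diameter (U i j) <= dl"
  "!!i. (\<Sum>j. hausdorff_weight k (U i j)) <= ennreal (e / 2 * (1/2) ^ i)" by blast
 define V where "V m = (case prod_decode m of (i, j) => U i j)" for m
 have "(\<Sum>m. hausdorff_weight k (V m)) = (\<Sum>i. \<Sum>j. hausdorff_weight k (U i j))"
  using suminf_ennreal_2dimen[of "%i. \<Sum>j. hausdorff_weight k (U i j)" "%(i, j). hausdorff_weight k (U i j)"] by (simp add: V_def split_def)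
 also have "... <= (\<Sum>i. ennreal (e / 2 * (1/2) ^ i))" by (intro suminf_le U(4)) auto
 also have "... = ennreal e" by (rule trans[OF suminf_ennreal_half]) (use e in simp_all)
 finally have "(\<Sum>m. hausdorff_weight k (V m)) <= ennreal e" .
 moreover have "(UN i. A i) <= (UN m. V m)" proof
  fix x assume "x : (UN i. A i)"
  then obtain i j where "x : U i j" using U(1) by blast
  hence "x : V (prod_encode (i, j))" by (simp add: V_def)
  thus "x : (UN m. V m)" by blast
 qed
 ultimately show "EX U. (UN i. A i) <= (UN m. U m) & (ALL m. bounded (U m) & diameter (U m) <= dl) & (\<Sum>m. hausdorff_weight k (U m)) <= ennreal e"
  using U(2,3) by (intro exI[of _ V]) (auto simp: V_def split: prod.split)
qed

lemma hausdorff_null_Un: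
 assumes "hnull k A" "hnull k B"
 shows "hnull k (A Un B)" proof (rule hausdorff_null_subset)
 show "hnull k (\<Union>i::nat. if i = 0 then A else B)" using assms by (intro hausdorff_null_UN) simp
 show "A Un B <= (\<Union>i::nat. if i = 0 then A else B)" by (auto intro: UN_I[of 0] UN_I[of 1])
qed

text \<open>The sum of weights is written as an integral for counting measure on the covering
  family, the form in which Tonelli's theorem applies. In the enumeration spare indices receive the
  empty set, which has weight 0 even for \<open>k = 0\<close>.\<close>

lemma hausdorff_null_countable:
 fixes A :: "'a::metric_space set"
 assumes "!!dl e :: real. 0 < dl ==> 0 < e ==> EX D. countable D & A <= \<Union>D & (ALL K:D. bounded K & diameter K <= dl) &
  (\<integral>\<^sup>+K. hausdorff_weight k K \<partial>count_space D) <= ennreal e"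
 shows "hnull k A" unfolding hausdorff_null_iff proof (intro allI impI)
 fix dl e :: real assume dl: "0 < dl" and e: "0 < e"
 obtain D where D: "countable D" "A <= \<Union>D" "!!K. K : D ==> bounded K" "!!K. K : D ==> diameter K <= dl"
  "(\<integral>\<^sup>+K. hausdorff_weight k K \<partial>count_space D) <= ennreal e" using assms[OF dl e] by blast
 define T where "T = to_nat_on D ` D"
 define U where "U m = (if m : T then from_nat_into D m else {})" for m
 have mem: "from_nat_into D m : D" if "m : T" for m using that D(1) by (auto simp: T_def)
 have "(\<Sum>m. hausdorff_weight k (U m)) = (\<integral>\<^sup>+m. hausdorff_weight k (U m) \<partial>count_space UNIV)"
  by (simp add: nn_integral_count_space_nat)
 also have "... = (\<integral>\<^sup>+m. hausdorff_weight k (U m) \<partial>count_space T)"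
  by (rule nn_integral_count_space_eq[symmetric]) (auto simp: U_def hausdorff_weight_def)
 also have "... = (\<integral>\<^sup>+K. hausdorff_weight k (U (to_nat_on D K)) \<partial>count_space D)"
  by (rule nn_integral_bij_count_space[symmetric]) (use D(1) in "auto simp: T_def intro: inj_on_imp_bij_betw")
 also have "... = (\<integral>\<^sup>+K. hausdorff_weight k K \<partial>count_space D)"
  by (rule nn_integral_cong) (use D(1) in "auto simp: U_def T_def")
 finally have "(\<Sum>m. hausdorff_weight k (U m)) <= ennreal e" using D(5) by simp
 moreover have "A <= (UN m. U m)" proof
  fix x assume "x : A"
  then obtain K where "K : D" "x : K" using D(2) by blast
  hence "x : U (to_nat_on D K)" using D(1) by (auto simp: U_def T_def)
  thus "x : (UN m. U m)" by blast
 qed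
 ultimately show "EX U. A <= (UN m. U m) & (ALL m. bounded (U m) & diameter (U m) <= dl) & (\<Sum>m. hausdorff_weight k (U m)) <= ennreal e"
  using D(3,4) mem dl by (intro exI[of _ U]) (auto simp: U_def)
qed

lemma diameter_le_dist:
 fixes U :: "'a::real_normed_vector set"
 assumes "!!x y. x : U ==> y : U ==> dist x y <= d" "0 <= d"
 shows "bounded U" "diameter U <= d" using assms by (auto intro!: diameter_le simp: dist_norm[symmetric] bounded_two_points)

lemma hausdorff_weight_le:
 fixes U :: "'a::real_normed_vector set"
 assumes "!!x y. x : U ==> y : U ==> dist x y <= d" "0 <= d"
 shows "hausdorff_weight k U <= ennreal (unit_ball_vol k * d ^ k)" proof -
 have "diameter U / 2 <= d" "0 <= diameter U" using diameter_le_dist[of U d] assms diameter_ge_0[of U] by auto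
 hence "(diameter U / 2) ^ k <= d ^ k" by (intro power_mono) auto
 thus ?thesis by (auto simp: hausdorff_weight_def intro!: ennreal_leI mult_left_mono)
qed

text \<open>The images of the level sets of a labelling form the cover, so that a covering argument
  becomes a count of labels.\<close>

lemma hausdorff_null_labels:
 fixes f :: "'b => 'a::real_normed_vector"
 assumes lab: "!!dl e :: real. 0 < dl ==> 0 < e ==> EX (lab :: 'b => 'c) N d. finite (lab ` Y) & real (card (lab ` Y)) <= N & 0 <= d & d <= dl &
   N * d ^ k <= e & (ALL x:Y. ALL y:Y. lab x = lab y --> dist (f x) (f y) <= d)"
 shows "hnull k (f ` Y)" proof (rule hausdorff_null_countable)
 fix dl e :: real assume dl: "0 < dl" and e: "0 < e"
 define v where "v = unit_ball_vol (real k)"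
 have v: "0 < v" by (simp add: v_def)
 obtain lab :: "'b => 'c" and N d where L: "finite (lab ` Y)" "real (card (lab ` Y)) <= N" "0 <= d" "d <= dl" "N * d ^ k <= e / v"
  "!!x y. x : Y ==> y : Y ==> lab x = lab y ==> dist (f x) (f y) <= d" using lab[OF dl, of "e / v"] e v by auto
 define K where "K l = f ` {x : Y. lab x = l}" for l
 define D where "D = K ` lab ` Y"
 have fD: "finite D" using L(1) by (simp add: D_def)
 have Kd: "dist x y <= d" if "x : K l" "y : K l" for x y l using that L(6) by (auto simp: K_def)
 have "(\<integral>\<^sup>+K. hausdorff_weight k K \<partial>count_space D) = (SUM K:D. hausdorff_weight k K)"
  by (rule nn_integral_count_space_finite[OF fD])
 also have "... <= (SUM K:D. ennreal (v * d ^ k))" unfolding v_def by (intro sum_mono hausdorff_weight_le) (use Kd L(3) in "auto simp: D_def")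
 also have "... = ennreal (real (card D) * (v * d ^ k))" using v L(3) by (simp add: ennreal_mult ennreal_of_nat_eq_real_of_nat)
 also have "... <= ennreal e" proof (rule ennreal_leI)
  have "real (card D) <= N" using card_image_le[OF L(1), of K] L(2) by (simp add: D_def)
  hence "real (card D) * (v * d ^ k) <= N * (v * d ^ k)" using v L(3) by (intro mult_right_mono) auto
  also have "... = v * (N * d ^ k)" by simp
  also have "... <= v * (e / v)" using v L(5) by (intro mult_left_mono) auto
  finally show "real (card D) * (v * d ^ k) <= e" using v by simp
 qed
 finally have "(\<integral>\<^sup>+K. hausdorff_weight k K \<partial>count_space D) <= ennreal e" .
 moreover have "f ` Y <= \<Union>D" by (auto simp: D_def K_def)
 moreover have "ALL K:D. bounded K & diameter K <= dl" proof
  fix K' assume "K' : D"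
  then obtain l where l: "K' = K l" by (auto simp: D_def)
  show "bounded K' & diameter K' <= dl" unfolding l using diameter_le_dist[of "K l" d, OF Kd[where l = l] L(3)] L(4) by simp
 qed
 ultimately show "EX D. countable D & f ` Y <= \<Union>D & (ALL K:D. bounded K & diameter K <= dl) &
  (\<integral>\<^sup>+K. hausdorff_weight k K \<partial>count_space D) <= ennreal e" using countable_finite[OF fD] by blast
qed

lemma hausdorff_null_lipschitz_image:
 fixes f :: "'a::euclidean_space => 'b::euclidean_space"
 assumes S: "hnull k S" and f: "L-lipschitz_on S f"
 shows "hnull k (f ` S)" unfolding hausdorff_null_iff proof (intro allI impI)
 fix dl e :: real assume dl: "0 < dl" and e: "0 < e"
 define M where "M = L + 1"
 have L0: "0 <= L" by (rule lipschitz_on_nonneg[OF f])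
 hence M: "0 < M" by (simp add: M_def)
 obtain U :: "nat => 'a set" where U: "S <= (UN i. U i)" "!!i. bounded (U i)" "!!i. diameter (U i) <= dl / M"
   "(\<Sum>i. hausdorff_weight k (U i)) <= ennreal (e / M ^ k)"
  using S[unfolded hausdorff_null_iff, rule_format, of "dl / M" "e / M ^ k"] dl e M by auto
 define V where "V i = f ` (U i Int S)" for i
 have Vd: "dist x y <= M * diameter (U i)" if xy: "x : V i" "y : V i" for x y i proof -
  obtain a b where ab: "a : U i" "b : U i" "a : S" "b : S" "x = f a" "y = f b" using xy unfolding V_def by blast
  have "dist x y <= L * dist a b" using lipschitz_onD[OF f ab(3,4)] ab by simp
  also have "... <= M * diameter (U i)" using L0 diameter_bounded_bound[OF U(2) ab(1,2)] by (intro mult_mono) (auto simp: M_def)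
  finally show ?thesis .
 qed
 have d0: "0 <= M * diameter (U i)" for i using M diameter_ge_0[OF U(2)] by simp
 have V: "bounded (V i)" "diameter (V i) <= M * diameter (U i)" for i using diameter_le_dist[of "V i", OF Vd[where i = i] d0[of i]] by auto
 have "hausdorff_weight k (V i) <= ennreal (M ^ k) * hausdorff_weight k (U i)" for i proof (cases "V i = {}")
  case False
  hence "U i ~= {}" by (auto simp: V_def)
  have "(diameter (V i) / 2) ^ k <= (M * (diameter (U i) / 2)) ^ k" using V(2)[of i] diameter_ge_0[OF V(1), of i] by (intro power_mono) auto
  hence "unit_ball_vol k * (diameter (V i) / 2) ^ k <= unit_ball_vol k * (M * (diameter (U i) / 2)) ^ k" by (intro mult_left_mono) auto
  also have "... = M ^ k * (unit_ball_vol k * (diameter (U i) / 2) ^ k)" unfolding power_mult_distrib by simp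
  finally have "hausdorff_weight k (V i) <= ennreal (M ^ k * (unit_ball_vol k * (diameter (U i) / 2) ^ k))"
   using False by (simp add: hausdorff_weight_def ennreal_leI)
  also have "... = ennreal (M ^ k) * hausdorff_weight k (U i)"
   using \<open>U i ~= {}\<close> M diameter_ge_0[OF U(2), of i] by (simp add: hausdorff_weight_def ennreal_mult)
  finally show ?thesis .
 qed (simp add: hausdorff_weight_def)
 hence "(\<Sum>i. hausdorff_weight k (V i)) <= (\<Sum>i. ennreal (M ^ k) * hausdorff_weight k (U i))" by (intro suminf_le) auto
 also have "... <= ennreal (M ^ k) * ennreal (e / M ^ k)" using U(4) by (simp add: mult_left_mono)
 also have "... = ennreal e" using M e by (simp add: ennreal_mult[symmetric])
 finally have "(\<Sum>i. hausdorff_weight k (V i)) <= ennreal e" .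
 moreover have "diameter (V i) <= dl" for i using V(2)[of i] mult_left_mono[OF U(3)[of i], of M] M by simp
 moreover have "f ` S <= (UN i. V i)" using U(1) by (fastforce simp: V_def)
 ultimately show "EX U. f ` S <= (UN i. U i) & (ALL i. bounded (U i) & diameter (U i) <= dl) & (\<Sum>i. hausdorff_weight k (U i)) <= ennreal e"
  using V(1) by (intro exI[of _ V] conjI allI)
qed

section \<open>Hausdorff null sets and Lebesgue null sets: cylinders and slices\<close>

lemma emeasure_cbox_two_sides:
 fixes l u :: "'a::euclidean_space"
 assumes I: "I <= Basis" and a: "0 <= a" "!!i. i : I ==> u <.> i - l <.> i = a"
  and b: "0 <= b" "!!i. i : Basis - I ==> u <.> i - l <.> i = b"
 shows "emeasure lborel (cbox l u) = ennreal (a ^ card I * b ^ card (Basis - I))" proof -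
 have lu: "l <.> i <= u <.> i" if "i : Basis" for i using a(1) a(2)[of i] b(1) b(2)[of i] that by (cases "i : I") auto
 have "(\<Prod>i\<in>Basis. (u - l) <.> i) = (\<Prod>i\<in>I Un (Basis - I). (u - l) <.> i)" using I by (intro prod.cong) auto
 also have "... = (\<Prod>i\<in>I. (u - l) <.> i) * (\<Prod>i\<in>Basis - I. (u - l) <.> i)"
  using finite_subset[OF I finite_Basis] by (intro prod.union_disjoint) auto
 also have "... = a ^ card I * b ^ card (Basis - I)" using a(2) b(2) by (simp add: inner_diff_left)
 finally show ?thesis using lu by (subst emeasure_lborel_cbox) auto
qed

definition cylinder :: "'a::euclidean_space set => real => 'a set => 'a set" where
 "cylinder I T S = {y. EX x:S. (ALL i:I. y <.> i = x <.> i) & (ALL j:Basis - I. <|y <.> j|> <= T)}"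

text \<open>A covering set of diameter \<open>d\<close> yields a box with sides \<open>2 * d\<close>
  in the directions of \<open>I\<close> and \<open>2 * T\<close> in the others. As
  \<open>2 * d = 4 * (d / 2)\<close>, its volume is \<open>C\<close> times the Hausdorff
  weight.\<close>

lemma hausdorff_null_cylinder:
 fixes S :: "'a::euclidean_space set"
 assumes I: "I <= Basis" and S: "hnull (card I) S" and T: "0 <= T"
  and m: "cylinder I T S : sets borel"
 shows "emeasure lborel (cylinder I T S) = 0" proof -
 define k where "k = card I"
 define C where "C = 4 ^ k / unit_ball_vol (real k) * (2 * T) ^ card (Basis - I)"
 have C0: "0 <= C" using T by (simp add: C_def)
 have "emeasure lborel (cylinder I T S) <= 0 + ennreal e" if e: "0 < e" for e proof -
  obtain U :: "nat => 'a set" where U: "S <= (UN i. U i)" "!!i. bounded (U i)" "(\<Sum>i. hausdorff_weight k (U i)) <= ennreal (e / (C + 1))"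
   using S[unfolded hausdorff_null_iff, rule_format, of 1 "e / (C + 1)"] e C0 by (auto simp: k_def)
  define z where "z i = (SOME x. x : U i)" for i
  define d where "d i = diameter (U i)" for i
  define lo where "lo i = (SUM b:Basis. (if b : I then z i <.> b - d i else - T) *. b)" for i
  define hi where "hi i = (SUM b:Basis. (if b : I then z i <.> b + d i else T) *. b)" for i
  define B where "B i = (if U i = {} then {} else cbox (lo i) (hi i))" for i
  have d0: "0 <= d i" for i using diameter_ge_0[OF U(2)] by (simp add: d_def)
  have Bm: "emeasure lborel (B i) <= ennreal C * hausdorff_weight k (U i)" for i proof (cases "U i = {}")
   case False
   have "emeasure lborel (cbox (lo i) (hi i)) = ennreal ((2 * d i) ^ card I * (2 * T) ^ card (Basis - I))"
    by (rule emeasure_cbox_two_sides[OF I]) (use I T d0 in "auto simp: lo_def hi_def subset_iff")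
   also have "(2 * d i) ^ card I * (2 * T) ^ card (Basis - I) = C * (unit_ball_vol k * (d i / 2) ^ k)" proof -
    have "2 * d i = 4 * (d i / 2)" by simp
    hence "(2 * d i) ^ k = 4 ^ k * (d i / 2) ^ k" by (simp only: power_mult_distrib)
    moreover have "unit_ball_vol (real k) ~= 0" using unit_ball_vol_pos[of "real k"] by linarith
    ultimately show ?thesis by (simp add: C_def k_def[symmetric])
   qed
   finally show ?thesis using False C0 d0[of i] by (simp add: B_def hausdorff_weight_def d_def ennreal_mult)
  qed (simp add: B_def)
  have "cylinder I T S <= (UN i. B i)" proof
   fix y assume "y : cylinder I T S"
   then obtain x where x: "x : S" "!!i. i : I ==> y <.> i = x <.> i" "!!j. j : Basis - I ==> <|y <.> j|> <= T" unfolding cylinder_def by blast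
   then obtain m where m: "x : U m" using U(1) by blast
   have zm: "z m : U m" unfolding z_def by (rule someI[of _ x]) (rule m)
   have "<|x <.> i - z m <.> i|> <= d m" if "i : Basis" for i
    using order_trans[OF Basis_le_norm[OF that, of "x - z m"]] diameter_bounded_bound[OF U(2) m zm] by (simp add: inner_diff_left dist_norm d_def)
   hence "y : cbox (lo m) (hi m)" using x(2,3) I unfolding mem_box lo_def hi_def by (force simp: abs_le_iff)
   thus "y : (UN i. B i)" using m by (auto simp: B_def)
  qed
  hence "emeasure lborel (cylinder I T S) <= emeasure lborel (UN i. B i)" by (intro emeasure_mono) (auto simp: B_def)
  also have "... <= (\<Sum>i. emeasure lborel (B i))" by (rule emeasure_subadditive_countably) (auto simp: B_def)
  also have "... <= (\<Sum>i. ennreal C * hausdorff_weight k (U i))" by (intro suminf_le Bm) auto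
  also have "... <= ennreal C * ennreal (e / (C + 1))" using U(3) by (simp add: mult_left_mono)
  also have "... = ennreal (C * (e / (C + 1)))" using C0 e by (intro ennreal_mult[symmetric]) auto
  also have "... <= 0 + ennreal e" using C0 e by (simp add: divide_le_eq algebra_simps)
  finally show ?thesis .
 qed
 hence "emeasure lborel (cylinder I T S) <= 0" by (rule ennreal_le_epsilon)
 thus ?thesis by simp
qed

text \<open>The cubes have disjoint interiors, so the sum of their volumes is the measure of the
  union of these interiors.\<close>

lemma null_set_dyadic_cover:
 fixes N :: "'a::euclidean_space set"
 assumes N: "N : sets borel" "emeasure lborel N = 0" "N <= cbox (- R *. One) (R *. One)" and R: "0 < R" and e: "0 < e"
 obtains D l u s where "countable D" "N <= \<Union>D" "!!K. K : D ==> K = cbox (l K) (u K)" "!!K. K : D ==> 0 < s K"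
  "!!K i. K : D ==> i : Basis ==> u K <.> i - l K <.> i = s K"
  "(\<integral>\<^sup>+K. ennreal (s K ^ DIM('a)) \<partial>count_space D) <= ennreal e" proof -
 have Nl: "N : lmeasurable" using N(1,2) by (intro fmeasurableI) auto
 have Nm: "measure lebesgue N = 0" using N(1,2) by (simp add: measure_def)
 obtain D where D: "countable D" "!!K. K : D ==> K <= cbox (- R *. One) (R *. One) & K ~= {} & (EX c d. K = cbox c d)"
  "pairwise (%A B. interior A Int interior B = {}) D"
  "!!u v. cbox u v : D ==> EX n. ALL i : Basis. v <.> i - u <.> i = (R *. One <.> i - (- R *. One) <.> i)/2^n"
  "N <= \<Union>D" "\<Union>D \<in> lmeasurable" "measure lebesgue (\<Union>D) <= measure lebesgue N + e"
  by (rule measurable_outer_intervals_bounded[OF Nl N(3) e]) (rule that)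
 have "EX l u s. K = cbox l u & 0 < s & (ALL i:Basis. u <.> i - l <.> i = s)" if K: "K : D" for K proof -
  obtain c d where cd: "K = cbox c d" using D(2)[OF K] by auto
  then obtain n where "ALL i : Basis. d <.> i - c <.> i = (R *. One <.> i - (- R *. One) <.> i)/2^n" using D(4)[of c d] K by blast
  hence "ALL i : Basis. d <.> i - c <.> i = 2 * R / 2 ^ n" by simp
  moreover have "0 < 2 * R / 2 ^ n" using R by simp
  ultimately show ?thesis using cd by blast
 qed
 hence "EX l. ALL K:D. EX u s. K = cbox (l K) u & 0 < s & (ALL i:Basis. u <.> i - l K <.> i = s)" by (intro bchoice) blast
 then obtain l where "ALL K:D. EX u s. K = cbox (l K) u & 0 < s & (ALL i:Basis. u <.> i - l K <.> i = s)" ..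
 hence "EX u. ALL K:D. EX s. K = cbox (l K) (u K) & 0 < s & (ALL i:Basis. u K <.> i - l K <.> i = s)" by (intro bchoice)
 then obtain u where "ALL K:D. EX s. K = cbox (l K) (u K) & 0 < s & (ALL i:Basis. u K <.> i - l K <.> i = s)" ..
 hence "EX s. ALL K:D. K = cbox (l K) (u K) & 0 < s K & (ALL i:Basis. u K <.> i - l K <.> i = s K)" by (intro bchoice)
 then obtain s where lus: "!!K. K : D ==> K = cbox (l K) (u K)" "!!K. K : D ==> 0 < s K"
  "!!K i. K : D ==> i : Basis ==> u K <.> i - l K <.> i = s K" by blast
 have Km: "emeasure lborel (interior K) = ennreal (s K ^ DIM('a))" if K: "K : D" for K proof -
  have "ALL b:Basis. l K <.> b <= u K <.> b" using lus(2,3)[OF K] by (smt (verit))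
  hence "emeasure lborel (box (l K) (u K)) = ennreal (\<Prod>b\<in>Basis. (u K - l K) <.> b)" by (intro emeasure_lborel_box) auto
  also have "(\<Prod>b\<in>Basis. (u K - l K) <.> b) = s K ^ DIM('a)" using lus(3)[OF K] by (simp add: inner_diff_left)
  finally show ?thesis using arg_cong[OF lus(1)[OF K], of interior] by (simp add: interior_cbox)
 qed
 have "(\<integral>\<^sup>+K. ennreal (s K ^ DIM('a)) \<partial>count_space D) = (\<integral>\<^sup>+K. emeasure lborel (interior K) \<partial>count_space D)"
  by (intro nn_integral_cong) (simp add: Km)
 also have "... = emeasure lborel (UN K:D. interior K)"
  by (rule emeasure_UN_countable[symmetric]) (use D(1,3) in "auto simp: disjoint_family_on_def pairwise_def")
 also have "... = emeasure lebesgue (UN K:D. interior K)"  proof -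
  have "(UN K:D. interior K) : sets lborel" using open_UN[of D interior] by auto
  thus ?thesis by (simp add: emeasure_completion)
 qed
 also have "... <= emeasure lebesgue (\<Union>D)" using interior_subset D(6) by (intro emeasure_mono) (auto intro: fmeasurableD)
 also have "... <= ennreal e" using D(7) Nm emeasure_eq_measure2[OF D(6)] by (simp add: ennreal_leI)
 finally have int: "(\<integral>\<^sup>+K. ennreal (s K ^ DIM('a)) \<partial>count_space D) <= ennreal e" .
 show thesis by (rule that[OF D(1,5) _ _ _ int]) (use lus in auto)
qed

text \<open>Fubini for the sum, over the cubes of a covering, of the side to the power \<open>card I\<close> on the slices that
 meet the cube.\<close>

lemma bounded_null_set_slices:
 fixes N :: "'a::euclidean_space set"
 assumes N: "N : sets borel" "emeasure lborel N = 0" "N <= cbox (- R *. One) (R *. One)" and R: "0 < R" and I: "I <= Basis"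
 shows "AE t in lborel. (ALL i:I. 0 <= t <.> i & t <.> i <= 1) --> hausdorff_measure (card I) {u:N. ALL j:Basis - I. u <.> j = t <.> j} = 0" proof -
 define k where "k = card I"
 have dim: "k + card (Basis - I) = DIM('a)"
  using card_Diff_subset[OF finite_subset[OF I finite_Basis] I] card_mono[OF finite_Basis I] by (simp add: k_def)
 define cov where "cov p D l u s \<longleftrightarrow> countable D & N <= \<Union>D & (ALL K:D. K = cbox (l K) (u K) & 0 < s K & (ALL i:Basis. u K <.> i - l K <.> i = s K)) &
  (\<integral>\<^sup>+K. ennreal (s K ^ DIM('a)) \<partial>count_space D) <= ennreal (1 / real (Suc p))" for p D l u s
 have "EX D l u s. cov p D l u s" for p proof -
  have "0 < 1 / real (Suc p)" by simp
  then obtain D l u s where "countable D" "N <= \<Union>D" "!!K. K : D ==> K = cbox (l K) (u K)" "!!K. K : D ==> 0 < s K"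
   "!!K i. K : D ==> i : Basis ==> u K <.> i - l K <.> i = s K"
   "(\<integral>\<^sup>+K. ennreal (s K ^ DIM('a)) \<partial>count_space D) <= ennreal (1 / real (Suc p))"
   by (rule null_set_dyadic_cover[OF N R]) (rule that)
  hence "cov p D l u s" unfolding cov_def by (intro conjI ballI) assumption+
  thus ?thesis by blast
 qed
 then obtain D l u s where "!!p. cov p (D p) (l p) (u p) (s p)" by metis
 hence D: "countable (D p)" "N <= \<Union>(D p)" "K : D p ==> K = cbox (l p K) (u p K)"
  "K : D p ==> 0 < s p K" "K : D p ==> i : Basis ==> u p K <.> i - l p K <.> i = s p K"
  "(\<integral>\<^sup>+K. ennreal (s p K ^ DIM('a)) \<partial>count_space (D p)) <= ennreal (1 / real (Suc p))" for p K i unfolding cov_def by blast+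
 \<comment> \<open>Parameters \<open>t\<close> whose slice can meet \<open>K\<close>. The slice is
   determined by the coordinates outside \<open>I\<close>; confining the others to
   \<open>[0, 1]\<close> gives this set the finite volume
   \<open>s ^ card (Basis - I)\<close>.\<close>
 define Q where "Q p K = cbox (SUM b:Basis. (if b : I then 0 else l p K <.> b) *. b) (SUM b:Basis. (if b : I then 1 else u p K <.> b) *. b)" for p K
 have Q: "emeasure lborel (Q p K) = ennreal (s p K ^ card (Basis - I))" if K: "K : D p" for p K proof -
  have "emeasure lborel (Q p K) = ennreal (1 ^ card I * s p K ^ card (Basis - I))"
   unfolding Q_def using D(4)[OF K] D(5)[OF K] I by (intro emeasure_cbox_two_sides[OF I]) (auto simp: subset_iff less_imp_le)
  thus ?thesis by simp
 qed
 define psi where "psi p t = (\<integral>\<^sup>+K. ennreal (s p K ^ k) * indicator (Q p K) t \<partial>count_space (D p))" for p t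
 have psim[measurable]: "psi p : borel_measurable lborel" for p proof -
  interpret sigma_finite_measure "count_space (D p)" by (rule sigma_finite_measure_count_space_countable[OF D(1)])
  have "(%w. ennreal (s p (snd w) ^ k) * indicator (Q p (snd w)) (fst w)) : borel_measurable (lborel \<Otimes>\<^sub>M count_space (D p))"
  proof (rule measurable_compose_countable'[where f = "%K w. ennreal (s p K ^ k) * indicator (Q p K) (fst w)" and g = snd, OF _ _ D(1)[of p]])
   show "(%w. ennreal (s p K ^ k) * indicator (Q p K) (fst w)) : borel_measurable (lborel \<Otimes>\<^sub>M count_space (D p))" for K
    by (rule measurable_compose[OF measurable_fst]) (auto simp: Q_def)
  qed simp
  thus ?thesis unfolding psi_def by (intro borel_measurable_nn_integral) (simp add: split_def)
 qed
 have "(NN t. psi p t) <= ennreal (1 / real (Suc p))" for p proof -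
  have "(NN t. psi p t) = (\<integral>\<^sup>+K. (NN t. ennreal (s p K ^ k) * indicator (Q p K) t) \<partial>count_space (D p))"
   unfolding psi_def by (rule nn_integral_count_space_nn_integral[OF D(1)]) (auto simp: Q_def)
  also have "... = (\<integral>\<^sup>+K. ennreal (s p K ^ DIM('a)) \<partial>count_space (D p))" proof (rule nn_integral_cong)
   fix K assume "K : space (count_space (D p))"
   hence K: "K : D p" by simp
   have "(NN t. ennreal (s p K ^ k) * indicator (Q p K) t) = ennreal (s p K ^ k) * emeasure lborel (Q p K)"
    by (rule nn_integral_cmult_indicator) (auto simp: Q_def)
   also have "... = ennreal (s p K ^ DIM('a))" using D(4)[OF K] by (simp add: Q[OF K] ennreal_mult[symmetric] power_add[symmetric] dim)
   finally show "(NN t. ennreal (s p K ^ k) * indicator (Q p K) t) = ennreal (s p K ^ DIM('a))" .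
  qed
  finally show ?thesis using D(6)[of p] by simp
 qed
 note psii = this
 have le: "(NN t. (INF p. psi p t)) <= ennreal (1 / real (Suc p))" for p
  by (rule order_trans[OF nn_integral_mono psii[of p]]) (auto intro: INF_lower)
 have "(NN t. (INF p. psi p t)) <= ennreal 0"
  by (rule LIMSEQ_le_const[OF tendsto_ennrealI[OF LIMSEQ_Suc[OF lim_1_over_n]]]) (use le in auto)
 hence "(NN t. (INF p. psi p t)) = 0" by simp
 hence "AE t in lborel. (INF p. psi p t) = 0" by (subst (asm) nn_integral_0_iff_AE) auto
 thus ?thesis proof eventually_elim
  fix t assume t: "(INF p. psi p t) = 0"
  show "(ALL i:I. 0 <= t <.> i & t <.> i <= 1) --> hausdorff_measure (card I) {u:N. ALL j:Basis - I. u <.> j = t <.> j} = 0"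
  proof (intro impI hausdorff_null_countable)
   fix dl e :: real assume dl: "0 < dl" and e: "0 < e" and tI: "ALL i:I. 0 <= t <.> i & t <.> i <= 1"
   define n where "n = real DIM('a)"
   define c where "c = unit_ball_vol (real k) * n ^ k"
   have n: "0 < n" by (simp add: n_def)
   have c: "0 < c" using n by (simp add: c_def)
   \<comment> \<open>One bound with two uses: \<open>e / c\<close> controls the sum of the weights,
     and \<open>(dl / n) ^ k\<close>, which also bounds every single term of the sum, controls the
     sides.\<close>
   define eta where "eta = min (e / c) ((dl / n) ^ k)"
   have "0 < eta" using e c dl n by (simp add: eta_def)
   hence "(INF p. psi p t) < ennreal eta" using t by simp
   then obtain p where p: "psi p t < ennreal eta" unfolding INF_less_iff by auto
   have eta1: "ennreal eta <= ennreal ((dl / n) ^ k)" "ennreal eta <= ennreal (e / c)" by (auto simp: eta_def intro!: ennreal_leI)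
   define D' where "D' = {K:D p. t : Q p K}"
   have Kd: "dist x y <= n * s p K" if K: "K : D p" and xy: "x : K" "y : K" for K x y proof -
    have "<|(x - y) <.> i|> <= s p K" if "i : Basis" for i proof -
     have "l p K <.> i <= x <.> i" "x <.> i <= u p K <.> i" "l p K <.> i <= y <.> i" "y <.> i <= u p K <.> i"
      using xy that D(3)[OF K] by (metis mem_box(2))+
     thus ?thesis using D(5)[OF K that] unfolding inner_diff_left by linarith
    qed
    hence "(SUM i:Basis. <|(x - y) <.> i|>) <= (SUM i:(Basis::'a set). s p K)" by (rule sum_mono)
    thus ?thesis using norm_le_l1[of "x - y"] by (simp add: n_def dist_norm)
   qed
   have iD: "(\<integral>\<^sup>+K. ennreal (s p K ^ k) \<partial>count_space D') = psi p t" proof -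
    have "(\<integral>\<^sup>+K. ennreal (s p K ^ k) \<partial>count_space D') = (\<integral>\<^sup>+K. ennreal (s p K ^ k) * indicator (Q p K) t \<partial>count_space D')"
     by (intro nn_integral_cong) (auto simp: D'_def)
    also have "... = psi p t" unfolding psi_def by (rule nn_integral_count_space_eq) (auto simp: D'_def indicator_def)
    finally show ?thesis .
   qed
   have sK: "n * s p K <= dl" if K: "K : D'" for K proof -
    have "ennreal (s p K ^ k) <= (\<integral>\<^sup>+K. ennreal (s p K ^ k) \<partial>count_space D')" using K by (rule nn_integral_ge_point)
    hence "ennreal (s p K ^ k) < ennreal ((dl / n) ^ k)" unfolding iD using p eta1(1) by (rule order_le_less_trans[OF _ order_less_le_trans])
    hence "s p K ^ k < (dl / n) ^ k" using dl n by (subst (asm) ennreal_less_iff) (use K D(4) in "auto simp: D'_def less_imp_le")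
    hence "s p K < dl / n" by (rule power_less_imp_less_base) (use dl n in simp)
    thus ?thesis using n by (simp add: less_divide_eq mult.commute less_imp_le)
   qed
   have "(\<integral>\<^sup>+K. hausdorff_weight k K \<partial>count_space D') <= (\<integral>\<^sup>+K. ennreal c * ennreal (s p K ^ k) \<partial>count_space D')"
   proof (rule nn_integral_mono)
    fix K assume "K : space (count_space D')"
    hence K: "K : D p" by (simp add: D'_def)
    have s0: "0 <= s p K" using D(4)[OF K] by simp
    have "hausdorff_weight k K <= ennreal (unit_ball_vol k * (n * s p K) ^ k)" by (rule hausdorff_weight_le) (use Kd[OF K] n s0 in auto)
    thus "hausdorff_weight k K <= ennreal c * ennreal (s p K ^ k)"
     using s0 c by (simp add: ennreal_mult[symmetric] c_def power_mult_distrib mult.assoc)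
   qed
   also have "... = ennreal c * psi p t" unfolding iD[symmetric] by (rule nn_integral_cmult) simp
   also have "... <= ennreal c * ennreal (e / c)" using order_trans[OF less_imp_le[OF p] eta1(2)] by (intro mult_left_mono) auto
   also have "... = ennreal e" using c e by (simp add: ennreal_mult[symmetric])
   finally have w: "(\<integral>\<^sup>+K. hausdorff_weight k K \<partial>count_space D') <= ennreal e" .
   have "{u:N. ALL j:Basis - I. u <.> j = t <.> j} <= \<Union>D'" proof
    fix x assume x: "x : {u:N. ALL j:Basis - I. u <.> j = t <.> j}"
    then obtain K where K: "K : D p" "x : K" using D(2)[of p] by auto
    have xK: "x : cbox (l p K) (u p K)" using K D(3)[OF K(1)] by simp
    have "t : Q p K" unfolding Q_def mem_box proof (intro ballI)
     fix i :: 'a assume i: "i : Basis"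
     show "(SUM b:Basis. (if b : I then 0 else l p K <.> b) *. b) <.> i <= t <.> i & t <.> i <= (SUM b:Basis. (if b : I then 1 else u p K <.> b) *. b) <.> i"
     proof (cases "i : I")
      case False
      hence "x <.> i = t <.> i" using x i by auto
      moreover have "l p K <.> i <= x <.> i" "x <.> i <= u p K <.> i" using xK i by (auto simp: mem_box)
      ultimately show ?thesis using False i by simp
     qed (use tI i in auto)
    qed
    thus "x : \<Union>D'" using K by (auto simp: D'_def)
   qed
   moreover have "ALL K:D'. bounded K & diameter K <= dl" proof
    fix K assume K: "K : D'"
    hence "K : D p" by (simp add: D'_def)
    hence "bounded K & diameter K <= n * s p K" using diameter_le_dist[of K "n * s p K", OF Kd] n D(4)[of K p] by auto
    thus "bounded K & diameter K <= dl" using sK[OF K] by linarith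
   qed
   moreover have "countable D'" using D(1)[of p] by (auto simp: D'_def)
   ultimately show "EX D. countable D & {u:N. ALL j:Basis - I. u <.> j = t <.> j} <= \<Union>D & (ALL K:D. bounded K & diameter K <= dl) &
    (\<integral>\<^sup>+K. hausdorff_weight (card I) K \<partial>count_space D) <= ennreal e" using w unfolding k_def by (intro exI[of _ D'] conjI)
  qed
 qed
qed

text \<open>The exceptional parameters for all bounded parts of \<open>N\<close> form one null set,
  which cannot contain the unit cube.\<close>

lemma null_set_slice:
 fixes N :: "'a::euclidean_space set"
 assumes N: "N : sets borel" "emeasure lborel N = 0" and I: "I <= Basis"
 obtains t where "hausdorff_measure (card I) {u:N. ALL j:Basis - I. u <.> j = t <.> j} = 0" proof -
 define B where "B R = cbox (- real (Suc R) *. (One::'a)) (real (Suc R) *. One)" for R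
 have "AE t in lborel. (ALL i:I. 0 <= t <.> i & t <.> i <= 1) --> hausdorff_measure (card I) {u:N Int B R. ALL j:Basis - I. u <.> j = t <.> j} = 0" for R
 proof (rule bounded_null_set_slices[where R = "real (Suc R)", OF _ _ _ _ I])
  show "N Int B R <= cbox (- real (Suc R) *. One) (real (Suc R) *. One)" by (simp add: B_def del: of_nat_Suc)
  show "emeasure lborel (N Int B R) = 0" using emeasure_mono[of "N Int B R" N lborel] N by auto
 qed (use N(1) in "auto simp: B_def")
 hence "AE t in lborel. ALL R. (ALL i:I. 0 <= t <.> i & t <.> i <= 1) --> hausdorff_measure (card I) {u:N Int B R. ALL j:Basis - I. u <.> j = t <.> j} = 0"
  unfolding AE_all_countable by (rule allI)
 then obtain Z where Z: "Z : null_sets lborel" "{t. ~ (ALL R. (ALL i:I. 0 <= t <.> i & t <.> i <= 1) --> hausdorff_measure (card I) {u:N Int B R. ALL j:Basis - I. u <.> j = t <.> j} = 0)} <= Z"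
  unfolding eventually_ae_filter by auto
 have "emeasure lborel (cbox 0 (One::'a)) = 1" by simp
 hence "~ cbox 0 (One::'a) <= Z" using emeasure_mono[of "cbox 0 One" Z lborel] null_setsD1[OF Z(1)] null_setsD2[OF Z(1)] by auto
 then obtain t where t: "t : cbox 0 One" "t \<notin> Z" by blast
 have "ALL i:I. 0 <= t <.> i & t <.> i <= 1" using t(1) I by (auto simp: mem_box)
 hence "hausdorff_measure (card I) {u:N Int B R. ALL j:Basis - I. u <.> j = t <.> j} = 0" for R using t(2) Z(2) by blast
 hence "hnull (card I) (UN R. {u:N Int B R. ALL j:Basis - I. u <.> j = t <.> j})" by (rule hausdorff_null_UN)
 moreover have "{u:N. ALL j:Basis - I. u <.> j = t <.> j} <= (UN R. {u:N Int B R. ALL j:Basis - I. u <.> j = t <.> j})" proof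
  fix x assume x: "x : {u:N. ALL j:Basis - I. u <.> j = t <.> j}"
  obtain R where R: "norm x <= real R" using real_arch_simple by blast
  have "x : B R" unfolding B_def mem_box proof
   fix i :: 'a assume i: "i : Basis"
   show "(- real (Suc R) *. One) <.> i <= x <.> i & x <.> i <= (real (Suc R) *. One) <.> i"
    using Basis_le_norm[OF i, of x] R i by (simp add: abs_le_iff)
  qed
  thus "x : (UN R. {u:N Int B R. ALL j:Basis - I. u <.> j = t <.> j})" using x by blast
 qed
 ultimately have "hausdorff_measure (card I) {u:N. ALL j:Basis - I. u <.> j = t <.> j} = 0" by (rule hausdorff_null_subset)
 thus thesis by (rule that)
qed

section \<open>Graphs over coordinate planes\<close>

text \<open>The projection stays in the type \<open>'a\<close>: coordinate planes of all dimensions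
  live in one space, because the dimension changes during the argument.\<close>

definition coord_proj :: "'a::euclidean_space set => 'a => 'a" where
 "coord_proj I x = (SUM i:I. (x <.> i) *. i)"

text \<open>\<open>Q\<close> is part of a Lipschitz graph over the plane of \<open>I\<close>. Put as
  a condition on pairs of points, the property passes to subsets and needs no parametrising
  function.\<close>

definition coord_graph :: "'a::euclidean_space set => real => 'a set => bool" where
 "coord_graph I C Q \<longleftrightarrow> (ALL x:Q. ALL y:Q. dist x y <= C * norm (coord_proj I (x - y)))"

definition C1_piece :: "('a::euclidean_space => real) => 'a set => bool" where
 "C1_piece f A \<longleftrightarrow> compact A & (EX g G. C1_grad g G & (ALL x:A. g x = f x))"

lemma linear_coord_proj: "linear (coord_proj I)"
 by (rule linearI) (simp_all add: coord_proj_def inner_add_left scaleR_add_left sum.distrib scaleR_sum_right)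

lemma coord_proj_inner:
 assumes "I <= Basis" "i : Basis"
 shows "coord_proj I x <.> i = (if i : I then x <.> i else 0)" proof -
 have "coord_proj I x <.> i = (SUM j:I. if j = i then x <.> i else 0)"
  unfolding coord_proj_def inner_sum_left using assms by (intro sum.cong) (auto simp: inner_Basis subset_iff)
 thus ?thesis using finite_subset[OF assms(1) finite_Basis] by simp
qed

lemma coord_proj_adjoint: "coord_proj I x <.> y = x <.> coord_proj I y"
 unfolding coord_proj_def inner_sum_left inner_sum_right by (simp add: inner_commute mult.commute)

lemma coord_proj_norm_le:
 assumes "I <= Basis" shows "norm (coord_proj I x) <= norm x" by (rule norm_le_componentwise) (use assms in "auto simp: coord_proj_inner")

lemma coord_proj_diff: "coord_proj I (x - y) = coord_proj I x - coord_proj I y" by (rule linear_diff[OF linear_coord_proj])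

lemma coord_proj_lipschitz: "I <= Basis ==> 1-lipschitz_on UNIV (coord_proj I)"
 using coord_proj_norm_le by (intro lipschitz_onI) (auto simp: dist_norm coord_proj_diff[symmetric])

lemma coord_proj_continuous: "continuous_on A (coord_proj I)"
 by (rule linear_continuous_on) (use linear_coord_proj in "simp add: linear_conv_bounded_linear")

lemma coord_proj_add:
 assumes "I <= Basis" shows "coord_proj I x + coord_proj (Basis - I) x = x"
 by (rule euclidean_eqI) (use assms in "auto simp: inner_add_left coord_proj_inner")

lemma coord_proj_shift:
 assumes "I <= Basis" shows "coord_proj I (coord_proj I x + coord_proj (Basis - I) t) = coord_proj I x"
 by (rule euclidean_eqI) (use assms in "auto simp: inner_add_left coord_proj_inner")

lemma C1_grad_compose_coord_proj:
 assumes "C1_grad f F" shows "C1_grad (%x. f (coord_proj I x + c)) (%x. coord_proj I (F (coord_proj I x + c)))"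
 by (rule C1_grad_compose_linear[OF assms linear_coord_proj coord_proj_adjoint linear_coord_proj])

lemma hausdorff_null_Union:
 fixes D :: "'a::metric_space set set"
 assumes "countable D" "!!A. A : D ==> hnull k A"
 shows "hnull k (\<Union>D)" proof -
 have z: "hnull k ({}::'a set)" unfolding hausdorff_null_iff by (intro allI impI exI[of _ "%_. {}"]) (auto simp: hausdorff_weight_def)
 show ?thesis proof (cases "D = {}")
  case False
  have "hnull k (UN n. from_nat_into D n)" by (intro hausdorff_null_UN assms(2) from_nat_into[OF False])
  thus ?thesis using range_from_nat_into[OF False assms(1)] by simp
 qed (simp add: z)
qed

lemma coord_graph_inverse:
 fixes Q :: "'a::euclidean_space set"
 assumes Q: "coord_graph I C Q"
 obtains gam where "(max 0 C)-lipschitz_on (coord_proj I ` Q) gam" "!!y. y : Q ==> gam (coord_proj I y) = y" proof -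
 define gam where "gam p = (SOME y. y : Q & coord_proj I y = p)" for p
 have gr: "dist x y <= max 0 C * norm (coord_proj I x - coord_proj I y)" if "x : Q" "y : Q" for x y proof -
  have "dist x y <= C * norm (coord_proj I x - coord_proj I y)" using Q that unfolding coord_graph_def coord_proj_diff by auto
  also have "... <= max 0 C * norm (coord_proj I x - coord_proj I y)" by (intro mult_right_mono) auto
  finally show ?thesis .
 qed
 have gam: "gam (coord_proj I y) = y" if y: "y : Q" for y proof -
  have "gam (coord_proj I y) : Q & coord_proj I (gam (coord_proj I y)) = coord_proj I y" unfolding gam_def by (rule someI[of _ y]) (use y in simp)
  thus ?thesis using gr[of "gam (coord_proj I y)" y] y by simp
 qed
 have "(max 0 C)-lipschitz_on (coord_proj I ` Q) gam" by (rule lipschitz_onI) (use gr in "auto simp: gam dist_norm")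
 thus thesis using gam by (rule that)
qed

text \<open>On a graph \<open>f\<close> is a Lipschitz function of the coordinates in
  \<open>I\<close>, extended to the whole space as a function of these alone. The C1 functions
  obtained there are pulled back through the affine plane at a good \<open>t\<close>; the leftover
  in that plane is Hausdorff null and is carried back to the graph by a Lipschitz map.\<close>

lemma coord_graph_C1_pieces:
 fixes f :: "'a::euclidean_space => real"
 assumes f: "L-lipschitz_on UNIV f" and Q: "compact Q" "coord_graph I C Q" and I: "I <= Basis"
 obtains D where "countable D" "!!A. A : D ==> C1_piece f A" "hnull (card I) (Q - \<Union>D)" proof -
 define C' where "C' = max 0 C"
 obtain gam where gaml: "C'-lipschitz_on (coord_proj I ` Q) gam" and gam: "!!y. y : Q ==> gam (coord_proj I y) = y"
  by (rule coord_graph_inverse[OF Q(2), folded C'_def]) (rule that)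
 have "(L * C')-lipschitz_on (coord_proj I ` Q) (%p. f (gam p))" by (rule lipschitz_on_compose2[OF gaml lipschitz_on_subset[OF f]]) simp
 then obtain F0 where F0: "(L * C')-lipschitz_on UNIV F0" "!!p. p : coord_proj I ` Q ==> F0 p = f (gam p)"
  by (rule lipschitz_extension_real) (rule that)
 define F where "F x = F0 (coord_proj I x)" for x
 have Ff: "F y = f y" if "y : Q" for y using F0(2) that by (simp add: F_def gam)
 have Fl: "(L * C' * 1)-lipschitz_on UNIV F"
  unfolding F_def by (rule lipschitz_on_compose2[OF coord_proj_lipschitz[OF I] lipschitz_on_subset[OF F0(1)]]) simp
 obtain A g G where A: "!!j::nat. compact (A j)" "!!j. C1_grad (g j ()) (G j ())" "!!j x. x : A j ==> g j () x = F x"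
  "emeasure lborel (- (UN j. A j)) = 0" by (rule lipschitz_C1_cover[of "{()}" "%_. F"]) (use Fl in auto)
 have "- (UN j. A j) : sets borel" using borel_compact[OF A(1)] by (intro borel_comp sets.countable_UN) auto
 then obtain t where t: "hausdorff_measure (card I) {u : - (UN j. A j). ALL j:Basis - I. u <.> j = t <.> j} = 0"
  by (rule null_set_slice[OF _ A(4) I]) (rule that)
 define tau where "tau x = coord_proj I x + coord_proj (Basis - I) t" for x
 have tauc: "continuous_on S tau" for S unfolding tau_def by (intro continuous_intros coord_proj_continuous)
 have ptau: "coord_proj I (tau y) = coord_proj I y" for y unfolding tau_def by (rule coord_proj_shift[OF I])
 define Q' where "Q' j = Q Int tau -` A j" for j
 have "C1_piece f (Q' j)" for j proof -
  have "compact (Q' j)" unfolding Q'_def by (intro compact_Int_closed Q(1) closed_vimage compact_imp_closed A(1) tauc)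
  moreover have "C1_grad (%x. g j () (tau x)) (%x. coord_proj I (G j () (tau x)))" unfolding tau_def by (rule C1_grad_compose_coord_proj[OF A(2)])
  moreover have "g j () (tau x) = f x" if "x : Q' j" for x proof -
   have "g j () (tau x) = F (tau x)" using that by (intro A(3)) (simp add: Q'_def)
   also have "... = F x" by (simp add: F_def ptau)
   finally show ?thesis using that Ff by (simp add: Q'_def)
  qed
  ultimately show ?thesis unfolding C1_piece_def by blast
 qed
 moreover have "hnull (card I) (Q - \<Union>(range Q'))" proof -
  define S where "S = tau ` (Q - \<Union>(range Q'))"
  have "S <= {u : - (UN j. A j). ALL j:Basis - I. u <.> j = t <.> j}" using I by (auto simp: S_def Q'_def tau_def inner_add_left coord_proj_inner)
  hence S0: "hnull (card I) S" by (rule hausdorff_null_subset[OF t])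
  have "C'-lipschitz_on S (%p. gam (coord_proj I p))" proof (rule lipschitz_onI)
   fix p q assume "p : S" "q : S"
   then obtain x y where xy: "x : Q" "y : Q" "p = tau x" "q = tau y" by (auto simp: S_def)
   have "dist p q = norm (coord_proj I x - coord_proj I y)" using xy by (simp add: tau_def dist_norm)
   thus "dist (gam (coord_proj I p)) (gam (coord_proj I q)) <= C' * dist p q"
    using lipschitz_onD[OF gaml, of "coord_proj I x" "coord_proj I y"] xy by (simp add: ptau dist_norm)
  qed (simp add: C'_def)
  from hausdorff_null_lipschitz_image[OF S0 this]
  have "hnull (card I) ((%p. gam (coord_proj I p)) ` S)" .
  moreover have "Q - \<Union>(range Q') <= (%p. gam (coord_proj I p)) ` S" proof
   fix x assume x: "x : Q - \<Union>(range Q')"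
   hence "x = gam (coord_proj I (tau x))" by (simp add: ptau gam)
   thus "x : (%p. gam (coord_proj I p)) ` S" using x unfolding S_def by blast
  qed
  ultimately show ?thesis by (rule hausdorff_null_subset)
 qed
 ultimately show thesis by (intro that[of "range Q'"]) auto
qed

section \<open>Lipschitz images split into graphs and a null set\<close>

definition coord_plane :: "'a::euclidean_space set => 'a set" where
 "coord_plane I = {x. ALL i:Basis. i \<notin> I --> x <.> i = 0}"

lemma subspace_coord_plane: "subspace (coord_plane I)" unfolding coord_plane_def subspace_def by (auto simp: inner_add_left)

text \<open>A basis of the image of the plane is completed by coordinate vectors \<open>J'\<close>
  to a basis of the space. Dropping the coordinates in \<open>J'\<close> kills only
  \<open>span J'\<close>, which meets the image trivially, so projecting the image to the
  complementary coordinates is injective.\<close>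

lemma injective_coord_proj:
 fixes T :: "'a::euclidean_space => 'a"
 assumes T: "linear T" and I: "I <= Basis" and inj: "!!e. e : coord_plane I ==> T e = 0 ==> e = 0"
 obtains J c where "J <= Basis" "card J = card I" "0 < c" "!!e. e : coord_plane I ==> c * norm e <= norm (coord_proj J (T e))" proof -
 let ?E = "coord_plane I"
 have sE: "span ?E = ?E" using subspace_coord_plane by (simp add: span_eq_iff)
 have injT: "inj_on T (span ?E)" proof (rule inj_onI)
  fix x y assume xy: "x : span ?E" "y : span ?E" "T x = T y"
  hence "x - y : ?E" unfolding sE by (intro subspace_diff[OF subspace_coord_plane])
  thus "x = y" using inj[of "x - y"] xy(3) linear_diff[OF T, of x y] by simp
 qed
 have sTE: "subspace (T ` ?E)" by (rule linear_subspace_image[OF T subspace_coord_plane])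
 have dTE: "dim (T ` ?E) = card I" using dim_image_eq[OF T injT] dim_substandard[OF I] by (simp add: coord_plane_def)
 obtain B0 where B0: "B0 <= T ` ?E" "independent B0" "T ` ?E <= span B0" "card B0 = dim (T ` ?E)" by (rule basis_exists)
 obtain B where B: "B0 <= B" "B <= B0 Un Basis" "independent B" "B0 Un Basis <= span B"
  using maximal_independent_subset_extend[of B0 "B0 Un Basis"] B0(2) by auto
 have sB: "span B = UNIV" using span_mono[OF B(4)] span_mono[of Basis "B0 Un Basis"] by (auto simp: span_span)
 have fB: "finite B" by (rule independent_imp_finite[OF B(3)])
 have cB: "card B = DIM('a)" using dim_eq_card[of B UNIV] B(3) sB by simp
 define J' where "J' = B - B0"
 have J': "J' <= Basis" using B(2) by (auto simp: J'_def)
 have cJ': "card J' + card I = DIM('a)"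
  using card_Diff_subset[OF finite_subset[OF B(1) fB] B(1)] card_mono[OF fB B(1)] cB B0(4) dTE by (simp add: J'_def)
 have dJ': "dim (span J') = card J'" using independent_mono[OF independent_Basis J'] by (simp add: dim_eq_card_independent)
 have "{x + y |x y. x : T ` ?E & y : span J'} = UNIV" proof -
  have "z : {x + y |x y. x : span B0 & y : span J'}" for z using sB B(1) unfolding span_Un[symmetric] J'_def by (simp add: Un_absorb1)
  moreover have "span B0 <= T ` ?E" using B0(1) sTE by (rule span_minimal)
  ultimately show ?thesis by blast
 qed
 hence "dim (T ` ?E Int span J') = 0" using dim_sums_Int[OF sTE subspace_span[of J']] dTE dJ' cJ' by (simp del: dim_eq_0)
 hence TJ: "T ` ?E Int span J' <= {0}" by simp
 define J where "J = Basis - J'"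
 have J: "J <= Basis" by (auto simp: J_def)
 have "EX c>0. ALL e:?E. c * norm e <= norm (coord_proj J (T e))" proof (rule injective_imp_isometric)
  show "closed ?E" by (rule closed_subspace[OF subspace_coord_plane])
  show "bounded_linear (%e. coord_proj J (T e))" using linear_compose[OF T linear_coord_proj[of J]] by (simp add: linear_conv_bounded_linear o_def)
  show "ALL e:?E. coord_proj J (T e) = 0 --> e = 0" proof (intro ballI impI)
   fix e assume e: "e : ?E" "coord_proj J (T e) = 0"
   have "T e = coord_proj (Basis - J) (T e)" using coord_proj_add[OF J, of "T e"] e(2) by simp
   moreover have "coord_proj (Basis - J) (T e) : span J'" unfolding coord_proj_def J_def by (intro span_sum span_scale span_base) auto
   ultimately have "T e = 0" using TJ e(1) by auto
   thus "e = 0" using inj e(1) by blast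
  qed
 qed (rule subspace_coord_plane)
 then obtain c where "c > 0" "!!e. e : ?E ==> c * norm e <= norm (coord_proj J (T e))" by blast
 moreover have "card J = card I" using cJ' card_Diff_subset[OF finite_subset[OF J' finite_Basis] J'] by (simp add: J_def)
 ultimately show thesis using that J by blast
qed

lemma norm_componentwise_le:
 fixes x :: "'a::euclidean_space"
 assumes "!!b. b : Basis ==> <|x <.> b|> <= d" shows "norm x <= real DIM('a) * d"
 using norm_le_l1[of x] sum_mono[of Basis "%b. <|x <.> b|>" "%_. d"] assms by fastforce

text \<open>At a noncritical point the derivative followed by a suitable coordinate projection
  expands by a factor \<open>c\<close>. Near the point the map deviates from its derivative by at
  most \<open>c / 2\<close>, so projected differences still control the differences of the
  parameters.\<close>

lemma noncritical_graph:
 fixes g :: "'a::euclidean_space => 'a => real" and H :: "'a => 'a"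
 assumes g: "!!b. b : Basis ==> C1_grad (g b) (G b)" and I: "I <= Basis" and Y: "!!x y. x : Y ==> y : Y ==> x - y : coord_plane I"
  and H: "!!x b. x : Y ==> b : Basis ==> H x <.> b = g b x"
  and nc: "!!e. e : coord_plane I ==> (ALL b:Basis. G b u <.> e = 0) ==> e = 0"
 obtains rho J C where "0 < rho" "J <= Basis" "card J = card I" "coord_graph J C (H ` (Y Int cball u rho))" proof -
 define n where "n = real DIM('a)"
 have n: "0 < n" by (simp add: n_def)
 define T where "T e = (SUM b:Basis. (G b u <.> e) *. b)" for e
 have Tb: "T e <.> b = G b u <.> e" if "b : Basis" for e b using that by (simp add: T_def)
 have T: "linear T" by (rule linearI) (auto simp: T_def inner_add_right scaleR_add_left sum.distrib scaleR_sum_right)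
 obtain J c where J: "J <= Basis" "card J = card I" "0 < c" "!!e. e : coord_plane I ==> c * norm e <= norm (coord_proj J (T e))"
 proof (rule injective_coord_proj[OF T I])
  show "e = 0" if "e : coord_plane I" "T e = 0" for e by (rule nc[OF that(1)]) (use that(2) Tb[of _ e] in auto)
 qed (rule that)
 define eps where "eps = c / (2 * n)"
 have eps: "0 < eps" "n * eps = c / 2" using n J(3) by (auto simp: eps_def)
 have "EX rho>0. ALL x. dist x u < rho --> dist (G b x) (G b u) < eps" if "b : Basis" for b
  using C1_gradD(2)[OF g[OF that]] eps(1) unfolding continuous_on_iff by blast
 then obtain rho where rho: "!!b. b : Basis ==> 0 < rho b & (ALL x. dist x u < rho b --> dist (G b x) (G b u) < eps)" by metis
 define r where "r = Min (rho ` Basis) / 2"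
 have r: "0 < r" using rho by (simp add: r_def)
 have rb: "r < rho b" if "b : Basis" for b proof -
  have "Min (rho ` Basis) <= rho b" using that by (intro Min_le) auto
  thus ?thesis using rho[OF that] unfolding r_def by linarith
 qed
 define A where "A = (SUM b:Basis. norm (G b u)) + c / 2"
 have A: "0 <= A" using J(3) by (simp add: A_def sum_nonneg)
 have "coord_graph J (A * (2 / c)) (H ` (Y Int cball u r))" unfolding coord_graph_def proof (clarify)
  fix x y assume xy: "x : Y" "x : cball u r" "y : Y" "y : cball u r"
  define d where "d = x - y"
  have "<|(H x - H y - T d) <.> b|> <= eps * norm d" if b: "b : Basis" for b proof -
   have "norm (G b z - G b u) <= eps" if "z : cball u r" for z proof -
    have "dist z u < rho b" using that rb[OF b] by (simp add: dist_commute)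
    thus ?thesis using rho[OF b] by (auto simp: dist_norm less_imp_le)
   qed
   from C1_grad_near_affine[OF g[OF b] convex_cball xy(4,2) this]
   show ?thesis using H[OF xy(1) b] H[OF xy(3) b] by (simp add: inner_diff_left Tb[OF b] d_def)
  qed
  hence N: "norm (H x - H y - T d) <= c / 2 * norm d"
   using norm_componentwise_le[of "H x - H y - T d" "eps * norm d"] unfolding eps(2)[symmetric] by (simp add: n_def mult.assoc)
  have "c * norm d <= norm (coord_proj J (T d))" using J(4) Y[OF xy(1,3)] by (simp add: d_def)
  also have "coord_proj J (T d) = coord_proj J (H x - H y) - coord_proj J (H x - H y - T d)" by (simp add: coord_proj_diff)
  also have "norm ... <= norm (coord_proj J (H x - H y)) + norm (coord_proj J (H x - H y - T d))" by (rule norm_triangle_ineq4)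
  also have "norm (coord_proj J (H x - H y - T d)) <= c / 2 * norm d" using coord_proj_norm_le[OF J(1)] N by (rule order_trans)
  finally have low: "c / 2 * norm d <= norm (coord_proj J (H x - H y))" by simp
  have "norm (T d) <= (SUM b:Basis. norm (G b u) * norm d)" unfolding T_def by (rule sum_norm_le) (simp add: Cauchy_Schwarz_ineq2)
  hence "norm (H x - H y) <= A * norm d"
   using N norm_triangle_sub[of "H x - H y" "T d"] unfolding A_def by (simp add: sum_distrib_right[symmetric] distrib_right)
  also have "... <= A * (2 / c * norm (coord_proj J (H x - H y)))" using low J(3) A by (intro mult_left_mono) (auto simp: field_simps)
  finally show "dist (H x) (H y) <= A * (2 / c) * norm (coord_proj J (H x - H y))" by (simp add: dist_norm mult.assoc)
 qed
 thus thesis using that r J(1,2) by blast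
qed

text \<open>A direction in the kernel of the derivative lets one slide a small cube of side \<open>r\<close>, up to an error
 \<open>dl r\<close> in the image, onto a face, which needs fewer than \<open>dl powr - card I\<close> cubes of side \<open>dl r\<close>.\<close>

lemma critical_image_null:
 fixes g :: "'a::euclidean_space => 'a => real" and Z :: "'a set"
 assumes g: "!!b. b : Basis ==> C1_grad (g b) (G b)" and I: "I <= Basis" and ZP: "!!x y. x : Z ==> y : Z ==> x - y : coord_plane I"
  and ZR: "!!x. x : Z ==> norm x <= R" and crit: "!!z. z : Z ==> EX e:coord_plane I. e ~= 0 & (ALL b:Basis. G b z <.> e = 0)"
 shows "hnull (card I) ((%x. SUM b:Basis. g b x *. b) ` Z)" proof (cases "Z = {}")
 case True
 thus ?thesis using hausdorff_null_Union[of "{}" "card I"] by simp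
next
 case False
 define F where "F x = (SUM b:Basis. g b x *. b)" for x
 define n where "n = real DIM('a)"
 define k where "k = card I"
 have n: "1 <= n" using DIM_positive[where 'a='a] by (simp add: n_def Suc_leI)
 have fI: "finite I" using I finite_Basis by (rule finite_subset)
 have R0: "0 <= R" using False ZR norm_ge_zero order_trans by blast
 \<comment> \<open>\<open>j\<close> will be a coordinate in which \<open>e\<close> is largest, so
   that dividing by \<open>e <.> j\<close> costs at most a factor \<open>n\<close>.\<close>
 define ker where "ker z e j \<longleftrightarrow> e : coord_plane I & (ALL b:Basis. G b z <.> e = 0) & j : I & e <.> j ~= 0 & norm e <= n * <|e <.> j|>" for z e j
 have "EX e j. ker z e j" if z: "z : Z" for z proof -
  obtain e where e: "e : coord_plane I" "e ~= 0" "ALL b:Basis. G b z <.> e = 0" using crit[OF z] by auto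
  have "Max ((%b. <|e <.> b|>) ` Basis) : (%b. <|e <.> b|>) ` Basis" by (rule Max_in) auto
  then obtain j where jM: "j : Basis" "Max ((%b. <|e <.> b|>) ` Basis) = <|e <.> j|>" by blast
  have j: "j : Basis" "!!b. b : Basis ==> <|e <.> b|> <= <|e <.> j|>" unfolding jM(2)[symmetric] by (auto intro: Max_ge jM(1))
  have ne: "norm e <= n * <|e <.> j|>" using norm_componentwise_le[of e, OF j(2)] by (simp add: n_def)
  hence "e <.> j ~= 0" using e(2) by auto
  hence "j : I" using e(1) j(1) by (auto simp: coord_plane_def)
  thus ?thesis using e ne \<open>e <.> j ~= 0\<close> unfolding ker_def by blast
 qed
 then obtain E J where "!!z. z : Z ==> ker z (E z) (J z)" by metis
 hence EJ: "E z : coord_plane I" "b : Basis ==> G b z <.> E z = 0" "J z : I" "E z <.> J z ~= 0" "norm (E z) <= n * <|E z <.> J z|>"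
  if "z : Z" for z b using that unfolding ker_def by blast+
 have kpos: "1 <= k" using False EJ(3) fI card_gt_0_iff[of I] by (auto simp: k_def Suc_le_eq)
 have "EX M. ALL x:cball 0 (R + 1). norm (G b x) <= M" if "b : Basis" for b
  using compact_imp_bounded[OF compact_continuous_image[OF continuous_on_subset[OF C1_gradD(2)[OF g[OF that]]] compact_cball]]
  unfolding bounded_iff by (metis image_eqI subset_UNIV)
 then obtain M' where M': "!!b x. b : Basis ==> x : cball 0 (R + 1) ==> norm (G b x) <= M' b" by metis
 define M where "M = Max (insert 0 (M' ` Basis))"
 have M0: "0 <= M" by (simp add: M_def)
 have M: "norm (G b x) <= M" if "b : Basis" "x : cball 0 (R + 1)" for b x
  unfolding M_def by (rule order_trans[OF M'[OF that] Max_ge]) (use that(1) in auto)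
 \<comment> \<open>Per component of the image, sliding two points costs
   \<open>2 * n * d * r\<close>, and two slid points at distance at most \<open>n * d * r\<close>
   have values differing by at most \<open>M * n * d * r\<close>; summing over components gives
   another \<open>n\<close>.\<close>
 define C where "C = 2 * n^2 + n^2 * M"
 have C: "0 < C" using n M0 by (simp add: C_def add_pos_nonneg)
 define C' where "C' = (2 * R + 5) ^ k * (4 * n + 5) ^ (k - 1) * C ^ k"
 have C': "0 <= C'" using R0 n C by (simp add: C'_def)
 have "hnull k (F ` Z)" proof (rule hausdorff_null_labels)
  fix dl e :: real assume dl: "0 < dl" and e: "0 < e"
  define d where "d = min 1 (e / (C' + 1))"
  have d: "0 < d" "d <= 1" "d <= e / (C' + 1)" using e C' by (auto simp: d_def)
  have "EX rho>0. ALL x:cball 0 (R + 1). ALL y:cball 0 (R + 1). dist y x < rho --> dist (G b y) (G b x) < d" if b: "b : Basis" for b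
   using compact_uniformly_continuous[OF continuous_on_subset[OF C1_gradD(2)[OF g[OF b]] subset_UNIV] compact_cball] d(1)
   unfolding uniformly_continuous_on_def by blast
  then obtain rho where rho: "!!b. b : Basis ==> 0 < rho b & (ALL x:cball 0 (R + 1). ALL y:cball 0 (R + 1). dist y x < rho b --> dist (G b y) (G b x) < d)" by metis
  define rho0 where "rho0 = Min (rho ` Basis)"
  have rho0: "0 < rho0" "!!b. b : Basis ==> rho0 <= rho b" using rho by (auto simp: rho0_def)
  \<comment> \<open>\<open>1 / (2 * n)\<close> keeps the working balls inside
    \<open>cball 0 (R + 1)\<close>, \<open>rho0 / (4 * n)\<close> keeps the variation of the
    gradients there below \<open>d\<close>, and \<open>dl / (C * d)\<close> bounds the diameters of
    the covering sets.\<close>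
  define r where "r = Min {1, 1 / (2 * n), dl / (C * d), rho0 / (4 * n)}"
  have r: "0 < r" "r <= 1" "r <= 1 / (2 * n)" "r <= dl / (C * d)" "r <= rho0 / (4 * n)" using dl n C d(1) rho0(1) by (auto simp: r_def)
  have nr: "2 * n * r <= 1" "2 * n * r < rho0" using r n rho0(1) by (auto simp: field_simps)
  define m1 where "m1 = \<lceil>R / r\<rceil> + 1"
  define m2 where "m2 = \<lceil>2 * n / d\<rceil> + 1"
  have fl: "\<lfloor>t\<rfloor> : {- (\<lceil>q\<rceil> + 1)..\<lceil>q\<rceil> + 1}" if "<|t|> <= q" for t q :: real using that by (auto; linarith)
  have cnt: "real (card {- (\<lceil>q\<rceil> + 1)..\<lceil>q\<rceil> + 1}) <= 2 * q + 5" if "0 <= q" for q :: real using that by simp linarith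
  \<comment> \<open>Cell of the grid of side \<open>r\<close>; in each occupied cell one point of
    \<open>Z\<close> is chosen as representative.\<close>
  define base where "base v = restrict (%i. \<lfloor>v <.> i / r\<rfloor>) I" for v :: 'a
  define u where "u l = (SOME z. z : Z & base z = l)" for l
  have u: "u (base v) : Z" "base (u (base v)) = base v" if "v : Z" for v using someI[of "%z. z : Z & base z = base v" v] that by (auto simp: u_def)
  \<comment> \<open>Slides \<open>v\<close> along the kernel direction at the representative until
    the coordinate \<open>J\<close> agrees with that of the representative. Only
    \<open>k - 1\<close> coordinates remain to be subdivided at the finer step
    \<open>d * r\<close>.\<close>
  define sl where "sl v = v - (((v - u (base v)) <.> J (u (base v))) / (E (u (base v)) <.> J (u (base v)))) *. E (u (base v))" for v
  define lb where "lb v = restrict (%i. \<lfloor>(sl v - u (base v)) <.> i / (d * r)\<rfloor>) (I - {J (u (base v))})" for v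
  have close: "<|(v - w) <.> i|> <= r" if vw: "v : Z" "w : Z" "base v = base w" and i: "i : Basis" for v w i proof (cases "i : I")
   case True
   hence "\<lfloor>v <.> i / r\<rfloor> = \<lfloor>w <.> i / r\<rfloor>" using fun_cong[OF vw(3), of i] by (simp add: base_def)
   hence "<|v <.> i / r - w <.> i / r|> <= 1" by linarith
   thus ?thesis using r(1) by (simp add: diff_divide_distrib[symmetric] inner_diff_left[symmetric] abs_divide divide_le_eq)
  qed (use ZP[OF vw(1,2)] i r(1) in "auto simp: coord_plane_def")
  have S: "norm (v - u (base v)) <= n * r" "norm (sl v - v) <= n * r" "(sl v - u (base v)) <.> J (u (base v)) = 0" "sl v - u (base v) : coord_plane I"
   "!!b. b : Basis ==> G b (u (base v)) <.> (sl v - v) = 0" if v: "v : Z" for v proof -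
   let ?u = "u (base v)"
   have c: "<|(v - ?u) <.> i|> <= r" if "i : Basis" for i using close[OF v u(1)[OF v] u(2)[OF v, symmetric] that] .
   show "norm (v - ?u) <= n * r" using norm_componentwise_le[of "v - ?u" r] c by (simp add: n_def)
   note ej = EJ[OF u(1)[OF v]]
   have jB: "J ?u : Basis" using ej(3) I by auto
   have "norm (sl v - v) = <|(v - ?u) <.> J ?u|> * (norm (E ?u) / <|E ?u <.> J ?u|>)" by (simp add: sl_def)
   also have "... <= r * n" using c[OF jB] ej(4,5) n by (intro mult_mono) (auto simp: divide_le_eq)
   finally show "norm (sl v - v) <= n * r" by (simp add: mult.commute)
   show "(sl v - ?u) <.> J ?u = 0" using ej(4) by (simp add: sl_def inner_diff_left)
   have "sl v - ?u = (v - ?u) - (((v - ?u) <.> J ?u) / (E ?u <.> J ?u)) *. E ?u" by (simp add: sl_def)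
   thus "sl v - ?u : coord_plane I"
    by (simp only:) (rule subspace_diff[OF subspace_coord_plane ZP[OF v u(1)[OF v]] subspace_scale[OF subspace_coord_plane ej(1)]])
   show "G b ?u <.> (sl v - v) = 0" if "b : Basis" for b using ej(2)[OF that] by (simp add: sl_def)
  qed
  have T: "norm (sl v - u (base v)) <= 2 * n * r" if v: "v : Z" for v using norm_triangle_ineq[of "sl v - v" "v - u (base v)"] S(1,2)[OF v] by simp
  have lab: "(base v, lb v) : (SIGMA l:base ` Z. PiE (I - {J (u l)}) (%_. {- m2..m2}))" if v: "v : Z" for v proof -
   have "lb v : PiE (I - {J (u (base v))}) (%_. {- m2..m2})" proof (unfold lb_def, rule restrict_PiE_iff[THEN iffD2], rule ballI)
    fix i assume "i : I - {J (u (base v))}"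
    hence "<|(sl v - u (base v)) <.> i|> <= 2 * n * r" using order_trans[OF Basis_le_norm T[OF v]] I by auto
    hence "<|(sl v - u (base v)) <.> i / (d * r)|> <= 2 * n / d" using d(1) r(1) by (simp add: abs_divide field_simps)
    thus "\<lfloor>(sl v - u (base v)) <.> i / (d * r)\<rfloor> : {- m2..m2}" unfolding m2_def by (rule fl)
   qed
   thus ?thesis using v by auto
  qed
  have bZ: "base ` Z <= PiE I (%_. {- m1..m1})" proof (rule image_subsetI, unfold base_def restrict_PiE_iff, rule ballI)
   fix v i assume v: "v : Z" and i: "i : I"
   have "<|v <.> i|> <= R" using order_trans[OF Basis_le_norm ZR[OF v]] i I by auto
   hence "<|v <.> i / r|> <= R / r" using r(1) by (simp add: abs_divide divide_right_mono)
   thus "\<lfloor>v <.> i / r\<rfloor> : {- m1..m1}" unfolding m1_def by (rule fl)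
  qed
  have fB: "finite (base ` Z)" by (rule finite_subset[OF bZ]) (auto intro!: finite_PiE fI)
  let ?L = "SIGMA l:base ` Z. PiE (I - {J (u l)}) (%_. {- m2..m2})"
  have fL: "finite ?L" by (intro finite_SigmaI fB finite_PiE) (auto simp: fI)
  have cb: "real (card (base ` Z)) <= ((2 * R + 5) / r) ^ k" proof -
   have "card (base ` Z) <= card (PiE I (%_. {- m1..m1}))" by (rule card_mono[OF _ bZ]) (auto intro!: finite_PiE fI)
   also have "... = card {- m1..m1} ^ k" by (simp add: card_PiE[OF fI] k_def)
   finally have "real (card (base ` Z)) <= real (card {- m1..m1}) ^ k" by (metis of_nat_le_iff of_nat_power)
   also have "... <= ((2 * R + 5) / r) ^ k" proof (rule power_mono)
    have "real (card {- m1..m1}) <= 2 * (R / r) + 5" unfolding m1_def using R0 r(1) by (intro cnt) auto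
    also have "... <= (2 * R + 5) / r" using r(1,2) by (simp add: field_simps)
    finally show "real (card {- m1..m1}) <= (2 * R + 5) / r" .
   qed simp
   finally show ?thesis .
  qed
  have c2: "real (card {- m2..m2}) <= (4 * n + 5) / d" proof -
   have "real (card {- m2..m2}) <= 2 * (2 * n / d) + 5" unfolding m2_def using n d(1) by (intro cnt) auto
   also have "... <= (4 * n + 5) / d" using d(1,2) by (simp add: field_simps)
   finally show ?thesis .
  qed
  have "card ?L = (SUM l:base ` Z. card (PiE (I - {J (u l)}) (%_. {- m2..m2})))" by (rule card_SigmaI[OF fB]) (auto intro!: finite_PiE simp: fI)
  also have "... = (SUM l:base ` Z. card {- m2..m2} ^ (k - 1))" proof (rule sum.cong[OF refl])
   fix l assume "l : base ` Z"
   hence "J (u l) : I" using EJ(3) u(1) by auto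
   thus "card (PiE (I - {J (u l)}) (%_. {- m2..m2})) = card {- m2..m2} ^ (k - 1)" using fI by (simp add: card_PiE k_def)
  qed
  finally have "card ?L = (SUM l:base ` Z. card {- m2..m2} ^ (k - 1))" .
  hence "real (card ?L) = real (card (base ` Z)) * real (card {- m2..m2}) ^ (k - 1)" by simp
  also have "... <= ((2 * R + 5) / r) ^ k * ((4 * n + 5) / d) ^ (k - 1)" using R0 r(1) by (intro mult_mono cb power_mono c2) auto
  finally have cL: "real (card ?L) <= ((2 * R + 5) / r) ^ k * ((4 * n + 5) / d) ^ (k - 1)" .
  \<comment> \<open>The count has one factor \<open>1 / d\<close> less than the \<open>k\<close>
    factors \<open>d\<close> coming from the diameters, so a factor \<open>d\<close> survives and
    makes the total small.\<close>
  have "((2 * R + 5) / r) ^ k * ((4 * n + 5) / d) ^ (k - 1) * (C * d * r) ^ k = C' * d" proof -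
   have "d ^ k = d * d ^ (k - 1)" using kpos by (metis One_nat_def Suc_le_D diff_Suc_1 power_Suc)
   thus ?thesis using r(1) d(1) unfolding C'_def power_divide power_mult_distrib by simp
  qed
  also have "... <= e" proof -
   have "C' * d <= C' * (e / (C' + 1))" using d(3) C' by (rule mult_left_mono)
   also have "... <= e" using e C' by (simp add: divide_le_eq algebra_simps)
   finally show ?thesis .
  qed
  finally have small: "((2 * R + 5) / r) ^ k * ((4 * n + 5) / d) ^ (k - 1) * (C * d * r) ^ k <= e" .
  have dist: "dist (F v) (F w) <= C * d * r" if vw: "v : Z" "w : Z" and eq: "(base v, lb v) = (base w, lb w)" for v w proof -
   have bvw: "base v = base w" "lb v = lb w" using eq by auto
   let ?u = "u (base v)"
   have uR: "cball ?u (2 * n * r) <= cball 0 (R + 1)" using ZR[OF u(1)[OF vw(1)]] nr(1) by (simp add: cball_subset_cball_iff)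
   have inb: "v : cball ?u (2 * n * r)" "w : cball ?u (2 * n * r)" "sl v : cball ?u (2 * n * r)" "sl w : cball ?u (2 * n * r)" proof -
    have "0 <= n * r" using n r(1) by simp
    thus "v : cball ?u (2 * n * r)" "w : cball ?u (2 * n * r)" using S(1)[OF vw(1)] S(1)[OF vw(2)] bvw(1) by (auto simp: dist_norm norm_minus_commute)
    show "sl v : cball ?u (2 * n * r)" "sl w : cball ?u (2 * n * r)" using T[OF vw(1)] T[OF vw(2)] bvw(1) by (auto simp: dist_norm norm_minus_commute)
   qed
   have "<|(sl v - sl w) <.> i|> <= d * r" if i: "i : Basis" for i proof -
    consider "i = J ?u" | "i : I - {J ?u}" | "i \<notin> I" by blast
    hence "<|(sl v - ?u) <.> i - (sl w - ?u) <.> i|> <= d * r" proof cases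
     case 1
     thus ?thesis using S(3)[OF vw(1)] S(3)[OF vw(2)] bvw(1) d(1) r(1) by simp
    next
     case 2
     hence "\<lfloor>(sl v - ?u) <.> i / (d * r)\<rfloor> = \<lfloor>(sl w - ?u) <.> i / (d * r)\<rfloor>"
      using fun_cong[OF bvw(2), of i] bvw(1) by (simp add: lb_def)
     hence "<|(sl v - ?u) <.> i / (d * r) - (sl w - ?u) <.> i / (d * r)|> <= 1" by linarith
     thus ?thesis using d(1) r(1) by (simp add: diff_divide_distrib[symmetric] abs_divide divide_le_eq)
    next
     case 3
     thus ?thesis using S(4)[OF vw(1)] S(4)[OF vw(2)] bvw(1) i d(1) r(1) by (auto simp: coord_plane_def)
    qed
    thus ?thesis by (simp add: inner_diff_left)
   qed
   hence sw: "norm (sl v - sl w) <= n * (d * r)" using norm_componentwise_le[of "sl v - sl w" "d * r"] by (simp add: n_def)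
   have slide: "<|g b (sl x) - g b x|> <= d * (n * r)" if b: "b : Basis" and x: "x : Z" "base x = base v" "x : cball ?u (2 * n * r)" "sl x : cball ?u (2 * n * r)" for b x
   proof -
    have "norm (G b z - G b ?u) <= d" if z: "z : cball ?u (2 * n * r)" for z proof -
     have "dist z ?u < rho b" using z nr(2) rho0(2)[OF b] by (simp add: dist_commute)
     moreover have "?u : cball ?u (2 * n * r)" using n r(1) by simp
     ultimately show ?thesis using rho[OF b] uR z by (auto simp: dist_norm less_imp_le subset_iff)
    qed
    from C1_grad_near_affine[OF g[OF b] convex_cball x(3,4) this]
    have "<|g b (sl x) - g b x|> <= d * norm (sl x - x)" using S(5)[OF x(1) b] x(2) by simp
    also have "... <= d * (n * r)" using S(2)[OF x(1)] d(1) by (intro mult_left_mono) auto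
    finally show ?thesis .
   qed
   have "<|(F v - F w) <.> b|> <= 2 * (d * (n * r)) + M * (n * (d * r))" if b: "b : Basis" for b proof -
    have "norm (G b z - 0) <= M" if "z : cball ?u (2 * n * r)" for z using M[OF b] subsetD[OF uR that] by simp
    from C1_grad_near_affine[OF g[OF b] convex_cball inb(4,3) this]
    have "<|g b (sl v) - g b (sl w)|> <= M * norm (sl v - sl w)" by simp
    also have "... <= M * (n * (d * r))" using sw M0 by (rule mult_left_mono)
    finally have "<|g b v - g b w|> <= 2 * (d * (n * r)) + M * (n * (d * r))"
     using slide[OF b vw(1) refl inb(1,3)] slide[OF b vw(2) bvw(1)[symmetric] inb(2,4)] by linarith
    thus ?thesis using b by (simp add: F_def inner_diff_left)
   qed
   hence "norm (F v - F w) <= n * (2 * (d * (n * r)) + M * (n * (d * r)))" unfolding n_def by (rule norm_componentwise_le)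
   also have "... = C * d * r" by (simp add: C_def power2_eq_square algebra_simps)
   finally show ?thesis by (simp add: dist_norm)
  qed
  have sub: "(%v. (base v, lb v)) ` Z <= ?L" using lab by blast
  show "EX (lab :: 'a => ('a => int) \<times> ('a => int)) N D. finite (lab ` Z) & real (card (lab ` Z)) <= N & 0 <= D & D <= dl &
   N * D ^ k <= e & (ALL x:Z. ALL y:Z. lab x = lab y --> dist (F x) (F y) <= D)" proof (intro exI conjI ballI impI)
   show "finite ((%v. (base v, lb v)) ` Z)" by (rule finite_subset[OF sub fL])
   show "real (card ((%v. (base v, lb v)) ` Z)) <= ((2 * R + 5) / r) ^ k * ((4 * n + 5) / d) ^ (k - 1)" using card_mono[OF fL sub] cL by linarith
   show "C * d * r <= dl" using r(4) C d(1) by (simp add: le_divide_eq mult.commute)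
   show "0 <= C * d * r" using C d(1) r(1) by simp
  qed (use small dist in auto)
 qed
 thus ?thesis by (simp add: F_def[abs_def] k_def)
qed

text \<open>As \<open>k <= DIM('a)\<close>, the parameter space is realised by a coordinate plane in
  \<open>'a\<close>, and the map extends to \<open>'a\<close> by ignoring the other coordinates. It
  agrees with C1 maps off a Lebesgue null set, and some parallel plane \<open>P\<close> meets that
  set in a null set of dimension \<open>k\<close>. Noncritical points of \<open>P\<close> give
  graphs, critical ones a null image.\<close>

lemma lipschitz_image_graphs:
 fixes S :: "'a::euclidean_space set"
 assumes S: "lipschitz_image k S" and k: "k <= DIM('a)"
 shows "EX D. countable D & (ALL Q:D. compact Q & (EX J C. J <= Basis & card J = k & coord_graph J C Q)) & hnull k (S - \<Union>D)" proof -
 obtain h :: "(nat => real) => 'a" and L where h: "!!x y. x : topspace (Euclidean_space k) ==> y : topspace (Euclidean_space k) ==>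
   dist (h x) (h y) <= L * L2_set (%i. x i - y i) {..<k}" "S = h ` topspace (Euclidean_space k)" using S unfolding lipschitz_image_def by blast
 obtain I where I: "I <= (Basis::'a set)" "card I = k" using obtain_subset_with_card_n[OF k] by blast
 have fI: "finite I" using I(1) finite_Basis by (rule finite_subset)
 obtain bet where bet: "bij_betw bet {..<k} I" using ex_bij_betw_nat_finite[OF fI] I(2) by (auto simp: atLeast0LessThan)
 have betI: "bet m : I" if "m < k" for m using bet that by (auto simp: bij_betw_def)
 define p where "p u m = (if m < k then u <.> bet m else 0)" for u m
 have pE: "p u : topspace (Euclidean_space k)" for u by (simp add: p_def topspace_Euclidean_space)
 define H where "H u = h (p u)" for u
 define L' where "L' = <|L|> * real k"
 have HL: "L'-lipschitz_on UNIV H" proof (rule lipschitz_onI)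
  fix u v :: 'a
  have "L2_set (%i. p u i - p v i) {..<k} <= (\<Sum>i<k. <|p u i - p v i|>)" by (rule L2_set_le_sum_abs)
  also have "... <= (\<Sum>i<k. dist u v)" proof (rule sum_mono)
   fix i assume "i : {..<k}"
   thus "<|p u i - p v i|> <= dist u v"
    using Basis_le_norm[of "bet i" "u - v"] betI[of i] I(1) by (auto simp: p_def inner_diff_left[symmetric] dist_norm)
  qed
  finally have 1: "L2_set (%i. p u i - p v i) {..<k} <= real k * dist u v" by simp
  have "dist (H u) (H v) <= L * L2_set (%i. p u i - p v i) {..<k}" unfolding H_def by (rule h(1)[OF pE pE])
  also have "... <= <|L|> * L2_set (%i. p u i - p v i) {..<k}" by (intro mult_right_mono L2_set_nonneg) simp
  also have "... <= <|L|> * (real k * dist u v)" using 1 by (rule mult_left_mono) simp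
  finally show "dist (H u) (H v) <= L' * dist u v" by (simp add: L'_def mult.assoc)
 qed (simp add: L'_def)
 have "L'-lipschitz_on UNIV (%u. H u <.> b)" if "b : Basis" for b proof (rule lipschitz_onI)
  show "dist (H u <.> b) (H v <.> b) <= L' * dist u v" for u v
   using order_trans[OF Basis_le_norm[OF that, of "H u - H v"]] lipschitz_onD[OF HL, of u v] by (simp add: dist_norm inner_diff_left)
 qed (simp add: L'_def)
 hence HbL: "!!b. b : Basis ==> EX L. L-lipschitz_on UNIV (%u. H u <.> b)" by blast
 obtain X g G where X: "!!j::nat. compact (X j)" "!!j b. b : Basis ==> C1_grad (g j b) (G j b)"
  "!!j b x. b : Basis ==> x : X j ==> g j b x = H x <.> b" "emeasure lborel (- (UN j. X j)) = 0"
  by (rule lipschitz_C1_cover[of Basis "%b u. H u <.> b", OF finite_Basis HbL]) (assumption, rule that)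
 have "- (UN j. X j) : sets borel" using borel_compact[OF X(1)] by (intro borel_comp sets.countable_UN) auto
 then obtain t where t: "hausdorff_measure (card I) {u : - (UN j. X j). ALL j:Basis - I. u <.> j = t <.> j} = 0"
  by (rule null_set_slice[OF _ X(4) I(1)]) (rule that)
 define P where "P = {u. ALL j:Basis - I. u <.> j = t <.> j}"
 have cP: "closed P" proof -
  have "P = (INT j:Basis - I. {u. u <.> j = t <.> j})" by (auto simp: P_def)
  thus ?thesis by (auto intro!: closed_INT closed_Collect_eq continuous_intros)
 qed
 have SP: "S <= H ` P" proof
  fix y assume "y : S"
  then obtain x where x: "x : topspace (Euclidean_space k)" "y = h x" using h(2) by auto
  define u where "u = (SUM b:Basis. (if b : I then x (inv_into {..<k} bet b) else t <.> b) *. b)"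
  have "p u m = x m" for m using x(1) betI[of m] I(1) inv_into_f_f[OF bij_betw_imp_inj_on[OF bet], of m]
   by (auto simp: p_def u_def topspace_Euclidean_space subset_iff)
  hence "H u = y" using x(2) by (simp add: H_def ext[of "p u" x])
  moreover have "u : P" by (auto simp: P_def u_def)
  ultimately show "y : H ` P" by blast
 qed
 define Y where "Y j = X j Int P" for j
 have Yc: "compact (Y j)" for j unfolding Y_def by (intro compact_Int_closed X(1) cP)
 have YP: "x - y : coord_plane I" if "x : Y j" "y : Y j" for x y j using that by (auto simp: Y_def P_def coord_plane_def inner_diff_left)
 define Z where "Z j = {u : Y j. EX e:coord_plane I. e ~= 0 & (ALL b:Basis. G j b u <.> e = 0)}" for j
 have ZY: "Z j <= Y j" for j by (auto simp: Z_def)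
 have HZ: "hnull k (H ` Z j)" for j proof -
  obtain R where R: "!!x. x : Y j ==> norm x <= R" using compact_imp_bounded[OF Yc[of j]] unfolding bounded_iff by auto
  have "hnull (card I) ((%x. SUM b:Basis. g j b x *. b) ` Z j)" proof (rule critical_image_null[OF X(2)[of _ j] I(1)])
   show "x - y : coord_plane I" if "x : Z j" "y : Z j" for x y using that ZY YP by blast
   show "norm x <= R" if "x : Z j" for x using that ZY R by blast
   show "EX e:coord_plane I. e ~= 0 & (ALL b:Basis. G j b z <.> e = 0)" if "z : Z j" for z using that by (simp add: Z_def)
  qed
  moreover have "(SUM b:Basis. g j b x *. b) = H x" if "x : Z j" for x proof -
   have "(SUM b:Basis. g j b x *. b) = (SUM b:Basis. (H x <.> b) *. b)" using that ZY by (intro sum.cong refl) (auto simp: X(3) Y_def subset_iff)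
   thus ?thesis by (simp add: euclidean_representation)
  qed
  ultimately show ?thesis by (simp add: I(2) cong: image_cong_simp)
 qed
 define good where "good j u rho \<longleftrightarrow> 0 < rho & (EX J C. J <= Basis & card J = k & coord_graph J C (H ` (Y j Int cball u rho)))" for j u rho
 define cov where "cov j U r \<longleftrightarrow> countable U & (ALL u:U. good j u (r u)) & Y j - Z j <= (UN u:U. ball u (r u))" for j U r
 have "EX U r. cov j U r" for j proof -
  have "EX rho. good j u rho" if u: "u : Y j - Z j" for u proof -
   have nc: "e = 0" if "e : coord_plane I" "ALL b:Basis. G j b u <.> e = 0" for e using u that by (auto simp: Z_def)
   have HX: "H x <.> b = g j b x" if "x : Y j" "b : Basis" for x b using X(3)[OF that(2)] that(1) by (auto simp: Y_def)
   obtain rho J C where "0 < rho" "J <= Basis" "card J = card I" "coord_graph J C (H ` (Y j Int cball u rho))"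
    by (rule noncritical_graph[where g = "g j" and G = "G j" and Y = "Y j" and H = H and u = u, OF X(2) I(1) YP HX nc])
     (assumption | rule that)+
   thus ?thesis unfolding good_def I(2) by blast
  qed
  hence "EX r. ALL u:Y j - Z j. good j u (r u)" by (intro bchoice) blast
  then obtain r where r: "!!u. u : Y j - Z j ==> good j u (r u)" by blast
  \<comment> \<open>Lindelof's theorem leaves countably many balls, hence countably many
    graphs.\<close>
  obtain F where F: "F <= (%u. ball u (r u)) ` (Y j - Z j)" "countable F" "\<Union>F = (UN u:Y j - Z j. ball u (r u))"
   by (rule Lindelof[of "(%u. ball u (r u)) ` (Y j - Z j)"]) auto
  obtain U where U: "U <= Y j - Z j" "countable U" "F = (%u. ball u (r u)) ` U" using conjI[OF F(2,1), unfolded countable_subset_image] by blast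
  have "Y j - Z j <= (UN u:U. ball u (r u))" proof -
   have "u : \<Union>F" if "u : Y j - Z j" for u unfolding F(3) using r[OF that] that by (intro UN_I[of u]) (auto simp: good_def)
   thus ?thesis using U(3) by auto
  qed
  moreover have "ALL u:U. good j u (r u)" using r U(1) by blast
  ultimately show ?thesis using U(2) unfolding cov_def by blast
 qed
 then obtain U r where Ur: "!!j. cov j (U j) (r j)" by metis
 have U: "countable (U j)" "u : U j ==> good j u (r j u)" "Y j - Z j <= (UN u:U j. ball u (r j u))" for j u
  using Ur[of j] unfolding cov_def by simp_all
 define D where "D = (UN j. (%u. H ` (Y j Int cball u (r j u))) ` U j)"
 have "compact Q & (EX J C. J <= Basis & card J = k & coord_graph J C Q)" if QD: "Q : D" for Q proof -
  obtain j u where ju: "u : U j" "Q = H ` (Y j Int cball u (r j u))" using QD unfolding D_def by blast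
  have "compact Q" unfolding ju
   by (intro compact_continuous_image compact_Int_closed Yc closed_cball lipschitz_on_continuous_on[OF lipschitz_on_subset[OF HL]]) simp
  thus ?thesis using U(2)[OF ju(1)] ju(2) by (auto simp: good_def)
 qed
 moreover have "hnull k (S - \<Union>D)" proof (rule hausdorff_null_subset)
  have "hnull k (H ` {u : - (UN j. X j). ALL j:Basis - I. u <.> j = t <.> j})"
   unfolding I(2)[symmetric] by (rule hausdorff_null_lipschitz_image[OF t lipschitz_on_subset[OF HL]]) simp
  thus "hnull k (H ` {u : - (UN j. X j). ALL j:Basis - I. u <.> j = t <.> j} Un (UN j. H ` Z j))" by (intro hausdorff_null_Un hausdorff_null_UN HZ)
  show "S - \<Union>D <= H ` {u : - (UN j. X j). ALL j:Basis - I. u <.> j = t <.> j} Un (UN j. H ` Z j)" proof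
   fix y assume y: "y : S - \<Union>D"
   then obtain u where u: "u : P" "y = H u" using SP by blast
   show "y : H ` {u : - (UN j. X j). ALL j:Basis - I. u <.> j = t <.> j} Un (UN j. H ` Z j)" proof (cases "EX j. u : X j")
    case True
    then obtain j where j: "u : Y j" using u(1) by (auto simp: Y_def)
    have "u : Z j" proof (rule ccontr)
     assume "u \<notin> Z j"
     then obtain v where v: "v : U j" "u : ball v (r j v)" using U(3)[of j] j by blast
     hence "y : H ` (Y j Int cball v (r j v))" using j u(2) by auto
     hence "y : \<Union>D" using v(1) unfolding D_def by blast
     thus False using y by simp
    qed
    thus ?thesis using u(2) by blast
   next
    case False
    thus ?thesis using u by (intro UnI1 image_eqI[of _ _ u]) (auto simp: P_def)
   qed
  qed
 qed
 moreover have "countable D" unfolding D_def using U(1) by auto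
 ultimately show ?thesis by blast
qed

lemma lipschitz_image_C1_pieces:
 fixes S :: "'a::euclidean_space set"
 assumes S: "lipschitz_image k S" and k: "k <= DIM('a)" and f: "L-lipschitz_on UNIV f"
 shows "EX D. countable D & (ALL A:D. C1_piece f A) & hnull k (S - \<Union>D)" proof -
 obtain D where D: "countable D" "!!Q. Q : D ==> compact Q & (EX J C. J <= Basis & card J = k & coord_graph J C Q)"
  "hnull k (S - \<Union>D)" using lipschitz_image_graphs[OF S k] by blast
 define cov where "cov Q A \<longleftrightarrow> countable A & (ALL B:A. C1_piece f B) & hnull k (Q - \<Union>A)" for Q A
 have "EX A. cov Q A" if Q: "Q : D" for Q proof -
  obtain J C where J: "compact Q" "J <= Basis" "card J = k" "coord_graph J C Q" using D(2)[OF Q] by blast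
  obtain A where "countable A" "!!B. B : A ==> C1_piece f B" "hnull (card J) (Q - \<Union>A)"
   by (rule coord_graph_C1_pieces[OF f J(1,4,2)]) (rule that)
  thus ?thesis using J(3) unfolding cov_def by auto
 qed
 then obtain A where Ar: "!!Q. Q : D ==> cov Q (A Q)" by metis
 have A: "countable (A Q)" "B : A Q ==> C1_piece f B" "hnull k (Q - \<Union>(A Q))" if "Q : D" for Q B using Ar[OF that] unfolding cov_def by simp_all
 have "hnull k (\<Union>((%Q. Q - \<Union>(A Q)) ` D))" using D(1) A(3) by (intro hausdorff_null_Union) auto
 hence "hnull k ((S - \<Union>D) Un \<Union>((%Q. Q - \<Union>(A Q)) ` D))" by (rule hausdorff_null_Un[OF D(3)])
 hence "hnull k (S - \<Union>(UN Q:D. A Q))" by (rule hausdorff_null_subset) blast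
 moreover have "countable (UN Q:D. A Q)" using D(1) A(1) by auto
 moreover have "ALL B:(UN Q:D. A Q). C1_piece f B" using A(2) by auto
 ultimately show ?thesis by (intro exI[of _ "UN Q:D. A Q"]) simp
qed

section \<open>Joining C1 pieces with small loss of measure\<close>

lemma inner_compact:
 fixes M :: "'a::euclidean_space measure"
 assumes [simp]: "sets M = sets borel" and B: "B : sets borel" "emeasure M B < \<infinity>" and e: "0 < e"
 obtains K where "compact K" "K <= B" "emeasure M (B - K) <= ennreal e" proof -
 define N where "N = density M (indicator B)"
 have sN: "sets N = sets borel" by (simp add: N_def)
 have N: "emeasure N C = emeasure M (B Int C)" if "C : sets borel" for C unfolding N_def using B(1) that by (simp add: emeasure_restricted)
 have NB: "emeasure N B = emeasure M B" using N[OF B(1)] by simp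
 have "emeasure N (space N) ~= \<infinity>" using N[of UNIV] B(2) sets_eq_imp_space_eq[OF sN] by simp
 from inner_regular[OF sN this B(1)]
 have S: "emeasure M B = (SUP K\<in>{K. K <= B & compact K}. emeasure N K)" using NB by simp
 have "EX K. K <= B & compact K & emeasure M B <= emeasure M K + ennreal e" proof (cases "emeasure M B <= ennreal e")
  case False
  obtain b where b: "emeasure M B = ennreal b" "0 <= b" using B(2) by (cases "emeasure M B") auto
  hence eb: "e < b" using False e by (simp add: not_le ennreal_less_iff)
  hence "ennreal (b - e) < emeasure M B" using b e by (simp add: ennreal_less_iff)
  then obtain K where K: "K <= B" "compact K" "ennreal (b - e) < emeasure N K" unfolding S less_SUP_iff by auto
  have "emeasure N K = emeasure M K" using N[OF borel_compact[OF K(2)]] K(1) by (simp add: Int_absorb1)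
  moreover have "ennreal b = ennreal (b - e) + ennreal e" using eb e by (simp add: ennreal_plus[symmetric] del: ennreal_plus)
  ultimately have "emeasure M B <= emeasure M K + ennreal e" using K(3) b(1) by (simp add: add_right_mono less_imp_le)
  thus ?thesis using K(1,2) by blast
 qed (intro exI[of _ "{}"], simp)
 then obtain K where K: "K <= B" "compact K" "emeasure M B <= emeasure M K + ennreal e" by blast
 have Km: "K : sets M" using borel_compact[OF K(2)] by simp
 have fK: "emeasure M K ~= \<infinity>" using emeasure_mono[OF K(1), of M] B by (auto simp: top_unique)
 have "emeasure M (B - K) = emeasure M B - emeasure M K" using K(1) B(1) Km fK by (intro emeasure_Diff) auto
 also have "... <= ennreal e" using K(3) fK by (simp add: ennreal_minus_le_iff add.commute)
 finally show thesis using that K(1,2) by blast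
qed

lemma C1_glue:
 fixes P Q :: "'a::euclidean_space set"
 assumes P: "compact P" "compact Q" "P Int Q = {}" and p: "C1_grad p P'" and q: "C1_grad q Q'"
 obtains h H where "C1_grad h H" "!!x. x : P ==> h x = p x" "!!x. x : Q ==> h x = q x" proof -
 have "open (- P)" "Q <= - P" using compact_imp_closed[OF P(1)] P(3) by auto
 then obtain tht Tht T where t: "C1_grad tht Tht" "T <= - P" "!!x. x \<notin> T ==> tht x = 0" "!!x. x : Q ==> tht x = 1"
  by (rule C1_cutoff[OF P(2)]) (rule that)
 show thesis proof (rule that[OF C1_grad_add[OF p C1_grad_mult[OF t(1) C1_grad_diff[OF q p]]]])
  show "p x + tht x * (q x - p x) = p x" if "x : P" for x using t(2) t(3)[of x] that by auto
  show "p x + tht x * (q x - p x) = q x" if "x : Q" for x using t(4)[OF that] by simp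
 qed
qed

lemma C1_piece_approx:
 fixes M :: "'a::euclidean_space measure"
 assumes [simp]: "sets M = sets borel" and A: "A : sets borel" "emeasure M A < \<infinity>" and D: "countable D" "!!B. B : D ==> C1_piece f B"
  and null: "emeasure M (A - \<Union>D) = 0" and e: "0 < e"
 obtains P where "P <= A" "C1_piece f P" "emeasure M (A - P) <= ennreal e" proof -
 have pe: "C1_piece f {}" using C1_grad_const[of 0] unfolding C1_piece_def by auto
 define Q where "Q = from_nat_into (insert {} D)"
 have rQ: "range Q = insert {} D" unfolding Q_def using D(1) by (intro range_from_nat_into) auto
 have QC: "C1_piece f (Q m)" for m using rangeI[of Q m] rQ D(2) pe by auto
 have Qm: "Q m : sets borel" for m using QC by (auto simp: C1_piece_def borel_compact)
 define U where "U N = (\<Union>m<N. Q m)" for N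
 have Um: "U N : sets borel" for N unfolding U_def using Qm by auto
 have UA: "emeasure M (A - U N) < \<infinity>" for N using emeasure_mono[of "A - U N" A M] A by (auto simp: less_top[symmetric] top_unique)
 have "(%N. emeasure M (A - U N)) ----> emeasure M (INT N. A - U N)" proof (rule Lim_emeasure_decseq)
  show "decseq (%N. A - U N)" unfolding decseq_def U_def by (auto simp: less_le_trans)
  show "emeasure M (A - U i) ~= \<infinity>" for i using UA[of i] by simp
 qed (use A Um in auto)
 moreover have "(INT N. A - U N) = A - \<Union>D" proof -
  have "(UN N. U N) = \<Union>(range Q)" by (auto simp: U_def)
  thus ?thesis using rQ by auto
 qed
 ultimately have "(%N. emeasure M (A - U N)) ----> 0" using null by simp
 hence "\<forall>\<^sub>F N in sequentially. emeasure M (A - U N) < ennreal (e / 2)" by (rule order_tendstoD) (use e in simp)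
 then obtain N where N: "emeasure M (A - U N) < ennreal (e / 2)" using eventually_happens'[OF sequentially_bot] by blast
 define d where "d = e / (2 * (real N + 1))"
 have d: "0 < d" using e by (simp add: d_def)
 \<comment> \<open>The part added for \<open>Q k\<close> lies outside \<open>U k\<close>, so it is a
   compact set disjoint from the earlier piece and the two C1 functions can be glued. Each stage
   loses at most \<open>d\<close>.\<close>
 have "EX P. P <= A Int U k & C1_piece f P & emeasure M (A Int U k - P) <= ennreal (real k * d)" for k proof (induction k)
  case 0
  show ?case using pe by (intro exI[of _ "{}"]) (simp add: U_def)
 next
  case (Suc k)
  then obtain P where P: "P <= A Int U k" "C1_piece f P" "emeasure M (A Int U k - P) <= ennreal (real k * d)" by blast
  define B where "B = A Int Q k - U k"
  have Bm: "B : sets borel" unfolding B_def using A Qm Um by auto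
  have "B <= A" by (auto simp: B_def)
  hence "emeasure M B < \<infinity>" using emeasure_mono[of B A M] A by (auto intro: order_le_less_trans)
  then obtain K where K: "compact K" "K <= B" "emeasure M (B - K) <= ennreal d" by (rule inner_compact[OF assms(1) Bm _ d]) (rule that)
  obtain p P' where p: "compact P" "C1_grad p P'" "!!x. x : P ==> p x = f x" using P(2) unfolding C1_piece_def by blast
  obtain q Q' where q: "C1_grad q Q'" "!!x. x : Q k ==> q x = f x" using QC[of k] unfolding C1_piece_def by blast
  have "P Int K = {}" using P(1) K(2) by (auto simp: B_def)
  then obtain h H where h: "C1_grad h H" "!!x. x : P ==> h x = p x" "!!x. x : K ==> h x = q x"
   by (rule C1_glue[OF p(1) K(1) _ p(2) q(1)]) (assumption | rule that)+
  have "C1_piece f (P Un K)" unfolding C1_piece_def proof (intro conjI exI ballI)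
   show "h x = f x" if "x : P Un K" for x using that h(2,3) p(3) q(2) K(2) by (auto simp: B_def)
  qed (use p(1) K(1) h(1) in auto)
  moreover have Uk: "U (Suc k) = U k Un Q k" by (auto simp: U_def less_Suc_eq)
  moreover have "emeasure M (A Int U (Suc k) - (P Un K)) <= ennreal (real (Suc k) * d)" proof -
   have m: "A Int U k - P : sets M" "B - K : sets M" using A Um Bm borel_compact[OF p(1)] borel_compact[OF K(1)] by auto
   have "emeasure M (A Int U (Suc k) - (P Un K)) <= emeasure M ((A Int U k - P) Un (B - K))" by (rule emeasure_mono) (use Uk m in "auto simp: B_def")
   also have "... <= emeasure M (A Int U k - P) + emeasure M (B - K)" by (rule emeasure_subadditive[OF m])
   also have "... <= ennreal (real k * d) + ennreal d" by (intro add_mono P(3) K(3))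
   also have "... = ennreal (real (Suc k) * d)" using d by (simp add: ennreal_plus[symmetric] distrib_right del: ennreal_plus)
   finally show ?thesis .
  qed
  moreover have "P Un K <= A Int U (Suc k)" using P(1) K(2) unfolding Uk B_def by blast
  ultimately show ?case by blast
 qed
 then obtain P where P: "P <= A Int U N" "C1_piece f P" "emeasure M (A Int U N - P) <= ennreal (real N * d)" by blast
 have Pm: "P : sets borel" using P(2) by (auto simp: C1_piece_def borel_compact)
 have "emeasure M (A - P) <= emeasure M ((A Int U N - P) Un (A - U N))" by (rule emeasure_mono) (use A Um Pm in auto)
 also have "... <= emeasure M (A Int U N - P) + emeasure M (A - U N)" by (rule emeasure_subadditive) (use A Um Pm in auto)
 also have "... <= ennreal (e / 2) + ennreal (e / 2)" proof (rule add_mono)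
  have "real N * d <= e / 2" using e by (simp add: d_def field_simps)
  thus "emeasure M (A Int U N - P) <= ennreal (e / 2)" using P(3) ennreal_leI order_trans by blast
 qed (use N in simp)
 also have "... = ennreal e" using e by (simp add: ennreal_plus[symmetric] del: ennreal_plus)
 finally show thesis using that[of P] P by blast
qed

text \<open>On each unit ball the sum is one fixed finite sum of C1 functions.\<close>

lemma C1_locally_finite_sum:
 fixes h :: "nat => 'a::euclidean_space => real"
 assumes h: "!!j. C1_grad (h j) (H j)" and z: "!!j x. norm x + 1 <= real j ==> h j x = 0 & H j x = 0"
 obtains g G where "C1_grad g G" "!!x N. norm x + 1 <= real N ==> g x = (\<Sum>j<N. h j x)" proof -
 define c where "c x = nat \<lceil>norm x + 1\<rceil>" for x :: 'a
 have c: "norm x + 1 <= real (c x)" for x by (simp add: c_def) linarith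
 have sum: "(\<Sum>j<N. f j) = (\<Sum>j<c x. f j)" if N: "norm x + 1 <= real N" and f: "!!j. norm x + 1 <= real j ==> f j = 0"
  for x N and f :: "nat => 'b::real_vector" proof -
  have "(\<Sum>j<max N (c x). f j) = (\<Sum>j<n. f j)" if "norm x + 1 <= real n" "n <= max N (c x)" for n
   by (rule sum.mono_neutral_right) (use that f in "auto simp: not_less intro: order_trans")
  from this[of N] this[of "c x"] show ?thesis using N c[of x] by simp
 qed
 define g where "g x = (\<Sum>j<c x. h j x)" for x
 define G where "G x = (\<Sum>j<c x. H j x)" for x
 have gs: "g x = (\<Sum>j<N. h j x)" "G x = (\<Sum>j<N. H j x)" if "norm x + 1 <= real N" for x N
  unfolding g_def G_def using sum[OF that, of "%j. h j x"] sum[OF that, of "%j. H j x"] z by auto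
 have S: "C1_grad (%x. \<Sum>j<N. h j x) (%x. \<Sum>j<N. H j x)" for N by (rule C1_grad_sum) (rule h)
 have loc: "norm y + 1 <= real (c x + 1)" if "y : ball x 1" for x y
  using that norm_triangle_ineq2[of y x] c[of x] by (simp add: dist_norm norm_minus_commute)
 have "C1_grad g G" unfolding C1_grad_def proof (intro conjI allI)
  show "(g has_derivative (%v. G x <.> v)) (at x)" for x proof (rule has_derivative_transform_within_open)
   show "((%y. \<Sum>j<c x + 1. h j y) has_derivative (%v. G x <.> v)) (at x)"
    using C1_gradD(1)[OF S[of "c x + 1"], of x] gs(2)[OF loc[of x x]] by simp
   show "(\<Sum>j<c x + 1. h j y) = g y" if "y : ball x 1" for y using gs(1)[OF loc[OF that]] by simp
  qed auto
  have "isCont G x" for x proof -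
   have "isCont (%y. \<Sum>j<c x + 1. H j y) x" using C1_gradD(2)[OF S[of "c x + 1"]] by (simp add: continuous_on_eq_continuous_at)
   moreover have "\<forall>\<^sub>F y in nhds x. G y = (\<Sum>j<c x + 1. H j y)"
    using gs(2)[OF loc] by (intro eventually_nhds_in_open[THEN eventually_mono, of "ball x 1"]) auto
   ultimately show ?thesis by (subst isCont_cong) auto
  qed
  thus "continuous_on UNIV G" by (simp add: continuous_on_eq_continuous_at)
 qed
 thus thesis using that gs(1) by blast
qed

text \<open>A Radon measure may have infinite mass, so the loss is distributed over bounded shells
  \<open>A j\<close>. The shell losses add up to \<open>e / 2\<close>, which leaves room for the
  strict inequality.\<close>

lemma lusin_of_C1_pieces:
 fixes M :: "'a::euclidean_space measure"
 assumes rM: "radon_measure M" and D: "countable D" "!!B. B : D ==> C1_piece f B" "emeasure M (- \<Union>D) = 0" and e: "0 < e"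
 shows "EX g G. C1_grad g G & emeasure M {x. g x ~= f x} < ennreal e" proof -
 have sM[simp]: "sets M = sets borel" using rM by (simp add: radon_measure_def)
 define A where "A j = {x::'a. real j <= norm x & norm x < real j + 1}" for j
 have Am: "A j : sets borel" for j unfolding A_def by measurable
 have Af: "emeasure M (A j) < \<infinity>" for j proof -
  have "emeasure M (A j) <= emeasure M (cball 0 (real j + 1))" by (rule emeasure_mono) (auto simp: A_def)
  also have "... < \<infinity>" using rM compact_cball unfolding radon_measure_def by blast
  finally show ?thesis .
 qed
 have UDm: "\<Union>D \<in> sets borel" using D(1,2) by (intro sets.countable_Union) (auto simp: C1_piece_def intro: borel_compact)
 have "EX P. P <= A j & C1_piece f P & emeasure M (A j - P) <= ennreal (e / 4 * (1/2) ^ j)" for j proof -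
  have n: "emeasure M (A j - \<Union>D) = 0" using emeasure_mono[of "A j - \<Union>D" "- \<Union>D" M] D(3) UDm by auto
  have p: "0 < e / 4 * (1/2) ^ j" using e by simp
  show ?thesis by (rule C1_piece_approx[OF sM Am Af D(1,2) n p]) auto
 qed
 then obtain P where P: "!!j. P j <= A j" "!!j. C1_piece f (P j)" "!!j. emeasure M (A j - P j) <= ennreal (e / 4 * (1/2) ^ j)" by metis
 hence cP: "compact (P j)" for j by (simp add: C1_piece_def)
 have "EX p. EX p'. C1_grad p p' & (ALL x:P j. p x = f x)" for j using P(2)[of j] by (simp add: C1_piece_def)
 then obtain p p' where p: "!!j. C1_grad (p j) (p' j)" "!!j x. x : P j ==> p j x = f x" by metis
 \<comment> \<open>A neighbourhood of \<open>P j\<close> free of the other pieces: those with index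
   up to \<open>Suc j\<close> are removed, finitely many, and later ones have norm at least
   \<open>real j + 2\<close>.\<close>
 define U where "U j = {x. real j - 1 < norm x} Int {x. norm x < real j + 2} - (UN i:{..Suc j} - {j}. P i)" for j
 have "EX h H. C1_grad h H & (ALL x. x : P j --> h x = f x) & (ALL x. x \<notin> U j --> h x = 0 & H x = 0)" for j proof -
  have o: "open (U j)" unfolding U_def
   by (intro open_Diff open_Int open_Collect_less continuous_intros closed_UN ballI compact_imp_closed cP finite_Diff finite_atMost)
  have s: "P j <= U j" proof
   fix x assume x: "x : P j"
   hence xA: "real j <= norm x" "norm x < real j + 1" using P(1)[of j] by (auto simp: A_def)
   have "x \<notin> P i" if "i ~= j" for i proof
    assume "x : P i"
    hence "real i <= norm x" "norm x < real i + 1" using P(1)[of i] by (auto simp: A_def)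
    thus False using xA that by linarith
   qed
   thus "x : U j" using xA by (auto simp: U_def)
  qed
  obtain tht Tht T where t: "C1_grad tht Tht" "T <= U j" "!!x. x \<notin> T ==> tht x = 0" "!!x. x : P j ==> tht x = 1" "!!x. tht x = 0 \<or> tht x = 1 ==> Tht x = 0"
   by (rule C1_cutoff[OF cP o s]) (rule that)
  have "tht x = 0 & Tht x = 0" if "x \<notin> U j" for x using t(2,3,5) that by blast
  thus ?thesis using C1_grad_mult[OF t(1) p(1)[of j]] t(4) p(2)
   by (intro exI[of _ "%x. tht x * p j x"] exI[of _ "%x. tht x *. p' j x + p j x *. Tht x"]) auto
 qed
 then obtain h H where h: "!!j. C1_grad (h j) (H j)" "!!j x. x : P j ==> h j x = f x" "!!j x. x \<notin> U j ==> h j x = 0 & H j x = 0" by metis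
 have hz: "h j x = 0 & H j x = 0" if "norm x + 1 <= real j" for j x by (rule h(3)) (use that in "auto simp: U_def")
 obtain g G where g: "C1_grad g G" "!!x N. norm x + 1 <= real N ==> g x = (\<Sum>j<N. h j x)"
  by (rule C1_locally_finite_sum[OF h(1) hz]) (assumption, rule that)
 have gf: "g x = f x" if x: "x : P j" for x j proof -
  have xA: "real j <= norm x" "norm x < real j + 1" using x P(1)[of j] by (auto simp: A_def)
  have "h i x = 0" if "i ~= j" for i proof -
   have "x \<notin> U i" proof (cases "j <= Suc i")
    case False
    hence "real i + 2 <= real j" by linarith
    thus ?thesis using xA by (auto simp: U_def)
   qed (use x that in "auto simp: U_def")
   thus ?thesis using h(3) by blast
  qed
  hence "(\<Sum>i<j + 2. h i x) = (\<Sum>i<j + 2. if i = j then h j x else 0)" by (intro sum.cong) auto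
  thus ?thesis using g(2)[of x "j + 2"] xA h(2)[OF x] by simp
 qed
 have "{x. g x ~= f x} <= (UN j. A j - P j)" proof
  fix x assume "x : {x. g x ~= f x}"
  hence "x \<notin> P j" for j using gf by auto
  moreover have "x : A (nat \<lfloor>norm x\<rfloor>)" by (auto simp: A_def)
  ultimately show "x : (UN j. A j - P j)" by blast
 qed
 hence "emeasure M {x. g x ~= f x} <= emeasure M (UN j. A j - P j)" using Am borel_compact[OF cP] by (intro emeasure_mono) auto
 also have "... <= (\<Sum>j. emeasure M (A j - P j))" using Am borel_compact[OF cP] by (intro emeasure_subadditive_countably) auto
 also have "... <= (\<Sum>j. ennreal (e / 4 * (1/2) ^ j))" by (intro suminf_le P(3)) auto
 also have "... = ennreal (e / 2)" by (rule trans[OF suminf_ennreal_half]) (use e in simp_all)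
 also have "ennreal (e / 2) < ennreal e" using e by (simp add: ennreal_less_iff)
 finally show ?thesis using g(1) by blast
qed

section \<open>Reduction of the dimension\<close>

lemma bump_density: "emeasure (density lborel (%t. ennreal (bump (t::'a::euclidean_space)))) UNIV = 1" proof -
 have [measurable]: "bump : borel_measurable (borel :: 'a measure)" by (rule borel_measurable_continuous_onI[OF continuous_bump])
 have "emeasure (density lborel (%t. ennreal (bump (t::'a)))) UNIV = (NN t. ennreal (bump (t::'a)))"
  by (subst emeasure_density) auto
 also have "... = 1" using nn_integral_eq_integral[OF integrable_bump] by (simp add: bump_nonneg bump_integral)
 finally show ?thesis .
qed

lemma coord_proj_inner_mem:
 assumes "I <= Basis" "i : I"
 shows "coord_proj I x <.> i = x <.> i" "coord_proj (Basis - I) x <.> i = 0" using assms by (auto simp: coord_proj_inner subset_iff)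

text \<open>Keeps the coordinates in \<open>I\<close> of a point distributed by \<open>N\<close> and
  replaces the others by an independent choice with density \<open>bump\<close>. If \<open>N\<close>
  lives on a compact set that is null in dimension \<open>card I\<close>, its smear lives on a
  Lebesgue null cylinder.\<close>

definition smear :: "'a::euclidean_space set => 'a measure => 'a measure" where
 "smear I N = distr (N \<Otimes>\<^sub>M density lborel (%t. ennreal (bump t))) borel (%z. coord_proj I (fst z) + coord_proj (Basis - I) (snd z))"

lemma smear:
 fixes N :: "'a::euclidean_space measure"
 assumes fin: "finite_measure N" and [measurable_cong]: "sets N = sets borel"
 shows "finite_measure (smear I N)" "sets (smear I N) = sets borel" "measure (smear I N) UNIV = measure N UNIV"
  "AE x in N. x : A ==> I <= Basis ==> cylinder I 1 A : sets borel ==> AE x in smear I N. x : cylinder I 1 A"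
  "f : borel_measurable borel ==> (!!x. <|f x|> <= b) ==> (LINT y|smear I N. f y) =
   (LINT x|N. LINT t|lborel. bump t * f (coord_proj I x + coord_proj (Basis - I) t))"
  "f : borel_measurable borel ==> (!!x. <|f x|> <= b) ==> r < (LINT y|smear I N. f y) ==>
   EX t. r < (LINT x|N. f (coord_proj I x + coord_proj (Basis - I) t))" proof -
 let ?T = "density lborel (%t. ennreal (bump (t::'a)))"
 let ?s = "%z::'a \<times> 'a. coord_proj I (fst z) + coord_proj (Basis - I) (snd z)"
 interpret N: finite_measure N by (rule fin)
 interpret T: finite_measure ?T by (rule finite_measureI) (simp add: bump_density)
 interpret P: pair_sigma_finite N ?T ..
 interpret NT: finite_measure "N \<Otimes>\<^sub>M ?T" by (rule finite_measure_pair_measure) unfold_locales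
 have pm[measurable]: "coord_proj J : borel_measurable borel" for J :: "'a set" by (rule borel_measurable_continuous_onI[OF coord_proj_continuous])
 have bm[measurable]: "bump : borel_measurable (borel :: 'a measure)" by (rule borel_measurable_continuous_onI[OF continuous_bump])
 have sT[measurable_cong]: "sets ?T = sets borel" by simp
 have sm[measurable]: "?s : measurable (N \<Otimes>\<^sub>M ?T) borel" by measurable
 have spN: "space N = UNIV" using sets_eq_imp_space_eq[OF assms(2)] by simp
 show "finite_measure (smear I N)" unfolding smear_def by (rule NT.finite_measure_distr[OF sm])
 show "sets (smear I N) = sets borel" by (simp add: smear_def)
 have "emeasure (smear I N) UNIV = emeasure (N \<Otimes>\<^sub>M ?T) (UNIV \<times> UNIV)"
  unfolding smear_def using sm by (subst emeasure_distr) (auto simp: space_pair_measure spN)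
 also have "... = emeasure N UNIV * emeasure ?T UNIV" by (rule T.emeasure_pair_measure_Times) (use assms(2) in auto)
 finally show "measure (smear I N) UNIV = measure N UNIV" by (simp add: measure_def bump_density)
 show "AE x in smear I N. x : cylinder I 1 A" if A: "AE x in N. x : A" "I <= Basis" "cylinder I 1 A : sets borel" proof -
  have "AE t in ?T. t : cbox (- One) One" proof (subst AE_density)
   show "AE t in lborel. 0 < ennreal (bump t) --> t : cbox (- One) (One::'a)" proof (intro AE_I2 impI)
    fix t :: 'a assume "0 < ennreal (bump t)"
    hence "norm t <= 1" using bump_outside[of t] by (cases "norm t <= 1") auto
    thus "t : cbox (- One) One" using Basis_le_norm[of _ t] by (fastforce simp: mem_box abs_le_iff)
   qed
  qed simp
  have "AE z in N \<Otimes>\<^sub>M ?T. ?s z : cylinder I 1 A" proof -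
   have "AE x in N. AE t in ?T. coord_proj I x + coord_proj (Basis - I) t : cylinder I 1 A" using A(1) proof eventually_elim
    fix x assume x: "x : A"
    show "AE t in ?T. coord_proj I x + coord_proj (Basis - I) t : cylinder I 1 A" using \<open>AE t in ?T. t : cbox (- One) One\<close>
    proof eventually_elim
     fix t :: 'a assume "t : cbox (- One) One"
     hence "<|t <.> j|> <= 1" if "j : Basis" for j using that by (force simp: mem_box abs_le_iff)
     thus "coord_proj I x + coord_proj (Basis - I) t : cylinder I 1 A"
      unfolding cylinder_def using x A(2) by (auto intro!: bexI[of _ x] simp: inner_add_left coord_proj_inner coord_proj_inner_mem[OF A(2)])
    qed
   qed
   moreover have "{z : space (N \<Otimes>\<^sub>M ?T). ?s z : cylinder I 1 A} : sets (N \<Otimes>\<^sub>M ?T)"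
    using measurable_sets[OF sm A(3)] by (simp add: vimage_def Int_def conj_commute)
   ultimately show ?thesis by (intro P.AE_pair_measure) auto
  qed
  thus ?thesis unfolding smear_def using A(3) by (subst AE_distr_iff[OF sm]) auto
 qed
 have I0: "(LINT y|smear I N. f y) = (LINT z|(N \<Otimes>\<^sub>M ?T). f (?s z))" "integrable (N \<Otimes>\<^sub>M ?T) (%z. f (?s z))"
  if [measurable]: "f : borel_measurable borel" and "!!x. <|f x|> <= b" for f :: "'a => real" and b unfolding smear_def using that
  by (auto intro!: integral_distr NT.integrable_const_bound[of _ b])
 show "(LINT y|smear I N. f y) = (LINT x|N. LINT t|lborel. bump t * f (coord_proj I x + coord_proj (Basis - I) t))" if f: "f : borel_measurable borel" "!!x. <|f x|> <= b" for f :: "'a => real" and b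
 proof -
  note f(1)[measurable]
  have "(LINT z|(N \<Otimes>\<^sub>M ?T). f (?s z)) = (LINT x|N. LINT t|?T. f (coord_proj I x + coord_proj (Basis - I) t))"
   using P.integral_fst'[OF I0(2)[OF f]] by simp
  also have "... = (LINT x|N. LINT t|lborel. bump t * f (coord_proj I x + coord_proj (Basis - I) t))"
   by (rule lint_cong[OF refl], subst integral_density) (auto simp: bump_nonneg)
  finally show ?thesis using I0(1)[OF f] by simp
 qed
 show "EX t. r < (LINT x|N. f (coord_proj I x + coord_proj (Basis - I) t))"
  if f: "f : borel_measurable borel" "!!x. <|f x|> <= b" and r: "r < (LINT y|smear I N. f y)" for f :: "'a => real" and b r proof (rule ccontr)
  assume "~ ?thesis"
  hence le: "(LINT x|N. f (coord_proj I x + coord_proj (Basis - I) t)) <= r" for t by (simp add: not_less)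
  have i: "integrable (N \<Otimes>\<^sub>M ?T) (%(x, t). f (coord_proj I x + coord_proj (Basis - I) t))" using I0(2)[OF f] by (simp add: split_def)
  have "(LINT y|smear I N. f y) = (LINT t|?T. LINT x|N. f (coord_proj I x + coord_proj (Basis - I) t))"
   using P.integral_snd[OF i] I0(1)[OF f] by (simp add: split_def)
  also have "... <= (LINT t|?T. r)" by (rule integral_mono[OF P.integrable_snd[OF i]]) (use le in auto)
  also have "... = r" by (simp add: measure_def bump_density)
  finally show False using r by simp
 qed
qed

text \<open>Test fields are constructed for the smeared measure. In directions outside
  \<open>I\<close> that measure has a C1 density, so these parts of the divergence can be integrated
  by parts and are as small as the field itself. Some coordinate in \<open>I\<close> must then carry
  a fixed share of the divergence.\<close>

lemma directional_test_function:
 fixes N :: "'a::euclidean_space measure"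
 assumes fin: "finite_measure N" and sets[measurable_cong]: "sets N = sets borel" and A: "compact A" "AE x in N. x : A" and M: "0 < measure N UNIV"
  and I: "I <= Basis" and H: "hnull (card I) A"
 obtains c where "0 < c" "!!r. 0 < r ==> EX l:I. EX phi Phi. C1_grad phi Phi & (ALL x. norm (Phi x) <= field_bound TYPE('a) & <|phi x|> <= r &
  coord_proj I (Phi x) = Phi x) & c <= (LINT x|N. Phi x <.> l)" proof -
 define n where "n = real DIM('a)"
 have n: "0 < n" by (simp add: n_def)
 define m where "m = energy_const TYPE('a) / (10 * tent_mass TYPE('a)) * measure N UNIV"
 have m: "0 < m" using constants_pos(1)[where 'a='a] tent_mass_pos[where 'a='a] M by (simp add: m_def)
 obtain B :: "'a => 'a" where B: "C1_grad bump B" "!!x. 1 < norm x ==> B x = 0" by (rule C1_grad_bump) (rule that)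
 have Bi: "integrable lborel (%t. norm (B t))" by (rule integrable_norm, rule lborel_integrable_compact_support[OF C1_gradD(2)[OF B(1)] B(2)])
 define b where "b = (LBINT t. norm (B t))"
 have b: "0 <= b" unfolding b_def by (rule lint_nonneg) simp
 let ?S = "smear I N"
 let ?sg = "%x t. coord_proj I x + coord_proj (Basis - I) t"
 have cyl: "cylinder I 1 A = (%z. ?sg (fst z) (snd z)) ` (A \<times> cbox (- One) One)" proof (intro set_eqI iffI)
  fix y assume "y : cylinder I 1 A"
  then obtain x where x: "x : A" "!!i. i : I ==> y <.> i = x <.> i" "!!j. j : Basis - I ==> <|y <.> j|> <= 1" unfolding cylinder_def by blast
  have "y = ?sg x (coord_proj (Basis - I) y)" by (rule euclidean_eqI) (use I x(2) in "auto simp: inner_add_left coord_proj_inner")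
  moreover have "coord_proj (Basis - I) y : cbox (- One) One" using x(3) by (auto simp: mem_box coord_proj_inner abs_le_iff minus_le_iff)
  ultimately show "y : (%z. ?sg (fst z) (snd z)) ` (A \<times> cbox (- One) One)"
   using x(1) by (intro image_eqI[of _ _ "(x, coord_proj (Basis - I) y)"]) auto
 next
  fix y assume "y : (%z. ?sg (fst z) (snd z)) ` (A \<times> cbox (- One) One)"
  then obtain x t where xt: "x : A" "t : cbox (- One) One" "y = ?sg x t" by auto
  have "<|t <.> j|> <= 1" if "j : Basis" for j using xt(2) that by (force simp: mem_box abs_le_iff)
  thus "y : cylinder I 1 A" unfolding cylinder_def xt(3) using xt(1) I
   by (auto intro!: bexI[of _ x] simp: inner_add_left coord_proj_inner coord_proj_inner_mem)
 qed
 have cc: "compact (cylinder I 1 A)" unfolding cyl by (intro compact_continuous_image compact_Times A(1) compact_cbox continuous_intros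
    continuous_on_compose2[OF coord_proj_continuous[of UNIV]]) auto
 have c0: "emeasure lborel (cylinder I 1 A) = 0" by (rule hausdorff_null_cylinder[OF I H _ borel_compact[OF cc]]) simp
 have "EX l:I. EX phi Phi. C1_grad phi Phi & (ALL x. norm (Phi x) <= field_bound TYPE('a) & <|phi x|> <= r &
  coord_proj I (Phi x) = Phi x) & m / (4 * n) <= (LINT x|N. Phi x <.> l)" if r: "0 < r" for r proof -
  \<comment> \<open>With this bound on the field all directions outside \<open>I\<close> together
    contribute at most \<open>m / 2\<close>; the summand 1 avoids division by zero.\<close>
  define q where "q = min r (m / (2 * (n * (b * measure N UNIV) + 1)))"
  have den: "0 < n * (b * measure N UNIV) + 1" using n b by (intro add_nonneg_pos mult_nonneg_nonneg) auto
  have q: "0 < q" "q <= r" using r m den by (auto simp: q_def)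
  have "q * (2 * (n * (b * measure N UNIV) + 1)) <= m" using den by (simp add: q_def min_le_iff_disj pos_le_divide_eq[symmetric])
  hence q2: "n * (q * b * measure N UNIV) <= m / 2" using q(1) by (simp add: algebra_simps)
  have "0 < measure ?S UNIV" using M smear(3)[OF fin sets] by simp
  from singular_test_fields[OF smear(1,2)[OF fin sets] cc c0 smear(4)[OF fin sets A(2) I borel_compact[OF cc]] this q(1)]
  obtain phi Phi where p: "!!i. i : Basis ==> C1_grad (phi i) (Phi i)" "!!i x. i : Basis ==> norm (Phi i x) <= field_bound TYPE('a)"
   "!!i x. i : Basis ==> <|phi i x|> <= q" and div: "m <= (LINT x|?S. (SUM i:Basis. Phi i x <.> i))" unfolding smear(3)[OF fin sets] m_def by blast
  have fm: "(%x. Phi i x <.> i) : borel_measurable borel" "<|Phi i x <.> i|> <= field_bound TYPE('a)" if "i : Basis" for i x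
   using C1_grad_borel(2)[OF p(1)[OF that]] order_trans[OF Basis_le_norm[OF that] p(2)[OF that]] by auto
  interpret S: finite_measure ?S by (rule smear(1)[OF fin sets])
  have fi: "integrable ?S (%x. Phi i x <.> i)" if "i : Basis" for i by (rule S.integrable_const_bound[of _ "field_bound TYPE('a)"])
     (use fm[OF that] in "auto simp: measurable_cong_sets[OF smear(2)[OF fin sets] refl]")
  have J: "(LINT x|?S. Phi j x <.> j) <= q * b * measure N UNIV" if j: "j : Basis - I" for j proof -
   interpret N: finite_measure N by (rule fin)
   have jB: "j : Basis" using j by simp
   \<comment> \<open>For fixed \<open>x\<close> the component \<open>j\<close> of the gradient is a
     genuine derivative in the smearing variable \<open>t\<close>, and it is moved onto
     \<open>bump\<close>.\<close>
   have in1: "<|LINT t|lborel. bump t * (Phi j (?sg x t) <.> j)|> <= q * b" for x proof -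
    have C: "C1_grad (%t. phi j (coord_proj (Basis - I) t + coord_proj I x)) (%t. coord_proj (Basis - I) (Phi j (coord_proj (Basis - I) t + coord_proj I x)))"
     by (rule C1_grad_compose_coord_proj[OF p(1)[OF jB]])
    note cs = C1_grad_continuous[OF B(1), of UNIV] C1_grad_continuous[OF C, of UNIV] C1_gradD(2)[OF B(1)] C1_gradD(2)[OF C]
    have "(LBINT t. bump t * (Phi j (?sg x t) <.> j)) = (LBINT t. (bump t *. coord_proj (Basis - I) (Phi j (coord_proj (Basis - I) t + coord_proj I x))) <.> j)"
     using j by (simp add: coord_proj_inner add.commute)
    also have "... = (LBINT t. bump t *. coord_proj (Basis - I) (Phi j (coord_proj (Basis - I) t + coord_proj I x))) <.> j"
     by (rule integral_inner_left, rule lborel_integrable_compact_support[of _ 1])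
       (use bump_outside in "auto intro!: continuous_intros cs")
    also have "... = - (LBINT t. phi j (coord_proj (Basis - I) t + coord_proj I x) *. B t) <.> j"
     by (subst C1_grad_integral_by_parts[OF B(1) C bump_outside]) auto
    also have "<|...|> <= norm (LBINT t. phi j (coord_proj (Basis - I) t + coord_proj I x) *. B t)"
     using Basis_le_norm[OF jB, of "LINT t|lborel. phi j (coord_proj (Basis - I) t + coord_proj I x) *. B t"] by simp
    also have "... <= (LBINT t. norm (phi j (coord_proj (Basis - I) t + coord_proj I x) *. B t))" by (rule integral_norm_bound)
    also have "... <= (LBINT t. q * norm (B t))" proof (rule integral_mono)
     show "integrable lborel (%t. norm (phi j (coord_proj (Basis - I) t + coord_proj I x) *. B t))"
      by (rule integrable_norm, rule lborel_integrable_compact_support[of _ 1]) (use B(2) in "auto intro!: continuous_intros cs")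
    qed (use p(3)[OF jB] Bi in "auto intro!: mult_right_mono")
    also have "... = q * b" by (simp add: b_def)
    finally show ?thesis .
   qed
   have "(LINT x|?S. Phi j x <.> j) = (LINT x|N. LINT t|lborel. bump t * (Phi j (?sg x t) <.> j))" by (rule smear(5)[OF fin sets fm[OF jB]])
   \<comment> \<open>If the inner integral is not integrable in \<open>x\<close>, the outer one is 0
     by convention, which satisfies the bound as well.\<close>
   also have "... <= (LINT x|N. q * b)" proof (cases "integrable N (%x. LINT t|lborel. bump t * (Phi j (?sg x t) <.> j))")
    case True
    thus ?thesis by (rule integral_mono) (use in1 in "auto simp: abs_le_iff")
   qed (use q(1) b in "simp add: not_integrable_integral_eq")
   also have "... = q * b * measure N UNIV" using sets_eq_imp_space_eq[OF sets] by simp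
   finally show ?thesis .
  qed
  \<comment> \<open>Otherwise the directions in \<open>I\<close> give at most \<open>m / 4\<close>
    and the others at most \<open>m / 2\<close>, together less than \<open>m\<close>.\<close>
  have "EX l:I. m / (4 * n) < (LINT x|?S. Phi l x <.> l)" proof (rule ccontr)
   assume "~ ?thesis"
   hence le: "(LINT x|?S. Phi l x <.> l) <= m / (4 * n)" if "l : I" for l using that by (auto simp: not_less)
   have cn: "card I <= DIM('a)" "card (Basis - I) <= DIM('a)" using I by (auto intro: card_mono)
   have "m <= (SUM i:Basis. LINT x|?S. Phi i x <.> i)" using div fi by simp
   also have "... = (SUM i:I. LINT x|?S. Phi i x <.> i) + (SUM i:Basis - I. LINT x|?S. Phi i x <.> i)"
    using sum.subset_diff[OF I finite_Basis, of "%i. LINT x|?S. Phi i x <.> i"] by simp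
   also have "... <= real (card I) * (m / (4 * n)) + real (card (Basis - I)) * (q * b * measure N UNIV)" by (intro add_mono sum_bounded_above le J)
   also have "... <= n * (m / (4 * n)) + n * (q * b * measure N UNIV)" using cn m n q(1) b by (intro add_mono mult_right_mono) (auto simp: n_def)
   also have "... <= m / 4 + m / 2" using q2 n by (intro add_mono) auto
   finally show False using m by simp
  qed
  then obtain l where l: "l : I" "m / (4 * n) < (LINT x|?S. Phi l x <.> l)" by blast
  have lB: "l : Basis" using l(1) I by auto
  \<comment> \<open>The integral over the smear is an average over \<open>t\<close>, so some
    \<open>t\<close> does at least as well; fixing it leaves a function of the coordinates in
    \<open>I\<close> alone.\<close>
  obtain t where t: "m / (4 * n) < (LINT x|N. Phi l (?sg x t) <.> l)" using smear(6)[OF fin sets fm[OF lB] l(2)] by blast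
  have eq: "coord_proj I v <.> l = v <.> l" "coord_proj I (coord_proj I v) = coord_proj I v" for v
   using coord_proj_inner[OF I lB] l(1) by (auto intro!: euclidean_eqI[where 'a='a] simp: coord_proj_inner[OF I])
  show ?thesis
   using l(1) t C1_grad_compose_coord_proj[OF p(1)[OF lB], of I "coord_proj (Basis - I) t"] order_trans[OF coord_proj_norm_le[OF I] p(2)[OF lB]]
    order_trans[OF p(3)[OF lB] q(2)]
   by (intro bexI[of _ l] exI[of _ "%x. phi l (?sg x t)"] exI[of _ "%x. coord_proj I (Phi l (?sg x t))"]) (auto simp: eq)
 qed
 moreover have "0 < m / (4 * n)" using m n by simp
 ultimately show thesis by (intro that)
qed

text \<open>The test functions yield gradients converging to a field \<open>w\<close> with a
  component along \<open>l\<close> bounded below on a set of positive measure. By the approximation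
  property chords of a smaller piece are almost orthogonal to \<open>a = w x0\<close>, so the
  coordinate \<open>l\<close> of a chord is controlled by its other coordinates in
  \<open>I\<close>.\<close>

lemma lusin_graph_reduction:
 fixes M :: "'a::euclidean_space measure"
 assumes fin: "finite_measure M" and sets[measurable_cong]: "sets M = sets borel" and lus: "lusin_C1 M"
  and A: "compact A" "0 < emeasure M A" and I: "I <= Basis" and gr: "coord_graph I C A" and H: "hnull (card I) A"
 obtains l A' C' where "l : I" "compact A'" "A' <= A" "0 < emeasure M A'" "coord_graph (I - {l}) C' A'" proof -
 interpret finite_measure M by (rule fin)
 define N where "N = density M (indicator A)"
 have Am: "A : sets borel" by (rule borel_compact[OF A(1)])
 note d = finite_density_indicator[OF fin sets Am, folded N_def]
 interpret N: finite_measure N by (rule d(1))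
 have NA: "AE x in N. x : A" unfolding N_def using Am by (subst AE_density) (auto simp: indicator_def)
 define m where "m = measure N UNIV"
 have m: "0 < m" using A(2) d(3)[of UNIV] by (simp add: m_def emeasure_eq_measure)
 define D where "D = field_bound TYPE('a)"
 have D: "0 < D" using constants_pos(3)[where 'a='a] by (simp add: D_def)
 define T where "T c l r phi Phi \<longleftrightarrow> C1_grad phi Phi & (ALL x. norm (Phi x) <= D & <|phi x|> <= r & coord_proj I (Phi x) = Phi x) & c <= (LINT x|N. Phi x <.> l)"
  for c r and l :: 'a and phi Phi
 obtain c where c: "0 < c" "!!r. 0 < r ==> EX l:I. EX phi Phi. T c l r phi Phi"
  by (rule directional_test_function[OF d(1,2) A(1) NA m[unfolded m_def] I H, folded D_def, folded T_def]) (rule that)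
 \<comment> \<open>The direction may depend on \<open>r\<close>; finiteness of \<open>I\<close> and
   monotonicity in \<open>r\<close> give one that serves all. With \<open>l\<close> fixed, the lower
   bound on the integral is preserved by midpoints, as the selection of gradients requires.\<close>
 have "EX l:I. ALL r>0. EX phi Phi. T c l r phi Phi" proof (rule ccontr)
  assume "~ ?thesis"
  hence "ALL l:I. EX r. 0 < r & ~ (EX phi Phi. T c l r phi Phi)" by blast
  hence "EX r. ALL l:I. 0 < r l & ~ (EX phi Phi. T c l (r l) phi Phi)" by (rule bchoice)
  then obtain r where r: "ALL l:I. 0 < r l & ~ (EX phi Phi. T c l (r l) phi Phi)" ..
  define r0 where "r0 = Min (insert 1 (r ` I))"
  have fI: "finite I" by (rule finite_subset[OF I finite_Basis])
  have "0 < r0" using r fI by (simp add: r0_def)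
  then obtain l phi Phi where l: "l : I" "T c l r0 phi Phi" using c(2) by blast
  have "r0 <= r l" using l(1) fI by (auto simp: r0_def)
  hence "T c l (r l) phi Phi" using l(2) unfolding T_def by (auto intro: order_trans)
  thus False using r l(1) by blast
 qed
 then obtain l where l: "l : I" "!!r. 0 < r ==> EX phi Phi. T c l r phi Phi" by blast
 have lB: "l : Basis" using l(1) I by auto
 define F where "F i = {(phi, Phi). T c l ((1/2) ^ i) phi Phi}" for i :: nat
 define e where "e = c / (4 * D)"
 have e: "0 < e" using c(1) D by (simp add: e_def)
 have FD: "C1_grad (fst p) (snd p)" "norm (snd p x) <= D" "<|fst p x|> <= (1/2) ^ i" "coord_proj I (snd p x) = snd p x"
  "c <= (LINT x|N. snd p x <.> l)" if "p : F i" for p i x using that by (auto simp: F_def T_def)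
 have bi: "integrable N (%x. snd p x <.> l)" if p: "p : F i" for p i proof (rule N.integrable_const_bound[of _ D])
  show "AE x in N. norm (snd p x <.> l) <= D" using order_trans[OF Basis_le_norm[OF lB] FD(2)[OF p]] by auto
  show "(%x. snd p x <.> l) : borel_measurable N" using C1_grad_borel(2)[OF FD(1)[OF p]] unfolding measurable_cong_sets[OF d(2) refl] by simp
 qed
 obtain p B where p: "!!i. p i : F i" "closed B" "measure N (- B) <= e" "!!i x. x : B ==> norm (snd (p i) x - snd (p (Suc i)) x) <= (1/2) ^ i"
 proof (rule convex_gradient_selection[where C = F and G = snd and L = D, OF d(1,2) _ _ _ _ _ e])
  show "F i ~= {}" for i using l(2)[of "(1/2) ^ i"] by (auto simp: F_def)
  show "F (Suc i) <= F i" for i proof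
   fix q assume q: "q : F (Suc i)"
   have "(1/2) ^ Suc i <= (1/2 :: real) ^ i" by simp
   hence "<|fst q x|> <= (1/2) ^ i" for x using FD(3)[OF q, of x] by linarith
   thus "q : F i" using q unfolding F_def T_def by auto
  qed
  show "EX r:F i. ALL x. snd r x = (1/2) *. (snd q x + snd q' x)" if q: "q : F i" and q': "q' : F i" for i q q'
  proof (rule bexI[of _ "midpoint_pair q q'"])
   have "coord_proj I (snd (midpoint_pair q q') x) = snd (midpoint_pair q q') x" for x
    unfolding midpoint_pair(4) linear_scale[OF linear_coord_proj] linear_add[OF linear_coord_proj] FD(4)[OF q] FD(4)[OF q'] ..
   moreover have "c <= (LINT x|N. snd (midpoint_pair q q') x <.> l)"
    using FD(5)[OF q] FD(5)[OF q'] bi[OF q] bi[OF q'] by (simp add: midpoint_pair(4) inner_add_left)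
   ultimately show "midpoint_pair q q' : F i" using midpoint_pair(1)[OF FD(1)[OF q] FD(1)[OF q']] midpoint_pair(2)[OF FD(2)[OF q] FD(2)[OF q']]
     midpoint_pair(3)[where c = 0, of q _ "(1/2) ^ i" q'] FD(3)[OF q] FD(3)[OF q'] unfolding F_def T_def by (auto simp: split_beta)
  qed (simp add: midpoint_pair(4))
 qed (use FD(2) C1_gradD(2)[OF FD(1)] in "auto intro: that")
 define G where "G i = snd (p i)" for i
 have G: "C1_grad (fst (p i)) (G i)" "norm (G i x) <= D" "coord_proj I (G i x) = G i x" "c <= (LINT x|N. G i x <.> l)" for i x
  unfolding G_def using FD[OF p(1)] by auto
 define w where "w x = (\<Sum>i. G (Suc i) x - G i x) + G 0 x" for x
 have ul: "uniform_limit B G w sequentially" proof -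
  have "uniform_limit B (%k x. \<Sum>i<k. G (Suc i) x - G i x) (%x. \<Sum>i. G (Suc i) x - G i x) sequentially"
   by (rule Weierstrass_m_test[where M = "%i. (1/2) ^ i"]) (use p(4) in "auto simp: G_def norm_minus_commute intro!: summable_geometric")
  hence "uniform_limit B (%k x. (\<Sum>i<k. G (Suc i) x - G i x) + G 0 x) w sequentially"
   unfolding w_def by (intro uniform_limit_add uniform_limit_const)
  moreover have "(\<Sum>i<k. G (Suc i) x - G i x) + G 0 x = G k x" for k x using sum_lessThan_telescope[of "%i. G i x" k] by simp
  ultimately show ?thesis by simp
 qed
 have wl: "(%i. G i x) ----> w x" if "x : B" for x by (rule tendsto_uniform_limitI[OF ul that])
 have wc: "continuous_on B w"
  by (rule uniform_limit_theorem[OF _ ul sequentially_bot]) (intro always_eventually allI continuous_on_subset[OF C1_gradD(2)[OF G(1)]] subset_UNIV)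
 \<comment> \<open>Of the integral \<open>c\<close>, at most \<open>c / 4\<close> is lost on the
   complement of \<open>B\<close> by the choice of \<open>e\<close>, and points of
   \<open>A Int B\<close> outside \<open>K1\<close> give at most \<open>2 * c3 * m = c / 4\<close>.
   The remaining half must come from \<open>K1\<close>.\<close>
 define c3 where "c3 = c / (8 * m)"
 have c3: "0 < c3" using c(1) m by (simp add: c3_def)
 define K1 where "K1 = {x : A Int B. c3 <= w x <.> l}"
 have K1: "compact K1" proof -
  have "closed {x : A Int B. c3 <= w x <.> l}"
   by (intro continuous_on_closed_Collect_le continuous_intros continuous_on_subset[OF wc] closed_Int compact_imp_closed A(1) p(2)) auto
  hence "compact (A Int {x : A Int B. c3 <= w x <.> l})" by (rule compact_Int_closed[OF A(1)])
  moreover have "A Int {x : A Int B. c3 <= w x <.> l} = K1" by (auto simp: K1_def)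
  ultimately show ?thesis by simp
 qed
 have K1A: "K1 <= A" by (auto simp: K1_def)
 have K1m: "K1 : sets borel" by (rule borel_compact[OF K1])
 have K1p: "0 < emeasure M K1" proof -
  have "\<forall>\<^sub>F i in sequentially. ALL x:B. dist (G i x) (w x) < c3" using ul c3 unfolding uniform_limit_iff by blast
  then obtain i where i: "!!x. x : B ==> dist (G i x) (w x) < c3" using eventually_happens'[OF sequentially_bot] by blast
  have "c <= (LINT x|N. G i x <.> l)" by (rule G(4))
  also have "... <= (LINT x|N. D * indicator (- B) x + D * indicator K1 x + 2 * c3)" proof (rule integral_mono_AE)
   show "integrable N (%x. G i x <.> l)" unfolding G_def by (rule bi[OF p(1)])
   show "integrable N (%x. D * indicator (- B) x + D * indicator K1 x + 2 * c3)"
    using K1m p(2) d(2) by (intro Bochner_Integration.integrable_add integrable_mult_right integrable_real_indicator) (auto simp: N.emeasure_eq_measure)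
   show "AE x in N. G i x <.> l <= D * indicator (- B) x + D * indicator K1 x + 2 * c3" using NA proof eventually_elim
    fix x assume x: "x : A"
    have GD: "G i x <.> l <= D" using order_trans[OF Basis_le_norm[OF lB, of "G i x"] G(2)] by linarith
    show "G i x <.> l <= D * indicator (- B) x + D * indicator K1 x + 2 * c3" proof (cases "x : B & x \<notin> K1")
     case True
     have "<|(G i x - w x) <.> l|> <= c3" using order_trans[OF Basis_le_norm[OF lB]] i[of x] True by (fastforce simp: dist_norm)
     hence "G i x <.> l <= w x <.> l + c3" by (simp add: inner_diff_left)
     thus ?thesis using True x D by (auto simp: K1_def indicator_def)
    qed (use GD c3 D in "auto simp: indicator_def")
   qed
  qed
  also have "... = D * measure N (- B) + D * measure N K1 + 2 * c3 * m" proof -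
   have spN: "space N = UNIV" using sets_eq_imp_space_eq[OF d(2)] by simp
   have iB: "integrable N (%x. D * indicator (- B) x)" "integrable N (%x. D * indicator K1 x)"
    using K1m p(2) d(2) by (auto intro!: integrable_mult_right integrable_real_indicator simp: N.emeasure_eq_measure)
   show ?thesis using iB by (simp add: m_def spN)
  qed
  also have "... <= c / 4 + D * measure N K1 + c / 4" using p(3) D m mult_left_mono[OF p(3), of D] by (simp add: c3_def e_def)
  finally have "0 < D * measure N K1" using c(1) by linarith
  hence "0 < measure N K1" using D by (simp add: zero_less_mult_iff)
  thus ?thesis using d(3)[OF K1m] K1A by (simp add: Int_absorb1 emeasure_eq_measure)
 qed
 define C' where "C' = max 1 C"
 have C': "1 <= C'" by (simp add: C'_def)
 \<comment> \<open>Small enough for the flatness error \<open>12 * eta * norm v\<close>, estimated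
   through the graph condition, to be absorbed into half of the lower bound
   \<open>c3\<close>.\<close>
 define eta where "eta = min 1 (c3 / (24 * C'))"
 have eta: "0 < eta" "eta <= 1" "12 * eta * C' <= c3 / 2" using c3 C' by (auto simp: eta_def min_def field_simps)
 have "uniformly_continuous_on K1 w" by (rule compact_uniformly_continuous[OF continuous_on_subset[OF wc] K1]) (auto simp: K1_def)
 then obtain rho where rho: "0 < rho" "!!x y. x : K1 ==> y : K1 ==> dist y x < rho ==> dist (w y) (w x) < eta"
  using eta(1) unfolding uniformly_continuous_on_def by metis
 obtain x0 where x0: "x0 : K1" "0 < emeasure M (K1 Int cball x0 (rho / 2))"
  by (rule positive_measure_cball[OF sets K1 K1p, of "rho / 2"]) (use rho(1) in "auto intro: that")
 define K2 where "K2 = K1 Int cball x0 (rho / 2)"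
 have K2: "compact K2" unfolding K2_def by (intro compact_Int_closed K1 closed_cball)
 define a where "a = w x0"
 have x0B: "x0 : B" using x0(1) by (simp add: K1_def)
 obtain A' where A': "compact A'" "A' <= K2" "0 < emeasure M A'" "!!x y. x : A' ==> y : A' ==> <|a <.> (y - x)|> <= 12 * eta * dist x y"
 proof (rule lusin_C1_flat[OF fin sets lus K2 x0(2)[folded K2_def] G(1,2) _ _ _ eta(1,2)])
  show "uniform_limit UNIV (%i. fst (p i)) (%_. 0) sequentially" proof (rule uniform_limitI)
   fix u :: real assume "0 < u"
   hence "\<forall>\<^sub>F i in sequentially. (1/2 :: real) ^ i < u" using order_tendstoD(2)[OF LIMSEQ_realpow_zero[of "1/2"]] by auto
   thus "\<forall>\<^sub>F i in sequentially. ALL x:UNIV. dist (fst (p i) x) 0 < u" proof eventually_elim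
    case (elim i)
    thus ?case using order_le_less_trans[OF FD(3)[OF p(1)[of i]] elim] by simp
   qed
  qed
  show "uniform_limit K2 G w sequentially" by (rule uniform_limit_on_subset[OF ul]) (auto simp: K2_def K1_def)
  show "norm (w x - a) <= eta" if "x : K2" for x using rho(2)[OF x0(1), of x] that rho(1) by (simp add: K2_def a_def dist_norm norm_minus_commute)
 qed (rule that)
 have aD: "norm a <= D" unfolding a_def using G(2) by (intro LIMSEQ_le_const2[OF tendsto_norm[OF wl[OF x0B]]]) auto
 \<comment> \<open>The vector \<open>a\<close> lies in the plane of \<open>I\<close>, so its product
   with a chord involves only the coordinates of the chord in \<open>I\<close>.\<close>
 have "(%i. coord_proj I (G i x0)) ----> coord_proj I a"
  unfolding a_def by (rule bounded_linear.tendsto[OF _ wl[OF x0B]]) (use linear_coord_proj in "simp add: linear_conv_bounded_linear")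
 hence "(%i. G i x0) ----> coord_proj I a" by (simp add: G(3))
 hence aI: "coord_proj I a = a" using LIMSEQ_unique wl[OF x0B] unfolding a_def by blast
 have al: "c3 <= a <.> l" using x0(1) by (simp add: K1_def a_def)
 have "coord_graph (I - {l}) (C' * (2 + 2 * D / c3)) A'" unfolding coord_graph_def proof (intro ballI)
  fix x y assume xy: "x : A'" "y : A'"
  define v where "v = x - y"
  define P where "P = coord_proj (I - {l}) v"
  have cp: "coord_proj I v = (v <.> l) *. l + P" unfolding P_def coord_proj_def using sum.remove[OF finite_subset[OF I finite_Basis] l(1)] by blast
  have "a <.> v = a <.> coord_proj I v" using aI coord_proj_adjoint[of I a v] by simp
  also have "... = (v <.> l) * (a <.> l) + a <.> P" by (simp add: cp inner_add_right)
  finally have av: "(v <.> l) * (a <.> l) = a <.> v - a <.> P" by simp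
  have "x : A" "y : A" using xy A'(2) K1A by (auto simp: K2_def)
  hence "norm v <= C * norm (coord_proj I v)" using gr unfolding coord_graph_def v_def dist_norm by blast
  also have "... <= C' * norm (coord_proj I v)" by (intro mult_right_mono) (auto simp: C'_def)
  also have "norm (coord_proj I v) <= <|v <.> l|> + norm P" unfolding cp using norm_triangle_ineq[of "(v <.> l) *. l" P] lB by simp
  finally have nv: "norm v <= C' * (<|v <.> l|> + norm P)" using C' by simp
  \<comment> \<open>The chord is nearly orthogonal to \<open>a\<close>, whose component along
    \<open>l\<close> is at least \<open>c3\<close>; this bounds \<open>v <.> l\<close> by the
    remaining part \<open>P\<close> plus a multiple of \<open>v <.> l\<close> that is
    absorbed.\<close>
  have "c3 * <|v <.> l|> <= <|v <.> l|> * (a <.> l)" using mult_right_mono[OF al abs_ge_zero[of "v <.> l"]] by (simp add: mult.commute)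
  also have "... = <|a <.> v - a <.> P|>" using al c3 by (simp add: av[symmetric] abs_mult)
  also have "... <= <|a <.> v|> + <|a <.> P|>" by (rule abs_triangle_ineq4)
  also have "<|a <.> v|> <= 12 * eta * norm v" using A'(4)[OF xy(2,1)] by (simp add: v_def dist_norm norm_minus_commute)
  also have "... <= 12 * eta * (C' * (<|v <.> l|> + norm P))" using nv eta(1) by (intro mult_left_mono) auto
  also have "... <= c3 / 2 * (<|v <.> l|> + norm P)" using mult_right_mono[OF eta(3), of "<|v <.> l|> + norm P"] by (simp add: mult.assoc)
  also have "<|a <.> P|> <= D * norm P" using order_trans[OF Cauchy_Schwarz_ineq2 mult_right_mono[OF aD norm_ge_zero]] .
  finally have "c3 / 2 * <|v <.> l|> <= (c3 / 2 + D) * norm P" by (simp add: algebra_simps)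
  hence "<|v <.> l|> <= (1 + 2 * D / c3) * norm P" using c3 by (simp add: field_simps)
  hence "C' * (<|v <.> l|> + norm P) <= C' * ((1 + 2 * D / c3) * norm P + norm P)" using C' by (intro mult_left_mono) auto
  also have "... = C' * (2 + 2 * D / c3) * norm P" by (simp add: algebra_simps)
  finally show "dist x y <= C' * (2 + 2 * D / c3) * norm (coord_proj (I - {l}) (x - y))" using nv by (simp add: v_def P_def dist_norm)
 qed
 thus thesis using that[OF l(1) A'(1) _ A'(3)] A'(2) K1A by (auto simp: K2_def)
qed

section \<open>Exhaustion by graphs and the two implications\<close>

lemma coord_graph_lipschitz_image:
 fixes Q :: "'a::euclidean_space set"
 assumes Q: "coord_graph I C Q" and I: "I <= Basis"
 shows "EX S. lipschitz_image (card I) S & Q <= S" proof -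
 obtain gam where gam: "(max 0 C)-lipschitz_on (coord_proj I ` Q) gam" "!!y. y : Q ==> gam (coord_proj I y) = y"
  by (rule coord_graph_inverse[OF Q]) (rule that)
 define L where "L = max 0 C"
 define k where "k = card I"
 have "EX g. L-lipschitz_on UNIV g & (ALL p:coord_proj I ` Q. g p = gam p <.> b)" if b: "b : Basis" for b proof -
  have "L-lipschitz_on (coord_proj I ` Q) (%p. gam p <.> b)" proof (rule lipschitz_onI)
   fix p q assume "p : coord_proj I ` Q" "q : coord_proj I ` Q"
   thus "dist (gam p <.> b) (gam q <.> b) <= L * dist p q" using order_trans[OF Basis_le_norm[OF b, of "gam p - gam q"]] lipschitz_onD[OF gam(1)]
    by (simp add: dist_norm inner_diff_left L_def)
  qed (simp add: L_def)
  thus ?thesis by (rule lipschitz_extension_real) auto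
 qed
 then obtain g where g: "!!b. b : Basis ==> L-lipschitz_on UNIV (g b)" "!!b y. b : Basis ==> y : Q ==> g b (coord_proj I y) = y <.> b"
  using gam(2) by (metis image_eqI)
 have fI: "finite I" by (rule finite_subset[OF I finite_Basis])
 obtain bet where bet: "bij_betw bet {..<k} I" using ex_bij_betw_nat_finite[OF fI] by (auto simp: atLeast0LessThan k_def)
 have betI: "bet m : I" if "m < k" for m using bet that by (auto simp: bij_betw_def)
 define u where "u x = (\<Sum>m<k. x m *. bet m)" for x :: "nat => real"
 define h where "h x = (SUM b:Basis. g b (u x) *. b)" for x
 have ul: "dist (u x) (u y) <= real k * L2_set (%i. x i - y i) {..<k}" for x y proof -
  have "dist (u x) (u y) = norm (\<Sum>m<k. (x m - y m) *. bet m)" by (simp add: u_def dist_norm sum_subtractf scaleR_left_diff_distrib)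
  also have "... <= (\<Sum>m<k. L2_set (%i. x i - y i) {..<k})" proof (rule sum_norm_le)
   fix m assume m: "m : {..<k}"
   have "norm ((x m - y m) *. bet m) = <|x m - y m|>" using betI[of m] m I by auto
   also have "... <= L2_set (%i. <|x i - y i|>) {..<k}" using m by (intro member_le_L2_set) auto
   also have "... = L2_set (%i. x i - y i) {..<k}" by (simp add: L2_set_def)
   finally show "norm ((x m - y m) *. bet m) <= L2_set (%i. x i - y i) {..<k}" .
  qed
  finally show ?thesis by simp
 qed
 have "dist (h x) (h y) <= real DIM('a) * L * real k * L2_set (%i. x i - y i) {..<k}" for x y proof -
  have "<|(h x - h y) <.> b|> <= L * (real k * L2_set (%i. x i - y i) {..<k})" if b: "b : Basis" for b proof -
   have "<|(h x - h y) <.> b|> <= L * dist (u x) (u y)"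
    using lipschitz_onD[OF g(1)[OF b], of "u x" "u y"] b by (simp add: h_def inner_diff_left dist_real_def)
   also have "... <= L * (real k * L2_set (%i. x i - y i) {..<k})" by (rule mult_left_mono[OF ul]) (simp add: L_def)
   finally show ?thesis .
  qed
  from norm_componentwise_le[OF this] show ?thesis by (simp add: dist_norm mult.assoc)
 qed
 hence "lipschitz_image k (h ` topspace (Euclidean_space k))" unfolding lipschitz_image_def by blast
 moreover have "Q <= h ` topspace (Euclidean_space k)" proof
  fix y assume y: "y : Q"
  define x where "x m = (if m < k then y <.> bet m else 0)" for m
  have "u x = coord_proj I y" unfolding u_def coord_proj_def x_def using sum.reindex_bij_betw[OF bet, of "%i. (y <.> i) *. i"] by simp
  hence "h x = (SUM b:Basis. (y <.> b) *. b)" unfolding h_def using g(2)[OF _ y] by (intro sum.cong) auto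
  hence "y = h x" by (simp add: euclidean_representation)
  moreover have "x : topspace (Euclidean_space k)" by (simp add: x_def topspace_Euclidean_space)
  ultimately show "y : h ` topspace (Euclidean_space k)" by blast
 qed
 ultimately show ?thesis unfolding k_def by blast
qed

text \<open>A compact graph on which \<open>M\<close> is absolutely continuous with respect to the
  Hausdorff measure of the dimension of the graph: the building block of a rectifiable
  measure.\<close>

definition ac_graph :: "'a::euclidean_space measure => 'a set => 'a set => bool" where
 "ac_graph M J K \<longleftrightarrow> compact K & J <= Basis & (EX C. coord_graph J C K) &
   (ALL A:sets borel. A <= K --> hnull (card J) A --> emeasure M A = 0)"

lemma ac_graph_Union_borel:
 assumes "countable U" "!!K. K : U ==> EX J. ac_graph M J K" shows "\<Union>U \<in> sets borel"
proof (rule sets.countable_Union[OF assms(1)], rule subsetI)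
 fix K assume "K : U"
 thus "K : sets borel" using assms(2) by (auto simp: ac_graph_def borel_compact)
qed

text \<open>A graph of least dimension among those of positive measure inside \<open>B\<close>
  works: a Hausdorff null subset of positive measure would contain, by the reduction, a graph of
  smaller dimension. The search starts from the trivial graph over all coordinates.\<close>

lemma lusin_ac_graph:
 fixes M :: "'a::euclidean_space measure"
 assumes fin: "finite_measure M" and sets[simp]: "sets M = sets borel" and lus: "lusin_C1 M" and B: "B : sets borel" "0 < emeasure M B"
 obtains J K where "K <= B" "0 < emeasure M K" "ac_graph M J K" proof -
 interpret finite_measure M by (rule fin)
 have inner: "EX K. compact K & K <= A & 0 < emeasure M K" if A: "A : sets borel" "0 < emeasure M A" for A proof -
  have f: "0 < measure M A / 2" "emeasure M A < \<infinity>" using A(2) by (auto simp: emeasure_eq_measure)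
  obtain K where K: "compact K" "K <= A" "emeasure M (A - K) <= ennreal (measure M A / 2)" by (rule inner_compact[OF sets A(1) f(2,1)]) (rule that)
  have "measure M A = measure M K + measure M (A - K)"
   using finite_measure_Union[of K "A - K"] A(1) borel_compact[OF K(1)] K(2) by (simp add: Un_absorb1)
  hence "0 < measure M K" using K(3) f(1) by (simp add: emeasure_eq_measure)
  thus ?thesis using K by (auto simp: emeasure_eq_measure)
 qed
 define P where "P k \<longleftrightarrow> (EX I K C. I <= Basis & card I = k & compact K & K <= B & 0 < emeasure M K & coord_graph I C K)" for k
 obtain K0 where K0: "compact K0" "K0 <= B" "0 < emeasure M K0" using inner[OF B] by blast
 have "coord_graph Basis 1 K0" by (simp add: coord_graph_def coord_proj_def euclidean_representation dist_norm)
 hence "P DIM('a)" unfolding P_def using K0 by blast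
 define k where "k = (LEAST k. P k)"
 have Pk: "P k" unfolding k_def using \<open>P DIM('a)\<close> by (rule LeastI)
 then obtain I K C where K: "I <= Basis" "card I = k" "compact K" "K <= B" "0 < emeasure M K" "coord_graph I C K" unfolding P_def by blast
 have "emeasure M A = 0" if A: "A : sets borel" "A <= K" "hnull (card I) A" for A proof (rule ccontr)
  assume "emeasure M A ~= 0"
  then obtain A1 where A1: "compact A1" "A1 <= A" "0 < emeasure M A1" using inner[OF A(1)] by (auto simp: zero_less_iff_neq_zero)
  have g: "coord_graph I C A1" using K(6) A1(2) A(2) unfolding coord_graph_def by blast
  obtain l A' C' where l: "l : I" "compact A'" "A' <= A1" "0 < emeasure M A'" "coord_graph (I - {l}) C' A'"
   by (rule lusin_graph_reduction[OF fin sets lus A1(1,3) K(1) g hausdorff_null_subset[OF A(3) A1(2)]]) (rule that)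
  have "card (I - {l}) < k" using K(2) l(1) finite_subset[OF K(1) finite_Basis] by (metis card_Diff1_less)
  moreover have "P (card (I - {l}))" unfolding P_def by (rule exI[of _ "I - {l}"], rule exI[of _ A'], rule exI[of _ C'])
    (use l K(1) order_trans[OF l(3) order_trans[OF A1(2) order_trans[OF A(2) K(4)]]] in auto)
  ultimately show False using not_less_Least[of _ P] unfolding k_def by blast
 qed
 hence "ac_graph M I K" using K unfolding ac_graph_def by blast
 thus thesis using that K(4,5) by blast
qed

text \<open>Exhaustion: the supremum of the measures covered by countable families is attained by
  the union of a maximising sequence, and one more graph in the complement would exceed it.\<close>

lemma lusin_ac_graph_cover_finite:
 fixes M :: "'a::euclidean_space measure"
 assumes fin: "finite_measure M" and sets[simp]: "sets M = sets borel" and lus: "lusin_C1 M"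
 shows "EX U. countable U & (ALL K:U. EX J. ac_graph M J K) & emeasure M (- \<Union>U) = 0" proof -
 interpret finite_measure M by (rule fin)
 define S where "S = {U. countable U & (ALL K:U. EX J. ac_graph M J K)}"
 have Sm: "\<Union>U \<in> sets M" if "U : S" for U using that ac_graph_Union_borel[of U M] by (simp add: S_def)
 have "{} : S" by (simp add: S_def)
 then obtain f where f: "range f <= (%U. emeasure M (\<Union>U)) ` S" "(SUP U\<in>S. emeasure M (\<Union>U)) = Sup (range (f :: nat => ennreal))"
  using ennreal_SUP_countable_SUP[of S "%U. emeasure M (\<Union>U)"] by auto
 hence "ALL n. EX U. U : S & f n = emeasure M (\<Union>U)" by auto
 from choice[OF this] obtain V where V: "!!n. V n : S" "!!n. f n = emeasure M (\<Union>(V n))" by blast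
 define U where "U = (UN n. V n)"
 have US: "U : S" using V(1) by (auto simp: U_def S_def)
 have max: "emeasure M (\<Union>W) <= emeasure M (\<Union>U)" if "W : S" for W proof -
  have "emeasure M (\<Union>W) <= (SUP U\<in>S. emeasure M (\<Union>U))" using that by (rule SUP_upper)
  also have "... <= emeasure M (\<Union>U)" unfolding f(2) using V(2) Sm[OF US] by (auto intro!: SUP_least emeasure_mono simp: U_def)
  finally show ?thesis .
 qed
 have "emeasure M (- \<Union>U) = 0" proof (rule ccontr)
  assume "emeasure M (- \<Union>U) ~= 0"
  hence p: "0 < emeasure M (- \<Union>U)" by (simp add: zero_less_iff_neq_zero)
  have m: "- \<Union>U \<in> sets borel" using Sm[OF US] by auto
  obtain J K where K: "K <= - \<Union>U" "0 < emeasure M K" "ac_graph M J K" by (rule lusin_ac_graph[OF fin sets lus m p]) (rule that)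
  have "insert K U : S" using US K(3) by (auto simp: S_def)
  hence "emeasure M (K Un \<Union>U) <= emeasure M (\<Union>U)" using max[of "insert K U"] by simp
  moreover have "emeasure M (K Un \<Union>U) = emeasure M K + emeasure M (\<Union>U)"
   using K(1,3) Sm[OF US] by (intro plus_emeasure[symmetric]) (auto simp: ac_graph_def borel_compact)
  ultimately show False using K(2) by (simp add: emeasure_eq_measure ennreal_plus[symmetric] del: ennreal_plus)
 qed
 thus ?thesis using US unfolding S_def by blast
qed

text \<open>The finite case is applied to restrictions to balls, which inherit the approximation
  property. Each graph is cut down to its ball, since absolute continuity is known only for the
  restricted measure.\<close>

lemma lusin_ac_graph_cover:
 fixes M :: "'a::euclidean_space measure"
 assumes rM: "radon_measure M" and lus: "lusin_C1 M"
 shows "EX U. countable U & (ALL K:U. EX J. ac_graph M J K) & emeasure M (- \<Union>U) = 0" proof -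
 have sM[simp]: "sets M = sets borel" using rM by (simp add: radon_measure_def)
 have "EX U. countable U & (ALL K:U. EX J. ac_graph M J K) & emeasure M (cball 0 (real j) - \<Union>U) = 0" for j :: nat proof -
  let ?B = "cball (0::'a) (real j)"
  define N where "N = density M (indicator ?B)"
  have sN: "sets N = sets borel" by (simp add: N_def)
  have N: "emeasure N A = emeasure M (?B Int A)" if "A : sets borel" for A unfolding N_def using that by (simp add: emeasure_restricted)
  have "emeasure N (space N) ~= \<infinity>" proof -
   have "emeasure M ?B < \<infinity>" using rM compact_cball unfolding radon_measure_def by blast
   thus ?thesis using N[of UNIV] sets_eq_imp_space_eq[OF sN] by simp
  qed
  hence fN: "finite_measure N" by (rule finite_measureI)
  have lN: "lusin_C1 N" unfolding lusin_C1_def proof (intro allI impI)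
   fix f :: "'a => real" and e :: real assume f: "EX L. L-lipschitz_on UNIV f" and e: "0 < e"
   obtain g G where g: "C1_grad g G" "emeasure M {x. g x ~= f x} < ennreal e" using lus f e unfolding lusin_C1_def by blast
   have "open {x. g x ~= f x}" using f C1_grad_continuous[OF g(1)] by (auto intro!: open_Collect_neq dest: lipschitz_on_continuous_on)
   hence "emeasure N {x. g x ~= f x} <= emeasure M {x. g x ~= f x}" by (subst N) (auto intro!: emeasure_mono)
   thus "EX g G. C1_grad g G & emeasure N {x. g x ~= f x} < ennreal e" using g by (blast intro: order_le_less_trans)
  qed
  obtain V where V: "countable V" "!!K. K : V ==> EX J. ac_graph N J K" "emeasure N (- \<Union>V) = 0"
   using lusin_ac_graph_cover_finite[OF fN sN lN] by blast
  have "EX J. ac_graph M J (K Int ?B)" if K: "K : V" for K proof -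
   obtain J C where J: "compact K" "J <= Basis" "coord_graph J C K"
    "!!A. A : sets borel ==> A <= K ==> hnull (card J) A ==> emeasure N A = 0" using V(2)[OF K] unfolding ac_graph_def by blast
   have "emeasure M A = 0" if "A : sets borel" "A <= K Int ?B" "hnull (card J) A" for A using J(4)[of A] that N[of A] by (simp add: Int_absorb1)
   moreover have "coord_graph J C (K Int ?B)" using J(3) unfolding coord_graph_def by blast
   ultimately have "ac_graph M J (K Int ?B)" using compact_Int_closed[OF J(1) closed_cball] J(2) unfolding ac_graph_def by blast
   thus ?thesis ..
  qed
  moreover have "emeasure M (?B - \<Union>((%K. K Int ?B) ` V)) = 0" proof -
   have "- \<Union>V \<in> sets borel" using ac_graph_Union_borel[OF V(1,2)] by auto
   moreover have "?B - \<Union>((%K. K Int ?B) ` V) = ?B Int - \<Union>V" by auto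
   ultimately show ?thesis using V(3) N by simp
  qed
  ultimately show ?thesis using V(1) by (intro exI[of _ "(%K. K Int ?B) ` V"]) auto
 qed
 hence "ALL j. EX U. countable U & (ALL K:U. EX J. ac_graph M J K) & emeasure M (cball 0 (real j) - \<Union>U) = 0" ..
 from choice[OF this] obtain U where
  Ur: "ALL j. countable (U j) & (ALL K:U j. EX J. ac_graph M J K) & emeasure M (cball 0 (real j) - \<Union>(U j)) = 0" ..
 have U: "countable (U j)" "K : U j ==> EX J. ac_graph M J K" "emeasure M (cball 0 (real j) - \<Union>(U j)) = 0" for j K
  using spec[OF Ur, of j] by simp_all
 have "cball 0 (real j) - \<Union>(U j) : sets borel" for j using ac_graph_Union_borel[OF U(1,2)] by auto
 hence n: "(UN j. cball 0 (real j) - \<Union>(U j)) : null_sets M" using U(3) by (intro null_sets_UN null_setsI) auto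
 have "\<Union>(UN j. U j) : sets borel" by (rule ac_graph_Union_borel[where M = M], use U(1) in simp, elim UN_E, rule U(2))
 hence m: "- \<Union>(UN j. U j) : sets M" by auto
 have "- \<Union>(UN j. U j) <= (UN j. cball 0 (real j) - \<Union>(U j))" proof
  fix x assume x: "x : - \<Union>(UN j. U j)"
  obtain j where "norm x <= real j" using real_arch_simple by blast
  thus "x : (UN j. cball 0 (real j) - \<Union>(U j))" using x by auto
 qed
 from null_sets_subset[OF n m this] have "emeasure M (- \<Union>(UN j. U j)) = 0" by (rule null_setsD1)
 thus ?thesis using U(1,2) by (intro exI[of _ "UN j. U j"]) auto
qed

lemma ac_graph_rectifiable_measure:
 fixes M :: "'a::euclidean_space measure"
 assumes rM: "radon_measure M" and U: "countable U" "!!K. K : U ==> ac_graph M (J K) K & card (J K) = k"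
  and E: "E : sets borel" "E <= \<Union>U"
 shows "rectifiable_measure k (density M (indicator E))" proof -
 have sM[simp]: "sets M = sets borel" using rM by (simp add: radon_measure_def)
 have em: "emeasure (density M (indicator E)) A = emeasure M (E Int A)" if "A : sets borel" for A using that E(1) by (simp add: emeasure_restricted)
 have Km: "K : sets borel" if "K : U" for K using U(2)[OF that] by (simp add: ac_graph_def borel_compact)
 have radon: "radon_measure (density M (indicator E))" unfolding radon_measure_def proof (intro conjI allI impI)
  fix K :: "'a set" assume K: "compact K"
  have "emeasure M (E Int K) <= emeasure M K" using borel_compact[OF K] by (intro emeasure_mono) auto
  also have "... < \<infinity>" using rM K unfolding radon_measure_def by blast
  finally show "emeasure (density M (indicator E)) K < \<infinity>" using em[OF borel_compact[OF K]] by simp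
 qed simp
 \<comment> \<open>The empty set is included so that the family can be enumerated by natural numbers
   even if \<open>U\<close> is empty; a constant map supplies its Lipschitz image.\<close>
 have "EX S. lipschitz_image k S & K <= S" if "K : insert {} U" for K proof (cases "K = {}")
  case True
  have "lipschitz_image k ((%_. 0::'a) ` topspace (Euclidean_space k))" unfolding lipschitz_image_def by (intro exI[of _ "%_. 0"] exI[of _ 0]) simp
  thus ?thesis using True by blast
 next
  case False
  hence "ac_graph M (J K) K" "card (J K) = k" using U(2) that by auto
  thus ?thesis using coord_graph_lipschitz_image unfolding ac_graph_def by blast
 qed
 hence "EX F. ALL K:insert {} U. lipschitz_image k (F K) & K <= F K" by (intro bchoice) blast
 then obtain F where F: "!!K. K : insert {} U ==> lipschitz_image k (F K)" "!!K. K : insert {} U ==> K <= F K" by blast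
 define Q where "Q = from_nat_into (insert {} U)"
 have Q: "Q m : insert {} U" for m unfolding Q_def by (rule from_nat_into) simp
 have rQ: "range Q = insert {} U" unfolding Q_def using U(1) by (intro range_from_nat_into) auto
 have sub: "\<Union>U - (UN m. F (Q m)) = {}" using F(2) rQ by (auto simp: image_iff) (metis insertI2 rangeE subsetD)
 hence "rectifiable_set k (\<Union>U)" unfolding rectifiable_set_def
  using F(1)[OF Q] hausdorff_null_Union[of "{}" k] by (intro exI[of _ "%m. F (Q m)"]) (simp only: sub, simp)
 moreover have "emeasure (density M (indicator E)) A = 0" if A: "A : sets borel" "hausdorff_restriction k (\<Union>U) A = 0" for A proof -
  have "A Int K : null_sets M" if K: "K : U" for K proof (rule null_setsI)
   have "hnull k (A Int K)" using A(2) unfolding hausdorff_restriction_def by (rule hausdorff_null_subset) (use K in blast)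
   thus "emeasure M (A Int K) = 0" using U(2)[OF K] A(1) Km[OF K] unfolding ac_graph_def by blast
  qed (use A(1) Km[OF K] in auto)
  hence "(UN K:U. A Int K) : null_sets M" using U(1) by (intro null_sets_UN') auto
  hence "E Int A : null_sets M" by (rule null_sets_subset) (use E A(1) in auto)
  thus ?thesis using em[OF A(1)] by auto
 qed
 ultimately show ?thesis unfolding rectifiable_measure_def using radon by blast
qed

lemma lusin_rectifiable_decomposition:
 fixes M :: "'a::euclidean_space measure"
 assumes rM: "radon_measure M" and lus: "lusin_C1 M"
 shows "EX nu. (ALL i<=DIM('a). rectifiable_measure i (nu i)) & (ALL A:sets borel. emeasure M A = (\<Sum>i\<le>DIM('a). emeasure (nu i) A))" proof -
 have sM[simp]: "sets M = sets borel" using rM by (simp add: radon_measure_def)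
 obtain U where U: "countable U" "!!K. K : U ==> EX J. ac_graph M J K" "emeasure M (- \<Union>U) = 0" using lusin_ac_graph_cover[OF rM lus] by blast
 obtain J where J: "!!K. K : U ==> ac_graph M (J K) K" using U(2) by metis
 define V where "V i = {K : U. card (J K) = i}" for i
 define D where "D i = \<Union>(V i)" for i
 have V: "countable (V i)" for i unfolding V_def using U(1) by (rule countable_subset[rotated]) auto
 have Dm: "D i : sets borel" for i unfolding D_def by (rule ac_graph_Union_borel[OF V]) (use U(2) in "auto simp: V_def")
 \<comment> \<open>What already belongs to graphs of lower dimension is removed from those of higher
   dimension, so that the restrictions add up to \<open>M\<close>.\<close>
 define E where "E = disjointed D"
 have Em: "E i : sets borel" for i using Dm unfolding E_def disjointed_def by (intro sets.Diff sets.finite_UN) auto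
 define nu where "nu i = density M (indicator (E i))" for i
 have nu: "emeasure (nu i) A = emeasure M (E i Int A)" if "A : sets borel" for i A unfolding nu_def using that Em by (simp add: emeasure_restricted)
 have "rectifiable_measure i (nu i)" for i unfolding nu_def by (rule ac_graph_rectifiable_measure[OF rM V _ Em, where J = J])
    (use J disjointed_subset[of D i] in "auto simp: V_def E_def D_def")
 moreover have "emeasure M A = (\<Sum>i\<le>DIM('a). emeasure (nu i) A)" if A: "A : sets borel" for A proof -
  have "(\<Union>i\<le>DIM('a). E i) = (UN i:{0..<Suc DIM('a)}. D i)"
   using finite_UN_disjointed_eq[of D "Suc DIM('a)"] by (simp add: E_def atLeast0LessThan lessThan_Suc_atMost)
  also have "... = \<Union>U" proof -
   have "K : V (card (J K)) & card (J K) < Suc DIM('a)" if "K : U" for K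
    using J[OF that] that card_mono[OF finite_Basis, of "J K"] by (simp add: V_def ac_graph_def)
   thus ?thesis by (force simp: D_def V_def)
  qed
  finally have UE: "(\<Union>i\<le>DIM('a). E i) = \<Union>U" .
  have Um: "\<Union>U \<in> sets borel" by (rule ac_graph_Union_borel[OF U(1,2)])
  have n: "- \<Union>U \<in> null_sets M" using U(3) Um by (intro null_setsI) auto
  have "emeasure M A = emeasure M (A - - \<Union>U)" using emeasure_Diff_null_set[OF n, of A] A by simp
  also have "A - - \<Union>U = (\<Union>i\<le>DIM('a). E i Int A)" using UE by auto
  also have "emeasure M ... = (\<Sum>i\<le>DIM('a). emeasure M (E i Int A))" proof (rule sum_emeasure[symmetric])
   show "disjoint_family_on (%i. E i Int A) {..DIM('a)}" using disjoint_family_disjointed[of D] unfolding E_def disjoint_family_on_def by blast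
  qed (use Em A in auto)
  finally show ?thesis using nu[OF A] by simp
 qed
 ultimately show ?thesis by blast
qed

text \<open>The C1 pieces found for the different dimensions are pooled. A Borel set that avoids
  them all is null for every summand, hence for \<open>M\<close>, and the pieces can then be
  joined.\<close>

lemma rectifiable_decomposition_lusin:
 fixes M :: "'a::euclidean_space measure"
 assumes rM: "radon_measure M" and nu: "!!i. i <= DIM('a) ==> rectifiable_measure i (nu i)"
  and sum: "!!A. A : sets borel ==> emeasure M A = (\<Sum>i\<le>DIM('a). emeasure (nu i) A)"
 shows "lusin_C1 M" unfolding lusin_C1_def proof (intro allI impI)
 fix f :: "'a => real" and e :: real assume "EX L. L-lipschitz_on UNIV f" and e: "0 < e"
 then obtain L where f: "L-lipschitz_on UNIV f" by blast
 have "EX D. countable D & (ALL A:D. C1_piece f A) & (ALL A:sets borel. A Int \<Union>D = {} --> emeasure (nu i) A = 0)" if i: "i <= DIM('a)" for i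
 proof -
  obtain E F where E: "hnull i (E - (\<Union>m::nat. F m))" "!!m. lipschitz_image i (F m)"
   "!!A. A : sets borel ==> hausdorff_restriction i E A = 0 ==> emeasure (nu i) A = 0"
   using nu[OF i] unfolding rectifiable_measure_def rectifiable_set_def by blast
  have "ALL m. EX D. countable D & (ALL A:D. C1_piece f A) & hnull i (F m - \<Union>D)" using lipschitz_image_C1_pieces[OF E(2) i f] by blast
  from choice[OF this] obtain D where Dr: "ALL m. countable (D m) & (ALL A:D m. C1_piece f A) & hnull i (F m - \<Union>(D m))" ..
  have "emeasure (nu i) A = 0" if A: "A : sets borel" "A Int \<Union>(UN m. D m) = {}" for A proof (rule E(3)[OF A(1)])
   have "hnull i ((E - (UN m. F m)) Un (UN m. F m - \<Union>(D m)))" using Dr by (intro hausdorff_null_Un E(1) hausdorff_null_UN) blast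
   thus "hausdorff_restriction i E A = 0" unfolding hausdorff_restriction_def by (rule hausdorff_null_subset) (use A(2) in blast)
  qed
  moreover have "countable (UN m. D m)" using Dr by auto
  moreover have "ALL A:(UN m. D m). C1_piece f A" using Dr by auto
  ultimately show ?thesis by (intro exI[of _ "UN m. D m"]) simp
 qed
 hence "ALL i:{..DIM('a)}. EX D. countable D & (ALL A:D. C1_piece f A) & (ALL A:sets borel. A Int \<Union>D = {} --> emeasure (nu i) A = 0)" by simp
 from bchoice[OF this] obtain D where D: "ALL i:{..DIM('a)}. countable (D i) & (ALL A:D i. C1_piece f A) &
  (ALL A:sets borel. A Int \<Union>(D i) = {} --> emeasure (nu i) A = 0)" ..
 let ?D = "\<Union>i\<le>DIM('a). D i"
 have C: "countable ?D" using D by (intro countable_UN) auto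
 have P: "C1_piece f A" if "A : ?D" for A using that D by auto
 have "\<Union>?D : sets borel" by (rule sets.countable_Union[OF C], rule subsetI) (use P in "auto simp: C1_piece_def borel_compact")
 hence m: "- \<Union>?D : sets borel" by auto
 have "emeasure (nu i) (- \<Union>?D) = 0" if "i <= DIM('a)" for i proof -
  have "- \<Union>?D Int \<Union>(D i) = {}" using that by auto
  thus ?thesis using D that m by auto
 qed
 hence n: "emeasure M (- \<Union>?D) = 0" using sum[OF m] by simp
 show "EX g G. C1_grad g G & emeasure M {x. g x ~= f x} < ennreal e" by (rule lusin_of_C1_pieces[OF rM C _ n e]) (rule P)
qed

theorem theorem1p1:
  fixes \<mu> :: "(real ^ 'n) measure"
  assumes "radon_measure \<mu>"
  shows "(\<exists>\<nu> :: nat \<Rightarrow> (real ^ 'n) measure.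
            (\<forall>i \<le> CARD('n). rectifiable_measure i (\<nu> i)) \<and>
            (\<forall>A \<in> sets borel. emeasure \<mu> A = (\<Sum>i\<le>CARD('n). emeasure (\<nu> i) A)))
         \<longleftrightarrow>
         (\<forall>f :: real ^ 'n \<Rightarrow> real. (\<exists>L. L-lipschitz_on UNIV f) \<longrightarrow>
            (\<forall>\<epsilon> :: real. \<epsilon> > 0 \<longrightarrow>
               (\<exists>g :: real ^ 'n \<Rightarrow> real. class_C1 g \<and>
                  emeasure \<mu> {x. g x \<noteq> f x} < ennreal \<epsilon>)))"
    (is "?L \<longleftrightarrow> ?R")
proof -
  have dim: "DIM(real ^ 'n) = CARD('n)" by simp
  have "?L \<longleftrightarrow> lusin_C1 \<mu>"
  proof
    assume ?L
    then show "lusin_C1 \<mu>" using rectifiable_decomposition_lusin[OF assms] unfolding dim by blast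
  next
    assume "lusin_C1 \<mu>"
    from lusin_rectifiable_decomposition[OF assms this] show ?L unfolding dim .
  qed
  also have "\<dots> \<longleftrightarrow> ?R" unfolding lusin_C1_def class_C1_iff_C1_grad by (intro iff_allI) blast
  finally show ?thesis .
qed

end
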